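(* Let $k\ge 0$ be an integer and $\ell\in\{k,k-1\}$. There exists a constant $\alpha>0$, independent of $h$, such that $$\inf_{\boldsymbol v_h\in (\mathring{\mathbb V}^{\mathrm{div}}_{k,\ell}\cap\ker(\mathrm{div}))\setminus\{0\}}\ \sup_{\boldsymbol\tau_h\in\Sigma_k^{\mathrm{tn}}\setminus\{0\}}\frac{(\mathrm{div}_w\boldsymbol\tau_h,\boldsymbol v_h)_{0,h}}{\|\boldsymbol\tau_h\|_{\mathrm{div}_w}\,\|\boldsymbol v_h\|}\ \ge\ \alpha .$$
   Context: Setting. $\Omega\subset\mathbb R^d$ ($d\ge 2$) is a bounded polytope and $\{\mathcal T_h\}_{h>0}$ is a shape-regular family of simplicial meshes of $\Omega$, $h=\max_{T\in\mathcal T_h}h_T$, $h_T=\mathrm{diam}(T)$, $h_F=\mathrm{diam}(F)$. $\mathcal F_h$ (resp. $\mathring{\mathcal F}_h$) is the set of all (resp. interior) faces. Each face $F$ carries a fixed unit normal $\boldsymbol n_F$ (outward to $\Omega$ if $F\subset\partial\Omega$). The jump $[\![v]\!]$ on an interior face is the trace from the element for which $\boldsymbol n_F$ is outward minus the trace from the other element; on boundary faces it is the trace itself. In integrals over $F$, $\boldsymbol n=\boldsymbol n_F$. $\Pi_F\boldsymbol v=\boldsymbol v-(\boldsymbol v\cdot\boldsymbol n_F)\boldsymbol n_F$. $\mathbb T$ is the space of traceless $d\times d$ real matrices. The divergence of matrix fields is row-wise. $(\cdot,\cdot)_D$ is the $L^2(D)$ inner product and $\|\cdot\|$ the $L^2(\Omega)$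 norm. $\mathbb P_k(D)$: polynomials of degree $\le k$; $\mathbb H_k(D)$: homogeneous polynomials of degree $k$; $\mathbb P_{-1}=\mathbb H_{-1}=\{0\}$. Velocity space: $\mathbb V^{\mathrm{div}}_{k,\ell}(T)=\mathbb P_k(T;\mathbb R^d)+\mathbb H_\ell(T)\boldsymbol x$ and $\mathring{\mathbb V}^{\mathrm{div}}_{k,\ell}=\{\boldsymbol v\in H(\mathrm{div},\Omega):\boldsymbol v|_T\in\mathbb V^{\mathrm{div}}_{k,\ell}(T)\ \forall T\in\mathcal T_h,\ \boldsymbol v\cdot\boldsymbol n=0\text{ on }\partial\Omega\}$. $\ker(\mathrm{div})$ denotes the divergence-free fields. Stress space: $\Sigma_k^{\mathrm{tn}}=\{\boldsymbol\tau\in L^2(\Omega;\mathbb T):\boldsymbol\tau|_T\in\mathbb P_k(T;\mathbb T)\ \forall T\in\mathcal T_h,\ [\![\Pi_F\boldsymbol\tau\boldsymbol n]\!]=0\ \forall F\in\mathring{\mathcal F}_h\}$. Weak divergence form: $(\mathrm{div}_w\boldsymbol\tau,\boldsymbol v)_{0,h}=\sum_{T\in\mathcal T_h}(\mathrm{div}\,\boldsymbol\tau,\boldsymbol v)_T-\sum_{F\in\mathring{\mathcal F}_h}([\![\boldsymbol n^{\intercal}\boldsymbol\tau\boldsymbol n]\!],\boldsymbol n\cdot\boldsymbol v)_F$. Norm: $\|\boldsymbol\tau\|_{\mathrm{div}_w}^2=\|\boldsymbol\tau\|^2+\sum_{T\in\mathcal T_h}\|\mathrm{div}\,\boldsymbol\tau\|_{L^2(T)}^2+\sum_{F\in\mathring{\mathcal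 F}_h}h_F^{-1}\|[\![\boldsymbol\tau\boldsymbol n]\!]\|_{L^2(F)}^2$. *)

theory Defs
  imports "HOL-Analysis.Analysis"
begin

subsection \<open>Polynomials\<close>

text \<open>Degrees are integers, so that index \<open>-1\<close> yields the zero space (empty sum of monomials).\<close>

definition monomial :: "('n \<Rightarrow> nat) \<Rightarrow> real^'n::finite \<Rightarrow> real" where
  "monomial e x = (\<Prod>i\<in>UNIV. (x $ i) ^ e i)"

definition poly_space :: "int \<Rightarrow> (real^'n::finite \<Rightarrow> real) set" where
  "poly_space m = {p. \<exists>c. p = (\<lambda>x. \<Sum>e | int (\<Sum>i\<in>UNIV. e i) \<le> m. c e * monomial e x)}"

definition hom_poly_space :: "int \<Rightarrow> (real^'n::finite \<Rightarrow> real) set" where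
  "hom_poly_space m = {p. \<exists>c. p = (\<lambda>x. \<Sum>e | int (\<Sum>i\<in>UNIV. e i) = m. c e * monomial e x)}"

definition vec_poly_space :: "int \<Rightarrow> (real^'n::finite \<Rightarrow> real^'n) set" where
  "vec_poly_space m = {p. \<forall>i. (\<lambda>x. p x $ i) \<in> poly_space m}"

definition traceless :: "(real^'n^'n::finite) set" where
  "traceless = {A. trace A = 0}"

definition traceless_poly_space :: "int \<Rightarrow> (real^'n::finite \<Rightarrow> real^'n^'n) set" where
  "traceless_poly_space m =
     {p. (\<forall>i j. (\<lambda>x. p x $ i $ j) \<in> poly_space m) \<and> (\<forall>x. p x \<in> traceless)}"

definition div_shape_space :: "int \<Rightarrow> int \<Rightarrow> (real^'n::finite \<Rightarrow> real^'n) set" where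
  "div_shape_space k l =
     {\<lambda>x. p x + q x *\<^sub>R x | p q. p \<in> vec_poly_space k \<and> q \<in> hom_poly_space l}"

subsection \<open>Derivatives, square-integrable fields and weak divergence\<close>

definition partial :: "'n \<Rightarrow> (real^'n::finite \<Rightarrow> real) \<Rightarrow> real^'n \<Rightarrow> real" where
  "partial i f x = frechet_derivative f (at x) (axis i 1)"

definition gradient :: "(real^'n::finite \<Rightarrow> real) \<Rightarrow> real^'n \<Rightarrow> real^'n" where
  "gradient f x = (\<chi> i. partial i f x)"

definition divergence :: "(real^'n::finite \<Rightarrow> real^'n) \<Rightarrow> real^'n \<Rightarrow> real" where
  "divergence v x = (\<Sum>i\<in>UNIV. partial i (\<lambda>y. v y $ i) x)"

text \<open>Here \<open>\<tau> y $ i\<close> is the \<open>i\<close>-th row.\<close>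

definition mat_divergence :: "(real^'n::finite \<Rightarrow> real^'n^'n) \<Rightarrow> real^'n \<Rightarrow> real^'n" where
  "mat_divergence \<tau> x = (\<chi> i. divergence (\<lambda>y. \<tau> y $ i) x)"

primrec C_diff :: "nat \<Rightarrow> (real^'n::finite \<Rightarrow> real) \<Rightarrow> bool" where
  "C_diff 0 f \<longleftrightarrow> continuous_on UNIV f"
| "C_diff (Suc m) f \<longleftrightarrow> (\<forall>x. f differentiable (at x)) \<and> (\<forall>i. C_diff m (partial i f))"

definition test_functions :: "(real^'n::finite) set \<Rightarrow> (real^'n \<Rightarrow> real) set" where
  "test_functions \<Omega> =
     {\<phi>. (\<forall>m. C_diff m \<phi>) \<and> compact (closure {x. \<phi> x \<noteq> 0}) \<and> closure {x. \<phi> x \<noteq> 0} \<subseteq> \<Omega>}"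

text \<open>Elements of \<open>L\<^sup>2(D; S)\<close> are given by representatives, so that being zero means being zero
  almost everywhere. On matrices, \<open>norm\<close> and \<open>\<bullet>\<close> are the Frobenius ones.\<close>

definition L2_space :: "(real^'n::finite) set \<Rightarrow> 'b set \<Rightarrow> (real^'n \<Rightarrow> 'b::euclidean_space) set" where
  "L2_space D S = {f. set_borel_measurable lebesgue D f
     \<and> set_integrable lebesgue D (\<lambda>x. (norm (f x))\<^sup>2) \<and> (AE x\<in>D in lebesgue. f x \<in> S)}"

definition L2_norm :: "(real^'n::finite) set \<Rightarrow> (real^'n \<Rightarrow> 'b::euclidean_space) \<Rightarrow> real" where
  "L2_norm D f = sqrt (LINT x:D|lebesgue. (norm (f x))\<^sup>2)"

definition L2_inner ::
  "(real^'n::finite) set \<Rightarrow> (real^'n \<Rightarrow> 'b::euclidean_space) \<Rightarrow> (real^'n \<Rightarrow> 'b) \<Rightarrow> real" where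
  "L2_inner D f g = (LINT x:D|lebesgue. f x \<bullet> g x)"

definition zero_on :: "(real^'n::finite) set \<Rightarrow> (real^'n \<Rightarrow> 'b::euclidean_space) \<Rightarrow> bool" where
  "zero_on D f \<longleftrightarrow> (AE x\<in>D in lebesgue. f x = 0)"

definition weak_divergence ::
  "(real^'n::finite) set \<Rightarrow> (real^'n \<Rightarrow> real^'n) \<Rightarrow> (real^'n \<Rightarrow> real) \<Rightarrow> bool" where
  "weak_divergence \<Omega> v w \<longleftrightarrow>
     (\<forall>\<phi>\<in>test_functions \<Omega>. L2_inner \<Omega> v (gradient \<phi>) = - L2_inner \<Omega> w \<phi>)"

definition Hdiv :: "(real^'n::finite) set \<Rightarrow> (real^'n \<Rightarrow> real^'n) set" where
  "Hdiv \<Omega> = {v \<in> L2_space \<Omega> UNIV. \<exists>w \<in> L2_space \<Omega> UNIV. weak_divergence \<Omega> v w}"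

definition ker_div :: "(real^'n::finite) set \<Rightarrow> (real^'n \<Rightarrow> real^'n) set" where
  "ker_div \<Omega> = {v \<in> Hdiv \<Omega>. weak_divergence \<Omega> v (\<lambda>x. 0)}"

subsection \<open>Domain and meshes\<close>

text \<open>In finite element usage a polytope need not be convex: \<open>\<Omega>\<close> is the (open) interior of a
  finite union of convex polytopes.\<close>

definition polytopal_domain :: "(real^'n::finite) set \<Rightarrow> bool" where
  "polytopal_domain \<Omega> \<longleftrightarrow>
     \<Omega> \<noteq> {} \<and> (\<exists>P. finite P \<and> (\<forall>p\<in>P. polytope p) \<and> \<Omega> = interior (\<Union>P))"

text \<open>Elements are closed simplices; conformity is part of \<^const>\<open>triangulation\<close>.\<close>

definition simplicial_mesh :: "(real^'n::finite) set \<Rightarrow> (real^'n) set set \<Rightarrow> bool" where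
  "simplicial_mesh \<Omega> \<T> \<longleftrightarrow> triangulation \<T> \<and> (\<forall>T\<in>\<T>. int CARD('n) simplex T)
     \<and> \<Union>\<T> = closure \<Omega>"

definition mesh_size :: "(real^'n::finite) set set \<Rightarrow> real" where
  "mesh_size \<T> = Max (diameter ` \<T>)"

definition inball_diameter :: "(real^'n::finite) set \<Rightarrow> real" where
  "inball_diameter T = Sup {2 * r | c r. 0 \<le> r \<and> cball c r \<subseteq> T}"

definition shape_regular :: "(real^'n::finite) set set set \<Rightarrow> bool" where
  "shape_regular \<M> \<longleftrightarrow> (\<exists>\<sigma>. \<forall>\<T>\<in>\<M>. \<forall>T\<in>\<T>. diameter T \<le> \<sigma> * inball_diameter T)"

definition mesh_faces :: "(real^'n::finite) set set \<Rightarrow> (real^'n) set set" where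
  "mesh_faces \<T> = {F. \<exists>T\<in>\<T>. F facet_of T}"

definition interior_faces ::
  "(real^'n::finite) set \<Rightarrow> (real^'n) set set \<Rightarrow> (real^'n) set set" where
  "interior_faces \<Omega> \<T> = {F \<in> mesh_faces \<T>. \<not> F \<subseteq> frontier \<Omega>}"

definition unit_normal :: "real^'n::finite \<Rightarrow> (real^'n) set \<Rightarrow> bool" where
  "unit_normal n F \<longleftrightarrow> norm n = 1 \<and> (\<forall>x\<in>F. \<forall>y\<in>F. n \<bullet> (y - x) = 0)"

definition outward :: "real^'n::finite \<Rightarrow> (real^'n) set \<Rightarrow> (real^'n) set \<Rightarrow> bool" where
  "outward n F T \<longleftrightarrow> (\<forall>x\<in>F. \<forall>y\<in>T. n \<bullet> (y - x) \<le> 0)"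

definition face_normals ::
  "(real^'n::finite) set \<Rightarrow> (real^'n) set set \<Rightarrow> ((real^'n) set \<Rightarrow> real^'n) \<Rightarrow> bool" where
  "face_normals \<Omega> \<T> \<nu> \<longleftrightarrow> (\<forall>F\<in>mesh_faces \<T>. unit_normal (\<nu> F) F \<and>
     (F \<subseteq> frontier \<Omega> \<longrightarrow> (\<forall>T\<in>\<T>. F facet_of T \<longrightarrow> outward (\<nu> F) F T)))"

subsection \<open>Traces, jumps and integration over faces\<close>

text \<open>Trace on the boundary of \<open>T\<close> of a field that is continuous up to the boundary from inside \<open>T\<close>.\<close>

definition elem_trace :: "(real^'n::finite) set \<Rightarrow> (real^'n \<Rightarrow> 'b::euclidean_space) \<Rightarrow> real^'n \<Rightarrow> 'b" where
  "elem_trace T f x = Lim (at x within interior T) f"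

definition elem_out :: "(real^'n::finite) set set \<Rightarrow> real^'n \<Rightarrow> (real^'n) set \<Rightarrow> (real^'n) set" where
  "elem_out \<T> n F = (THE T. T \<in> \<T> \<and> F facet_of T \<and> outward n F T)"

definition elem_in :: "(real^'n::finite) set set \<Rightarrow> real^'n \<Rightarrow> (real^'n) set \<Rightarrow> (real^'n) set" where
  "elem_in \<T> n F = (THE T. T \<in> \<T> \<and> F facet_of T \<and> \<not> outward n F T)"

definition jump :: "(real^'n::finite) set \<Rightarrow> (real^'n) set set \<Rightarrow> ((real^'n) set \<Rightarrow> real^'n)
    \<Rightarrow> (real^'n) set \<Rightarrow> (real^'n \<Rightarrow> 'b::euclidean_space) \<Rightarrow> real^'n \<Rightarrow> 'b" where
  "jump \<Omega> \<T> \<nu> F f x =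
     (if F \<in> interior_faces \<Omega> \<T>
      then elem_trace (elem_out \<T> (\<nu> F) F) f x - elem_trace (elem_in \<T> (\<nu> F) F) f x
      else elem_trace (elem_out \<T> (\<nu> F) F) f x)"

text \<open>The \<open>(d-1)\<close>-dimensional Lebesgue measure on a flat face \<open>F\<close> with unit normal \<open>n\<close>: by Fubini,
  the area of \<open>A \<subseteq> F\<close> is the volume of the prism of height 1 over \<open>A\<close> in direction \<open>n\<close>, and on
  this prism the closest point in the affine hull of \<open>F\<close> is the foot of the perpendicular.\<close>

definition face_measure :: "real^'n::finite \<Rightarrow> (real^'n) set \<Rightarrow> (real^'n) measure" where
  "face_measure n F =
     distr (restrict_space lborel {x + t *\<^sub>R n | x t. x \<in> F \<and> 0 \<le> t \<and> t \<le> 1}) borel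
       (closest_point (affine hull F))"

definition face_integral :: "real^'n::finite \<Rightarrow> (real^'n) set \<Rightarrow> (real^'n \<Rightarrow> real) \<Rightarrow> real" where
  "face_integral n F g = (LINT x:F|face_measure n F. g x)"

definition tangential :: "real^'n::finite \<Rightarrow> real^'n \<Rightarrow> real^'n" where
  "tangential n w = w - (w \<bullet> n) *\<^sub>R n"

subsection \<open>Finite element spaces\<close>

text \<open>Broken fields agree with a polynomial in the interior of each element; their values on the
  mesh skeleton (a null set) and outside \<open>\<Omega>\<close> are arbitrary and never used.\<close>

definition piecewise ::
  "(real^'n::finite) set set \<Rightarrow> (real^'n \<Rightarrow> 'b) set \<Rightarrow> (real^'n \<Rightarrow> 'b) \<Rightarrow> bool" where
  "piecewise \<T> X f \<longleftrightarrow> (\<forall>T\<in>\<T>. \<exists>p\<in>X. \<forall>x\<in>interior T. f x = p x)"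

definition velocity_space :: "(real^'n::finite) set \<Rightarrow> (real^'n) set set
    \<Rightarrow> ((real^'n) set \<Rightarrow> real^'n) \<Rightarrow> int \<Rightarrow> int \<Rightarrow> (real^'n \<Rightarrow> real^'n) set" where
  "velocity_space \<Omega> \<T> \<nu> k l =
     {v \<in> Hdiv \<Omega>. piecewise \<T> (div_shape_space k l) v \<and>
        (\<forall>T\<in>\<T>. \<forall>F. F facet_of T \<and> F \<subseteq> frontier \<Omega> \<longrightarrow>
           (\<forall>x\<in>F. elem_trace T v x \<bullet> \<nu> F = 0))}"

definition stress_space :: "(real^'n::finite) set \<Rightarrow> (real^'n) set set
    \<Rightarrow> ((real^'n) set \<Rightarrow> real^'n) \<Rightarrow> int \<Rightarrow> (real^'n \<Rightarrow> real^'n^'n) set" where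
  "stress_space \<Omega> \<T> \<nu> k =
     {\<tau> \<in> L2_space \<Omega> traceless. piecewise \<T> (traceless_poly_space k) \<tau> \<and>
        (\<forall>F\<in>interior_faces \<Omega> \<T>. \<forall>x\<in>F.
           jump \<Omega> \<T> \<nu> F (\<lambda>y. tangential (\<nu> F) (\<tau> y *v \<nu> F)) x = 0)}"

text \<open>For \<open>v\<close> in \<^const>\<open>velocity_space\<close> the normal component \<open>n \<bullet> v\<close> on an interior face is
  single-valued; it is evaluated as the trace from the element for which the normal is outward.\<close>

definition div_w_form :: "(real^'n::finite) set \<Rightarrow> (real^'n) set set \<Rightarrow> ((real^'n) set \<Rightarrow> real^'n)
    \<Rightarrow> (real^'n \<Rightarrow> real^'n^'n) \<Rightarrow> (real^'n \<Rightarrow> real^'n) \<Rightarrow> real" where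
  "div_w_form \<Omega> \<T> \<nu> \<tau> v =
     (\<Sum>T\<in>\<T>. L2_inner (interior T) (mat_divergence \<tau>) v)
     - (\<Sum>F\<in>interior_faces \<Omega> \<T>. face_integral (\<nu> F) F
          (\<lambda>x. jump \<Omega> \<T> \<nu> F (\<lambda>y. \<nu> F \<bullet> (\<tau> y *v \<nu> F)) x
               * elem_trace (elem_out \<T> (\<nu> F) F) (\<lambda>y. \<nu> F \<bullet> v y) x))"

definition div_w_norm :: "(real^'n::finite) set \<Rightarrow> (real^'n) set set \<Rightarrow> ((real^'n) set \<Rightarrow> real^'n)
    \<Rightarrow> (real^'n \<Rightarrow> real^'n^'n) \<Rightarrow> real" where
  "div_w_norm \<Omega> \<T> \<nu> \<tau> = sqrt ((L2_norm \<Omega> \<tau>)\<^sup>2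
     + (\<Sum>T\<in>\<T>. (L2_norm (interior T) (mat_divergence \<tau>))\<^sup>2)
     + (\<Sum>F\<in>interior_faces \<Omega> \<T>. inverse (diameter F) *
          face_integral (\<nu> F) F (\<lambda>x. (norm (jump \<Omega> \<T> \<nu> F (\<lambda>y. \<tau> y *v \<nu> F) x))\<^sup>2)))"

end

theory Submission
 imports Defs
begin

text \<open>No interpolation operator for general velocities is built: \<open>v\<close> is fixed and
  the stress may depend on it. Exactness of the pairing then costs one scalar per face and one per
  element, while all bounds remain uniform in \<open>v\<close>. The normal-normal components of the
  stress need no matching, because the weak form subtracts precisely their jumps. A traceless bubble
  is enough for the moment against \<open>grad V\<close>, because the trace of \<open>grad V\<close>
  is \<open>div V\<close>, which is zero. For \<open>l = k\<close> the velocity formally has degree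
  \<open>k + 1\<close>; Euler's identity brings divergence-free fields back to degree
  \<open>k\<close>, so that a bubble of degree one times \<open>grad V\<close> still has degree
  \<open>k\<close>. The obstacle is regularity: on a nonconvex polytope a potential of
  \<open>v\<close> need not lie in \<open>H\<^sup>2\<close>. On the cube, \<open>v\<close> is
  extended by zero, and the approximation by cosines may be as fine as its energy demands, since the
  number of modes never enters a bound. Powers of the mesh size cancel: on an element, the stress
  differs from the mean of \<open>G\<close> by the element size times the gradient of
  \<open>G\<close>, which pays for one inverse estimate and for the weight \<open>1 / h_F\<close> on
  faces.\<close>

abbreviation cont :: "('a::topological_space => 'b::topological_space) => bool" where "cont f \<equiv> continuous_on UNIV f"
abbreviation C1 :: "(real^'n::finite => real) => bool" where "C1 f \<equiv> C_diff (Suc 0) f"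

text \<open>A divergence-free \<open>v\<close> is, on every element, a polynomial \<open>V\<close> of degree at most \<open>k\<close>, with continuous normal
 components. On a cube around the domain each component of \<open>v\<close> is approximated by a cosine polynomial, for which Poisson's
 equation with Neumann conditions is solved termwise, with an explicit bound in \<open>H\<^sup>2\<close>. The deviator \<open>G\<close> of the matrix of
 gradients of these potentials is continuously differentiable and traceless, is bounded by \<open>v\<close>, and satisfies
 \<open>(div G, v) \<ge> \<parallel>v\<parallel>\<^sup>2 / 4\<close>, since \<open>v\<close> is orthogonal to all gradients. No elliptic regularity on the polytope is needed.

 It remains to interpolate \<open>G\<close> by a discrete stress \<open>\<tau>\<close> with the same pairing with \<open>v\<close>. On each face, the
 tangential-normal component is prescribed as the mean of \<open>G n\<close> plus the multiple of the tangential jump of \<open>V\<close>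
 that makes the error orthogonal to this jump; it is lifted into the elements by explicit matrices built from the
 barycentric gradients. A bubble without tangential-normal components, times one scalar per element, then corrects the moment against
 \<open>grad V\<close>. Poincare, trace and inverse inequalities bound \<open>\<tau>\<close> by \<open>G\<close>, uniformly on shape-regular simplices.\<close>

subsection \<open>Partial derivatives\<close>

lemma partial_eqI:
 fixes f :: "real^'n::finite => real"
 assumes "(f has_derivative f') (at x)"
 shows "partial i f x = f' (axis i 1)"
 using assms unfolding partial_def by (metis frechet_derivative_at)

lemma partial_line_deriv:
 fixes f :: "real^'n::finite => real"
 assumes "f differentiable (at (x + t *\<^sub>R u))"
 shows "((%t. f (x + t *\<^sub>R u)) has_real_derivative (SUM i:UNIV. u $ i * partial i f (x + t *\<^sub>R u))) (at t)"
proof -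
 let ?D = "frechet_derivative f (at (x + t *\<^sub>R u))"
 have d: "(f has_derivative ?D) (at (x + t *\<^sub>R u))"
  using assms frechet_derivative_works by blast
 then have lin: "linear ?D" using has_derivative_linear by blast
 have "((%t. x + t *\<^sub>R u) has_derivative (%s. s *\<^sub>R u)) (at t)"
  by (auto intro!: derivative_eq_intros)
 from diff_chain_at[OF this d]
 have "((%t. f (x + t *\<^sub>R u)) has_derivative (%s. ?D (s *\<^sub>R u))) (at t)" by (simp add: o_def)
 moreover have "?D (s *\<^sub>R u) = s * (SUM i:UNIV. u $ i * partial i f (x + t *\<^sub>R u))" for s
 proof -
  have u: "u = (SUM i:UNIV. (u $ i) *\<^sub>R axis i 1)"
   by (subst basis_expansion[symmetric]) (simp add: scalar_mult_eq_scaleR)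
  have "?D u = (SUM i:UNIV. u $ i * partial i f (x + t *\<^sub>R u))"
   by (subst u) (simp add: linear_sum[OF lin] linear_scale[OF lin] partial_def)
  then show ?thesis by (simp add: linear_scale[OF lin])
 qed
 ultimately show ?thesis unfolding has_field_derivative_def by (simp add: mult.commute[of _ "sum _ _"])
qed

lemma partial_eq_line_deriv:
 fixes f :: "real^'n::finite => real"
 assumes "f differentiable (at x)" "((%t. f (x + t *\<^sub>R axis i 1)) has_real_derivative D) (at 0)"
 shows "partial i f x = D"
proof -
 have "((%t. f (x + t *\<^sub>R axis i 1)) has_real_derivative (SUM j:UNIV. axis i 1 $ j * partial j f (x + 0 *\<^sub>R axis i 1))) (at 0)"
  by (rule partial_line_deriv) (use assms in simp)
 moreover have "(SUM j:UNIV. axis i 1 $ j * partial j f (x + 0 *\<^sub>R axis i 1)) = partial i f x"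
  by (simp add: axis_def if_distrib[of "%a. a * _"] cong: if_cong)
 ultimately show ?thesis using assms(2) DERIV_unique by metis
qed

lemma partial_add:
 fixes f g :: "real^'n::finite => real"
 assumes "f differentiable (at x)" "g differentiable (at x)"
 shows "partial i (%x. f x + g x) x = partial i f x + partial i g x"
proof -
 have "((%x. f x + g x) has_derivative (%h. frechet_derivative f (at x) h + frechet_derivative g (at x) h)) (at x)"
  using assms frechet_derivative_works by (intro has_derivative_add) blast+
 from partial_eqI[OF this] show ?thesis by (simp add: partial_def)
qed

lemma partial_mult:
 fixes f g :: "real^'n::finite => real"
 assumes "f differentiable (at x)" "g differentiable (at x)"
 shows "partial i (%x. f x * g x) x = f x * partial i g x + partial i f x * g x"
proof -
 have "((%x. f x * g x) has_derivative (%h. f x * frechet_derivative g (at x) h + frechet_derivative f (at x) h * g x)) (at x)"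
  using assms frechet_derivative_works by (intro has_derivative_mult) blast+
 from partial_eqI[OF this] show ?thesis by (simp add: partial_def)
qed

lemma partial_const [simp]: "partial i (%x. c) x = 0"
 by (rule partial_eqI[of _ "%_. 0"]) simp

lemma partial_cmult:
 fixes f :: "real^'n::finite => real"
 assumes "f differentiable (at x)"
 shows "partial i (%x. c * f x) x = c * partial i f x"
 using partial_mult[of "%x. c" x f i] assms by simp

lemma partial_sum:
 fixes f :: "'a => real^'n::finite => real"
 assumes "!!a. a : A ==> f a differentiable (at x)"
 shows "partial i (%x. SUM a:A. f a x) x = (SUM a:A. partial i (f a) x)"
proof -
 have "((%x. SUM a:A. f a x) has_derivative (%h. SUM a:A. frechet_derivative (f a) (at x) h)) (at x)"
  using assms frechet_derivative_works by (intro has_derivative_sum) blast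
 from partial_eqI[OF this] show ?thesis by (simp add: partial_def)
qed

lemma partial_diff:
 fixes f g :: "real^'n::finite => real"
 assumes "f differentiable (at x)" "g differentiable (at x)"
 shows "partial i (%x. f x - g x) x = partial i f x - partial i g x"
proof -
 have "((%x. f x - g x) has_derivative (%h. frechet_derivative f (at x) h - frechet_derivative g (at x) h)) (at x)"
  using assms frechet_derivative_works by (intro has_derivative_diff) blast+
 from partial_eqI[OF this] show ?thesis by (simp add: partial_def)
qed

text \<open>Serves fields that are polynomial only inside an element, and bumps outside their
  support.\<close>

lemma partial_local:
 fixes f g :: "real^'n::finite => real"
 assumes "open S" "x : S" "!!y. y : S ==> f y = g y"
 shows "partial i f x = partial i g x"
proof -
 have "(f has_derivative f') (at x) \<longleftrightarrow> (g has_derivative f') (at x)" for f'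
  using assms has_derivative_transform_within_open[of _ _ x UNIV S] by metis
 then show ?thesis unfolding partial_def frechet_derivative_def by simp
qed

lemma differentiable_coord [simp]: "(%x::real^'n::finite. x $ i) differentiable F"
 by (rule bounded_linear_imp_differentiable) (rule bounded_linear_vec_nth)

lemma partial_coord: "partial i (%x::real^'n::finite. x $ j) x = (if i = j then 1 else 0)"
 by (subst partial_eqI[OF bounded_linear_imp_has_derivative[OF bounded_linear_vec_nth]])
   (auto simp: axis_def)

lemma C1_cont: "C1 f ==> continuous_on S f"
 using differentiable_imp_continuous_within continuous_at_imp_continuous_on by (metis C_diff.simps(2))

lemma partial_add_fun:
 "(!!x. f differentiable (at x)) ==> (!!x. g differentiable (at x)) ==>
  partial i (%x. f x + g x) = (%x. partial i f x + partial i g x)"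
 by (rule ext) (rule partial_add)

lemma partial_diff_fun:
 "(!!x. f differentiable (at x)) ==> (!!x. g differentiable (at x)) ==>
  partial i (%x. f x - g x) = (%x. partial i f x - partial i g x)"
 by (rule ext) (rule partial_diff)

lemma partial_mult_fun:
 "(!!x. f differentiable (at x)) ==> (!!x. g differentiable (at x)) ==>
  partial i (%x. f x * g x) = (%x. f x * partial i g x + partial i f x * g x)"
 by (rule ext) (rule partial_mult)

lemma partial_cmult_fun:
 "(!!x. f differentiable (at x)) ==> partial i (%x. c * f x) = (%x. c * partial i f x)"
 by (rule ext) (rule partial_cmult)

lemma C1_const [simp]: "C1 (%x. c)"
 by simp

lemma C1_add:
 assumes "C1 f" "C1 g"
 shows "C1 (%x. f x + g x)"
 using assms by (auto simp: partial_add_fun intro!: continuous_intros)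

lemma C1_diff:
 assumes "C1 f" "C1 g"
 shows "C1 (%x. f x - g x)"
 using assms by (auto simp: partial_diff_fun intro!: continuous_intros)

lemma C1_mult:
 assumes "C1 f" "C1 g"
 shows "C1 (%x. f x * g x)"
 using assms C1_cont[OF assms(1)] C1_cont[OF assms(2)]
 by (auto simp: partial_mult_fun intro!: continuous_intros)

lemma C1_sum:
 assumes "!!a. a : A ==> C1 (f a)"
 shows "C1 (%x. SUM a:A. f a x)"
 using assms by (induction A rule: infinite_finite_induct) (auto intro: C1_add simp del: C_diff.simps)

lemma C1_prod:
 assumes "!!a. a : A ==> C1 (f a)"
 shows "C1 (%x. \<Prod>a\<in>A. f a x)"
 using assms by (induction A rule: infinite_finite_induct) (auto intro: C1_mult simp del: C_diff.simps)

lemma C1_coord: "C1 (%x. x $ i)"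
 by (simp add: partial_coord)

subsection \<open>Polynomial spaces\<close>

lemma finite_multi_index: "finite {e::'n::finite => nat. int (SUM i:UNIV. e i) <= m}"
proof (rule finite_subset)
 show "{e::'n => nat. int (SUM i:UNIV. e i) <= m} \<subseteq> PiE UNIV (%_. {..nat m})"
 proof
  fix e :: "'n => nat" assume "e : {e. int (SUM i:UNIV. e i) <= m}"
  then have "(SUM i:UNIV. e i) <= nat m" by (simp add: nat_le_iff le_nat_iff del: of_nat_sum)
  then have "e i <= nat m" for i using member_le_sum[of i UNIV e] by simp
  then show "e : PiE UNIV (%_. {..nat m})" by auto
 qed
qed (simp add: finite_PiE)

lemma finite_multi_index_eq: "finite {e::'n::finite => nat. int (SUM i:UNIV. e i) = m}"
 by (rule finite_subset[OF _ finite_multi_index[of m]]) auto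

lemma poly_spaceI:
 "(!!x. p x = (\<Sum>e | int (SUM i:UNIV. e i) <= m. c e * monomial e x)) ==> p : poly_space m"
 unfolding poly_space_def by (intro CollectI exI[of _ c] ext)

lemma ps_add:
 assumes "p : poly_space m" "q : poly_space m"
 shows "(%x. p x + q x) : poly_space m"
proof -
 from assms obtain c d where "p = (%x. \<Sum>e | int (SUM i:UNIV. e i) <= m. c e * monomial e x)"
  "q = (%x. \<Sum>e | int (SUM i:UNIV. e i) <= m. d e * monomial e x)"
  unfolding poly_space_def by blast
 then show ?thesis
  by (intro poly_spaceI[where c = "%e. c e + d e"]) (simp add: sum.distrib ring_distribs)
qed

lemma ps_cmult:
 assumes "p : poly_space m"
 shows "(%x. a * p x) : poly_space m"
proof -
 from assms obtain c where "p = (%x. \<Sum>e | int (SUM i:UNIV. e i) <= m. c e * monomial e x)"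
  unfolding poly_space_def by blast
 then show ?thesis
  by (intro poly_spaceI[where c = "%e. a * c e"]) (simp add: sum_distrib_left mult.assoc)
qed

lemma monomial_ps:
 fixes e :: "'n::finite => nat"
 assumes "int (SUM i:UNIV. e i) <= m"
 shows "monomial e : poly_space m"
proof (rule poly_spaceI[where c = "%e'. if e' = e then 1 else 0"])
 fix x
 have "(\<Sum>e' | int (SUM i:UNIV. e' i) <= m. (if e' = e then 1 else 0) * monomial e' x)
   = (SUM e':{e}. (if e' = e then 1 else 0) * monomial e' x)"
  by (rule sum.mono_neutral_right) (use assms finite_multi_index[of m] in auto)
 then show "monomial e x = (\<Sum>e' | int (SUM i:UNIV. e' i) <= m. (if e' = e then 1 else 0) * monomial e' x)"
  by simp
qed

lemma ps_zero [simp]: "(%x. 0) : poly_space m"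
 unfolding poly_space_def by (auto intro!: exI[of _ "%_. 0"])

lemma ps_induct [consumes 1, case_names zero mono add]:
 fixes p :: "real^'n::finite => real"
 assumes "p : poly_space m"
  and "Q (%x. 0)"
  and "!!c e. int (SUM i:UNIV. e i) <= m ==> Q (%x. c * monomial e x)"
  and "!!p q. p : poly_space m ==> q : poly_space m ==> Q p ==> Q q ==> Q (%x. p x + q x)"
 shows "Q p"
proof -
 from assms(1) obtain c where p: "p = (%x. \<Sum>e | int (SUM i:UNIV. e i) <= m. c e * monomial e x)"
  unfolding poly_space_def by blast
 have "A \<subseteq> {e. int (SUM i:UNIV. e i) <= m} ==>
   Q (%x. SUM e:A. c e * monomial e x) & (%x. SUM e:A. c e * monomial e x) : poly_space m" if "finite A" for A
  using that
 proof (induction A)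
  case empty
  then show ?case using assms(2) by simp
 next
  case (insert e A)
  have m: "(%x. c e * monomial e x) : poly_space m" using insert by (auto intro!: ps_cmult monomial_ps)
  then show ?case using insert by (simp add: assms(3,4) ps_add)
 qed
 then show ?thesis using finite_multi_index[of m] p by blast
qed

lemma ps_mono: "m <= m' ==> p : poly_space m ==> p : poly_space m'"
 by (erule ps_induct) (auto intro!: ps_add ps_cmult monomial_ps)

lemma hom_poly_space_subset: "p : hom_poly_space m ==> p : poly_space m"
proof -
 assume "p : hom_poly_space m"
 then obtain c where p: "p = (%x. \<Sum>e | int (SUM i:UNIV. e i) = m. c e * monomial e x)"
  unfolding hom_poly_space_def by blast
 have "(%x. SUM e:A. c e * monomial e x) : poly_space m" if "finite A" "A \<subseteq> {e. int (SUM i:UNIV. e i) = m}" for A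
  using that by (induction A) (auto intro!: ps_add ps_cmult monomial_ps)
 then show ?thesis using finite_multi_index_eq[of m] p by blast
qed

lemma ps_const: "0 <= m ==> (%x. c) : poly_space m"
 using ps_cmult[OF monomial_ps[of "%_. 0" m], of c] by (simp add: monomial_def)

lemma ps_coord: "1 <= m ==> (%x. x $ i) : poly_space m"
proof -
 assume "1 <= m"
 have "(%x::real^'a. x $ i) = monomial (%j. if j = i then 1 else 0)"
  by (auto simp: fun_eq_iff monomial_def if_distrib cong: if_cong)
 with \<open>1 <= m\<close> show ?thesis by (auto intro!: monomial_ps)
qed

lemma ps_sum:
 assumes "!!a. a : A ==> p a : poly_space m"
 shows "(%x. SUM a:A. p a x) : poly_space m"
 using assms by (induction A rule: infinite_finite_induct) (auto intro!: ps_add)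

lemma ps_diff:
 assumes "p : poly_space m" "q : poly_space m"
 shows "(%x. p x - q x) : poly_space m"
 using ps_add[OF assms(1) ps_cmult[OF assms(2), of "-1"]] by simp

lemma monomial_mult: "monomial e x * monomial e' x = monomial (%i. e i + e' i) x"
 by (simp add: monomial_def power_add prod.distrib)

lemma ps_mult:
 assumes "p : poly_space m" "q : poly_space m'"
 shows "(%x. p x * q x) : poly_space (m + m')"
 using assms(1)
proof (induction rule: ps_induct)
 case (mono c e)
 from assms(2) show ?case
 proof (induction rule: ps_induct)
  case (mono d e')
  have "(%x. c * monomial e x * (d * monomial e' x)) = (%x. (c * d) * monomial (%i. e i + e' i) x)"
   by (simp add: monomial_mult[symmetric] fun_eq_iff)
  then show ?case using mono \<open>int (sum e UNIV) <= m\<close>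
   by (auto intro!: ps_cmult monomial_ps simp: sum.distrib)
 qed (auto simp: algebra_simps intro!: ps_add)
qed (auto simp: algebra_simps intro!: ps_add)

lemma ps_power:
 assumes "p : poly_space 1"
 shows "(%x. p x ^ n) : poly_space (int n)"
proof (induction n)
 case 0
 then show ?case by (simp add: ps_const)
next
 case (Suc n)
 then show ?case using ps_mult[OF assms Suc] by simp
qed

text \<open>With the projection onto a hyperplane as \<open>f\<close>, a polynomial on a face
  becomes one that is constant along the normal, without raising the degree.\<close>

lemma ps_compose_affine:
 fixes f :: "real^'n::finite => real^'n"
 assumes "p : poly_space m" "!!i. (%x. f x $ i) : poly_space 1"
 shows "(%x. p (f x)) : poly_space m"
 using assms(1)
proof (induction rule: ps_induct)
 case (mono c e)
 have "(%x. \<Prod>i\<in>A. (f x $ i) ^ e i) : poly_space (int (SUM i:A. e i))" if "finite A" for A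
  using that
 proof (induction A)
  case empty
  then show ?case by (simp add: ps_const)
 next
  case (insert a A)
  then show ?case using ps_mult[OF ps_power[OF assms(2), of a "e a"] insert.IH] by simp
 qed
 from this[of UNIV] have "(%x. monomial e (f x)) : poly_space m"
  using ps_mono[OF mono] by (simp add: monomial_def)
 then show ?case by (rule ps_cmult)
qed (auto intro!: ps_add)

lemma ps_affine:
 fixes g :: "real^'n::finite"
 assumes "1 <= m"
 shows "(%x. g \<bullet> x + b) : poly_space m"
 unfolding inner_vec_def using assms
 by (auto intro!: ps_add ps_sum ps_cmult ps_const ps_coord)

lemma monomial_differentiable [simp]: "monomial e differentiable (at x)"
 unfolding monomial_def[abs_def]
 using C1_prod[of UNIV "%i x. (x $ i) ^ e i"]
proof -
 have "C1 (%x::real^'a. (x $ i) ^ n)" for i n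
  by (induction n) (auto intro!: C1_mult C1_coord simp del: C_diff.simps)
 then have "C1 (%x. \<Prod>i\<in>UNIV. (x $ i) ^ e i)" by (intro C1_prod)
 then show "(%x. \<Prod>i\<in>UNIV. (x $ i) ^ e i) differentiable (at x)" by simp
qed

lemma partial_monomial: "partial i (monomial e) x = real (e i) * monomial (e(i := e i - 1)) x"
proof (rule partial_eq_line_deriv)
 have eq: "monomial f (x + t *\<^sub>R axis i 1) = (x $ i + t) ^ f i * (\<Prod>j\<in>UNIV-{i}. (x $ j) ^ f j)" for t f
  unfolding monomial_def by (subst prod.remove[of _ i]) (auto simp: axis_def intro!: prod.cong)
 have "((%t. (x $ i + t) ^ e i * (\<Prod>j\<in>UNIV-{i}. (x $ j) ^ e j)) has_real_derivative
   (real (e i) * (x $ i + 0) ^ (e i - 1)) * (\<Prod>j\<in>UNIV-{i}. (x $ j) ^ e j)) (at 0)"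
  by (auto intro!: derivative_eq_intros)
 then show "((%t. monomial e (x + t *\<^sub>R axis i 1)) has_real_derivative
   real (e i) * monomial (e(i := e i - 1)) x) (at 0)"
  using eq[of "e(i := e i - 1)" 0] by (simp add: eq mult.assoc cong: prod.cong_simp)
qed simp

lemma ps_differentiable: "p : poly_space m ==> p differentiable (at x)"
 by (induction rule: ps_induct) auto

lemma ps_partial: "p : poly_space m ==> partial i p : poly_space (m - 1)"
proof (induction rule: ps_induct)
 case zero
 then show ?case by (simp add: partial_const[abs_def])
next
 case (mono c e)
 have "(%x. (c * real (e i)) * monomial (e(i := e i - 1)) x) : poly_space (m - 1)"
 proof (cases "e i = 0")
  case False
  have "(SUM j:UNIV. (e(i := e i - 1)) j) = (e i - 1) + (SUM j:UNIV-{i}. e j)"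
   by (subst sum.remove[of _ i]) auto
  moreover have "(SUM j:UNIV. e j) = e i + (SUM j:UNIV-{i}. e j)"
   by (subst sum.remove[of _ i]) auto
  ultimately show ?thesis using False mono by (intro ps_cmult monomial_ps) simp
 qed simp
 then show ?case by (simp add: partial_cmult_fun partial_monomial mult.assoc)
next
 case (add p q)
 then show ?case by (simp add: partial_add_fun ps_differentiable ps_add)
qed

lemma ps_continuous: "p : poly_space m ==> continuous_on S p"
 by (meson continuous_at_imp_continuous_on differentiable_imp_continuous_within ps_differentiable)

lemma ps_C_diff_1: "p : poly_space m ==> C1 p"
 using ps_continuous ps_differentiable ps_partial by (metis C_diff.simps)

text \<open>Euler's identity. It turns the divergence of \<open>q x *\<^sub>R x\<close> into
  \<open>(d + m) * q x\<close>, so that zero divergence determines \<open>q\<close> from the other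
  summand of a velocity.\<close>

lemma hom_poly_space_euler:
 assumes "q : hom_poly_space m"
 shows "(SUM i:UNIV. x $ i * partial i q x) = real_of_int m * q x"
proof -
 from assms obtain c where q: "q = (%x. \<Sum>e | int (SUM i:UNIV. e i) = m. c e * monomial e x)"
  unfolding hom_poly_space_def by blast
 have mon: "(SUM i:UNIV. x $ i * partial i (monomial e) x) = real (SUM i:UNIV. e i) * monomial e x" for e
 proof -
  have "x $ i * partial i (monomial e) x = real (e i) * monomial e x" for i
  proof (cases "e i = 0")
   case False
   have "monomial e x = (x $ i) ^ e i * (\<Prod>j\<in>UNIV-{i}. (x $ j) ^ e j)"
    unfolding monomial_def by (subst prod.remove[of _ i]) auto
   moreover have "monomial (e(i := e i - 1)) x = (x $ i) ^ (e i - 1) * (\<Prod>j\<in>UNIV-{i}. (x $ j) ^ e j)"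
    unfolding monomial_def by (subst prod.remove[of _ i]) auto
   ultimately show ?thesis using False by (simp add: partial_monomial power_eq_if)
  qed (simp add: partial_monomial)
  then show ?thesis by (simp add: sum_distrib_right)
 qed
 have "(SUM i:UNIV. x $ i * partial i q x) = (SUM i:UNIV. \<Sum>e | int (SUM i:UNIV. e i) = m. c e * (x $ i * partial i (monomial e) x))"
  unfolding q by (simp add: partial_sum partial_cmult sum_distrib_left mult.left_commute)
 also have "... = (\<Sum>e | int (SUM i:UNIV. e i) = m. c e * (real (SUM i:UNIV. e i) * monomial e x))"
  by (subst sum.swap) (simp add: mon sum_distrib_left[symmetric] del: of_nat_sum)
 also have "... = (\<Sum>e | int (SUM i:UNIV. e i) = m. real_of_int m * (c e * monomial e x))"
  by (rule sum.cong) (auto simp: mult.left_commute)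
 finally show ?thesis by (simp add: q sum_distrib_left)
qed

text \<open>Reduction to one variable. With the degree bound on lines, explicit extrapolation
  replaces compactness arguments in the norm equivalences.\<close>

lemma ps_line:
 fixes p :: "real^'n::finite => real"
 assumes "p : poly_space (int k)"
 shows "EX P. degree P <= k & (ALL t. p (y + t *\<^sub>R z) = poly P t)"
 using assms
proof (induction rule: ps_induct)
 case zero
 then show ?case by (intro exI[of _ 0]) simp
next
 case (mono c e)
 let ?P = "%A. \<Prod>i\<in>A. [:y $ i, z $ i:] ^ e i"
 have "degree (?P A) <= (SUM i:A. e i)" for A
 proof (induction A rule: infinite_finite_induct)
  case (insert a A)
  have "degree ([:y $ a, z $ a:] ^ e a) <= e a"
   by (rule order_trans[OF degree_power_le]) simp
  then show ?case using insert degree_mult_le[of "[:y $ a, z $ a:] ^ e a" "?P A"] by simp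
 qed auto
 moreover have "monomial e (y + t *\<^sub>R z) = poly (?P UNIV) t" for t
  by (simp add: monomial_def poly_prod mult.commute)
 moreover have "(SUM i:UNIV. e i) <= k" using mono by (simp del: of_nat_sum)
 ultimately show ?case
  by (intro exI[of _ "smult c (?P UNIV)"]) (auto intro: order_trans[OF degree_smult_le] dest: order_trans)
next
 case (add p q)
 then obtain P Q where "degree P <= k" "ALL t. p (y + t *\<^sub>R z) = poly P t" "degree Q <= k" "ALL t. q (y + t *\<^sub>R z) = poly Q t"
  by blast
 then show ?case by (intro exI[of _ "P + Q"]) (simp add: degree_add_le)
qed

lemma pderiv_sum: "pderiv (SUM a:A. p a) = (SUM a:A. pderiv (p a))"
 by (induction A rule: infinite_finite_induct) (auto simp: pderiv_add)

text \<open>The weights depend on the nodes only; hence the constants derived from them are the same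
  for all polynomials, centres and radii.\<close>

lemma lagrange_extrapolation:
 fixes t :: "nat => real"
 assumes "inj_on t {..k}"
 obtains w w' :: "nat => real" where
  "!!P. degree P <= k ==> poly P 0 = (\<Sum>j\<le>k. w j * poly P (t j))"
  "!!P. degree P <= k ==> poly (pderiv P) 0 = (\<Sum>j\<le>k. w' j * poly P (t j))"
proof -
 define L where "L j = (\<Prod>i\<in>{..k}-{j}. smult (1 / (t j - t i)) [:- t i, 1:])" for j
 have degL: "degree (L j) <= k" if "j <= k" for j
 proof -
  have "degree (L j) <= (SUM i:{..k}-{j}. degree (smult (1 / (t j - t i)) [:- t i, 1:]))"
   unfolding L_def by (rule order_trans[OF degree_prod_sum_le]) (auto simp: o_def simp del: smult_pCons)
  also have "... <= (SUM i:{..k}-{j}. 1)" by (intro sum_mono) simp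
  also have "... = k" using that by simp
  finally show ?thesis .
 qed
 have L: "poly (L j) (t m) = (if j = m then 1 else 0)" if "j <= k" "m <= k" for j m
 proof (cases "j = m")
  case True
  have "poly (smult (1 / (t m - t i)) [:- t i, 1:]) (t m) = 1" if "i : {..k} - {m}" for i
  proof -
   have "t m ~= t i" using assms that \<open>m <= k\<close> by (auto simp: inj_on_def)
   then show ?thesis by (simp add: diff_divide_distrib[symmetric])
  qed
  then have "poly (L m) (t m) = 1" unfolding L_def poly_prod by (intro prod.neutral) blast
  then show ?thesis using True by simp
 next
  case False
  then show ?thesis using that by (auto simp: L_def poly_prod)
 qed
 have eq: "P = (\<Sum>j\<le>k. smult (poly P (t j)) (L j))" if "degree P <= k" for P
 proof (rule poly_eqI_degree[where A = "t ` {..k}"])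
  have c: "card (t ` {..k}) = Suc k" using card_image[OF assms] by simp
  show "degree P < card (t ` {..k})" using that c by simp
  have "degree (\<Sum>j\<le>k. smult (poly P (t j)) (L j)) <= k"
   by (intro degree_sum_le) (auto intro: order_trans[OF degree_smult_le] degL)
  then show "degree (\<Sum>j\<le>k. smult (poly P (t j)) (L j)) < card (t ` {..k})" using c by simp
  fix x assume "x : t ` {..k}"
  then obtain m where m: "m <= k" "x = t m" by auto
  then show "poly P x = poly (\<Sum>j\<le>k. smult (poly P (t j)) (L j)) x"
   by (simp add: poly_sum L if_distrib sum.delta' cong: if_cong)
 qed
 show ?thesis
 proof (rule that[of "%j. poly (L j) 0" "%j. poly (pderiv (L j)) 0"])
  fix P :: "real poly" assume "degree P <= k"
  note e = eq[OF this]
  show "poly P 0 = (\<Sum>j\<le>k. poly (L j) 0 * poly P (t j))"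
   by (subst e) (simp add: poly_sum mult.commute)
  show "poly (pderiv P) 0 = (\<Sum>j\<le>k. poly (pderiv (L j)) 0 * poly P (t j))"
   by (subst e) (simp add: poly_sum mult.commute pderiv_sum pderiv_smult)
 qed
qed

subsection \<open>Integration on Euclidean space\<close>

abbreviation lborel_nn_integral :: "('a::euclidean_space => ennreal) => ennreal" (binder "NN " 10) where
 "lborel_nn_integral f \<equiv> nn_integral lborel f"

lemma cont_set_integrable:
 fixes f :: "'a::euclidean_space => 'b::{banach, second_countable_topology}"
 assumes "cont f" "bounded S" "S : sets borel"
 shows "set_integrable lborel S f"
proof -
 obtain r where "ALL x:S. norm x <= r" using assms(2) bounded_iff by blast
 then have "S \<subseteq> cball 0 r" by auto
 moreover have "set_integrable lborel (cball 0 r) f"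
  unfolding set_integrable_def
  by (rule borel_integrable_compact) (auto intro: continuous_on_subset[OF assms(1)])
 ultimately show ?thesis using assms(3) by (intro set_integrable_subset[of lborel "cball 0 r" f S]) auto
qed

lemma nn_integral_lborel_affine:
 fixes f :: "'a::euclidean_space => ennreal"
 assumes [measurable]: "f : borel_measurable borel" and "c ~= 0"
 shows "(NN x. f x) = ennreal (\<bar>c\<bar> ^ DIM('a)) * (NN x. f (t + c *\<^sub>R x))"
 by (subst lborel_affine[OF assms(2), of t])
   (simp add: nn_integral_density nn_integral_distr nn_integral_cmult)

lemma integral_lborel_affine:
 fixes f :: "'a::euclidean_space => real"
 assumes [measurable]: "f : borel_measurable borel" and "c ~= 0"
 shows "(LBINT x. f x) = \<bar>c\<bar> ^ DIM('a) * (LBINT x. f (t + c *\<^sub>R x))"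
 by (subst lborel_affine[OF assms(2), of t])
   (simp add: integral_density integral_distr)

lemma integrable_lborel_affine:
 fixes f :: "'a::euclidean_space => real"
 assumes [measurable]: "f : borel_measurable borel" and "c ~= 0" "integrable lborel f"
 shows "integrable lborel (%x. f (t + c *\<^sub>R x))"
proof -
 have "integrable (density (distr lborel borel (%x. t + c *\<^sub>R x)) (%_. \<bar>c\<bar>^DIM('a))) f"
  using assms(3) lborel_affine[OF assms(2), of t] by simp
 then have "integrable lborel (%x. \<bar>c\<bar>^DIM('a) * f (t + c *\<^sub>R x))"
  by (simp add: integrable_density integrable_distr_eq)
 then show ?thesis using assms(2) by simp
qed

lemma measure_lborel_ball:
 fixes c :: "'a::euclidean_space"
 assumes "0 < r"
 shows "measure lborel (ball c r) = r ^ DIM('a) * measure lborel (ball (0::'a) 1)"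
proof -
 have "(LBINT x. indicator (ball c r) x) = r ^ DIM('a) * (\<integral>x. indicator (ball c r) (c + r *\<^sub>R x) \<partial>(lborel::'a measure))"
  using integral_lborel_affine[of "indicator (ball c r)" r c] assms by (simp add: borel_measurable_indicator)
 moreover have "indicator (ball c r) (c + r *\<^sub>R x) = (indicator (ball (0::'a) 1) x :: real)" for x
  using assms by (auto simp: indicator_def dist_norm)
 ultimately show ?thesis by simp
qed

lemma measure_lborel_ball_pos:
 fixes c :: "'a::euclidean_space"
 assumes "0 < r"
 shows "0 < measure lborel (ball c r)"
 using content_ball_pos[OF assms, of c] by simp

lemma set_lebesgue_integral_mono_set:
 fixes f :: "'a => real"
 assumes "set_integrable M B f" "A : sets M" "A \<subseteq> B" "!!x. x : B ==> 0 <= f x"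
 shows "(LINT x:A|M. f x) <= (LINT x:B|M. f x)"
proof -
 have "set_integrable M A f" using assms(1-3) by (rule set_integrable_subset)
 then show ?thesis unfolding set_lebesgue_integral_def using assms
  by (intro integral_mono) (auto simp: set_integrable_def indicator_def)
qed

lemma set_integrable_sum:
 fixes f :: "'i => 'a => real"
 assumes "!!i. i : I ==> set_integrable M A (f i)"
 shows "set_integrable M A (%x. SUM i:I. f i x)"
 using assms by (simp add: set_integrable_def sum_distrib_left)

lemma set_integral_sum:
 fixes f :: "'i => 'a => real"
 assumes "!!i. i : I ==> set_integrable M A (f i)"
 shows "(LINT x:A|M. SUM i:I. f i x) = (SUM i:I. LINT x:A|M. f i x)"
 using assms by (simp add: set_lebesgue_integral_def set_integrable_def sum_distrib_left)

subsection \<open>Norm equivalences for polynomials\<close>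

text \<open>On each line from \<open>y\<close> through a point \<open>z\<close> of the half ball,
  \<open>p y\<close> is extrapolated from nodes near \<open>z\<close>, all inside the ball.
  Averaging the squared formula over \<open>z\<close> gives the integral.\<close>

lemma poly_sup_bound:
 fixes k :: nat and M :: real
 assumes "0 <= M"
 obtains C where "0 < C" "!!(p::real^'n::finite => real) c y r. p : poly_space (int k) ==> 0 < r ==> norm (y - c) <= M * r ==>
   (p y)^2 <= C / r ^ CARD('n) * (LBINT x:ball c r. (p x)^2)"
proof -
 \<comment> \<open>All nodes lie within \<delta> of 1, so a node moves \<open>z\<close> by at most
   \<open>\<delta> * (M + 1) * r = r / 2\<close>; starting in the half ball, it stays in the
   ball.\<close>
 define \<delta> where "\<delta> = 1 / (2 * (M + 1))"
 have \<delta>: "0 < \<delta>" "\<delta> <= 1/2" using assms by (auto simp: \<delta>_def field_simps)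
 define t where "t j = 1 - \<delta> * (real j / real (k + 1))" for j
 have t: "1 - \<delta> <= t j" "t j <= 1" "1/2 <= t j" if "j <= k" for j
 proof -
  have "real j / real (k + 1) <= 1" "0 <= real j / real (k+1)" using that by auto
  then have "\<delta> * (real j / real (k + 1)) <= \<delta>" "0 <= \<delta> * (real j / real (k + 1))"
   using \<delta> by (intro mult_left_le mult_nonneg_nonneg; linarith)+
  then show "1 - \<delta> <= t j" "t j <= 1" "1/2 <= t j" using \<delta> unfolding t_def by linarith+
 qed
 have "inj_on t {..k}" using \<delta> by (auto simp: inj_on_def t_def)
 then obtain w w' where w: "!!P. degree P <= k ==> poly P 0 = (\<Sum>j\<le>k. w j * poly P (t j))"
  using lagrange_extrapolation by blast
 define W where "W = (\<Sum>j\<le>k. (w j)^2)"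
 have W: "0 <= W" unfolding W_def by (simp add: sum_nonneg)
 let ?N = "CARD('n)"
 define B where "B = measure lborel (ball (0::real^'n) (1/2))"
 have B: "0 < B" unfolding B_def by (rule measure_lborel_ball_pos) simp
 define C where "C = (W + 1) * real (k + 1) * 2 ^ ?N / B"
 show ?thesis
 proof (rule that)
  show "0 < C" using W B by (auto simp: C_def intro!: divide_pos_pos mult_pos_pos)
  fix p :: "real^'n => real" and c y :: "real^'n" and r :: real
  assume p: "p : poly_space (int k)" and r: "0 < r" and y: "norm (y - c) <= M * r"
  have pc: "cont p" using p ps_continuous by blast
  then have [measurable]: "p : borel_measurable borel" by (rule borel_measurable_continuous_onI)
  define I where "I = (LBINT x:ball c r. (p x)^2)"
  have intI: "set_integrable lborel (ball c r) (%x. (p x)^2)"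
   by (rule cont_set_integrable) (auto intro!: continuous_intros pc)
  have I0: "0 <= I" unfolding I_def set_lebesgue_integral_def by (intro integral_nonneg_AE) auto
  let ?x = "%j z. (1 - t j) *\<^sub>R y + t j *\<^sub>R z"
  have pt: "(p y)^2 <= W * (\<Sum>j\<le>k. (p (?x j z))^2)" for z
  proof -
   obtain P where P: "degree P <= k" "!!s. p (y + s *\<^sub>R (z - y)) = poly P s"
    using ps_line[OF p] by blast
   have "p y = poly P 0" using P(2)[of 0] by simp
   also have "... = (\<Sum>j\<le>k. w j * p (?x j z))"
    using w[OF P(1)] by (simp add: P(2)[symmetric] algebra_simps)
   finally have "(p y)^2 = (\<Sum>j\<le>k. w j * p (?x j z))^2" by simp
   also have "... <= (\<Sum>j\<le>k. (w j)^2) * (\<Sum>j\<le>k. (p (?x j z))^2)"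
    by (rule Cauchy_Schwarz_ineq_sum)
   finally show ?thesis by (simp add: W_def)
  qed
  have int1: "set_integrable lborel (ball c (r/2)) (%z. (p (?x j z))^2)" for j
   by (rule cont_set_integrable) (auto intro!: continuous_intros continuous_on_compose2[OF pc])
  have bd: "(LBINT z:ball c (r/2). (p (?x j z))^2) <= 2 ^ ?N * I" if j: "j <= k" for j
  proof -
   have t0: "t j ~= 0" using t(3)[OF j] by auto
   have sub: "?x j z : ball c r" if "z : ball c (r/2)" for z
   proof -
    have z: "norm (z - c) < r/2" using that by (simp add: dist_norm norm_minus_commute)
    have eq: "?x j z - c = (z - c) + (1 - t j) *\<^sub>R (y - c) - (1 - t j) *\<^sub>R (z - c)" by (simp add: algebra_simps)
    have "norm (?x j z - c) <= norm (z - c) + norm ((1 - t j) *\<^sub>R (y - c)) + norm ((1 - t j) *\<^sub>R (z - c))"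
     unfolding eq by (rule order_trans[OF norm_triangle_ineq4 add_right_mono[OF norm_triangle_ineq]])
    also have "... = norm (z - c) + (1 - t j) * (norm (y - c) + norm (z - c))"
     using t(2)[OF j] by (simp add: distrib_left del: scaleR_diff_right scaleR_left_diff_distrib)
    also have "... <= norm (z - c) + \<delta> * (M * r + r)"
     using t[OF j] \<delta> y z r by (intro add_left_mono mult_mono) auto
    also have "\<delta> * (M * r + r) = r / 2" using assms by (simp add: \<delta>_def field_simps)
    finally show ?thesis using z by (simp add: dist_norm norm_minus_commute)
   qed
   have m: "(%x. indicator (ball c r) x * (p x)^2) : borel_measurable borel"
    by (intro borel_measurable_times borel_measurable_indicator borel_measurable_power)
      (auto intro!: borel_measurable_continuous_onI[OF pc])
   have int2: "integrable lborel (%z. indicator (ball c r) (?x j z) * (p (?x j z))^2)"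
    using integrable_lborel_affine[OF m t0, of "(1 - t j) *\<^sub>R y"] intI
    by (simp add: set_integrable_def)
   have "(LBINT z:ball c (r/2). (p (?x j z))^2) <= (LBINT z. indicator (ball c r) (?x j z) * (p (?x j z))^2)"
    unfolding set_lebesgue_integral_def
    using int1[of j] int2 sub by (intro integral_mono) (auto simp: set_integrable_def indicator_def)
   also have "... = I / \<bar>t j\<bar> ^ ?N"
    using integral_lborel_affine[OF m t0, of "(1 - t j) *\<^sub>R y"] t0
    by (simp add: I_def set_lebesgue_integral_def)
   also have "... <= I / (1/2) ^ ?N" using t(3)[OF j] I0
    by (intro divide_left_mono power_mono mult_pos_pos) auto
   finally show ?thesis by (simp add: field_simps power_one_over)
  qed
  have "(p y)^2 * (r ^ ?N * B) = (LBINT z:ball c (r/2). (p y)^2)"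
   using measure_lborel_ball[of "r/2" c] measure_lborel_ball[of "1/2" "0::real^'n"] r
   by (simp add: B_def set_lebesgue_integral_def power_divide)
  also have "... <= (LBINT z:ball c (r/2). W * (\<Sum>j\<le>k. (p (?x j z))^2))"
  proof (rule set_integral_mono)
   show "set_integrable lborel (ball c (r/2)) (%z. (p y)^2)"
    by (rule cont_set_integrable) auto
   show "set_integrable lborel (ball c (r/2)) (%z. W * (\<Sum>j\<le>k. (p (?x j z))^2))"
    using int1 by (intro set_integrable_mult_right set_integrable_sum) auto
  qed (use pt in blast)
  also have "... = W * (\<Sum>j\<le>k. (LBINT z:ball c (r/2). (p (?x j z))^2))"
   using int1 by (subst set_integral_mult_right, subst set_integral_sum) auto
  also have "... <= W * (\<Sum>j\<le>k. 2 ^ ?N * I)" using bd W by (intro mult_left_mono sum_mono) auto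
  also have "... <= (W + 1) * real (k + 1) * 2 ^ ?N * I" using I0 by (simp add: algebra_simps)
  finally show "(p y)^2 <= C / r ^ ?N * I" using r B by (simp add: C_def field_simps)
 qed
qed

text \<open>The derivative at \<open>y\<close> is a fixed combination of the values at
  \<open>k + 1\<close> points on a segment of length \<open>r\<close> from \<open>y\<close>. These
  lie within \<open>(M + 1) * r\<close> of \<open>c\<close>, where the bound on values applies; the
  step length \<open>r\<close> gives the factor \<open>1 / r\<^sup>2\<close>.\<close>

lemma poly_partial_bound:
 fixes k :: nat and M :: real
 assumes "0 <= M"
 obtains C where "0 < C" "!!(p::real^'n::finite => real) c y r i. p : poly_space (int k) ==> 0 < r ==> norm (y - c) <= M * r ==>
   (partial i p y)^2 <= C / (r^2 * r ^ CARD('n)) * (LBINT x:ball c r. (p x)^2)"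
proof -
 obtain C where C: "0 < C" "!!(p::real^'n::finite => real) c y r. p : poly_space (int k) ==> 0 < r ==> norm (y - c) <= (M + 1) * r ==>
   (p y)^2 <= C / r ^ CARD('n) * (LBINT x:ball c r. (p x)^2)"
  using poly_sup_bound[of "M + 1" k, where 'n = 'n] assms by auto
 define t where "t j = real j / real (k + 1)" for j
 have t: "0 <= t j" "t j <= 1" if "j <= k" for j using that by (auto simp: t_def)
 have "inj_on t {..k}" by (auto simp: inj_on_def t_def)
 then obtain w w' where w: "!!P. degree P <= k ==> poly (pderiv P) 0 = (\<Sum>j\<le>k. w' j * poly P (t j))"
  using lagrange_extrapolation by blast
 define W where "W = (\<Sum>j\<le>k. (w' j)^2)"
 have W: "0 <= W" unfolding W_def by (simp add: sum_nonneg)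
 show ?thesis
 proof (rule that)
  show "0 < (W + 1) * real (k + 1) * C" using W C by simp
  fix p :: "real^'n => real" and c y :: "real^'n" and r :: real and i :: 'n
  assume p: "p : poly_space (int k)" and r: "0 < r" and y: "norm (y - c) <= M * r"
  define I where "I = (LBINT x:ball c r. (p x)^2)"
  have I0: "0 <= I" unfolding I_def set_lebesgue_integral_def by (intro integral_nonneg_AE) auto
  let ?e = "r *\<^sub>R axis i (1::real)"
  obtain P where P: "degree P <= k" "!!s. p (y + s *\<^sub>R ?e) = poly P s"
   using ps_line[OF p] by blast
  have "((%s. p (y + s *\<^sub>R ?e)) has_real_derivative (SUM j:UNIV. ?e $ j * partial j p (y + 0 *\<^sub>R ?e))) (at 0)"
   by (rule partial_line_deriv) (rule ps_differentiable[OF p])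
  moreover have "(SUM j:UNIV. ?e $ j * partial j p (y + 0 *\<^sub>R ?e)) = r * partial i p y"
   by (simp add: axis_def if_distrib[of "%a. a * _"] if_distrib[of "%a. _ * a"] cong: if_cong)
  ultimately have "(poly P has_real_derivative r * partial i p y) (at 0)" by (simp only: P(2))
  then have "r * partial i p y = poly (pderiv P) 0" using DERIV_unique poly_DERIV by blast
  also have "... = (\<Sum>j\<le>k. w' j * p (y + t j *\<^sub>R ?e))" using w[OF P(1)] by (simp only: P(2))
  finally have "(r * partial i p y)^2 = (\<Sum>j\<le>k. w' j * p (y + t j *\<^sub>R ?e))^2" by simp
  also have "... <= W * (\<Sum>j\<le>k. (p (y + t j *\<^sub>R ?e))^2)"
   unfolding W_def by (rule Cauchy_Schwarz_ineq_sum)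
  also have "... <= W * (\<Sum>j\<le>k. C / r ^ CARD('n) * I)"
  proof (intro mult_left_mono sum_mono W)
   fix j assume "j : {..k}"
   then have j: "t j * r <= r" "0 <= t j * r" using t[of j] r by (auto simp: mult_left_le_one_le)
   have "norm (y + t j *\<^sub>R ?e - c) <= norm (y - c) + norm (t j *\<^sub>R ?e)"
    using norm_triangle_ineq[of "y - c" "t j *\<^sub>R ?e"] by (simp add: algebra_simps)
   also have "norm (t j *\<^sub>R ?e) = t j * r" using j(2) t[of j] \<open>j : _\<close> r by (simp add: norm_axis_1)
   finally have "norm (y + t j *\<^sub>R ?e - c) <= (M + 1) * r" using y j by (simp add: algebra_simps)
   then show "(p (y + t j *\<^sub>R ?e))^2 <= C / r ^ CARD('n) * I" unfolding I_def using C(2) p r by blast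
  qed
  also have "... = W * real (k + 1) * (C / r ^ CARD('n) * I)" by simp
  also have "... <= (W + 1) * real (k + 1) * (C / r ^ CARD('n) * I)"
   using I0 r C(1) by (intro mult_right_mono) auto
  finally show "(partial i p y)^2 <= (W + 1) * real (k + 1) * C / (r^2 * r ^ CARD('n)) * I"
   using r by (simp add: field_simps power_mult_distrib)
 qed
qed

subsection \<open>Linear bijections and Lebesgue measure\<close>

lemma emeasure_lborel_ball_eq:
 "emeasure lborel (ball c r) = ennreal (measure lborel (ball (c::'a::euclidean_space) r))"
 by (rule emeasure_eq_ennreal_measure) (use emeasure_bounded_finite[OF bounded_ball, of c r] in auto)

lemma nn_integral_lborel_translate:
 fixes f :: "'a::euclidean_space => ennreal"
 assumes [measurable]: "f : borel_measurable borel"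
 shows "(NN x. f (t + x)) = (NN x. f x)"
 using nn_integral_lborel_affine[OF assms, of 1 t] by simp

lemma nn_integral_lborel_reflect:
 fixes f :: "'a::euclidean_space => ennreal"
 assumes [measurable]: "f : borel_measurable borel"
 shows "(NN x. f (t - x)) = (NN x. f x)"
 using nn_integral_lborel_affine[OF assms, of "-1" t] by simp

lemma nn_integral_lborel_swap:
 fixes f :: "'a::euclidean_space => 'b::euclidean_space => ennreal"
 assumes "(%(x, y). f x y) : borel_measurable (borel \<Otimes>\<^sub>M borel)"
 shows "(NN x. NN y. f x y) = (NN y. NN x. f x y)"
proof -
 have "(%(y, x). f x y) : borel_measurable (borel \<Otimes>\<^sub>M borel)"
  using measurable_compose[OF measurable_pair_swap' assms] by (simp add: case_prod_unfold)
 then show ?thesis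
  by (intro lborel_pair.Fubini') (simp add: measurable_cong_sets[OF sets_pair_measure_cong[OF sets_lborel sets_lborel] refl])
qed

text \<open>The image of Lebesgue measure under a linear bijection is translation invariant; comparing it
 with Lebesgue measure by Fubini's theorem shows that the two are proportional.\<close>

lemma nn_integral_linear_bij:
 fixes A :: "'a::euclidean_space => 'a"
 assumes "linear A" "linear B" "!!x. A (B x) = x" "!!x. B (A x) = x"
 obtains c where "0 < c" "!!f. f : borel_measurable borel ==> (NN x. f (A x)) = ennreal c * (NN x. f x)"
proof -
 have contA: "cont A" using assms(1) by (simp add: linear_continuous_on linear_conv_bounded_linear)
 have contB: "cont B" using assms(2) by (simp add: linear_continuous_on linear_conv_bounded_linear)
 have [measurable]: "A : borel_measurable borel" using contA by (rule borel_measurable_continuous_onI)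
 define g where "g = (indicator (ball 0 1) :: 'a => ennreal)"
 have [measurable]: "g : borel_measurable borel" unfolding g_def by (intro borel_measurable_indicator) auto
 have gm: "(NN x. g x) = ennreal (measure lborel (ball (0::'a) 1))"
  by (simp add: g_def emeasure_lborel_ball_eq)
 define m where "m = measure lborel (ball (0::'a) 1)"
 have m: "0 < m" unfolding m_def by (rule measure_lborel_ball_pos) simp
 have pre: "A -` ball 0 1 = B ` ball 0 1" using assms(3,4) by (auto intro: image_eqI[where x = "A _"] simp del: mem_ball)
 have bdd: "bounded (A -` ball 0 1)"
  unfolding pre using bounded_linear_image[OF bounded_ball] assms(2) linear_conv_bounded_linear by blast
 have op: "open (A -` ball 0 1)" using contA by (simp add: open_vimage)
 have gA: "(NN x. g (A x)) = emeasure lborel (A -` ball 0 1)"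
 proof -
  have "g (A x) = indicator (A -` ball 0 1) x" for x by (simp add: g_def indicator_def)
  then show ?thesis using op by simp
 qed
 define q where "q = measure lborel (A -` ball 0 1)"
 have fin: "emeasure lborel (A -` ball 0 1) < \<infinity>" using bdd by (rule emeasure_bounded_finite)
 have gq: "(NN x. g (A x)) = ennreal q"
  unfolding gA q_def using fin by (simp add: emeasure_eq_ennreal_measure less_top[symmetric])
 have q: "0 < q"
 proof -
  have "0 : A -` ball 0 1" using linear_0[OF assms(1)] by simp
  then obtain e where "0 < e" "ball 0 e \<subseteq> A -` ball 0 1" using op open_contains_ball by blast
  moreover have "0 < measure lborel (ball (0::'a) e)" using \<open>0 < e\<close> by (rule measure_lborel_ball_pos)
  moreover have "measure lborel (ball (0::'a) e) <= q" unfolding q_def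
   using calculation fin op by (intro measure_mono_fmeasurable) (auto simp: fmeasurable_def)
  ultimately show ?thesis by linarith
 qed
 show ?thesis
 proof (rule that[of "q / m"])
  show "0 < q / m" using q m by simp
  fix f :: "'a => ennreal" assume [measurable]: "f : borel_measurable borel"
  have inv: "(NN x. h (A x + z)) = (NN x. h (A x))" if [measurable]: "h : borel_measurable borel" for h :: "'a => ennreal" and z
  proof -
   have "A x + z = A (B z + x)" for x using assms(1,3) by (simp add: linear_add)
   then show ?thesis using nn_integral_lborel_translate[of "%x. h (A x)" "B z"] by simp
  qed
  \<comment> \<open>The double integral of \<open>f (A x) * g (A x - y)\<close> factorises in both
    orders of integration, by invariance under translations. Hence the factor is the integral of
    \<open>g (A x)\<close> over that of \<open>g x\<close>.\<close>
  have "(NN x. f (A x)) * (NN y. g y) = (NN x. f (A x) * (NN y. g y))"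
   by (simp add: nn_integral_multc)
  also have "... = (NN x. f (A x) * (NN y. g (A x - y)))"
   by (simp add: nn_integral_lborel_reflect)
  also have "... = (NN x. NN y. f (A x) * g (A x - y))"
   by (simp add: nn_integral_cmult)
  also have "... = (NN y. NN x. f (A x) * g (A x - y))"
   by (rule nn_integral_lborel_swap) measurable
  also have "... = (NN y. NN x. f (A x + y) * g (A x))"
  proof (rule nn_integral_cong)
   fix y :: 'a
   show "(NN x. f (A x) * g (A x - y)) = (NN x. f (A x + y) * g (A x))"
    using inv[of "%x. f x * g (x - y)" y] by simp
  qed
  also have "... = (NN x. NN y. f (A x + y) * g (A x))"
   by (rule nn_integral_lborel_swap[symmetric]) measurable
  also have "... = (NN x. (NN y. f y) * g (A x))"
   by (simp add: nn_integral_multc nn_integral_lborel_translate)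
  also have "... = (NN y. f y) * (NN x. g (A x))"
   by (simp add: nn_integral_cmult)
  finally have e: "(NN x. f (A x)) * ennreal m = (NN y. f y) * ennreal q"
   unfolding gm gq m_def .
  have "(NN x. f (A x)) = (NN x. f (A x)) * ennreal m * ennreal (1 / m)"
   using m by (simp add: mult.assoc ennreal_mult'[symmetric])
  also have "... = (NN y. f y) * (ennreal q * ennreal (1 / m))"
   unfolding e by (simp add: mult.assoc)
  also have "ennreal q * ennreal (1 / m) = ennreal (q / m)" using m q by (simp add: ennreal_mult'[symmetric])
  also have "(NN y. f y) * ennreal (q / m) = ennreal (q / m) * (NN y. f y)"
   by (rule mult.commute)
  finally show "(NN x. f (A x)) = ennreal (q / m) * (NN y. f y)" .
 qed
qed

text \<open>A shear is the square of a shear to which it is conjugate, so its determinant \<open>c\<close> satisfies \<open>c = c\<^sup>2\<close>.\<close>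

lemma nn_integral_shear:
 fixes f :: "'a::euclidean_space => ennreal"
 assumes f: "f : borel_measurable borel" and "n \<bullet> v = 0"
 shows "(NN x. f (x + (n \<bullet> x + b) *\<^sub>R v)) = (NN x. f x)"
proof (cases "n = 0")
 case True
 then show ?thesis using nn_integral_lborel_translate[OF f, of "b *\<^sub>R v"] by (simp add: add.commute)
next
 case False
 define S where "S = (%s x. x + (n \<bullet> x) *\<^sub>R (s *\<^sub>R v))"
 define w where "w = n /\<^sub>R (n \<bullet> n)"
 have nw: "n \<bullet> w = 1" using False by (simp add: w_def)
 \<comment> \<open>\<open>D\<close> doubles the component along \<open>n\<close>, hence conjugates
   the shear \<open>S s\<close> to \<open>S (2 * s)\<close>.\<close>
 define D where "D = (%x. x + (n \<bullet> x) *\<^sub>R w)"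
 define D' where "D' = (%x. x - ((n \<bullet> x) / 2) *\<^sub>R w)"
 have linS: "linear (S s)" for s by (auto simp: S_def linear_iff algebra_simps inner_simps)
 have linD: "linear D" "linear D'" by (auto simp: D_def D'_def linear_iff algebra_simps inner_simps add_divide_distrib)
 have SS: "S s (S t x) = S (s + t) x" for s t x using assms(2) by (simp add: S_def algebra_simps inner_simps)
 have S0: "S 0 x = x" for x by (simp add: S_def)
 have DD: "D (D' x) = x" "D' (D x) = x" for x using nw
  by (auto simp: D_def D'_def algebra_simps inner_simps add_divide_distrib scaleR_add_left[symmetric])
 have [measurable]: "S s : borel_measurable borel" for s unfolding S_def by measurable
 have [measurable]: "D : borel_measurable borel" unfolding D_def by measurable
 have "EX c>0. ALL f. f : borel_measurable borel --> (NN x. f (S s x)) = ennreal c * (NN x. f x)" for s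
  by (rule nn_integral_linear_bij[of "S s" "S (- s)"]) (auto simp: linS SS S0)
 then obtain c where c: "!!s. 0 < c s" "!!s f. f : borel_measurable borel ==> (NN x. f (S s x)) = ennreal (c s) * (NN x. f x)"
  by metis
 obtain d where d: "0 < d" "!!f. f : borel_measurable borel ==> (NN x. f (D x)) = ennreal d * (NN x. f x)"
  using nn_integral_linear_bij[OF linD DD] by blast
 have com: "S s (D x) = D (S (2 * s) x)" for s x using assms(2) nw
  by (simp add: S_def D_def algebra_simps inner_simps scaleR_2[symmetric])
 define g where "g = (indicator (ball 0 1) :: 'a => ennreal)"
 have [measurable]: "g : borel_measurable borel" unfolding g_def by (intro borel_measurable_indicator) auto
 define m where "m = measure lborel (ball (0::'a) 1)"
 have gm: "(NN x. g x) = ennreal m"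
  by (simp add: g_def m_def emeasure_lborel_ball_eq)
 have m: "0 < m" unfolding m_def by (rule measure_lborel_ball_pos) simp
 have "ennreal (c s) * (ennreal (c s) * ennreal m) = ennreal (c (2 * s)) * ennreal m" for s
 proof -
  have "(NN x. g (S s (S s x))) = ennreal (c s) * (ennreal (c s) * ennreal m)"
   using c(2)[of "%x. g (S s x)" s] c(2)[of g s] gm by simp
  then show ?thesis using c(2)[of g "2 * s"] gm by (simp add: SS)
 qed
 then have c2: "c s * c s = c (2 * s)" for s
  using c(1) m by (simp add: ennreal_mult''[symmetric] mult.assoc less_imp_le)
 have "ennreal d * (ennreal (c s) * ennreal m) = ennreal (c (2 * s)) * (ennreal d * ennreal m)" for s
 proof -
  have "(NN x. g (S s (D x))) = ennreal d * (ennreal (c s) * ennreal m)"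
   using d(2)[of "%x. g (S s x)"] c(2)[of g s] gm by simp
  moreover have "(NN x. g (D (S (2 * s) x))) = ennreal (c (2 * s)) * (ennreal d * ennreal m)"
   using c(2)[of "%x. g (D x)" "2 * s"] d(2)[of g] gm by simp
  ultimately show ?thesis by (simp add: com)
 qed
 then have c3: "d * (c s * m) = c (2 * s) * (d * m)" for s
  using c(1) m d(1) by (simp add: ennreal_mult''[symmetric] less_imp_le)
 have "c 1 = 1"
 proof -
  have "c (1/2) = c 1" using c3[of "1/2"] d(1) m by simp
  then show ?thesis using c2[of "1/2"] c(1)[of 1] by simp
 qed
 have "(NN x. f (x + (n \<bullet> x + b) *\<^sub>R v)) = (NN x. f (b *\<^sub>R v + S 1 x))"
  by (simp add: S_def algebra_simps)
 also have "... = (NN x. f (b *\<^sub>R v + x))"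
  using c(2)[of "%x. f (b *\<^sub>R v + x)" 1] \<open>c 1 = 1\<close> f by simp
 finally show ?thesis using nn_integral_lborel_translate[OF f] by simp
qed

subsection \<open>Surface measure on a hyperplane\<close>

text \<open>By Fubini's theorem, the area of a subset of a hyperplane is the volume of the slab over it. The direction \<open>u\<close> of the
 slab may be oblique, which allows the faces of a simplex to be compared by shears.\<close>

definition slab_measure :: "'a::euclidean_space => real => 'a => real set => 'a measure" where
 "slab_measure n b u A = distr (density lborel (%x. indicator A (n \<bullet> x + b))) borel (%x. x - (n \<bullet> x + b) *\<^sub>R u)"

lemma sets_slab_measure [simp, measurable_cong]: "sets (slab_measure n b u A) = sets borel"
 and space_slab_measure [simp]: "space (slab_measure n b u A) = UNIV"
 by (simp_all add: slab_measure_def)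

lemma nn_integral_slab_measure:
 assumes [measurable]: "f : borel_measurable borel" "A : sets borel"
 shows "(\<integral>\<^sup>+x. f x \<partial>slab_measure n b u A) = (NN x. indicator A (n \<bullet> x + b) * f (x - (n \<bullet> x + b) *\<^sub>R u))"
 unfolding slab_measure_def by (simp add: nn_integral_distr nn_integral_density)

lemma integral_slab_measure:
 fixes f :: "'a::euclidean_space => real"
 assumes [measurable]: "f : borel_measurable borel" "A : sets borel"
 shows "(\<integral>x. f x \<partial>slab_measure n b u A) = (LBINT x. indicator A (n \<bullet> x + b) * f (x - (n \<bullet> x + b) *\<^sub>R u))"
proof -
 have "(%x. indicator A (n \<bullet> x + b) :: ennreal) = (%x. ennreal (indicator A (n \<bullet> x + b)))"
  by (auto simp: indicator_def)
 then show ?thesis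
  unfolding slab_measure_def by (simp add: integral_distr integral_density)
qed

lemma integrable_slab_measure:
 fixes f :: "'a::euclidean_space => real"
 assumes [measurable]: "f : borel_measurable borel" "A : sets borel"
 shows "integrable (slab_measure n b u A) f \<longleftrightarrow> integrable lborel (%x. indicator A (n \<bullet> x + b) * f (x - (n \<bullet> x + b) *\<^sub>R u))"
proof -
 have "(%x. indicator A (n \<bullet> x + b) :: ennreal) = (%x. ennreal (indicator A (n \<bullet> x + b)))"
  by (auto simp: indicator_def)
 then show ?thesis
  unfolding slab_measure_def by (simp add: integrable_distr_eq integrable_density)
qed

text \<open>For a function invariant along \<open>u\<close>, integrals over slabs transversal to \<open>u\<close> only see the widths.\<close>

lemma slab_exchange:
 fixes G :: "'a::euclidean_space => ennreal"
 assumes [measurable]: "G : borel_measurable borel" "A : sets borel" "B : sets borel"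
  and inv: "!!x t. G (x + t *\<^sub>R u) = G x"
  and n: "\<bar>n \<bullet> u\<bar> = 1" "\<bar>n' \<bullet> u\<bar> = 1"
 shows "emeasure lborel B * (NN x. indicator A (n \<bullet> x + b) * G x) =
     emeasure lborel A * (NN x. indicator B (n' \<bullet> x + b') * G x)"
proof -
 have len: "(NN t. indicator B (s + e * t)) = emeasure lborel B" if [measurable]: "B : sets borel" and "\<bar>e\<bar> = 1" for B s and e :: real
 proof -
  have "e ~= 0" using that by auto
  then show ?thesis using nn_integral_lborel_affine[of "indicator B :: real => ennreal" e s] that by simp
 qed
 have "emeasure lborel B * (NN x. indicator A (n \<bullet> x + b) * G x) =
  (NN x. indicator A (n \<bullet> x + b) * G x * emeasure lborel B)"
  by (subst nn_integral_multc) (measurable, simp add: mult.commute)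
 also have "... = (NN x. indicator A (n \<bullet> x + b) * G x * (NN t. indicator B ((n' \<bullet> x + b') + (n' \<bullet> u) * t)))"
  by (simp only: len[OF assms(3) n(2)])
 also have "... = (NN x. NN t. indicator A (n \<bullet> x + b) * G x * indicator B ((n' \<bullet> x + b') + (n' \<bullet> u) * t))"
  by (simp add: nn_integral_cmult)
 also have "... = (NN t. NN x. indicator A (n \<bullet> x + b) * G x * indicator B ((n' \<bullet> x + b') + (n' \<bullet> u) * t))"
  by (rule nn_integral_lborel_swap) measurable
 also have "... = (NN t. NN x. indicator A (n \<bullet> x + b + (- (n \<bullet> u)) * t) * G x * indicator B (n' \<bullet> x + b'))"
 proof (rule nn_integral_cong)
  fix t :: real
  have *: "G (t *\<^sub>R u + x) = G x" for x using inv[of x t] by (simp add: add.commute)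
  show "(NN x. indicator A (n \<bullet> x + b) * G x * indicator B ((n' \<bullet> x + b') + (n' \<bullet> u) * t))
    = (NN x. indicator A (n \<bullet> x + b + (- (n \<bullet> u)) * t) * G x * indicator B (n' \<bullet> x + b'))"
   using nn_integral_lborel_translate[of "%x. indicator A (n \<bullet> x + b + (- (n \<bullet> u)) * t) * G x * indicator B (n' \<bullet> x + b')" "t *\<^sub>R u"]
   by (simp add: inv inner_add_right algebra_simps)
 qed
 also have "... = (NN x. NN t. indicator A (n \<bullet> x + b + (- (n \<bullet> u)) * t) * G x * indicator B (n' \<bullet> x + b'))"
  by (rule nn_integral_lborel_swap[symmetric]) measurable
 also have "... = (NN x. emeasure lborel A * G x * indicator B (n' \<bullet> x + b'))"
  using n len[of A "- (n \<bullet> u)"] by (simp add: nn_integral_multc)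
 finally show ?thesis by (simp add: nn_integral_cmult[symmetric] mult.assoc mult.commute mult.left_commute)
qed

text \<open>The case of \<open>slab_exchange\<close> with one direction and two thicknesses: the
  measure is proportional to the thickness. Cross-multiplication avoids dividing in
  \<open>ennreal\<close>.\<close>

lemma slab_measure_scale:
 assumes [measurable]: "A : sets borel" "B : sets borel" and "n \<bullet> u = 1"
 shows "emeasure lborel B * emeasure (slab_measure n b u A) S = emeasure lborel A * emeasure (slab_measure n b u B) S"
proof (cases "S : sets borel")
 case True
 then have [measurable]: "S : sets borel" .
 have *: "x + t *\<^sub>R u - (n \<bullet> (x + t *\<^sub>R u) + b) *\<^sub>R u = x - (n \<bullet> x + b) *\<^sub>R u" for x t
  using assms(3) by (simp add: inner_add_right algebra_simps)
 have e: "emeasure (slab_measure n b u A) S = (NN x. indicator A (n \<bullet> x + b) * indicator S (x - (n \<bullet> x + b) *\<^sub>R u))"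
  if [measurable]: "A : sets borel" for A
  using nn_integral_slab_measure[OF borel_measurable_indicator[OF \<open>S : sets borel\<close>] that, of n b u] by simp
 show ?thesis unfolding e[OF assms(1)] e[OF assms(2)]
  by (rule slab_exchange[where u = u]) ((measurable; fail) | (simp only: *; fail) | (simp add: assms(3); fail))+
next
 case False
 then show ?thesis by (simp add: emeasure_notin_sets)
qed

text \<open>The shear along \<open>u - w\<close> keeps every level of \<open>n\<close>, preserves
  volume and takes one projection to the other.\<close>

lemma slab_measure_shear:
 assumes [measurable]: "A : sets borel" and "n \<bullet> u = 1" "n \<bullet> w = 1"
 shows "slab_measure n b u A = slab_measure n b w A"
proof (rule measure_eqI)
 fix S assume "S : sets (slab_measure n b u A)"
 then have [measurable]: "S : sets borel" by simp
 have e: "emeasure (slab_measure n b u A) S = (NN x. indicator A (n \<bullet> x + b) * indicator S (x - (n \<bullet> x + b) *\<^sub>R u))"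
  if [measurable]: "A : sets borel" for A u
  using nn_integral_slab_measure[OF borel_measurable_indicator[OF \<open>S : sets borel\<close>] that, of n b u] by simp
 have nv: "n \<bullet> (u - w) = 0" using assms by (simp add: inner_diff_right)
 have *: "x + (n \<bullet> x + b) *\<^sub>R (u - w) - (n \<bullet> (x + (n \<bullet> x + b) *\<^sub>R (u - w)) + b) *\<^sub>R u = x - (n \<bullet> x + b) *\<^sub>R w" for x
 proof -
  have "n \<bullet> (x + (n \<bullet> x + b) *\<^sub>R (u - w)) = n \<bullet> x" using nv by (simp add: inner_add_right)
  then show ?thesis by (simp add: algebra_simps)
 qed
 have **: "n \<bullet> (x + (n \<bullet> x + b) *\<^sub>R (u - w)) = n \<bullet> x" for x using nv by (simp add: inner_add_right)
 show "emeasure (slab_measure n b u A) S = emeasure (slab_measure n b w A) S"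
  unfolding e[OF assms(1)]
  using nn_integral_shear[of "%x. indicator A (n \<bullet> x + b) * indicator S (x - (n \<bullet> x + b) *\<^sub>R u)" n "u - w" b, OF _ nv]
  unfolding * unfolding ** by simp
qed simp

text \<open>Cavalieri's principle: translation by \<open>- t *\<^sub>R u\<close> brings a given
  point into the unit slab for a set of \<open>t\<close> of length one, so integrating over lines
  that start in the slab counts each point once.\<close>

lemma slab_integral:
 fixes G :: "'a::euclidean_space => real"
 assumes G: "integrable lborel G" and [measurable]: "G : borel_measurable borel" and n: "n \<bullet> u = 1"
 shows "(LBINT x. G x) = (LBINT x. indicator {0..<1} (n \<bullet> x + b) * (LBINT t. G (x + t *\<^sub>R u)))"
proof -
 let ?f = "%x t. indicator {0..<1} (n \<bullet> x + b) * G (x + t *\<^sub>R u)"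
 have len: "(NN t. indicator {0..<1} (s - t)) = 1" for s :: real
  using nn_integral_lborel_affine[of "indicator {0..<1} :: real => ennreal" "-1" s] by simp
 have "(NN x. NN t. ennreal (norm (?f x t))) = (NN x. ennreal (norm (G x)))"
 proof -
  have "(NN x. NN t. ennreal (norm (?f x t))) = (NN t. NN x. ennreal (norm (?f x t)))"
   by (rule nn_integral_lborel_swap) measurable
  also have "... = (NN t. NN x. indicator {0..<1} (n \<bullet> x + b - t) * ennreal (norm (G x)))"
  proof (rule nn_integral_cong)
   fix t :: real
   have "(NN x. ennreal (norm (?f x t))) = (NN x. ennreal (norm (?f ((- t) *\<^sub>R u + x) t)))"
    by (rule nn_integral_lborel_translate[symmetric]) measurable
   also have "... = (NN x. indicator {0..<1} (n \<bullet> x + b - t) * ennreal (norm (G x)))"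
    using n by (intro nn_integral_cong) (auto simp: inner_add_right inner_diff_right indicator_def algebra_simps)
   finally show "(NN x. ennreal (norm (?f x t))) = (NN x. indicator {0..<1} (n \<bullet> x + b - t) * ennreal (norm (G x)))" .
  qed
  also have "... = (NN x. NN t. indicator {0..<1} (n \<bullet> x + b - t) * ennreal (norm (G x)))"
   by (rule nn_integral_lborel_swap[symmetric]) measurable
  finally show ?thesis by (simp add: nn_integral_multc len)
 qed
 also have "... < \<infinity>" using G by (simp add: integrable_iff_bounded)
 finally have fin: "(NN x. NN t. ennreal (norm (?f x t))) < \<infinity>" .
 have int: "integrable (lborel \<Otimes>\<^sub>M lborel) (%(x, t). ?f x t)"
 proof (rule integrableI_bounded)
  show "(\<integral>\<^sup>+z. ennreal (norm (case z of (x, t) => ?f x t)) \<partial>(lborel \<Otimes>\<^sub>M lborel)) < \<infinity>"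
   using fin by (subst lborel.nn_integral_fst[symmetric]) (auto simp: case_prod_unfold)
 qed measurable
 have "(LBINT x. indicator {0..<1} (n \<bullet> x + b) * (LBINT t. G (x + t *\<^sub>R u))) = (LBINT x. LBINT t. ?f x t)"
  by simp
 also have "... = (LBINT t. LBINT x. ?f x t)"
  using lborel_pair.Fubini_integral[OF int] by simp
 also have "... = (LBINT t. LBINT x. indicator {0..<1} (n \<bullet> x + b - t) * G x)"
 proof (rule Bochner_Integration.integral_cong[OF refl])
  fix t :: real
  have "(LBINT x. ?f x t) = (LBINT x. ?f ((- t) *\<^sub>R u + 1 *\<^sub>R x) t)"
   by (subst integral_lborel_affine[of _ 1 "(- t) *\<^sub>R u"]) auto
  also have "... = (LBINT x. indicator {0..<1} (n \<bullet> x + b - t) * G x)"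
   using n by (intro Bochner_Integration.integral_cong) (auto simp: inner_add_right inner_diff_right indicator_def algebra_simps)
  finally show "(LBINT x. ?f x t) = (LBINT x. indicator {0..<1} (n \<bullet> x + b - t) * G x)" .
 qed
 also have "... = (LBINT x. LBINT t. indicator {0..<1} (n \<bullet> x + b - t) * G x)"
 proof (rule lborel_pair.Fubini_integral)
  show "integrable (lborel \<Otimes>\<^sub>M lborel) (%(x, t). indicator {0..<1} (n \<bullet> x + b - t) * G x)"
  proof (rule integrableI_bounded)
   have "(NN x. NN t. ennreal (norm (indicator {0..<1} (n \<bullet> x + b - t) * G x))) =
    (NN x. NN t. indicator {0..<1} (n \<bullet> x + b - t) * ennreal (norm (G x)))"
    by (intro nn_integral_cong) (auto simp: indicator_def)
   also have "... < \<infinity>" using G by (simp add: nn_integral_multc len integrable_iff_bounded)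
   finally show "(\<integral>\<^sup>+z. ennreal (norm (case z of (x, t) => indicator {0..<1} (n \<bullet> x + b - t) * G x)) \<partial>(lborel \<Otimes>\<^sub>M lborel)) < \<infinity>"
    by (subst lborel.nn_integral_fst[symmetric]) (auto simp: case_prod_unfold)
  qed measurable
 qed
 also have "... = (LBINT x. G x)"
 proof (rule Bochner_Integration.integral_cong[OF refl])
  fix x
  have "(LBINT t. indicator {0..<1} (n \<bullet> x + b - t)) = (1::real)"
   using integral_lborel_affine[of "indicator {0..<1} :: real => real" "-1" "n \<bullet> x + b"] by simp
  then show "(LBINT t. indicator {0..<1} (n \<bullet> x + b - t) * G x) = G x" by simp
 qed
 finally show ?thesis by simp
qed

text \<open>The projected integrand is constant along \<open>u\<close>, so any transversal slab of
  unit width yields the same integral. Surface integrals over two faces can thus be subtracted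
  inside one slab.\<close>

lemma slab_change:
 fixes f :: "'a::euclidean_space => real"
 assumes [measurable]: "f : borel_measurable borel" and n: "n \<bullet> u = 1" "\<bar>n' \<bullet> u\<bar> = 1"
 shows "(LBINT x. indicator {0..<1} (n' \<bullet> x + b') * f (x - (n \<bullet> x + b) *\<^sub>R u)) = (\<integral>x. f x \<partial>slab_measure n b u {0..<1})"
  and "integrable lborel (%x. indicator {0..<1} (n' \<bullet> x + b') * f (x - (n \<bullet> x + b) *\<^sub>R u)) \<longleftrightarrow> integrable (slab_measure n b u {0..<1}) f"
proof -
 let ?p = "%x. x - (n \<bullet> x + b) *\<^sub>R u"
 let ?M = "distr (density lborel (%x. ennreal (indicator {0..<1} (n' \<bullet> x + b')))) borel ?p"
 have inv: "x + t *\<^sub>R u - (n \<bullet> (x + t *\<^sub>R u) + b) *\<^sub>R u = x - (n \<bullet> x + b) *\<^sub>R u" for x t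
  using n by (simp add: inner_add_right algebra_simps)
 have eq: "?M = slab_measure n b u {0..<1}"
 proof (rule measure_eqI)
  fix S assume "S : sets ?M"
  then have S: "S : sets borel" by simp
  note [measurable] = S
  have ind: "ennreal (indicator {0..<1} (n' \<bullet> x + b')) = indicator {0..<1} (n' \<bullet> x + b')" for x
   by (auto simp: indicator_def)
  have "emeasure ?M S = (\<integral>\<^sup>+x. indicator S x \<partial>?M)" using S by simp
  also have "... = (NN x. indicator {0..<1} (n' \<bullet> x + b') * indicator S (?p x))"
   by (simp add: nn_integral_distr nn_integral_density ind del: nn_integral_indicator)
  also have "... = (NN x. indicator {0..<1} (n \<bullet> x + b) * indicator S (?p x))"
   using slab_exchange[of "%x. indicator S (?p x)" "{0..<1}" "{0..<1}" u n' n b' b] n by (simp add: inv)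
  also have "... = emeasure (slab_measure n b u {0..<1}) S"
   using nn_integral_slab_measure[OF borel_measurable_indicator[OF S], of "{0..<1}" n b u] S by simp
  finally show "emeasure ?M S = emeasure (slab_measure n b u {0..<1}) S" .
 qed simp
 show "(LBINT x. indicator {0..<1} (n' \<bullet> x + b') * f (?p x)) = (\<integral>x. f x \<partial>slab_measure n b u {0..<1})"
  unfolding eq[symmetric] by (simp add: integral_distr integral_density)
 show "integrable lborel (%x. indicator {0..<1} (n' \<bullet> x + b') * f (?p x)) \<longleftrightarrow> integrable (slab_measure n b u {0..<1}) f"
  unfolding eq[symmetric] by (simp add: integrable_distr_eq integrable_density)
qed

lemma slab_set_integrable:
 fixes f :: "'a::euclidean_space => real"
 assumes f: "cont f" and F: "bounded F" "F : sets borel" and A: "bounded A" "A : sets borel"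
 shows "set_integrable (slab_measure n b u A) F f"
proof -
 let ?p = "%x. x - (n \<bullet> x + b) *\<^sub>R u"
 have [measurable]: "f : borel_measurable borel" using f by (rule borel_measurable_continuous_onI)
 note [measurable] = F(2) A(2)
 let ?S = "{x. n \<bullet> x + b : A & ?p x : F}"
 have "bounded ?S"
 proof -
  obtain r where r: "!!x. x : F ==> norm x <= r" using F(1) bounded_iff by blast
  obtain q where q: "!!x. x : A ==> \<bar>x\<bar> <= q" using A(1) bounded_iff by (metis real_norm_def)
  have "norm x <= r + q * norm u" if "x : ?S" for x
  proof -
   have "norm x <= norm (?p x) + norm ((n \<bullet> x + b) *\<^sub>R u)" using norm_triangle_ineq[of "?p x" "(n \<bullet> x + b) *\<^sub>R u"] by simp
   also have "... <= r + q * norm u" using that r q by (auto intro!: add_mono mult_right_mono)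
   finally show ?thesis .
  qed
  then show ?thesis using bounded_iff by blast
 qed
 moreover have "?S : sets borel" by measurable
 moreover have "cont (%x. f (?p x))"
  by (rule continuous_on_compose2[OF f]) (auto intro!: continuous_intros)
 ultimately have "set_integrable lborel ?S (%x. f (?p x))" by (intro cont_set_integrable)
 moreover have e2: "indicator A (n \<bullet> x + b) * (indicator F (?p x) * f (?p x)) = indicator ?S x * f (?p x)" for x
  by (auto simp: indicator_def)
 moreover have e3: "integrable (slab_measure n b u A) (%x. indicator F x * f x) \<longleftrightarrow>
   integrable lborel (%x. indicator A (n \<bullet> x + b) * (indicator F (?p x) * f (?p x)))"
  by (rule integrable_slab_measure) measurable
 ultimately show ?thesis by (simp only: set_integrable_def e3 e2 real_scaleR_def)
qed

subsection \<open>Barycentric coordinates\<close>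

text \<open>The simplex is handled through its barycentric coordinates as affine functions on the
  whole space; \<open>g a\<close> is the gradient of the coordinate of the vertex
  \<open>a\<close>.\<close>

locale bary =
 fixes C :: "(real^'n::finite) set" and g :: "real^'n => real^'n" and \<beta> :: "real^'n => real"
 assumes fin: "finite C" and card_C: "card C = CARD('n) + 1"
  and delta: "!!a b. a : C ==> b : C ==> g a \<bullet> b + \<beta> a = (if a = b then 1 else 0)"
  and sum1: "!!x. (SUM a:C. g a \<bullet> x + \<beta> a) = 1"
  and repr: "!!x. (SUM a:C. (g a \<bullet> x + \<beta> a) *\<^sub>R a) = x"
begin

abbreviation lam :: "real^'n => real^'n => real" where "lam a x \<equiv> g a \<bullet> x + \<beta> a"
abbreviation T :: "(real^'n) set" where "T \<equiv> convex hull C"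
abbreviation face :: "real^'n => (real^'n) set" where "face a \<equiv> convex hull (C - {a})"

text \<open>The area on the face opposite to \<open>a\<close>, divided by \<open>norm (g a)\<close>.
  With this normalisation \<open>- g a\<close> takes the place of the outward unit normal in the
  divergence theorem.\<close>

definition surf :: "real^'n => (real^'n) measure" where
 "surf a = slab_measure (g a) (\<beta> a) (g a /\<^sub>R (g a \<bullet> g a)) {0..<1}"

lemma sum_g: "(SUM a:C. g a) = 0"
proof -
 have "(SUM a:C. g a) \<bullet> x = 0" for x
 proof -
  have "(SUM a:C. g a) \<bullet> x = (SUM a:C. lam a x) - (SUM a:C. lam a 0)"
   by (simp add: inner_sum_left sum_subtractf[symmetric])
  then show ?thesis using sum1[of x] sum1[of 0] by simp
 qed
 then show ?thesis using inner_eq_zero_iff by blast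
qed

lemma g_edge: "a : C ==> b : C ==> c : C ==> g a \<bullet> (b - c) = (if a = b then 1 else 0) - (if a = c then 1 else 0)"
 using delta[of a b] delta[of a c] by (simp add: inner_diff_right)

lemma vec_repr: "(SUM a:C. (g a \<bullet> u) *\<^sub>R (a - i)) = u"
proof -
 have "(SUM a:C. (g a \<bullet> u) *\<^sub>R a) = (SUM a:C. lam a u *\<^sub>R a) - (SUM a:C. lam a 0 *\<^sub>R a)"
  by (simp add: sum_subtractf[symmetric] scaleR_add_left)
 also have "... = u" by (simp only: repr) simp
 finally have "(SUM a:C. (g a \<bullet> u) *\<^sub>R a) = u" .
 moreover have "(SUM a:C. (g a \<bullet> u) *\<^sub>R i) = 0"
  using sum_g by (simp add: scaleR_sum_left[symmetric] inner_sum_left[symmetric])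
 ultimately show ?thesis by (simp add: scaleR_diff_right sum_subtractf)
qed

lemma exists_other: "a : C ==> EX b:C. b ~= a"
proof -
 assume "a : C"
 have "C ~= {a}" using card_C by auto
 then show ?thesis using \<open>a : C\<close> by blast
qed

lemma g_nonzero: "a : C ==> g a ~= 0"
 using exists_other[of a] delta[of a] delta[of a a] by (metis inner_zero_left zero_neq_one)

lemma T_iff: "x : T \<longleftrightarrow> (ALL a:C. 0 <= lam a x)"
proof
 assume "x : T"
 then obtain u where u: "ALL b:C. 0 <= u b" "sum u C = 1" "(SUM b:C. u b *\<^sub>R b) = x"
  using convex_hull_finite[OF fin] by blast
 show "ALL a:C. 0 <= lam a x"
 proof
  fix a assume a: "a : C"
  have "lam a x = (SUM b:C. u b * (g a \<bullet> b)) + (SUM b:C. u b) * \<beta> a"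
   using u by (auto simp: inner_sum_right)
  also have "... = (SUM b:C. u b * lam a b)" by (simp add: sum_distrib_right sum.distrib distrib_left)
  also have "... = u a" using a fin by (simp add: delta if_distrib cong: if_cong)
  finally show "0 <= lam a x" using u a by simp
 qed
next
 assume "ALL a:C. 0 <= lam a x"
 then show "x : T" unfolding convex_hull_finite[OF fin] using sum1[of x] repr[of x]
  by (intro CollectI exI[of _ "%b. lam b x"] conjI)
qed

lemma face_iff: "a : C ==> x : face a \<longleftrightarrow> x : T & lam a x = 0"
proof -
 assume a: "a : C"
 have sub: "face a \<subseteq> T" by (rule hull_mono) auto
 have "face a \<subseteq> {x. lam a x = 0}"
 proof (rule hull_minimal)
  show "C - {a} \<subseteq> {x. lam a x = 0}" using a delta by auto
  have "{x. lam a x = 0} = {x. g a \<bullet> x = - \<beta> a}" by auto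
  then show "convex {x. lam a x = 0}" by (simp add: convex_hyperplane)
 qed
 moreover have "x : face a" if "x : T" "lam a x = 0" for x
 proof -
  have "(SUM b:C - {a}. lam b x) = 1" "(SUM b:C - {a}. lam b x *\<^sub>R b) = x"
   using sum1[of x] repr[of x] that(2) sum.remove[OF fin a, of "%b. lam b x"]
    sum.remove[OF fin a, of "%b. lam b x *\<^sub>R b"] by auto
  moreover have "ALL b:C - {a}. 0 <= lam b x" using T_iff[of x] that(1) by simp
  ultimately show ?thesis unfolding convex_hull_finite[OF finite_Diff[OF fin]]
   by (intro CollectI exI[of _ "%b. lam b x"] conjI)
 qed
 ultimately show ?thesis using sub by blast
qed

lemma compact_T: "compact T" using fin by (simp add: finite_imp_compact_convex_hull)
lemma compact_face: "compact (face a)" using fin by (simp add: finite_imp_compact_convex_hull)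
lemma T_borel [measurable]: "T : sets borel" using compact_T by (simp add: borel_compact)
lemma face_borel [measurable]: "face a : sets borel" using compact_face by (simp add: borel_compact)

lemma affine_hull_face: "a : C ==> affine hull (face a) = {x. lam a x = 0}"
proof -
 assume a: "a : C"
 have "affine hull (face a) = affine hull (C - {a})" by (rule affine_hull_convex_hull)
 also have "... = {x. lam a x = 0}"
 proof
  show "affine hull (C - {a}) \<subseteq> {x. lam a x = 0}"
  proof (rule hull_minimal)
   show "C - {a} \<subseteq> {x. lam a x = 0}" using a delta by auto
   have "{x. lam a x = 0} = {x. g a \<bullet> x = - \<beta> a}" by auto
   then show "affine {x. lam a x = 0}" by (simp add: affine_hyperplane)
  qed
  show "{x. lam a x = 0} \<subseteq> affine hull (C - {a})"
  proof
   fix x assume "x : {x. lam a x = 0}"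
   then have "(SUM b:C - {a}. lam b x) = 1" "(SUM b:C - {a}. lam b x *\<^sub>R b) = x"
    using sum1[of x] repr[of x] sum.remove[OF fin a, of "%b. lam b x"]
     sum.remove[OF fin a, of "%b. lam b x *\<^sub>R b"] by auto
   then show "x : affine hull (C - {a})" unfolding affine_hull_finite[OF finite_Diff[OF fin]]
    by (intro CollectI exI[of _ "%b. lam b x"] conjI)
  qed
 qed
 finally show ?thesis .
qed

lemma independent: "~ affine_dependent C"
proof
 assume "affine_dependent C"
 then obtain a where a: "a : C" "a : affine hull (C - {a})" unfolding affine_dependent_def by blast
 then have "lam a a = 0" using affine_hull_face[OF a(1)] affine_hull_convex_hull[of "C - {a}"] by auto
 then show False using delta[of a a] a by simp
qed

lemma facet_iff: "F facet_of T \<longleftrightarrow> (EX a:C. F = face a)"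
proof -
 have "2 <= card C" using card_C by simp
 then show ?thesis using facet_of_convex_hull_affine_independent_alt[OF independent] by blast
qed

lemma inj_face: "a : C ==> b : C ==> face a = face b ==> a = b"
proof (rule ccontr)
 assume a: "a : C" "b : C" "face a = face b" "a ~= b"
 then have "b : face a" by (intro hull_inc) auto
 then have "b : face b" using a by simp
 then show False using a(2) face_iff[of b b] delta[of b b] by simp
qed

lemma interior_T: "interior T = {x. ALL a:C. 0 < lam a x}"
proof
 show "{x. ALL a:C. 0 < lam a x} \<subseteq> interior T"
 proof (rule interior_maximal)
  show "{x. ALL a:C. 0 < lam a x} \<subseteq> T" using T_iff by (auto simp: less_imp_le)
  have "{x. ALL a:C. 0 < lam a x} = (\<Inter>a\<in>C. {x. 0 < lam a x})" by auto
  then show "open {x. ALL a:C. 0 < lam a x}" using fin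
   by (auto intro!: open_INT open_Collect_less continuous_intros)
 qed
 show "interior T \<subseteq> {x. ALL a:C. 0 < lam a x}"
 proof
  fix x assume x: "x : interior T"
  then obtain e where e: "0 < e" "cball x e \<subseteq> T" using mem_interior_cball by blast
  show "x : {x. ALL a:C. 0 < lam a x}"
  proof (intro CollectI ballI)
   fix a assume a: "a : C"
   let ?y = "x - (e / norm (g a)) *\<^sub>R g a"
   have "?y : cball x e" using e g_nonzero[OF a] by (simp add: dist_norm)
   then have "0 <= lam a ?y" using e T_iff a by blast
   also have "lam a ?y = lam a x - e * norm (g a)"
    using g_nonzero[OF a] by (simp add: inner_diff_right power2_norm_eq_inner[symmetric] power2_eq_square)
   finally have "e * norm (g a) <= lam a x" by simp
   moreover have "0 < e * norm (g a)" using e g_nonzero[OF a] by simp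
   ultimately show "0 < lam a x" by linarith
  qed
 qed
qed

lemma g_u: "a : C ==> g a \<bullet> (g a /\<^sub>R (g a \<bullet> g a)) = 1"
 using g_nonzero by simp

lemma surf_eq: "a : C ==> g a \<bullet> u = 1 ==> surf a = slab_measure (g a) (\<beta> a) u {0..<1}"
 unfolding surf_def by (rule slab_measure_shear) (use g_u in auto)

lemma sets_surf [simp, measurable_cong]: "sets (surf a) = sets borel"
 by (simp add: surf_def)

lemma surf_integrable:
 fixes f :: "real^'n => real"
 assumes "cont f"
 shows "set_integrable (surf a) (face a) f"
 unfolding surf_def using assms compact_face[of a]
 by (intro slab_set_integrable) (auto simp: compact_imp_bounded)

text \<open>Fundamental theorem of calculus on lines parallel to the edge: in direction
  \<open>j - m\<close> they enter through the face opposite to \<open>j\<close>, and leave through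
  the one opposite to \<open>m\<close>.\<close>

lemma divergence_edge:
 fixes \<phi> :: "real^'n => real"
 assumes \<phi>: "C1 \<phi>" and j: "j : C" and m: "m : C" and "j ~= m"
 shows "(LBINT x:T. (j - m) \<bullet> gradient \<phi> x) = (LINT x:face m|surf m. \<phi> x) - (LINT x:face j|surf j. \<phi> x)"
proof -
 let ?e = "j - m"
 let ?D = "%x. ?e \<bullet> gradient \<phi> x"
 have \<phi>c: "cont \<phi>" using \<phi> C1_cont by blast
 have gc: "cont ?D"
  using \<phi> unfolding gradient_def inner_vec_def by (auto intro!: continuous_intros)
 have [measurable]: "\<phi> : borel_measurable borel" "?D : borel_measurable borel"
  using \<phi>c gc by (auto intro: borel_measurable_continuous_onI)
 have gj: "g j \<bullet> ?e = 1" and gm: "g m \<bullet> ?e = -1" and go: "!!a. a : C ==> a ~= j ==> a ~= m ==> g a \<bullet> ?e = 0"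
  using g_edge j m \<open>j ~= m\<close> by auto
 have gm': "g m \<bullet> (- ?e) = 1" by (simp only: inner_minus_right gm minus_minus)
 have gj': "\<bar>g j \<bullet> (- ?e)\<bar> = 1" by (simp only: inner_minus_right gj abs_minus_cancel abs_one)
 define G where "G x = indicator T x * ?D x" for x
 have [measurable]: "G : borel_measurable borel" unfolding G_def by measurable
 have intG: "integrable lborel G"
  using cont_set_integrable[OF gc compact_imp_bounded[OF compact_T] T_borel]
  by (simp add: set_integrable_def G_def[abs_def])
 let ?pj = "%x. x - lam j x *\<^sub>R ?e"
 let ?pm = "%x. x - lam m x *\<^sub>R (- ?e)"
 have lamline: "lam j (x + t *\<^sub>R ?e) = lam j x + t" "lam m (x + t *\<^sub>R ?e) = lam m x - t"
  "!!a. a : C ==> a ~= j ==> a ~= m ==> lam a (x + t *\<^sub>R ?e) = lam a x" for x t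
  using gj gm go by (auto simp: inner_add_right)
 have line: "x + t *\<^sub>R ?e : T \<longleftrightarrow> - lam j x <= t & t <= lam m x & (ALL a:C - {j, m}. 0 <= lam a x)" for x t
 proof -
  have "x + t *\<^sub>R ?e : T \<longleftrightarrow> 0 <= lam j (x + t *\<^sub>R ?e) & 0 <= lam m (x + t *\<^sub>R ?e) & (ALL a:C - {j, m}. 0 <= lam a (x + t *\<^sub>R ?e))"
   unfolding T_iff using j m by blast
  then show ?thesis using lamline(1,2)[of x t] lamline(3)[of _ x t] by auto
 qed
 have pj: "?pj x = x + (- lam j x) *\<^sub>R ?e" and pm: "?pm x = x + lam m x *\<^sub>R ?e" for x
  by (simp_all only: scaleR_minus_left scaleR_minus_right diff_minus_eq_add add_uminus_conv_diff)
 \<comment> \<open>Along the edge only the coordinates of \<open>j\<close> and \<open>m\<close>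
   change, in opposite directions. The line through \<open>x\<close> meets the simplex iff this
   holds, and then both end points lie on the two faces.\<close>
 let ?good = "%x. - lam j x <= lam m x & (ALL a:C - {j, m}. 0 <= lam a x)"
 have fj: "?pj x : face j \<longleftrightarrow> ?good x" for x
  unfolding face_iff[OF j] pj line using lamline(1)[of x "- lam j x"] by auto
 have fm: "?pm x : face m \<longleftrightarrow> ?good x" for x
  unfolding face_iff[OF m] pm line using lamline(2)[of x "lam m x"] by auto
 have inner: "(LBINT t. G (x + t *\<^sub>R ?e)) = indicator (face m) (?pm x) * \<phi> (?pm x) - indicator (face j) (?pj x) * \<phi> (?pj x)" for x
 proof (cases "?good x")
  case True
  have "(LBINT t. G (x + t *\<^sub>R ?e)) = (LBINT t. ?D (x + t *\<^sub>R ?e) * indicator {- lam j x..lam m x} t)"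
   using True line by (intro Bochner_Integration.integral_cong) (auto simp: G_def indicator_def)
  also have "... = \<phi> (x + lam m x *\<^sub>R ?e) - \<phi> (x + (- lam j x) *\<^sub>R ?e)"
  proof (rule integral_FTC_Icc_real)
   show "- lam j x <= lam m x" using True by simp
   fix t
   show "((%t. \<phi> (x + t *\<^sub>R ?e)) has_real_derivative ?D (x + t *\<^sub>R ?e)) (at t)"
    using partial_line_deriv[of \<phi> x t ?e] \<phi> by (simp add: gradient_def inner_vec_def)
   show "isCont (%t. ?D (x + t *\<^sub>R ?e)) t"
    using continuous_on_compose2[OF gc, of UNIV "%t. x + t *\<^sub>R ?e"]
    by (auto simp: continuous_on_eq_continuous_at intro!: continuous_intros)
  qed
  finally show ?thesis using True fj[of x] fm[of x] unfolding pj pm by simp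
 next
  case False
  then have "G (x + t *\<^sub>R ?e) = 0" for t using line[of x t] by (auto simp: G_def)
  then show ?thesis using False fj fm by auto
 qed
 define fm where "fm x = indicator (face m) x * \<phi> x" for x
 define fj where "fj x = indicator (face j) x * \<phi> x" for x
 have [measurable]: "fm : borel_measurable borel" "fj : borel_measurable borel"
  unfolding fm_def fj_def by measurable
 have sj: "surf j = slab_measure (g j) (\<beta> j) ?e {0..<1}" using gj by (intro surf_eq j)
 have sm: "surf m = slab_measure (g m) (\<beta> m) (- ?e) {0..<1}" using gm' by (intro surf_eq m)
 have ij: "integrable (surf j) fj" and im: "integrable (surf m) fm"
  using surf_integrable[OF \<phi>c] by (auto simp: set_integrable_def fj_def[abs_def] fm_def[abs_def])
 have Ij: "integrable lborel (%x. indicator {0..<1} (lam j x) * fj (?pj x))"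
  "(LBINT x. indicator {0..<1} (lam j x) * fj (?pj x)) = (\<integral>x. fj x \<partial>surf j)"
  using slab_change[of fj "g j" ?e "g j" "\<beta> j" "\<beta> j"] gj ij unfolding sj by auto
 have Im: "integrable lborel (%x. indicator {0..<1} (lam j x) * fm (?pm x))"
  "(LBINT x. indicator {0..<1} (lam j x) * fm (?pm x)) = (\<integral>x. fm x \<partial>surf m)"
  using slab_change[of fm "g m" "- ?e" "g j" "\<beta> j" "\<beta> m", OF _ gm' gj'] im unfolding sm by auto
 have "(LBINT x:T. ?D x) = (LBINT x. G x)" by (simp add: set_lebesgue_integral_def G_def)
 also have "... = (LBINT x. indicator {0..<1} (lam j x) * (LBINT t. G (x + t *\<^sub>R ?e)))"
  by (rule slab_integral) (use intG gj in auto)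
 also have "... = (LBINT x. indicator {0..<1} (lam j x) * fm (?pm x) - indicator {0..<1} (lam j x) * fj (?pj x))"
  by (simp only: inner fm_def fj_def right_diff_distrib)
 also have "... = (\<integral>x. fm x \<partial>surf m) - (\<integral>x. fj x \<partial>surf j)"
  using Ij Im by simp
 finally show ?thesis by (simp add: set_lebesgue_integral_def fm_def fj_def)
qed

text \<open>The direction is expanded in edges from a vertex \<open>i\<close>. The face opposite to
  \<open>i\<close> collects the sum of all \<open>g a \<bullet> e\<close>, which is zero because the
  gradients add up to zero.\<close>

theorem divergence_direction:
 fixes \<phi> :: "real^'n => real"
 assumes \<phi>: "C1 \<phi>"
 shows "(LBINT x:T. e \<bullet> gradient \<phi> x) = - (SUM a:C. (g a \<bullet> e) * (LINT x:face a|surf a. \<phi> x))"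
proof -
 obtain i where i: "i : C" using card_C by fastforce
 let ?S = "%a. LINT x:face a|surf a. \<phi> x"
 have gc: "cont (%x. v \<bullet> gradient \<phi> x)" for v
  using \<phi> unfolding gradient_def inner_vec_def by (auto intro!: continuous_intros)
 have int: "set_integrable lborel T (%x. v \<bullet> gradient \<phi> x)" for v
  by (rule cont_set_integrable[OF gc compact_imp_bounded[OF compact_T] T_borel])
 have "e \<bullet> gradient \<phi> x = (SUM a:C. (g a \<bullet> e) * ((a - i) \<bullet> gradient \<phi> x))" for x
  by (subst vec_repr[of e i, symmetric]) (simp add: inner_sum_left)
 then have "(LBINT x:T. e \<bullet> gradient \<phi> x) = (SUM a:C. LBINT x:T. (g a \<bullet> e) * ((a - i) \<bullet> gradient \<phi> x))"
  using int by (simp add: set_integral_sum)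
 also have "... = (SUM a:C. (g a \<bullet> e) * (?S i - ?S a))"
 proof (rule sum.cong[OF refl])
  fix a assume "a : C"
  then show "(LBINT x:T. (g a \<bullet> e) * ((a - i) \<bullet> gradient \<phi> x)) = (g a \<bullet> e) * (?S i - ?S a)"
   using divergence_edge[OF \<phi> _ i, of a] by (cases "a = i") auto
 qed
 also have "... = (SUM a:C. g a \<bullet> e) * ?S i - (SUM a:C. (g a \<bullet> e) * ?S a)"
  by (simp add: right_diff_distrib sum_subtractf sum_distrib_right)
 also have "(SUM a:C. g a \<bullet> e) = 0" using sum_g by (simp add: inner_sum_left[symmetric])
 finally show ?thesis by simp
qed

theorem divergence_theorem:
 fixes V :: "real^'n => real^'n"
 assumes V: "!!i. C1 (%x. V x $ i)"
 shows "(LBINT x:T. divergence V x) = - (SUM a:C. LINT x:face a|surf a. g a \<bullet> V x)"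
proof -
 have gr: "axis i 1 \<bullet> gradient \<phi> x = partial i \<phi> x" for i \<phi> x
  by (simp add: gradient_def inner_axis')
 have pc: "cont (partial i (%x. V x $ i))" for i using V[of i] by simp
 have int: "set_integrable lborel T (partial i (%x. V x $ i))" for i
  by (rule cont_set_integrable[OF pc compact_imp_bounded[OF compact_T] T_borel])
 have Vc: "cont (%x. V x $ i)" for i using V C1_cont by blast
 have ints: "set_integrable (surf a) (face a) (%x. g a $ i * V x $ i)" for a i
  by (rule surf_integrable) (intro continuous_intros Vc)
 have "(LBINT x:T. divergence V x) = (SUM i:UNIV. LBINT x:T. partial i (%x. V x $ i) x)"
  unfolding divergence_def using int by (simp add: set_integral_sum)
 also have "... = (SUM i:UNIV. - (SUM a:C. LINT x:face a|surf a. g a $ i * V x $ i))"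
  using divergence_direction[OF V, of "axis _ 1"] by (simp add: gr inner_axis)
 also have "... = - (SUM a:C. SUM i:UNIV. LINT x:face a|surf a. g a $ i * V x $ i)"
  by (simp add: sum_negf) (rule sum.swap)
 also have "... = - (SUM a:C. LINT x:face a|surf a. g a \<bullet> V x)"
  using ints by (simp add: inner_vec_def set_integral_sum)
 finally show ?thesis .
qed

end

text \<open>The gradient of the coordinate of \<open>a\<close> is the component of an edge
  \<open>a - b\<close> orthogonal to the opposite face, scaled. The other identities are affine,
  hold at the vertices, and extend to their affine hull, which is the whole space.\<close>

lemma simplex_bary:
 fixes T :: "(real^'n::finite) set"
 assumes "int CARD('n) simplex T"
 obtains C g \<beta> where "bary C g \<beta>" "T = convex hull C"
proof -
 from assms obtain C where ind: "~ affine_dependent C" and c: "int (card C) = int CARD('n) + 1" and T: "T = convex hull C"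
  unfolding simplex_def by blast
 have fin: "finite C" using ind aff_independent_finite by blast
 have card: "card C = CARD('n) + 1" using c by simp
 have hull: "affine hull C = UNIV"
  using affine_independent_span_eq[OF ind] card by simp
 have "EX gb. ALL b:C. fst gb \<bullet> b + snd gb = (if a = b then 1 else (0::real))" if a: "a : C" for a
 proof -
  have "C ~= {a}" using card by auto
  then obtain b where b: "b : C" "b ~= a" using a by blast
  let ?S = "(%x. x - b) ` (C - {a})"
  have bS: "b : C - {a}" using b by blast
  obtain y z where y: "y : span ?S" and z: "!!w. w : span ?S ==> orthogonal z w" and yz: "a - b = y + z"
   using orthogonal_subspace_decomp_exists[of ?S "a - b"] by blast
  have "z ~= 0"
  proof
   assume "z = 0"
   then have ab: "a - b : span ?S" using y yz by simp
   have "a : affine hull (C - {a})"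
   proof -
    have "affine hull (C - {a}) = {b + v |v. v : span {x - b |x. x : (C - {a}) - {b}}}"
     by (rule affine_hull_span[OF bS])
    moreover have "span {x - b |x. x : (C - {a}) - {b}} = span ?S"
    proof -
     have "?S = insert 0 {x - b |x. x : (C - {a}) - {b}}" using bS by auto
     then show ?thesis by (simp only: span_insert_0)
    qed
    ultimately show ?thesis using ab by (simp only: mem_Collect_eq) (intro exI[of _ "a - b"], simp)
   qed
   then show False using ind a unfolding affine_dependent_def by blast
  qed
  then have zz: "z \<bullet> z ~= 0" by simp
  have zab: "z \<bullet> (a - b) = z \<bullet> z"
   using z[OF y] by (simp add: yz inner_add_right orthogonal_def)
  have zc: "z \<bullet> (x - b) = 0" if "x : C - {a}" for x
   using z[OF span_base, of "x - b"] that by (simp add: orthogonal_def)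
  let ?g = "z /\<^sub>R (z \<bullet> z)"
  have "?g \<bullet> x + - (?g \<bullet> b) = (if a = x then 1 else 0)" if "x : C" for x
  proof -
   have "?g \<bullet> x + - (?g \<bullet> b) = (z \<bullet> (x - b)) / (z \<bullet> z)" by (simp add: inner_diff_right divide_inverse algebra_simps)
   then show ?thesis using zab zc[of x] that zz by (cases "a = x") auto
  qed
  then show ?thesis by (intro exI[of _ "(?g, - (?g \<bullet> b))"]) simp
 qed
 then obtain G where G: "!!a b. a : C ==> b : C ==> fst (G a) \<bullet> b + snd (G a) = (if a = b then 1 else (0::real))"
  by metis
 define g \<beta> where "g a = fst (G a)" and "\<beta> a = snd (G a)" for a
 have delta: "g a \<bullet> b + \<beta> a = (if a = b then 1 else 0)" if "a : C" "b : C" for a b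
  using G that by (simp add: g_def \<beta>_def)
 have s1: "(SUM a:C. g a \<bullet> x + \<beta> a) = 1" for x
 proof -
  have "affine hull C \<subseteq> {x. (SUM a:C. g a \<bullet> x + \<beta> a) = 1}"
  proof (rule hull_minimal)
   show "C \<subseteq> {x. (SUM a:C. g a \<bullet> x + \<beta> a) = 1}" using delta fin by auto
   have "{x. (SUM a:C. g a \<bullet> x + \<beta> a) = 1} = {x. (SUM a:C. g a) \<bullet> x = 1 - (SUM a:C. \<beta> a)}"
    by (auto simp: inner_sum_left sum.distrib)
   then show "affine {x. (SUM a:C. g a \<bullet> x + \<beta> a) = 1}" by (simp add: affine_hyperplane)
  qed
  then show ?thesis using hull by auto
 qed
 have rp: "(SUM a:C. (g a \<bullet> x + \<beta> a) *\<^sub>R a) = x" for x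
 proof -
  have "affine hull C \<subseteq> {x. (SUM a:C. (g a \<bullet> x + \<beta> a) *\<^sub>R a) = x}"
  proof (rule hull_minimal)
   show "C \<subseteq> {x. (SUM a:C. (g a \<bullet> x + \<beta> a) *\<^sub>R a) = x}"
    using delta fin by (auto simp: if_distrib[of "%r. r *\<^sub>R _"] cong: if_cong)
   show "affine {x. (SUM a:C. (g a \<bullet> x + \<beta> a) *\<^sub>R a) = x}"
    unfolding affine_def
   proof (intro ballI allI impI)
    fix x y u v assume x: "x : {x. (SUM a:C. (g a \<bullet> x + \<beta> a) *\<^sub>R a) = x}" and y: "y : {x. (SUM a:C. (g a \<bullet> x + \<beta> a) *\<^sub>R a) = x}" and uv: "u + v = (1::real)"
    have "g a \<bullet> (u *\<^sub>R x + v *\<^sub>R y) + \<beta> a = u * (g a \<bullet> x + \<beta> a) + v * (g a \<bullet> y + \<beta> a)" for a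
    proof -
     have "\<beta> a = u * \<beta> a + v * \<beta> a" using uv by (simp add: distrib_right[symmetric])
     then show ?thesis by (simp add: inner_add_right algebra_simps)
    qed
    then have "(SUM a:C. (g a \<bullet> (u *\<^sub>R x + v *\<^sub>R y) + \<beta> a) *\<^sub>R a)
      = u *\<^sub>R (SUM a:C. (g a \<bullet> x + \<beta> a) *\<^sub>R a) + v *\<^sub>R (SUM a:C. (g a \<bullet> y + \<beta> a) *\<^sub>R a)"
     by (simp only: scaleR_add_left scaleR_add_right scaleR_scaleR[symmetric] sum.distrib scaleR_sum_right)
    then show "u *\<^sub>R x + v *\<^sub>R y : {x. (SUM a:C. (g a \<bullet> x + \<beta> a) *\<^sub>R a) = x}" using x y by simp
   qed
  qed
  then show ?thesis using hull by auto
 qed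
 have "bary C g \<beta>" by unfold_locales (use fin card delta s1 rp in auto)
 with T that show ?thesis by blast
qed

section \<open>Unit normals, area on faces and size bounds in barycentric terms\<close>

context bary begin

text \<open>A normal of the face annihilates all edges between its vertices, which leaves only the
  multiple of \<open>g a\<close> in the dual expansion. As the coordinate of \<open>a\<close> grows
  into the simplex, the sign of \<kappa> tells the side.\<close>

lemma unit_normal_parallel:
 assumes a: "a : C" and \<nu>: "unit_normal \<nu> (face a)"
 obtains \<kappa> where "\<nu> = \<kappa> *\<^sub>R g a" "\<bar>\<kappa>\<bar> * norm (g a) = 1"
  "outward \<nu> (face a) T \<longleftrightarrow> \<kappa> < 0"
proof -
 obtain i where i: "i : C" "i ~= a" using exists_other[OF a] by blast
 have iF: "b : face a" if "b : C" "b ~= a" for b using that by (intro hull_inc) auto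
 define \<kappa> where "\<kappa> = \<nu> \<bullet> (a - i)"
 have "\<nu> \<bullet> w = \<kappa> *\<^sub>R g a \<bullet> w" for w
 proof -
  have "\<nu> \<bullet> w = (SUM b:C. (g b \<bullet> w) * (\<nu> \<bullet> (b - i)))"
   by (subst vec_repr[of w i, symmetric]) (simp add: inner_sum_right)
  also have "... = (SUM b:C. if b = a then (g a \<bullet> w) * \<kappa> else 0)"
   using \<nu> iF[of i] i iF unfolding unit_normal_def \<kappa>_def by (intro sum.cong) auto
  finally show ?thesis using fin a by simp
 qed
 then have eq: "\<nu> = \<kappa> *\<^sub>R g a" by (metis vector_eq_rdot)
 have n1: "\<bar>\<kappa>\<bar> * norm (g a) = 1" using \<nu> unfolding unit_normal_def eq by simp
 have "outward \<nu> (face a) T \<longleftrightarrow> \<kappa> < 0"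
 proof
  assume o: "outward \<nu> (face a) T"
  have "a : T" using a by (intro hull_inc)
  then have "\<nu> \<bullet> (a - i) <= 0" using o iF[OF i] unfolding outward_def by blast
  then show "\<kappa> < 0" using n1 \<kappa>_def by (cases "\<kappa> = 0") auto
 next
  assume k: "\<kappa> < 0"
  show "outward \<nu> (face a) T" unfolding outward_def
  proof (intro ballI)
   fix x y assume x: "x : face a" and y: "y : T"
   have "\<nu> \<bullet> (y - x) = \<kappa> * (lam a y - lam a x)" by (simp add: eq inner_diff_right right_diff_distrib)
   moreover have "lam a x = 0" "0 <= lam a y" using x y face_iff[OF a] T_iff a by auto
   ultimately show "\<nu> \<bullet> (y - x) <= 0" using k by (simp add: mult_nonpos_nonneg)
  qed
 qed
 with eq n1 that show ?thesis by blast
qed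

lemma closest_point_face:
 assumes a: "a : C" and \<nu>: "\<nu> = \<kappa> *\<^sub>R g a" "\<bar>\<kappa>\<bar> * norm (g a) = 1"
 shows "closest_point (affine hull (face a)) x = x - (\<nu> \<bullet> x + \<kappa> * \<beta> a) *\<^sub>R \<nu>"
proof (rule closest_point_unique[symmetric])
 let ?H = "affine hull (face a)"
 let ?p = "x - (\<nu> \<bullet> x + \<kappa> * \<beta> a) *\<^sub>R \<nu>"
 have H: "?H = {x. lam a x = 0}" by (rule affine_hull_face[OF a])
 have \<kappa>0: "\<kappa> ~= 0" using \<nu>(2) by auto
 have nn: "\<nu> \<bullet> \<nu> = 1"
 proof -
  have "\<nu> \<bullet> \<nu> = (\<bar>\<kappa>\<bar> * norm (g a))^2" unfolding \<nu>(1)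
   by (simp add: power_mult_distrib power2_norm_eq_inner power2_eq_square[of \<kappa>] mult.assoc)
  then show ?thesis using \<nu>(2) by simp
 qed
 have lam: "\<kappa> * lam a y = \<nu> \<bullet> y + \<kappa> * \<beta> a" for y by (simp add: \<nu>(1) distrib_left)
 have "\<kappa> * lam a ?p = 0" unfolding lam by (simp add: inner_diff_right nn)
 then show pH: "?p : ?H" using \<kappa>0 H by simp
 show "convex ?H" "closed ?H" by (simp_all add: affine_imp_convex)
 show "ALL z:?H. dist x ?p <= dist x z"
 proof
  fix z assume "z : ?H"
  then have "\<nu> \<bullet> z + \<kappa> * \<beta> a = 0" using lam[of z] H by simp
  then have "\<nu> \<bullet> (x - z) = \<nu> \<bullet> x + \<kappa> * \<beta> a" by (simp add: inner_diff_right)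
  moreover have "\<bar>\<nu> \<bullet> (x - z)\<bar> <= norm \<nu> * norm (x - z)" by (rule Cauchy_Schwarz_ineq2)
  moreover have "norm \<nu> = 1" using nn by (simp add: norm_eq_sqrt_inner)
  ultimately show "dist x ?p <= dist x z" by (simp add: dist_norm)
 qed
qed

text \<open>The prism defining the area is an orthogonal slab over the face, and the closest point
  is its projection. Passing from the unit normal to \<open>g a\<close> changes the thickness by
  \<open>norm (g a)\<close>.\<close>

lemma face_integral_surf:
 fixes \<phi> :: "real^'n => real"
 assumes a: "a : C" and u: "unit_normal \<nu> (face a)" and [measurable]: "\<phi> : borel_measurable borel"
 shows "face_integral \<nu> (face a) \<phi> = norm (g a) * (LINT x:face a|surf a. \<phi> x)"
proof -
 obtain \<kappa> where \<kappa>: "\<nu> = \<kappa> *\<^sub>R g a" "\<bar>\<kappa>\<bar> * norm (g a) = 1"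
  using unit_normal_parallel[OF a u] by metis
 have ng: "0 < norm (g a)" using g_nonzero[OF a] by simp
 have nn: "\<nu> \<bullet> \<nu> = 1" using u unfolding unit_normal_def by (simp add: norm_eq_1)
 let ?b = "\<kappa> * \<beta> a"
 let ?F = "face a"
 let ?P = "{x + t *\<^sub>R \<nu> |x t. x : ?F & 0 <= t & t <= 1}"
 let ?p = "%x. x - (\<nu> \<bullet> x + ?b) *\<^sub>R \<nu>"
 let ?f = "%x. indicator ?F x * \<phi> x"
 have [measurable]: "?f : borel_measurable borel" by measurable
 have cp: "closest_point (affine hull ?F) = ?p" using closest_point_face[OF a \<kappa>] by auto
 have lam0: "\<nu> \<bullet> x + ?b = 0" if "x : ?F" for x
 proof -
  have "\<nu> \<bullet> x + ?b = \<kappa> * lam a x" by (simp add: \<kappa>(1) distrib_left)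
  then show ?thesis using that face_iff[OF a] by simp
 qed
 have P: "x : ?P \<longleftrightarrow> (\<nu> \<bullet> x + ?b) : {0..1} & ?p x : ?F" for x
 proof
  assume "x : ?P"
  then obtain y t where y: "x = y + t *\<^sub>R \<nu>" "y : ?F" "0 <= t" "t <= 1" by blast
  then have "\<nu> \<bullet> x + ?b = t" using lam0[OF y(2)] nn by (simp add: inner_add_right)
  then show "(\<nu> \<bullet> x + ?b) : {0..1} & ?p x : ?F" using y by simp
 next
  assume "(\<nu> \<bullet> x + ?b) : {0..1} & ?p x : ?F"
  then show "x : ?P" by (auto intro!: exI[of _ "?p x"] exI[of _ "\<nu> \<bullet> x + ?b"])
 qed
 have "?P = {x. (\<nu> \<bullet> x + ?b) : {0..1} & ?p x : ?F}" using P by blast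
 also have "... : sets borel" by measurable
 finally have PB: "?P : sets borel" .
 have "face_integral \<nu> ?F \<phi> = (\<integral>x. ?f x \<partial>face_measure \<nu> ?F)"
  by (simp add: face_integral_def set_lebesgue_integral_def)
 also have "... = (\<integral>x. ?f (?p x) \<partial>restrict_space lborel ?P)"
  unfolding face_measure_def cp by (rule integral_distr) (auto intro!: measurable_restrict_space1)
 also have "... = (LBINT x. indicator ?P x * ?f (?p x))"
  using PB by (subst integral_restrict_space) auto
 also have "... = (LBINT x. indicator {0..1} (\<nu> \<bullet> x + ?b) * ?f (?p x))"
  using P by (intro Bochner_Integration.integral_cong) (auto simp: indicator_def)
 also have "... = (\<integral>x. ?f x \<partial>slab_measure \<nu> ?b \<nu> {0..1})"
  by (rule integral_slab_measure[symmetric]) measurable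
 \<comment> \<open>The prism is closed while \<open>surf\<close> uses a half-open interval; both
   have length one, so the measures agree.\<close>
 also have "slab_measure \<nu> ?b \<nu> {0..1} = slab_measure \<nu> ?b \<nu> {0..<1}"
 proof (rule measure_eqI)
  fix A assume "A : sets (slab_measure \<nu> ?b \<nu> {0..1})"
  show "emeasure (slab_measure \<nu> ?b \<nu> {0..1}) A = emeasure (slab_measure \<nu> ?b \<nu> {0..<1}) A"
   using slab_measure_scale[of "{0..1}" "{0..<1}" \<nu> \<nu> ?b A] nn by simp
 qed simp
 also have "(\<integral>x. ?f x \<partial>slab_measure \<nu> ?b \<nu> {0..<1}) = norm (g a) * (\<integral>x. ?f x \<partial>surf a)"
 proof -
  let ?w = "g a /\<^sub>R (g a \<bullet> g a)"
  \<comment> \<open>The range of the coordinate of \<open>a\<close> on the slab. For negative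
    \<kappa> the slab lies on the other side of the face, so the interval and its open end are
    reversed.\<close>
  let ?I = "if 0 < \<kappa> then {0..<norm (g a)} else {- norm (g a)<..0}"
  have k: "norm (g a) = 1 / \<bar>\<kappa>\<bar>" "\<kappa> ~= 0" using \<kappa>(2) ng by (auto simp: eq_divide_eq mult.commute)
  have w: "g a \<bullet> ?w = 1" by (rule g_u[OF a])
  have proj: "lam a x *\<^sub>R ?w = (\<nu> \<bullet> x + ?b) *\<^sub>R \<nu>" for x
  proof -
   have "\<kappa> * \<kappa> * (g a \<bullet> g a) = 1" using nn by (simp add: \<kappa>(1) mult.assoc)
   then have "inverse (g a \<bullet> g a) = \<kappa> * \<kappa>" using k(2) ng
    by (metis inverse_unique mult.commute)
   moreover have "\<nu> \<bullet> x + ?b = \<kappa> * lam a x" by (simp add: \<kappa>(1) distrib_left)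
   ultimately show ?thesis by (simp add: \<kappa>(1) mult_ac)
  qed
  have inI: "\<nu> \<bullet> x + ?b : {0..<1} \<longleftrightarrow> lam a x : ?I" for x
  proof -
   have "0 <= \<kappa> * L & \<kappa> * L < 1 \<longleftrightarrow> L : ?I" for L
   proof (cases "0 < \<kappa>")
    case True
    then show ?thesis using k by (simp add: zero_le_mult_iff pos_less_divide_eq mult.commute)
   next
    case False
    then have "\<kappa> < 0" using k by simp
    then show ?thesis using k by (auto simp: zero_le_mult_iff neg_divide_less_eq mult.commute)
   qed
   moreover have "\<nu> \<bullet> x + ?b = \<kappa> * lam a x" by (simp add: \<kappa>(1) distrib_left)
   ultimately show ?thesis by simp
  qed
  have mI [measurable]: "?I : sets borel" by simp
  have lenI: "emeasure lborel ?I = ennreal (norm (g a))" by simp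
  have "(\<integral>x. ?f x \<partial>slab_measure \<nu> ?b \<nu> {0..<1}) = (LBINT x. indicator {0..<1} (\<nu> \<bullet> x + ?b) * ?f (?p x))"
   by (rule integral_slab_measure) measurable
  also have "... = (LBINT x. indicator ?I (lam a x) * ?f (x - lam a x *\<^sub>R ?w))"
   by (simp only: indicator_def inI proj)
  also have "... = (\<integral>x. ?f x \<partial>slab_measure (g a) (\<beta> a) ?w ?I)"
   by (rule integral_slab_measure[symmetric]) measurable
  also have "slab_measure (g a) (\<beta> a) ?w ?I = density (surf a) (%_. ennreal (norm (g a)))"
  proof (rule measure_eqI)
   fix A assume "A : sets (slab_measure (g a) (\<beta> a) ?w ?I)"
   then have "A : sets (surf a)" by simp
   then have "emeasure (density (surf a) (%_. ennreal (norm (g a)))) A = ennreal (norm (g a)) * emeasure (surf a) A"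
    by (simp add: emeasure_density nn_integral_cmult)
   then show "emeasure (slab_measure (g a) (\<beta> a) ?w ?I) A = emeasure (density (surf a) (%_. ennreal (norm (g a)))) A"
    using slab_measure_scale[OF mI _ w, of "{0..<1}" "\<beta> a" A] lenI by (simp add: surf_def)
  qed simp
  also have "(\<integral>x. ?f x \<partial>density (surf a) (%_. ennreal (norm (g a)))) = norm (g a) * (\<integral>x. ?f x \<partial>surf a)"
   by (subst integral_density) auto
  finally show ?thesis .
 qed
 finally show ?thesis by (simp add: set_lebesgue_integral_def)
qed

text \<open>Moving from the centre by \<open>r\<close> against the gradient stays in the simplex, so
  the coordinate can drop by \<open>r * norm (g a)\<close> without becoming negative.\<close>

lemma norm_g_le:
 assumes "a : C" "0 < r" "cball z r \<subseteq> T"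
 shows "r * norm (g a) <= lam a z" "norm (g a) <= 1 / r"
proof -
 let ?y = "z - (r / norm (g a)) *\<^sub>R g a"
 have ng: "0 < norm (g a)" using g_nonzero[OF assms(1)] by simp
 have "?y : cball z r" using assms(2) ng by (simp add: dist_norm)
 then have "0 <= lam a ?y" using assms T_iff by blast
 also have "lam a ?y = lam a z - r * norm (g a)"
  using ng by (simp add: inner_diff_right power2_norm_eq_inner[symmetric] power2_eq_square)
 finally show 1: "r * norm (g a) <= lam a z" by simp
 have "z : T" using assms by auto
 then have "lam a z <= 1"
  using sum1[of z] member_le_sum[of a C "%a. lam a z"] fin assms(1) T_iff by auto
 then show "norm (g a) <= 1 / r" using 1 assms(2) by (simp add: field_simps)
qed

lemma edge_le_diameter: "a : T ==> b : T ==> norm (a - b) <= diameter T"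
 using diameter_bounded_bound[of T a b] compact_T by (simp add: compact_imp_bounded dist_norm)

lemma diameter_pos: "0 < diameter T"
proof -
 obtain a where a: "a : C" using card_C by fastforce
 obtain b where b: "b : C" "b ~= a" using exists_other[OF a] by blast
 have "norm (a - b) <= diameter T" using a b by (intro edge_le_diameter hull_inc) auto
 moreover have "0 < norm (a - b)" using b by simp
 ultimately show ?thesis by linarith
qed

lemma norm_g_ge: "a : C ==> 1 <= norm (g a) * diameter T"
proof -
 assume a: "a : C"
 obtain b where b: "b : C" "b ~= a" using exists_other[OF a] by blast
 have "1 = g a \<bullet> (a - b)" using g_edge[OF a a b(1)] b by simp
 also have "... <= norm (g a) * norm (a - b)" by (rule norm_cauchy_schwarz)
 also have "... <= norm (g a) * diameter T" using a b by (intro mult_left_mono edge_le_diameter hull_inc) auto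
 finally show ?thesis .
qed

end

subsection \<open>Integration by parts on mesh elements\<close>

definition outer_sign :: "real^'n::finite => (real^'n) set => (real^'n) set => real" where
 "outer_sign n F T = (if outward n F T then 1 else - 1)"

lemma element_divergence:
 fixes T :: "(real^'n::finite) set" and V :: "real^'n => real^'n"
 assumes T: "int CARD('n) simplex T" and \<nu>: "!!F. F facet_of T ==> unit_normal (\<nu> F) F"
  and V: "!!i. C1 (%x. V x $ i)"
 shows "(LBINT x:T. divergence V x) =
  (\<Sum>F | F facet_of T. outer_sign (\<nu> F) F T * face_integral (\<nu> F) F (%x. \<nu> F \<bullet> V x))"
proof -
 obtain C g \<beta> where b: "bary C g \<beta>" and TC: "T = convex hull C" using simplex_bary[OF T] .
 interpret bary C g \<beta> by (rule b)
 have fac: "{F. F facet_of T} = face ` C" using facet_iff TC by auto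
 have inj: "inj_on face C" using inj_face by (auto intro!: inj_onI)
 have Vc: "cont (%x. V x $ i)" for i using V C1_cont by blast
 then have "cont V" by (simp add: continuous_on_vec_lambda[of UNIV "%i x. V x $ i", simplified])
 then have [measurable]: "V : borel_measurable borel" by (rule borel_measurable_continuous_onI)
 have tm: "- (LINT x:face a|surf a. g a \<bullet> V x) =
   outer_sign (\<nu> (face a)) (face a) T * face_integral (\<nu> (face a)) (face a) (%x. \<nu> (face a) \<bullet> V x)" if a: "a : C" for a
 proof -
  let ?n = "\<nu> (face a)"
  have u: "unit_normal ?n (face a)" using \<nu> a fac by blast
  obtain \<kappa> where \<kappa>: "?n = \<kappa> *\<^sub>R g a" "\<bar>\<kappa>\<bar> * norm (g a) = 1" "outward ?n (face a) T \<longleftrightarrow> \<kappa> < 0"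
   using unit_normal_parallel[OF a u] TC by metis
  \<comment> \<open>The outward normal is a negative multiple of \<open>g a\<close>, and
    \<open>outer_sign\<close> undoes the choice of direction of the fixed normal; the product is -1
    in both cases.\<close>
  have s: "outer_sign ?n (face a) T * norm (g a) * \<kappa> = - 1"
  proof (cases "\<kappa> < 0")
   case True
   then show ?thesis using \<kappa>(2,3) by (simp add: outer_sign_def mult.commute)
  next
   case False
   then have "\<bar>\<kappa>\<bar> = \<kappa>" by simp
   then show ?thesis using \<kappa>(2,3) False by (simp add: outer_sign_def mult.commute)
  qed
  have "face_integral ?n (face a) (%x. ?n \<bullet> V x) = norm (g a) * (LINT x:face a|surf a. ?n \<bullet> V x)"
   by (rule face_integral_surf[OF a u]) measurable
  also have "(LINT x:face a|surf a. ?n \<bullet> V x) = \<kappa> * (LINT x:face a|surf a. g a \<bullet> V x)"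
   unfolding \<kappa>(1) by simp
  finally have "outer_sign ?n (face a) T * face_integral ?n (face a) (%x. ?n \<bullet> V x) =
    (outer_sign ?n (face a) T * norm (g a) * \<kappa>) * (LINT x:face a|surf a. g a \<bullet> V x)" by simp
  then show ?thesis using s by simp
 qed
 have "(LBINT x:T. divergence V x) = - (SUM a:C. LINT x:face a|surf a. g a \<bullet> V x)"
  unfolding TC by (rule divergence_theorem[OF V])
 also have "... = (SUM a:C. outer_sign (\<nu> (face a)) (face a) T * face_integral (\<nu> (face a)) (face a) (%x. \<nu> (face a) \<bullet> V x))"
  unfolding sum_negf[symmetric] by (rule sum.cong[OF refl]) (rule tm)
 also have "... = (SUM F:face ` C. outer_sign (\<nu> F) F T * face_integral (\<nu> F) F (%x. \<nu> F \<bullet> V x))"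
  by (simp add: sum.reindex[OF inj] o_def)
 finally show ?thesis unfolding fac .
qed

lemma divergence_scale:
 fixes V :: "real^'n::finite => real^'n"
 assumes "\<phi> differentiable (at x)" "!!i. (%x. V x $ i) differentiable (at x)"
 shows "divergence (%x. \<phi> x *\<^sub>R V x) x = \<phi> x * divergence V x + V x \<bullet> gradient \<phi> x"
 using assms by (simp add: divergence_def gradient_def inner_vec_def partial_mult sum.distrib sum_distrib_left mult.commute)

subsection \<open>Traces\<close>

text \<open>A convex \<open>T\<close> with interior points is the closure of its interior, so each
  of its points is a limit point and the limit in \<open>elem_trace\<close> is unique.\<close>

lemma elem_trace_eq:
 fixes T :: "(real^'n::finite) set" and f p :: "real^'n => 'b::euclidean_space"
 assumes T: "convex T" "interior T ~= {}" "closed T" and x: "x : T"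
  and f: "!!y. y : interior T ==> f y = p y" and p: "cont p"
 shows "elem_trace T f x = p x"
proof -
 have cl: "x : closure (interior T)" using convex_closure_interior[OF T(1,2)] x closure_subset by blast
 have "x islimpt interior T"
 proof (cases "x : interior T")
  case True
  then show ?thesis using interior_limit_point[of x "interior T"] by simp
 next
  case False
  then show ?thesis using cl by (auto simp: closure_def)
 qed
 then have nb: "at x within interior T ~= bot" by (simp add: trivial_limit_within)
 have "(p \<longlongrightarrow> p x) (at x within interior T)"
  using p by (meson continuous_on_def continuous_on_subset iso_tuple_UNIV_I tendsto_within_subset top_greatest)
 moreover have "eventually (%y. p y = f y) (at x within interior T)"
  using f by (auto simp: eventually_at_filter intro!: always_eventually)
 ultimately have "(f \<longlongrightarrow> p x) (at x within interior T)" using tendsto_cong by blast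
 then show ?thesis unfolding elem_trace_def by (rule tendsto_Lim[OF nb])
qed

lemma lebesgue_measurable_cong_null:
 fixes f g :: "'a::euclidean_space => 'b::euclidean_space"
 assumes "N : null_sets lebesgue" "g : borel_measurable lebesgue" "!!x. x \<notin> N ==> f x = g x"
 shows "f : borel_measurable lebesgue"
proof -
 have "g : borel_measurable (lebesgue_on (- N))" using assms(2) by (rule measurable_restrict_space1)
 then have "f : borel_measurable (lebesgue_on (- N))"
  by (subst measurable_cong[where g = g]) (auto simp: space_restrict_space assms(3))
 then show ?thesis using lebesgue_measurable_diff_null[OF assms(1)] by blast
qed

subsection \<open>Meshes\<close>

locale mesh =
 fixes \<Omega> :: "(real^'n::finite) set" and \<T> :: "(real^'n) set set" and \<nu> :: "(real^'n) set => real^'n"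
 assumes dom: "polytopal_domain \<Omega>" and mesh: "simplicial_mesh \<Omega> \<T>" and normals: "face_normals \<Omega> \<T> \<nu>"
begin

abbreviation fint :: "(real^'n) set => (real^'n => real) => real" where "fint F \<equiv> face_integral (\<nu> F) F"
abbreviation fsgn :: "(real^'n) set => (real^'n) set => real" where "fsgn F T \<equiv> outer_sign (\<nu> F) F T"
abbreviation Tout :: "(real^'n) set => (real^'n) set" where "Tout F \<equiv> elem_out \<T> (\<nu> F) F"
abbreviation Tin :: "(real^'n) set => (real^'n) set" where "Tin F \<equiv> elem_in \<T> (\<nu> F) F"

lemma finite_mesh: "finite \<T>"
 using mesh by (simp add: simplicial_mesh_def triangulation_def)

lemma simplex_T: "T : \<T> ==> int CARD('n) simplex T"
 using mesh by (simp add: simplicial_mesh_def)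

lemma Union_mesh: "\<Union>\<T> = closure \<Omega>"
 using mesh by (simp add: simplicial_mesh_def)

lemma Int_face: "T : \<T> ==> T' : \<T> ==> T \<inter> T' face_of T"
 using mesh by (simp add: simplicial_mesh_def triangulation_def)

lemma closed_T: "T : \<T> ==> closed T"
 by (rule closed_simplex[OF simplex_T])

lemma convex_T: "T : \<T> ==> convex T"
 by (rule convex_simplex[OF simplex_T])

lemma compact_T: "T : \<T> ==> compact T"
 by (rule compact_simplex[OF simplex_T])

lemma open_dom: "open \<Omega>"
 using dom by (auto simp: polytopal_domain_def)

text \<open>The domain is the interior of a closed set and hence has no slits. This is why the
  interiors of the elements, which only fill the closure of the domain, lie in the domain
  itself.\<close>

lemma interior_closure_dom: "interior (closure \<Omega>) \<subseteq> \<Omega>"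
proof -
 obtain P where P: "finite P" "!!p. p : P ==> polytope p" "\<Omega> = interior (\<Union>P)"
  using dom unfolding polytopal_domain_def by blast
 have "closed (\<Union>P)" using P by (intro closed_Union) (auto simp: polytope_imp_closed)
 then have "closure \<Omega> \<subseteq> \<Union>P" unfolding P(3) by (intro closure_minimal interior_subset)
 then have "interior (closure \<Omega>) \<subseteq> interior (\<Union>P)" by (rule interior_mono)
 then show ?thesis using P(3) by simp
qed

lemma T_subset: "T : \<T> ==> T \<subseteq> closure \<Omega>"
 using Union_mesh by blast

lemma interior_subset_dom: "T : \<T> ==> interior T \<subseteq> \<Omega>"
 using interior_mono[OF T_subset] interior_closure_dom by blast

lemma interior_nonempty: "T : \<T> ==> interior T ~= {}"
proof -
 assume T: "T : \<T>"
 have "aff_dim T = int CARD('n)" using aff_dim_simplex[OF simplex_T[OF T]] .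
 then have "affine hull T = UNIV" using aff_dim_eq_full[of T] by simp
 moreover have "T ~= {}" using \<open>aff_dim T = _\<close> by auto
 ultimately show ?thesis using convex_T[OF T] rel_interior_interior[of T] rel_interior_eq_empty by metis
qed

lemma face_full: "T : \<T> ==> T' : \<T> ==> T \<subseteq> T' ==> T = T'"
proof (rule ccontr)
 assume T: "T : \<T>" "T' : \<T>" "T \<subseteq> T'" "T ~= T'"
 have "T' \<inter> T face_of T'" using Int_face T by blast
 moreover have "T' \<inter> T = T" using T by blast
 ultimately have "aff_dim T < aff_dim T'" using face_of_aff_dim_lt[OF convex_T[OF T(2)]] T(4) by simp
 then show False using aff_dim_simplex[OF simplex_T] T by simp
qed

lemma interior_disjoint: "T : \<T> ==> T' : \<T> ==> T ~= T' ==> interior T \<inter> T' = {}"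
proof -
 assume T: "T : \<T>" "T' : \<T>" "T ~= T'"
 have f: "T \<inter> T' face_of T" using Int_face T by blast
 have "T \<inter> T' ~= T" using face_full[OF T(1,2)] T(3) by blast
 then have "(T \<inter> T') \<inter> rel_interior T = {}" using face_of_disjoint_rel_interior[OF f] by blast
 moreover have "rel_interior T = interior T"
  using interior_nonempty[OF T(1)] by (simp add: rel_interior_nonempty_interior)
 ultimately show ?thesis using interior_subset[of T] by blast
qed

lemma skeleton_null: "\<Omega> - (\<Union>T\<in>\<T>. interior T) : null_sets lebesgue"
proof -
 have "\<Omega> - (\<Union>T\<in>\<T>. interior T) \<subseteq> (\<Union>T\<in>\<T>. frontier T)"
 proof
  fix x assume x: "x : \<Omega> - (\<Union>T\<in>\<T>. interior T)"
  then have "x : \<Union>\<T>" using Union_mesh closure_subset by blast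
  then obtain T where "T : \<T>" "x : T" by blast
  then show "x : (\<Union>T\<in>\<T>. frontier T)" using x closure_subset by (auto simp: frontier_def)
 qed
 moreover have "negligible (\<Union>T\<in>\<T>. frontier T)"
  using finite_mesh convex_T by (intro negligible_Union) (auto intro: negligible_convex_frontier)
 ultimately show ?thesis using negligible_subset negligible_iff_null_sets by blast
qed

lemma element_integral_interior:
 fixes p :: "real^'n => real"
 assumes "T : \<T>" "cont p"
 shows "set_integrable lborel T p" "set_integrable lborel (interior T) p"
  "(LBINT x:interior T. p x) = (LBINT x:T. p x)"
proof -
 have Tb: "bounded T" "T : sets borel" using compact_T[OF assms(1)] by (auto simp: compact_imp_bounded borel_compact)
 show 1: "set_integrable lborel T p" using cont_set_integrable[OF assms(2) Tb] .
 show 2: "set_integrable lborel (interior T) p"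
  by (rule set_integrable_subset[OF 1]) (auto intro: interior_subset[THEN subsetD])
 have "frontier T : null_sets lborel"
 proof -
  have "frontier T : null_sets lebesgue"
   using negligible_convex_frontier[OF convex_T[OF assms(1)]] negligible_iff_null_sets by blast
  then show ?thesis using null_sets_completion_iff[of "frontier T" lborel] by (simp add: frontier_closed borel_closed)
 qed
 then have "AE x in lborel. x \<notin> frontier T" by (rule AE_not_in)
 moreover have "x : interior T \<longleftrightarrow> x : T" if "x \<notin> frontier T" for x
  using that interior_subset[of T] closure_subset[of T] by (auto simp: frontier_def)
 ultimately have "AE x in lborel. indicator (interior T) x *\<^sub>R p x = indicator T x *\<^sub>R p x"
  by (auto elim!: eventually_mono simp: indicator_def)
 then show "(LBINT x:interior T. p x) = (LBINT x:T. p x)"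
  unfolding set_lebesgue_integral_def using 1 2
  by (intro integral_cong_AE) (auto simp: set_integrable_def)
qed

text \<open>The values on the skeleton are arbitrary. Measurability rests on completeness of the
  Lebesgue measure and on the skeleton being a null set.\<close>

lemma broken_measurable:
 fixes f :: "real^'n => 'b::euclidean_space"
 assumes fP: "!!T x. T : \<T> ==> x : interior T ==> f x = P T x"
  and P: "!!T. T : \<T> ==> cont (P T)"
 shows "set_borel_measurable lebesgue \<Omega> f"
  and "AE x in lebesgue. indicator \<Omega> x *\<^sub>R f x = (SUM T:\<T>. indicator (interior T) x *\<^sub>R P T x)"
proof -
 let ?F = "%x. SUM T:\<T>. indicator (interior T) x *\<^sub>R P T x"
 let ?N = "\<Omega> - (\<Union>T\<in>\<T>. interior T)"
 have eq: "indicator \<Omega> x *\<^sub>R f x = ?F x" if xN: "x \<notin> ?N" for x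
 proof (cases "x : \<Omega>")
  case True
  then obtain T where T: "T : \<T>" "x : interior T" using xN by blast
  have "?F x = (SUM T':{T}. indicator (interior T') x *\<^sub>R P T' x)"
  proof (rule sum.mono_neutral_right[OF finite_mesh])
   show "ALL T':\<T> - {T}. indicator (interior T') x *\<^sub>R P T' x = 0"
   proof
    fix T' assume T': "T' : \<T> - {T}"
    then have "x \<notin> interior T'" using interior_disjoint[OF T(1), of T'] T interior_subset[of T'] by blast
    then show "indicator (interior T') x *\<^sub>R P T' x = 0" by simp
   qed
  qed (use T in auto)
  then show ?thesis using True T fP by simp
 next
  case False
  then have "x \<notin> interior T" if "T : \<T>" for T using interior_subset_dom[OF that] by blast
  then show ?thesis using False by simp
 qed
 have Fm: "?F : borel_measurable lborel"
  by (intro borel_measurable_sum borel_measurable_scaleR borel_measurable_indicator)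
    (auto intro!: borel_measurable_continuous_onI[OF P])
 show "set_borel_measurable lebesgue \<Omega> f" unfolding set_borel_measurable_def
  by (rule lebesgue_measurable_cong_null[OF skeleton_null measurable_completion[OF Fm] eq])
 show "AE x in lebesgue. indicator \<Omega> x *\<^sub>R f x = ?F x"
  by (rule AE_mp[OF AE_not_in[OF skeleton_null]]) (rule AE_I2, use eq in blast)
qed

lemma broken_integral:
 fixes f :: "real^'n => real"
 assumes fP: "!!T x. T : \<T> ==> x : interior T ==> f x = P T x"
  and P: "!!T. T : \<T> ==> cont (P T)"
 shows "set_integrable lebesgue \<Omega> f"
  and "(LINT x:\<Omega>|lebesgue. f x) = (SUM T:\<T>. LBINT x:T. P T x)"
proof -
 let ?F = "%x. SUM T:\<T>. indicator (interior T) x *\<^sub>R P T x"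
 note bm = broken_measurable[of f P, OF fP P]
 have m: "(%x. indicator \<Omega> x *\<^sub>R f x) : borel_measurable lebesgue"
  using bm(1) unfolding set_borel_measurable_def .
 have iT: "integrable lborel (%x. indicator (interior T) x *\<^sub>R P T x)" if "T : \<T>" for T
  using element_integral_interior(2)[OF that P[OF that]] by (simp add: set_integrable_def)
 have iF: "integrable lborel ?F" using iT by (intro Bochner_Integration.integrable_sum) auto
 then have iF': "integrable lebesgue ?F" by (rule integrable_completion[THEN iffD2, rotated]) (use iF in auto)
 have ae: "AE x in lebesgue. ?F x = indicator \<Omega> x *\<^sub>R f x" using bm(2) by (auto elim: eventually_mono)
 show "set_integrable lebesgue \<Omega> f" unfolding set_integrable_def
  by (rule integrable_cong_AE_imp[OF iF' m]) (use bm(2) in auto)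
 have "(LINT x:\<Omega>|lebesgue. f x) = (\<integral>x. ?F x \<partial>lebesgue)"
  unfolding set_lebesgue_integral_def using m iF' bm(2) by (intro integral_cong_AE) auto
 also have "... = (LBINT x. ?F x)" using iF by (intro integral_completion) auto
 also have "... = (SUM T:\<T>. LBINT x:interior T. P T x)"
  using iT by (simp add: Bochner_Integration.integral_sum set_lebesgue_integral_def)
 also have "... = (SUM T:\<T>. LBINT x:T. P T x)"
  using element_integral_interior(3) P by (intro sum.cong) auto
 finally show "(LINT x:\<Omega>|lebesgue. f x) = (SUM T:\<T>. LBINT x:T. P T x)" .
qed

lemma interior_integral_lebesgue:
 fixes f p :: "real^'n => real"
 assumes "T : \<T>" "!!x. x : interior T ==> f x = p x" "cont p"
 shows "(LINT x:interior T|lebesgue. f x) = (LBINT x:T. p x)"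
proof -
 have i: "integrable lborel (%x. indicator (interior T) x *\<^sub>R p x)"
  using element_integral_interior(2)[OF assms(1,3)] by (simp add: set_integrable_def)
 have "(LINT x:interior T|lebesgue. f x) = (\<integral>x. indicator (interior T) x *\<^sub>R p x \<partial>lebesgue)"
  unfolding set_lebesgue_integral_def using assms(2) by (intro Bochner_Integration.integral_cong) (auto simp: indicator_def)
 also have "... = (LBINT x:interior T. p x)"
  unfolding set_lebesgue_integral_def using i by (intro integral_completion) auto
 finally show ?thesis using element_integral_interior(3)[OF assms(1,3)] by simp
qed

lemma facet_normal: "T : \<T> ==> F facet_of T ==> unit_normal (\<nu> F) F"
 using normals unfolding face_normals_def mesh_faces_def by blast

lemma finite_facets: "T : \<T> ==> finite {F. F facet_of T}"
 using finite_polytope_facets simplex_imp_polytope simplex_T by blast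

lemma mesh_facesI: "T : \<T> ==> F facet_of T ==> F : mesh_faces \<T>"
 unfolding mesh_faces_def by blast

lemma finite_mesh_faces: "finite (mesh_faces \<T>)"
proof -
 have "mesh_faces \<T> = (\<Union>T\<in>\<T>. {F. F facet_of T})" by (auto simp: mesh_faces_def)
 then show ?thesis using finite_mesh finite_facets by simp
qed

text \<open>The segment from the vertex \<open>c\<close> through \<open>z\<close> can be prolonged
  inside the face; if the coordinate of \<open>c\<close> vanished at \<open>z\<close>, it would be
  negative beyond \<open>z\<close>.\<close>

lemma rel_interior_facet_lam:
 assumes b: "bary C g \<beta>" and a: "a : C" and z: "z : rel_interior (convex hull (C - {a}))" and c: "c : C" "c ~= a"
 shows "0 < g c \<bullet> z + \<beta> c"
proof (rule ccontr)
 interpret bary C g \<beta> by (rule b)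
 assume "~ 0 < lam c z"
 moreover have zF: "z : face a" using z rel_interior_subset by blast
 then have "0 <= lam c z" using face_iff[OF a] T_iff[of z] c(1) by simp
 ultimately have l0: "lam c z = 0" by simp
 have cF: "c : face a" using c by (intro hull_inc) auto
 obtain m where m: "1 < m" "(1 - m) *\<^sub>R c + m *\<^sub>R z : face a"
  using convex_rel_interior_if[OF convex_convex_hull z] hull_inc[OF cF, of affine] by blast
 have "0 <= lam c ((1 - m) *\<^sub>R c + m *\<^sub>R z)" using m(2) face_iff[OF a] T_iff c(1) by simp
 also have "lam c ((1 - m) *\<^sub>R c + m *\<^sub>R z) = (1 - m) * lam c c + m * lam c z"
  by (simp add: inner_add_right algebra_simps)
 also have "... = 1 - m" using l0 delta[OF c(1) c(1)] by simp
 finally show False using m(1) by simp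
qed

text \<open>By conformity the intersection is spanned by a subset of the vertices. At
  \<open>z\<close> all coordinates except that of \<open>a\<close> are positive, so no other vertex
  is missing; and not all occur, since elements are not nested.\<close>

lemma face_through_rel_interior:
 assumes T: "T : \<T>" and F: "F facet_of T" and z: "z : rel_interior F" and T': "T' : \<T>" "z : T'" "T' ~= T"
 shows "F facet_of T'" "T \<inter> T' = F"
proof -
 obtain C g \<beta> where b: "bary C g \<beta>" and TC: "T = convex hull C" using simplex_bary[OF simplex_T[OF T]] .
 interpret bary C g \<beta> by (rule b)
 obtain a where a: "a : C" "F = face a" using F facet_iff TC by blast
 have zF: "z : F" using z rel_interior_subset by blast
 have zT: "z : T" using zF F facet_of_imp_subset by blast
 have "T \<inter> T' face_of T" using Int_face T T' by blast
 then obtain c where c: "c \<subseteq> C" "T \<inter> T' = convex hull c"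
  using face_of_convex_hull_affine_independent[OF independent, of "T \<inter> T'"] TC by blast
 have "C - {a} \<subseteq> c"
 proof
  fix d assume d: "d : C - {a}"
  show "d : c"
  proof (rule ccontr)
   assume "d \<notin> c"
   then have "c \<subseteq> C - {d}" using c(1) by blast
   then have "convex hull c \<subseteq> face d" by (rule hull_mono)
   then have "z : face d" using c(2) zT T'(2) by blast
   then have "lam d z = 0" using face_iff[of d z] d by simp
   then show False using rel_interior_facet_lam[OF b a(1), of z d] z a(2) d by simp
  qed
 qed
 then have "c = C - {a} \<or> c = C" using c(1) a(1) by blast
 moreover have "c ~= C"
 proof
  assume "c = C"
  then have "T \<subseteq> T'" using c(2) TC by blast
  then show False using face_full[OF T T'(1)] T'(3) by simp
 qed
 ultimately show TF: "T \<inter> T' = F" using c(2) a(2) by simp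
 have "T' \<inter> T face_of T'" using Int_face T T' by blast
 then have "F face_of T'" using TF by (simp add: Int_commute)
 moreover have "aff_dim T = aff_dim T'" using aff_dim_simplex[OF simplex_T] T T' by simp
 ultimately show "F facet_of T'" using F unfolding facet_of_def by simp
qed

text \<open>Two elements on the same side of a common facet overlap near a relative interior point of it.\<close>

lemma facet_side_unique:
 assumes T: "T : \<T>" "T' : \<T>" and F: "F facet_of T" "F facet_of T'"
  and side: "outward (\<nu> F) F T \<longleftrightarrow> outward (\<nu> F) F T'"
 shows "T = T'"
proof (rule ccontr)
 assume ne: "T ~= T'"
 have Fne: "F ~= {}" "convex F" using F(1) facet_of_def face_of_imp_convex[of F T] convex_T[OF T(1)] by auto
 then obtain z where z: "z : rel_interior F" using rel_interior_eq_empty by blast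
 then have zF: "z : F" using rel_interior_subset by blast
 define s :: real where "s = (if outward (\<nu> F) F T then - 1 else 1)"
 have near: "eventually (%t. z + t *\<^sub>R (s *\<^sub>R \<nu> F) : interior T0) (at_right 0)"
  if T0: "T0 : \<T>" "F facet_of T0" "outward (\<nu> F) F T0 \<longleftrightarrow> outward (\<nu> F) F T" for T0
 proof -
  obtain C g \<beta> where b: "bary C g \<beta>" and TC: "T0 = convex hull C" using simplex_bary[OF simplex_T[OF T0(1)]] .
  interpret bary C g \<beta> by (rule b)
  obtain a where a: "a : C" "F = face a" using T0(2) facet_iff TC by blast
  have u: "unit_normal (\<nu> F) (face a)" using facet_normal[OF T0(1,2)] a(2) by simp
  obtain \<kappa> where \<kappa>: "\<nu> F = \<kappa> *\<^sub>R g a" "\<bar>\<kappa>\<bar> * norm (g a) = 1" "outward (\<nu> F) (face a) T0 \<longleftrightarrow> \<kappa> < 0"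
   using unit_normal_parallel[OF a(1) u] TC by metis
  have "\<kappa> ~= 0" using \<kappa>(2) by auto
  then have s\<kappa>: "0 < s * \<kappa>" using \<kappa>(3) T0(3) a(2) unfolding s_def by (auto simp: zero_less_mult_iff)
  have "eventually (%t. 0 < lam c (z + t *\<^sub>R (s *\<^sub>R \<nu> F))) (at_right 0)" if c: "c : C" for c
  proof (cases "c = a")
   case True
   have "lam a z = 0" using zF a face_iff by simp
   then have l: "lam a (z + t *\<^sub>R (s *\<^sub>R \<nu> F)) = t * (s * \<kappa>) * (g a \<bullet> g a)" for t
    by (simp add: inner_add_right \<kappa>(1) algebra_simps)
   have "0 < g a \<bullet> g a" using g_nonzero[OF a(1)] by simp
   then show ?thesis unfolding True l using s\<kappa> by (auto simp: eventually_at_filter intro!: mult_pos_pos)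
  next
   case False
   then have "0 < lam c z" using rel_interior_facet_lam[OF b a(1), of z c] z a(2) c by simp
   moreover have "((%t. lam c (z + t *\<^sub>R (s *\<^sub>R \<nu> F))) \<longlongrightarrow> lam c (z + 0 *\<^sub>R (s *\<^sub>R \<nu> F))) (at_right 0)"
    by (intro tendsto_intros)
   ultimately show ?thesis using order_tendstoD(1)[of _ _ "at_right 0" 0] by simp
  qed
  then have "eventually (%t. ALL c:C. 0 < lam c (z + t *\<^sub>R (s *\<^sub>R \<nu> F))) (at_right 0)"
   using fin by (simp add: eventually_ball_finite)
  then show ?thesis unfolding TC interior_T by simp
 qed
 have "eventually (%t. z + t *\<^sub>R (s *\<^sub>R \<nu> F) : interior T & z + t *\<^sub>R (s *\<^sub>R \<nu> F) : interior T') (at_right 0)"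
  using near[OF T(1) F(1)] near[OF T(2) F(2)] side by (simp add: eventually_conj)
 then obtain t where "z + t *\<^sub>R (s *\<^sub>R \<nu> F) : interior T & z + t *\<^sub>R (s *\<^sub>R \<nu> F) : interior T'"
  using eventually_happens'[OF trivial_limit_at_right_real] by blast
 then show False using interior_disjoint[OF T ne] interior_subset[of T'] by blast
qed

text \<open>A relative interior point of the face inside the domain cannot be covered by one element
  alone, since it would be interior to it. Two elements on one side are impossible, so exactly two
  remain, on opposite sides.\<close>

lemma interior_face_elements:
 assumes F: "F : interior_faces \<Omega> \<T>"
 obtains T1 T2 z where "T1 : \<T>" "T2 : \<T>" "T1 ~= T2" "F facet_of T1" "F facet_of T2"
  "outward (\<nu> F) F T1" "~ outward (\<nu> F) F T2" "{T : \<T>. F facet_of T} = {T1, T2}"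
  "Tout F = T1" "Tin F = T2"
  "z : rel_interior F" "z : \<Omega>" "{T : \<T>. z : T} = {T1, T2}"
proof -
 obtain T where T: "T : \<T>" "F facet_of T" and nF: "~ F \<subseteq> frontier \<Omega>"
  using F unfolding interior_faces_def mesh_faces_def by blast
 then obtain y where y: "y : F" "y \<notin> frontier \<Omega>" by blast
 have "y : closure \<Omega>" using y T facet_of_imp_subset[OF T(2)] T_subset[OF T(1)] by blast
 then have y\<Omega>: "y : \<Omega>" using y(2) open_dom by (simp add: frontier_def interior_open)
 have cF: "convex F" using T(2) facet_of_imp_face_of face_of_imp_convex[of F T] convex_T[OF T(1)] by blast
 have "y : closure (rel_interior F)" using convex_closure_rel_interior[OF cF] y(1) closure_subset by blast
 then have "\<Omega> \<inter> rel_interior F ~= {}" using open_dom y\<Omega> open_Int_closure_eq_empty[of \<Omega> "rel_interior F"] by blast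
 then obtain z where z: "z : rel_interior F" "z : \<Omega>" by blast
 have zF: "z : F" using z(1) rel_interior_subset by blast
 have all: "{T : \<T>. z : T} = {T : \<T>. F facet_of T}"
 proof (intro set_eqI iffI)
  fix T' assume T': "T' : {T : \<T>. z : T}"
  show "T' : {T : \<T>. F facet_of T}"
  proof (cases "T' = T")
   case False
   then show ?thesis using face_through_rel_interior(1)[OF T z(1), of T'] T' by simp
  qed (use T in simp)
 next
  fix T' assume "T' : {T : \<T>. F facet_of T}"
  then show "T' : {T : \<T>. z : T}" using zF facet_of_imp_subset by blast
 qed
 have "EX T':\<T>. T' ~= T & z : T'"
 proof (rule ccontr)
  assume no: "~ (EX T':\<T>. T' ~= T & z : T')"
  have "closed (\<Union>(\<T> - {T}))" using finite_mesh closed_T by (intro closed_Union) auto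
  then have "open (\<Omega> - \<Union>(\<T> - {T}))" using open_dom by (intro open_Diff)
  moreover have "z : \<Omega> - \<Union>(\<T> - {T})" using no z by blast
  moreover have "\<Omega> - \<Union>(\<T> - {T}) \<subseteq> T" using Union_mesh closure_subset[of \<Omega>] by blast
  ultimately have "z : interior T" by (metis interior_maximal subsetD)
  moreover have "F \<inter> rel_interior T = {}"
  proof -
   have "F ~= T" using T(2) by (auto simp: facet_of_def)
   then show ?thesis using face_of_disjoint_rel_interior[OF facet_of_imp_face_of[OF T(2)]] by simp
  qed
  ultimately show False using zF interior_subset_rel_interior[of T] by blast
 qed
 then obtain T' where T': "T' : \<T>" "T' ~= T" "z : T'" by blast
 then have F': "F facet_of T'" using all by blast
 have sides: "outward (\<nu> F) F T ~= outward (\<nu> F) F T'"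
  using facet_side_unique[OF T(1) T'(1) T(2) F'] T'(2) by metis
 have only: "T'' = T \<or> T'' = T'" if "T'' : \<T>" "F facet_of T''" for T''
  using facet_side_unique[OF that(1) T(1) that(2) T(2)] facet_side_unique[OF that(1) T'(1) that(2) F'] sides by metis
 have main: "EX T1 T2. T1 : \<T> & T2 : \<T> & T1 ~= T2 & F facet_of T1 & F facet_of T2 & outward (\<nu> F) F T1 & ~ outward (\<nu> F) F T2
   & (ALL T:\<T>. F facet_of T --> T = T1 \<or> T = T2)"
 proof (cases "outward (\<nu> F) F T")
  case True
  then show ?thesis using T T' F' sides only by (intro exI[of _ T] exI[of _ T']) auto
 next
  case False
  then show ?thesis using T T' F' sides only by (intro exI[of _ T'] exI[of _ T]) auto
 qed
 then obtain T1 T2 where t: "T1 : \<T>" "T2 : \<T>" "T1 ~= T2" "F facet_of T1" "F facet_of T2" "outward (\<nu> F) F T1" "~ outward (\<nu> F) F T2"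
  and only: "!!T. T : \<T> ==> F facet_of T ==> T = T1 \<or> T = T2" by blast
 have set: "{T : \<T>. F facet_of T} = {T1, T2}" using t only by blast
 have out: "Tout F = T1" unfolding elem_out_def using t only by (intro the_equality) blast+
 have inn: "Tin F = T2" unfolding elem_in_def using t only by (intro the_equality) blast+
 show ?thesis using that[OF t set out inn z] all set by simp
qed

end

subsection \<open>Bump functions\<close>

text \<open>The denominators are included because the family is then closed under differentiation up
  to linear combinations, and smoothness becomes an induction.\<close>

definition flat_exp :: "nat => real => real" where
 "flat_exp j s = (if 0 < s then exp (- (1 / s)) / s ^ j else 0)"

lemma flat_exp_tendsto_0: "(flat_exp j \<longlongrightarrow> 0) (at 0)"
proof -
 have "((%s. (inverse s) ^ j / exp (inverse s)) \<longlongrightarrow> (0::real)) (at_right 0)"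
  by (rule filterlim_compose[OF tendsto_power_div_exp_0 filterlim_inverse_at_top_right])
 moreover have "eventually (%s. (inverse s) ^ j / exp (inverse s) = flat_exp j s) (at_right 0)"
  unfolding eventually_at_filter
 proof (rule always_eventually, intro allI impI)
  fix s :: real assume "s : {0<..}"
  then show "(inverse s) ^ j / exp (inverse s) = flat_exp j s"
   by (simp add: flat_exp_def exp_minus inverse_eq_divide power_divide mult.commute)
 qed
 ultimately have r: "(flat_exp j \<longlongrightarrow> 0) (at_right 0)"
  by (rule Lim_transform_eventually)
 have "eventually (%s. flat_exp j s = 0) (at_left 0)"
  unfolding eventually_at_filter by (rule always_eventually) (auto simp: flat_exp_def)
 then have l: "(flat_exp j \<longlongrightarrow> 0) (at_left 0)" by (simp add: tendsto_eventually)
 show ?thesis using l r by (simp add: filterlim_at_split)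
qed

lemma flat_exp_deriv:
 "(flat_exp j has_real_derivative flat_exp (j + 2) s - real j * flat_exp (j + 1) s) (at s)"
proof (cases "s = 0")
 case True
 have "((%h. (flat_exp j (0 + h) - flat_exp j 0) / h) \<longlongrightarrow> 0) (at 0)"
 proof (rule Lim_transform_eventually[OF flat_exp_tendsto_0[of "j + 1"]])
  show "eventually (%h. flat_exp (j + 1) h = (flat_exp j (0 + h) - flat_exp j 0) / h) (at 0)"
   by (rule eventually_at_filter[THEN iffD2], rule always_eventually) (auto simp: flat_exp_def)
 qed
 then show ?thesis unfolding True DERIV_def by (simp add: flat_exp_def)
next
 case False
 show ?thesis
 proof (cases "0 < s")
  case True
  have "((%s. exp (- (1 / s)) / s ^ j) has_real_derivative flat_exp (j + 2) s - real j * flat_exp (j + 1) s) (at s)"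
  proof -
   have "((%s. exp (- (1 / s)) / s ^ j) has_real_derivative
    ((exp (- (1 / s)) * (1 / s^2)) * s ^ j - exp (- (1 / s)) * (real j * s ^ (j - 1))) / (s ^ j * s ^ j)) (at s)"
    using True by (auto intro!: derivative_eq_intros simp: power2_eq_square)
   moreover have "((exp (- (1 / s)) * (1 / s^2)) * s ^ j - exp (- (1 / s)) * (real j * s ^ (j - 1))) / (s ^ j * s ^ j)
     = flat_exp (j + 2) s - real j * flat_exp (j + 1) s"
    using True by (cases j) (simp_all add: flat_exp_def field_simps power2_eq_square)
   ultimately show ?thesis by simp
  qed
  then show ?thesis
   by (rule DERIV_cong_ev[THEN iffD1, rotated -1, OF _ refl _ refl])
     (use True in \<open>auto simp: flat_exp_def eventually_nhds intro!: exI[of _ "{0<..}"]\<close>)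
 next
  case neg: False
  then have "s < 0" using False by simp
  have "((%_. 0) has_real_derivative 0) (at s)" by simp
  then have "(flat_exp j has_real_derivative 0) (at s)"
   by (rule DERIV_cong_ev[THEN iffD1, rotated -1, OF _ refl _ refl])
     (use \<open>s < 0\<close> in \<open>auto simp: flat_exp_def eventually_nhds intro!: exI[of _ "{..<0}"]\<close>)
  then show ?thesis using \<open>s < 0\<close> by (simp add: flat_exp_def)
 qed
qed

text \<open>The functions generated from the composites by polynomial coefficients and sums; for
  polynomial \<sigma> they are stable under all partial derivatives.\<close>

inductive flat_comb :: "(real^'n::finite => real) => (real^'n => real) => bool" for \<sigma> where
 base: "q : poly_space m ==> flat_comb \<sigma> (%x. q x * flat_exp j (\<sigma> x))"
| add: "flat_comb \<sigma> f ==> flat_comb \<sigma> g ==> flat_comb \<sigma> (%x. f x + g x)"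

lemma flat_comb_derivs:
 assumes "flat_comb \<sigma> f" "\<sigma> : poly_space d"
 shows "(ALL x. f differentiable (at x)) & (ALL i. flat_comb \<sigma> (partial i f))"
 using assms(1)
proof induction
 case (base q m j)
 have d\<sigma>: "\<sigma> differentiable (at x)" for x using assms(2) by (rule ps_differentiable)
 have dq: "q differentiable (at x)" for x using base by (rule ps_differentiable)
 have der: "((%x. flat_exp j (\<sigma> x)) has_derivative
   (%h. (flat_exp (j + 2) (\<sigma> x) - real j * flat_exp (j + 1) (\<sigma> x)) * frechet_derivative \<sigma> (at x) h)) (at x)" for x
  using has_derivative_compose[OF frechet_derivative_works[THEN iffD1, OF d\<sigma>] flat_exp_deriv[unfolded has_field_derivative_def]]
  by (simp add: mult.commute)
 have dE: "(%x. flat_exp j (\<sigma> x)) differentiable (at x)" for x using der differentiable_def by blast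
 have pE: "partial i (%x. flat_exp j (\<sigma> x)) x = (flat_exp (j + 2) (\<sigma> x) - real j * flat_exp (j + 1) (\<sigma> x)) * partial i \<sigma> x" for i x
  using partial_eqI[OF der] by (simp add: partial_def)
 have eqp: "partial i (%x. q x * flat_exp j (\<sigma> x)) = (%x. ((q x * partial i \<sigma> x) * flat_exp (j + 2) (\<sigma> x)
   + ((- real j) * (q x * partial i \<sigma> x)) * flat_exp (j + 1) (\<sigma> x)) + partial i q x * flat_exp j (\<sigma> x))" for i
  by (rule ext) (simp add: partial_mult dq dE pE algebra_simps)
 have mm: "(%x. q x * partial i \<sigma> x) : poly_space (m + (d - 1))" for i
  by (rule ps_mult[OF base ps_partial[OF assms(2)]])
 have "flat_comb \<sigma> (partial i (%x. q x * flat_exp j (\<sigma> x)))" for i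
  unfolding eqp by (intro flat_comb.add flat_comb.base[OF mm] flat_comb.base[OF ps_cmult[OF mm]]
   flat_comb.base[OF ps_partial[OF base]])
 then show ?case using dq dE by simp
next
 case (add f g)
 then show ?case by (simp add: partial_add_fun flat_comb.add)
qed

lemma flat_comb_C_diff: "\<sigma> : poly_space d ==> flat_comb \<sigma> f ==> C_diff m f"
proof (induction m arbitrary: f)
 case 0
 then show ?case using flat_comb_derivs[of \<sigma> f d]
  by (auto intro!: continuous_at_imp_continuous_on differentiable_imp_continuous_within)
next
 case (Suc m)
 then show ?case using flat_comb_derivs[of \<sigma> f d] by simp
qed

lemma bump_exists:
 fixes z :: "real^'n::finite"
 assumes "0 < \<epsilon>"
 obtains \<phi> where "!!m. C_diff m \<phi>" "!!x. 0 <= \<phi> x" "!!x. \<phi> x ~= 0 \<longleftrightarrow> x : ball z \<epsilon>"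
proof -
 define \<sigma> :: "real^'n => real" where "\<sigma> x = 1 - (1 / \<epsilon>^2) * (SUM i:UNIV. (x $ i - z $ i) * (x $ i - z $ i))" for x
 have "(%x::real^'n. (x $ i - z $ i) * (x $ i - z $ i)) : poly_space (1 + 1)" for i
  by (intro ps_mult ps_diff ps_coord ps_const) auto
 then have \<sigma>: "\<sigma> : poly_space 2" unfolding \<sigma>_def[abs_def]
  by (intro ps_diff ps_const ps_cmult ps_sum) auto
 have \<sigma>n: "\<sigma> x = 1 - (norm (x - z))^2 / \<epsilon>^2" for x
  by (simp add: \<sigma>_def power2_norm_eq_inner inner_vec_def)
 have "flat_comb \<sigma> (%x. 1 * flat_exp 0 (\<sigma> x))" by (rule flat_comb.base[of _ 0]) (simp add: ps_const)
 then have "flat_comb \<sigma> (%x. flat_exp 0 (\<sigma> x))" by simp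
 then have "C_diff m (%x. flat_exp 0 (\<sigma> x))" for m using flat_comb_C_diff[OF \<sigma>] by blast
 moreover have "0 <= flat_exp 0 (\<sigma> x)" for x by (simp add: flat_exp_def)
 moreover have "flat_exp 0 (\<sigma> x) ~= 0 \<longleftrightarrow> x : ball z \<epsilon>" for x
 proof -
  have "flat_exp 0 (\<sigma> x) ~= 0 \<longleftrightarrow> 0 < \<sigma> x" by (simp add: flat_exp_def)
  also have "... \<longleftrightarrow> (norm (x - z))^2 < \<epsilon>^2" using assms by (simp add: \<sigma>n field_simps)
  also have "... \<longleftrightarrow> norm (x - z) < \<epsilon>" using assms by (auto intro: power2_less_imp_less power_strict_mono)
  finally show ?thesis by (simp add: dist_norm norm_minus_commute)
 qed
 ultimately show ?thesis using that by blast
qed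

lemma set_integral_pos:
 fixes f :: "'a::euclidean_space => real"
 assumes int: "set_integrable lborel D f" and nn: "!!x. x : D ==> 0 <= f x"
  and U: "open U" "U ~= {}" "U \<subseteq> D" "!!x. x : U ==> 0 < f x"
 shows "0 < (LBINT x:D. f x)"
proof -
 have nn': "AE x in lborel. 0 <= indicator D x *\<^sub>R f x" using nn by (auto simp: indicator_def)
 have ge: "0 <= (LBINT x:D. f x)"
  unfolding set_lebesgue_integral_def by (rule integral_nonneg_AE[OF nn'])
 have "(LBINT x:D. f x) ~= 0"
 proof
  assume "(LBINT x:D. f x) = 0"
  then have "AE x in lborel. indicator D x *\<^sub>R f x = 0"
   using integral_nonneg_eq_0_iff_AE[OF int[unfolded set_integrable_def] nn'] by (simp add: set_lebesgue_integral_def)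
  then have "AE x in lborel. x \<notin> U"
  proof (rule AE_mp, intro AE_I2 impI notI)
   fix x assume "indicator D x *\<^sub>R f x = 0" "x : U"
   then show False using U(3) U(4)[OF \<open>x : U\<close>] by (auto simp: indicator_def split: if_splits)
  qed
  then have "U : null_sets lborel" using U(1) by (simp add: AE_iff_null_sets)
  then have "negligible U" using negligible_iff_null_sets null_sets_completionI by blast
  then show False using open_not_negligible[OF U(1,2)] by simp
 qed
 then show ?thesis using ge by simp
qed

text \<open>Pulled back to the slab, the integrand is positive on the open set of points that
  project close to \<open>z\<close>.\<close>

lemma (in bary) surf_integral_pos:
 fixes f :: "real^'n => real"
 assumes a: "a : C" and f: "cont f" and nn: "!!x. x : face a ==> 0 <= f x"
  and z: "z : face a" "0 < f z" "!!b. b : C ==> b ~= a ==> 0 < lam b z"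
 shows "0 < (LINT x:face a|surf a. f x)"
proof -
 let ?u = "g a /\<^sub>R (g a \<bullet> g a)"
 let ?p = "%x. x - lam a x *\<^sub>R ?u"
 let ?D = "{x. lam a x : {0..<1} & ?p x : face a}"
 have [measurable]: "f : borel_measurable borel" using f by (rule borel_measurable_continuous_onI)
 have gu: "g a \<bullet> ?u = 1" by (rule g_u[OF a])
 have eq: "indicator {0..<1} (lam a x) * (indicator (face a) (?p x) * f (?p x)) = indicator ?D x *\<^sub>R f (?p x)" for x
  by (auto simp: indicator_def)
 have "(LINT x:face a|surf a. f x) = (\<integral>x. indicator (face a) x * f x \<partial>surf a)" by (simp add: set_lebesgue_integral_def)
 also have "... = (LBINT x. indicator {0..<1} (lam a x) * (indicator (face a) (?p x) * f (?p x)))"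
  unfolding surf_def by (rule integral_slab_measure) measurable
 also have "... = (LBINT x:?D. f (?p x))" by (simp only: eq set_lebesgue_integral_def)
 also have "0 < ..."
 proof (rule set_integral_pos)
  have "integrable (surf a) (%x. indicator (face a) x * f x)"
   using surf_integrable[OF f] by (simp add: set_integrable_def)
  then have "integrable lborel (%x. indicator {0..<1} (lam a x) * (indicator (face a) (?p x) * f (?p x)))"
   unfolding surf_def by (subst (asm) integrable_slab_measure) auto
  then show "set_integrable lborel ?D (%x. f (?p x))" by (simp only: eq set_integrable_def)
  show "0 <= f (?p x)" if "x : ?D" for x using that nn by simp
  let ?U = "{x. 0 < lam a x & lam a x < 1 & (ALL b:C - {a}. 0 < lam b (?p x)) & 0 < f (?p x)}"
  have "?U = {x. 0 < lam a x} \<inter> {x. lam a x < 1} \<inter> (\<Inter>b\<in>C - {a}. {x. 0 < lam b (?p x)}) \<inter> {x. 0 < f (?p x)}" by auto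
  moreover have "cont (%x. f (?p x))"
   by (rule continuous_on_compose2[OF f]) (auto intro!: continuous_intros)
  ultimately show "open ?U" using fin
   by (simp only:) (intro open_Int open_INT open_Collect_less continuous_intros ballI; simp)
  have lz: "lam a z = 0" using z(1) face_iff[OF a] by simp
  have l: "lam a (z + (1/2) *\<^sub>R ?u) = 1/2" using lz gu by (simp add: inner_add_right del: inner_scaleR_right) simp
  then have p: "?p (z + (1/2) *\<^sub>R ?u) = z" by (simp only: l) simp
  have "z + (1/2) *\<^sub>R ?u : ?U" unfolding mem_Collect_eq p l using z by simp
  then show "?U ~= {}" by blast
  show "?U \<subseteq> ?D"
  proof
   fix x assume x: "x : ?U"
   have "lam a (?p x) = 0" by (simp only: inner_diff_right inner_scaleR_right[of _ "lam a x" ?u] gu) simp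
   moreover from this have "?p x : T" unfolding T_iff using x by (metis (mono_tags, lifting) Diff_iff less_imp_le mem_Collect_eq order_refl singletonD)
   ultimately have "?p x : face a" using face_iff[OF a] by blast
   then show "x : ?D" using x by simp
  qed
  show "0 < f (?p x)" if "x : ?U" for x using that by simp
 qed
 finally show ?thesis .
qed

section \<open>Integrals over mesh faces, and the classical meaning of zero weak divergence\<close>

context mesh begin

text \<open>Hides the barycentric representation: up to a positive factor, face integrals are
  integrals for a measure that is positive near relative interior points.\<close>

lemma facet_measure:
 assumes T: "T : \<T>" and F: "F facet_of T"
 obtains M c where "0 < c" "sets M = sets borel"
  "!!\<phi>::real^'n => real. cont \<phi> ==> set_integrable M F \<phi> & fint F \<phi> = c * (LINT x:F|M. \<phi> x)"
  "!!(\<phi>::real^'n => real) z. cont \<phi> ==> (!!x. x : F ==> 0 <= \<phi> x) ==> z : rel_interior F ==> 0 < \<phi> z ==> 0 < (LINT x:F|M. \<phi> x)"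
proof -
 obtain C g \<beta> where b: "bary C g \<beta>" and TC: "T = convex hull C" using simplex_bary[OF simplex_T[OF T]] .
 interpret bary C g \<beta> by (rule b)
 obtain a where a: "a : C" "F = face a" using F facet_iff TC by blast
 have u: "unit_normal (\<nu> F) (face a)" using facet_normal[OF T F] a(2) by simp
 show ?thesis
 proof (rule that[of "norm (g a)" "surf a"])
  show "0 < norm (g a)" using g_nonzero[OF a(1)] by simp
  show "sets (surf a) = sets borel" by simp
  show "set_integrable (surf a) F \<phi> & fint F \<phi> = norm (g a) * (LINT x:F|surf a. \<phi> x)"
   if "cont \<phi>" for \<phi> :: "real^'n => real"
   using surf_integrable[OF that, of a] face_integral_surf[OF a(1) u borel_measurable_continuous_onI[OF that]] a(2) by simp
  show "0 < (LINT x:F|surf a. \<phi> x)" if "cont \<phi>" "!!x. x : F ==> 0 <= \<phi> x" "z : rel_interior F" "0 < \<phi> z" for \<phi> :: "real^'n => real" and z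
   unfolding a(2)
  proof (rule surf_integral_pos[OF a(1) that(1)])
   show "z : face a" using that(3) rel_interior_subset a(2) by blast
   show "0 < lam b z" if "b : C" "b ~= a" for b using rel_interior_facet_lam[OF b a(1)] \<open>z : rel_interior F\<close> a(2) that by simp
  qed (use that a(2) in auto)
 qed
qed

lemma face_integral_cong:
 "(!!x. x : F ==> f x = h x) ==> face_integral n F f = face_integral n F h"
 unfolding face_integral_def set_lebesgue_integral_def
 by (rule Bochner_Integration.integral_cong) (auto simp: indicator_def)

lemma face_integral_zero: "(!!x. x : F ==> f x = 0) ==> face_integral n F f = 0"
 using face_integral_cong[of F f "%_. 0" n] by (simp add: face_integral_def)

lemma face_integral_add:
 assumes "F : mesh_faces \<T>" "cont f" "cont h"
 shows "fint F (%x. f x + h x) = fint F f + fint F h"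
proof -
 obtain T where T: "T : \<T>" "F facet_of T" using assms(1) unfolding mesh_faces_def by blast
 obtain M c where m: "!!\<phi>::real^'n => real. cont \<phi> ==> set_integrable M F \<phi> & fint F \<phi> = c * (LINT x:F|M. \<phi> x)"
  using facet_measure[OF T] by metis
 show ?thesis using m[OF assms(2)] m[OF assms(3)] m[OF continuous_on_add[OF assms(2,3)]] by (simp add: distrib_left)
qed

lemma face_integral_cmult: "face_integral n F (%x. r * f x) = r * face_integral n F f"
 by (simp add: face_integral_def)

lemma face_integral_diff:
 assumes "F : mesh_faces \<T>" "cont f" "cont h"
 shows "fint F (%x. f x - h x) = fint F f - fint F h"
 using face_integral_add[OF assms(1,2), of "%x. (-1) * h x"] face_integral_cmult[of "\<nu> F" F "-1" h] assms(3)
 by (simp add: continuous_on_minus)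

lemma face_integral_sum:
 assumes "F : mesh_faces \<T>" "!!i. i : I ==> cont (f i)"
 shows "fint F (%x. SUM i:I. f i x) = (SUM i:I. fint F (f i))"
 using assms(2)
proof (induction I rule: infinite_finite_induct)
 case (insert i I)
 then show ?case using face_integral_add[OF assms(1), of "f i" "%x. SUM i:I. f i x"] by (simp add: continuous_on_sum)
qed (simp_all add: face_integral_zero)

lemma face_integral_mono:
 assumes "F : mesh_faces \<T>" "cont f" "cont h" "!!x. x : F ==> f x <= h x"
 shows "fint F f <= fint F h"
proof -
 obtain T where T: "T : \<T>" "F facet_of T" using assms(1) unfolding mesh_faces_def by blast
 obtain M c where m: "0 < c" "!!\<phi>::real^'n => real. cont \<phi> ==> set_integrable M F \<phi> & fint F \<phi> = c * (LINT x:F|M. \<phi> x)"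
  using facet_measure[OF T] by metis
 show ?thesis using m(2)[OF assms(2)] m(2)[OF assms(3)] m(1) assms(4)
  by (simp add: set_integral_mono)
qed

lemma face_integral_nonneg:
 assumes "!!x. x : F ==> 0 <= f x"
 shows "0 <= face_integral n F f"
 unfolding face_integral_def set_lebesgue_integral_def
 by (rule integral_nonneg_AE) (use assms in \<open>auto simp: indicator_def\<close>)

lemma element_ibp:
 fixes V :: "real^'n => real^'n"
 assumes T: "T : \<T>" and V: "!!i. C1 (%x. V x $ i)" and \<phi>: "C1 \<phi>"
 shows "(LBINT x:T. V x \<bullet> gradient \<phi> x) =
   (\<Sum>F | F facet_of T. fsgn F T * fint F (%x. \<phi> x * (\<nu> F \<bullet> V x)))
   - (LBINT x:T. \<phi> x * divergence V x)"
proof -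
 have Vc: "cont (%x. V x $ i)" for i using V C1_cont by blast
 have \<phi>c: "cont \<phi>" using \<phi> C1_cont by blast
 have c1: "cont (%x. \<phi> x * divergence V x)"
  unfolding divergence_def using V by (intro continuous_intros \<phi>c) auto
 have c2: "cont (%x. V x \<bullet> gradient \<phi> x)"
  unfolding gradient_def inner_vec_def using \<phi> by (auto intro!: continuous_intros Vc)
 have W: "C1 (%x. (\<phi> x *\<^sub>R V x) $ i)" for i
  unfolding vector_scaleR_component real_scaleR_def by (rule C1_mult[OF \<phi> V])
 have d: "divergence (%x. \<phi> x *\<^sub>R V x) x = \<phi> x * divergence V x + V x \<bullet> gradient \<phi> x" for x
  using V \<phi> by (intro divergence_scale) auto
 have "(LBINT x:T. \<phi> x * divergence V x + V x \<bullet> gradient \<phi> x) =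
  (\<Sum>F | F facet_of T. fsgn F T * fint F (%x. \<phi> x * (\<nu> F \<bullet> V x)))"
  using element_divergence[OF simplex_T[OF T] facet_normal[OF T] W] by (simp add: d)
 moreover have "(LBINT x:T. \<phi> x * divergence V x + V x \<bullet> gradient \<phi> x) =
   (LBINT x:T. \<phi> x * divergence V x) + (LBINT x:T. V x \<bullet> gradient \<phi> x)"
  using element_integral_interior(1)[OF T] c1 c2 by simp
 ultimately show ?thesis by simp
qed

text \<open>Localises the weak condition: only the elements that can meet the support of the bump
  contribute.\<close>

lemma test_integral:
 assumes v: "!!T x. T : \<T> ==> x : interior T ==> v x = V T x"
  and V: "!!T i. T : \<T> ==> C1 (%x. V T x $ i)"
  and w: "weak_divergence \<Omega> v (%x. 0)" and \<phi>: "!!m. C_diff m \<phi>" "!!x. \<phi> x ~= 0 \<longleftrightarrow> x : ball z \<epsilon>" "0 < \<epsilon>" "cball z \<epsilon> \<subseteq> \<Omega>"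
  and A: "\<A> \<subseteq> \<T>" "!!T. T : \<T> - \<A> ==> T \<inter> cball z \<epsilon> = {}"
 shows "(SUM T:\<A>. LBINT x:T. V T x \<bullet> gradient \<phi> x) = 0"
proof -
 have "{x. \<phi> x ~= 0} = ball z \<epsilon>" using \<phi>(2) by blast
 then have cl: "closure {x. \<phi> x ~= 0} = cball z \<epsilon>" using \<phi>(3) by simp
 have "\<phi> : test_functions \<Omega>"
  unfolding test_functions_def mem_Collect_eq cl using \<phi>(1,4) by (intro conjI allI) auto
 then have "L2_inner \<Omega> v (gradient \<phi>) = 0"
  using w unfolding weak_divergence_def by (simp add: L2_inner_def)
 moreover have "L2_inner \<Omega> v (gradient \<phi>) = (SUM T:\<T>. LBINT x:T. V T x \<bullet> gradient \<phi> x)"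
  unfolding L2_inner_def
 proof (rule broken_integral(2))
  show "v x \<bullet> gradient \<phi> x = V T x \<bullet> gradient \<phi> x" if "T : \<T>" "x : interior T" for T x using v that by simp
  show "cont (%x. V T x \<bullet> gradient \<phi> x)" if "T : \<T>" for T
  proof -
   have "cont (%x. V T x $ i)" for i using V[OF that] C1_cont by blast
   moreover have "cont (partial i \<phi>)" for i using \<phi>(1)[of "Suc 0"] by simp
   ultimately show ?thesis
    by (auto simp: gradient_def inner_vec_def intro!: continuous_on_sum continuous_on_mult)
  qed
 qed
 moreover have "(LBINT x:T. V T x \<bullet> gradient \<phi> x) = 0" if T: "T : \<T> - \<A>" for T
 proof -
  have "gradient \<phi> x = 0" if "x : T" for x
  proof -
   have x: "x : - cball z \<epsilon>" using A(2)[OF T] that by blast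
   have off: "\<phi> y = 0" if "y : - cball z \<epsilon>" for y using \<phi>(2)[of y] that by auto
   have "partial i \<phi> x = partial i (%x. 0) x" for i
    by (rule partial_local[OF _ x off]) auto
   then show ?thesis by (simp add: gradient_def vec_eq_iff)
  qed
  then have "(%x. indicator T x *\<^sub>R (V T x \<bullet> gradient \<phi> x)) = (%x. 0)" by (auto simp: indicator_def)
  then show ?thesis by (simp only: set_lebesgue_integral_def) simp
 qed
 ultimately show ?thesis using sum.mono_neutral_right[OF finite_mesh A(1), of "%T. LBINT x:T. V T x \<bullet> gradient \<phi> x"] by simp
qed

lemma facet_interior_disjoint: "T : \<T> ==> F facet_of T ==> F \<inter> interior T = {}"
proof -
 assume T: "T : \<T>" "F facet_of T"
 have "F ~= T" using T(2) by (auto simp: facet_of_def)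
 then have "F \<inter> rel_interior T = {}" using face_of_disjoint_rel_interior[OF facet_of_imp_face_of[OF T(2)]] by simp
 then show ?thesis using interior_subset_rel_interior[of T] by blast
qed

text \<open>A bump supported inside the element, where the divergence has one sign, has no boundary
  terms and would give a nonzero integral. Continuity carries the result to the boundary of the
  element.\<close>

lemma divergence_zero:
 assumes v: "!!T x. T : \<T> ==> x : interior T ==> v x = V T x"
  and V: "!!T i. T : \<T> ==> C1 (%x. V T x $ i)"
  and w: "weak_divergence \<Omega> v (%x. 0)" and T: "T : \<T>" and z: "z : T"
 shows "divergence (V T) z = 0"
proof -
 have dc: "cont (%x. divergence (V T) x)"
  unfolding divergence_def using V[OF T] by (intro continuous_intros) auto
 have int: "divergence (V T) z = 0" if z: "z : interior T" for z
 proof (rule ccontr)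
  define s where "s = sgn (divergence (V T) z)"
  assume "divergence (V T) z ~= 0"
  then have sz: "0 < s * divergence (V T) z" by (simp add: s_def sgn_if)
  let ?U = "interior T \<inter> {x. 0 < s * divergence (V T) x}"
  have "open ?U" by (intro open_Int open_interior open_Collect_less continuous_intros dc)
  then obtain \<epsilon> where \<epsilon>: "0 < \<epsilon>" "cball z \<epsilon> \<subseteq> ?U" using z sz open_contains_cball[of ?U] by blast
  obtain \<phi> where \<phi>: "!!m. C_diff m \<phi>" "!!x. 0 <= \<phi> x" "!!x. \<phi> x ~= 0 \<longleftrightarrow> x : ball z \<epsilon>"
   using bump_exists[OF \<epsilon>(1)] by metis
  have \<phi>1: "C1 \<phi>" using \<phi>(1) by blast
  have "(SUM T:{T}. LBINT x:T. V T x \<bullet> gradient \<phi> x) = 0"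
  proof (rule test_integral[where V = V and v = v, OF v V w \<phi>(1,3) \<epsilon>(1)])
   show "cball z \<epsilon> \<subseteq> \<Omega>" using \<epsilon>(2) interior_subset_dom[OF T] by blast
   show "T' \<inter> cball z \<epsilon> = {}" if "T' : \<T> - {T}" for T'
    using interior_disjoint[OF T, of T'] that \<epsilon>(2) by blast
  qed (use T in auto)
  then have "(LBINT x:T. V T x \<bullet> gradient \<phi> x) = 0" by simp
  moreover have "(\<Sum>F | F facet_of T. fsgn F T * fint F (%x. \<phi> x * (\<nu> F \<bullet> V T x))) = 0"
  proof (rule sum.neutral, rule ballI)
   fix F assume F: "F : {F. F facet_of T}"
   have "\<phi> x = 0" if "x : F" for x
    using facet_interior_disjoint[OF T, of F] F that \<epsilon>(2) \<phi>(3)[of x] ball_subset_cball[of z \<epsilon>] by blast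
   then show "fsgn F T * fint F (%x. \<phi> x * (\<nu> F \<bullet> V T x)) = 0"
    by (simp add: face_integral_zero)
  qed
  ultimately have z0: "(LBINT x:T. \<phi> x * divergence (V T) x) = 0"
   using element_ibp[OF T V[OF T] \<phi>1] by simp
  have c: "cont (%x. \<phi> x * (s * divergence (V T) x))"
   by (intro continuous_intros dc C1_cont[OF \<phi>1])
  have "0 < (LBINT x:T. \<phi> x * (s * divergence (V T) x))"
  proof (rule set_integral_pos[of _ _ "ball z \<epsilon>"])
   show "set_integrable lborel T (%x. \<phi> x * (s * divergence (V T) x))" by (rule element_integral_interior(1)[OF T c])
   have pos: "0 < \<phi> x * (s * divergence (V T) x)" if "x : ball z \<epsilon>" for x
   proof -
    have "0 < \<phi> x" using \<phi>(2)[of x] \<phi>(3)[of x] that by linarith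
    moreover have "0 < s * divergence (V T) x" using that \<epsilon>(2) ball_subset_cball[of z \<epsilon>] by blast
    ultimately show ?thesis by (rule mult_pos_pos)
   qed
   show "0 < \<phi> x * (s * divergence (V T) x)" if "x : ball z \<epsilon>" for x by (rule pos[OF that])
   show "0 <= \<phi> x * (s * divergence (V T) x)" if "x : T" for x
    using pos[of x] \<phi>(3)[of x] by (cases "x : ball z \<epsilon>") auto
   show "ball z \<epsilon> \<subseteq> T" using \<epsilon>(2) interior_subset[of T] ball_subset_cball[of z \<epsilon>] by blast
  qed (use \<epsilon>(1) in auto)
  moreover have "(%x. \<phi> x * (s * divergence (V T) x)) = (%x. s * (\<phi> x * divergence (V T) x))" by auto
  ultimately show False using z0 by simp
 qed
 have "closure (interior T) = T"
  using convex_closure_interior[OF convex_T[OF T] interior_nonempty[OF T]] closed_T[OF T] by simp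
 then have "z : closure (interior T)" using z by simp
 then show ?thesis
  using continuous_constant_on_closure[of "interior T" "%x. divergence (V T) x" 0 z] int continuous_on_subset[OF dc] by auto
qed

text \<open>Testing with a bump around a relative interior point of an interior face shows that the normal
 component cannot jump there; polynomials then agree on the whole face.\<close>

lemma normal_continuous:
 assumes v: "!!T x. T : \<T> ==> x : interior T ==> v x = V T x"
  and V: "!!T i. T : \<T> ==> (%x. V T x $ i) : poly_space (int K)"
  and w: "weak_divergence \<Omega> v (%x. 0)"
  and F: "F : interior_faces \<Omega> \<T>" and x: "x : F"
 shows "\<nu> F \<bullet> V (Tout F) x = \<nu> F \<bullet> V (Tin F) x"
proof -
 obtain T1 T2 z where t: "T1 : \<T>" "T2 : \<T>" "T1 ~= T2" "F facet_of T1" "F facet_of T2"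
  "outward (\<nu> F) F T1" "~ outward (\<nu> F) F T2" and set: "{T : \<T>. F facet_of T} = {T1, T2}"
  and oi: "Tout F = T1" "Tin F = T2"
  and z: "z : rel_interior F" "z : \<Omega>" and "{T : \<T>. z : T} = {T1, T2}"
  by (rule interior_face_elements[OF F])
 have FM: "F : mesh_faces \<T>" using mesh_facesI[OF t(1,4)] .
 have V1: "C1 (%x. V T x $ i)" if "T : \<T>" for T i by (rule ps_C_diff_1[OF V[OF that]])
 have Vc: "cont (%x. \<nu> F \<bullet> V T x)" if "T : \<T>" for T
  unfolding inner_vec_def by (intro continuous_intros ps_continuous[OF V[OF that]])
 define \<delta> where "\<delta> x = \<nu> F \<bullet> V T1 x - \<nu> F \<bullet> V T2 x" for x
 have \<delta>c: "cont \<delta>" unfolding \<delta>_def[abs_def] by (intro continuous_intros Vc t)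
 have zero: "\<delta> z = 0" if z: "z : rel_interior F" "z : \<Omega>" for z
 proof (rule ccontr)
  define s where "s = sgn (\<delta> z)"
  assume "\<delta> z ~= 0"
  then have sz: "0 < s * \<delta> z" by (simp add: s_def sgn_if)
  have zF: "z : F" using z(1) rel_interior_subset by blast
  \<comment> \<open>The other elements, and the other facets of the two neighbours: a small ball
    around \<open>z\<close> avoids them all, so only \<open>F\<close> contributes to the boundary
    terms.\<close>
  let ?O1 = "\<Union>(\<T> - {T1, T2})" and ?O2 = "\<Union>({F'. F' facet_of T1} - {F})" and ?O3 = "\<Union>({F'. F' facet_of T2} - {F})"
  have cf: "closed F'" if "T' : \<T>" "F' facet_of T'" for T' F'
   by (rule face_of_imp_closed[OF convex_T[OF that(1)] closed_T[OF that(1)] facet_of_imp_face_of[OF that(2)]])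
  have O1: "closed ?O1" by (rule closed_Union) (use finite_mesh closed_T in auto)
  have O2: "closed ?O2" by (rule closed_Union) (use finite_facets[OF t(1)] cf[OF t(1)] in auto)
  have O3: "closed ?O3" by (rule closed_Union) (use finite_facets[OF t(2)] cf[OF t(2)] in auto)
  have z1: "z \<notin> ?O1"
  proof
   assume "z : ?O1"
   then obtain T' where T': "T' : \<T>" "T' ~= T1" "T' ~= T2" "z : T'" by blast
   then have "F facet_of T'" using face_through_rel_interior(1)[OF t(1,4) z(1)] by blast
   then show False using T' set by blast
  qed
  have z23: "z \<notin> \<Union>({F'. F' facet_of T'} - {F})" if T': "T' : \<T>" "F facet_of T'" for T'
  proof
   assume "z : \<Union>({F'. F' facet_of T'} - {F})"
   then obtain F' where F': "F' facet_of T'" "F' ~= F" "z : F'" by blast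
   obtain C g \<beta> where b: "bary C g \<beta>" and TC: "T' = convex hull C" using simplex_bary[OF simplex_T[OF T'(1)]] .
   interpret bary C g \<beta> by (rule b)
   obtain a where a: "a : C" "F = face a" using T'(2) facet_iff TC by blast
   obtain a' where a': "a' : C" "F' = face a'" using F'(1) facet_iff TC by blast
   have "a' ~= a" using F'(2) a a' by blast
   then have "0 < lam a' z" using rel_interior_facet_lam[OF b a(1)] z(1) a a' by blast
   then show False using F'(3) a' face_iff[of a' z] by simp
  qed
  let ?U = "\<Omega> \<inter> (- ?O1) \<inter> (- ?O2) \<inter> (- ?O3) \<inter> {x. 0 < s * \<delta> x}"
  have "open {x. 0 < s * \<delta> x}" by (intro open_Collect_less continuous_intros \<delta>c)
  then have "open ?U" by (intro open_Int open_dom open_Compl O1 O2 O3)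
  moreover have "z : ?U" using z(2) z1 z23[OF t(1,4)] z23[OF t(2,5)] sz by simp
  ultimately have "EX \<epsilon>>0. cball z \<epsilon> \<subseteq> ?U" by (rule open_contains_cball[THEN iffD1, THEN bspec])
  then obtain \<epsilon> where \<epsilon>: "0 < \<epsilon>" and "cball z \<epsilon> \<subseteq> ?U" by (elim exE conjE) (rule that)
  then have sub: "cball z \<epsilon> \<subseteq> \<Omega>" "cball z \<epsilon> \<subseteq> - ?O1" "cball z \<epsilon> \<subseteq> - ?O2" "cball z \<epsilon> \<subseteq> - ?O3" "cball z \<epsilon> \<subseteq> {x. 0 < s * \<delta> x}"
   by (simp_all only: Int_subset_iff)
  obtain \<phi> where \<phi>: "!!m. C_diff m \<phi>" "!!x. 0 <= \<phi> x" "!!x. \<phi> x ~= 0 \<longleftrightarrow> x : ball z \<epsilon>"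
   using bump_exists[OF \<epsilon>, of z] by metis
  have \<phi>1: "C1 \<phi>" using \<phi>(1) by blast
  have \<phi>c: "cont \<phi>" by (rule C1_cont[OF \<phi>1])
  have "(SUM T:{T1, T2}. LBINT x:T. V T x \<bullet> gradient \<phi> x) = 0"
  proof (rule test_integral[where V = V and v = v, OF v V1 w \<phi>(1,3) \<epsilon>])
   show "cball z \<epsilon> \<subseteq> \<Omega>" by (rule sub(1))
   show "T' \<inter> cball z \<epsilon> = {}" if "T' : \<T> - {T1, T2}" for T' using that sub(2) by blast
  qed (use t in auto)
  moreover have el: "(LBINT x:T'. V T' x \<bullet> gradient \<phi> x) = fsgn F T' * fint F (%x. \<phi> x * (\<nu> F \<bullet> V T' x))"
   if T': "T' : \<T>" "F facet_of T'" and O: "cball z \<epsilon> \<subseteq> - \<Union>({F'. F' facet_of T'} - {F})" for T'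
  proof -
   have dz: "(LBINT x:T'. \<phi> x * divergence (V T') x) = 0"
   proof -
    have "(%x. indicator T' x *\<^sub>R (\<phi> x * divergence (V T') x)) = (%x. 0)"
     using divergence_zero[where V = V and v = v, OF v V1 w T'(1)] by (auto simp: indicator_def)
    then show ?thesis by (simp only: set_lebesgue_integral_def) simp
   qed
   have "(\<Sum>F' | F' facet_of T'. outer_sign (\<nu> F') F' T' * face_integral (\<nu> F') F' (%x. \<phi> x * (\<nu> F' \<bullet> V T' x)))
     = (SUM F':{F}. outer_sign (\<nu> F') F' T' * face_integral (\<nu> F') F' (%x. \<phi> x * (\<nu> F' \<bullet> V T' x)))"
   proof (rule sum.mono_neutral_right[OF finite_facets[OF T'(1)]], use T' in simp, rule ballI)
    fix F' assume F': "F' : {F'. F' facet_of T'} - {F}"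
    have "\<phi> x = 0" if "x : F'" for x
     using F' that O \<phi>(3)[of x] ball_subset_cball[of z \<epsilon>] by blast
    then show "outer_sign (\<nu> F') F' T' * face_integral (\<nu> F') F' (%x. \<phi> x * (\<nu> F' \<bullet> V T' x)) = 0"
     by (simp add: face_integral_zero)
   qed
   then show ?thesis using element_ibp[OF T'(1) V1[OF T'(1)] \<phi>1] dz by simp
  qed
  have e1: "(LBINT x:T1. V T1 x \<bullet> gradient \<phi> x) = fint F (%x. \<phi> x * (\<nu> F \<bullet> V T1 x))"
   using el[OF t(1,4) sub(3)] t(6) by (simp add: outer_sign_def)
  have e2: "(LBINT x:T2. V T2 x \<bullet> gradient \<phi> x) = - fint F (%x. \<phi> x * (\<nu> F \<bullet> V T2 x))"
   using el[OF t(2,5) sub(4)] t(7) by (simp add: outer_sign_def)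
  ultimately have "fint F (%x. \<phi> x * (\<nu> F \<bullet> V T1 x)) - fint F (%x. \<phi> x * (\<nu> F \<bullet> V T2 x)) = 0"
   using t(3) by (simp add: e1 e2)
  then have "fint F (%x. \<phi> x * (\<nu> F \<bullet> V T1 x) - \<phi> x * (\<nu> F \<bullet> V T2 x)) = 0"
   by (subst face_integral_diff[OF FM]) (auto intro!: continuous_intros \<phi>c Vc t)
  then have fz: "fint F (%x. s * (\<phi> x * (\<nu> F \<bullet> V T1 x) - \<phi> x * (\<nu> F \<bullet> V T2 x))) = 0"
   by (simp only: face_integral_cmult mult_zero_right)
  have eq: "(%x. s * (\<phi> x * (\<nu> F \<bullet> V T1 x) - \<phi> x * (\<nu> F \<bullet> V T2 x))) = (%x. \<phi> x * (s * \<delta> x))"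
   by (auto simp: \<delta>_def algebra_simps)
  obtain M c where M: "0 < c" "sets M = sets borel"
   "!!\<phi>::real^'n => real. cont \<phi> ==> set_integrable M F \<phi> & fint F \<phi> = c * (LINT x:F|M. \<phi> x)"
   "!!(\<phi>::real^'n => real) z. cont \<phi> ==> (!!x. x : F ==> 0 <= \<phi> x) ==> z : rel_interior F ==> 0 < \<phi> z ==> 0 < (LINT x:F|M. \<phi> x)"
   using facet_measure[OF t(1,4)] by metis
  have pc: "cont (%x. \<phi> x * (s * \<delta> x))" by (intro continuous_intros \<phi>c \<delta>c)
  have pos: "0 < \<phi> x * (s * \<delta> x)" if "x : ball z \<epsilon>" for x
  proof -
   have "0 < \<phi> x" using \<phi>(2)[of x] \<phi>(3)[of x] that by linarith
   moreover have "0 < s * \<delta> x" using that sub(5) ball_subset_cball[of z \<epsilon>] by blast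
   ultimately show ?thesis by (rule mult_pos_pos)
  qed
  have "0 < (LINT x:F|M. \<phi> x * (s * \<delta> x))"
  proof (rule M(4)[OF pc _ z(1)])
   show "0 <= \<phi> x * (s * \<delta> x)" for x using pos[of x] \<phi>(3)[of x] by (cases "x : ball z \<epsilon>") auto
   show "0 < \<phi> z * (s * \<delta> z)" using pos \<epsilon> by simp
  qed
  then have "0 < fint F (%x. \<phi> x * (s * \<delta> x))" using M(1) M(3)[OF pc] by simp
  then show False using fz unfolding eq by simp
 qed
 have "\<delta> : poly_space (int K)" unfolding \<delta>_def[abs_def] inner_vec_def inner_real_def
  by (intro ps_diff ps_sum ps_cmult V t)
 then obtain P where P: "!!s. \<delta> (z + s *\<^sub>R (x - z)) = poly P s" using ps_line by blast
 \<comment> \<open>The point \<open>x\<close> may lie on the frontier of the domain, where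
   \<open>zero\<close> does not apply. Near \<open>z\<close> the segment is inside, which already
   gives infinitely many roots.\<close>
 have "eventually (%s. z + s *\<^sub>R (x - z) : \<Omega>) (at_right (0::real))"
 proof -
  have "((%s. z + s *\<^sub>R (x - z)) \<longlongrightarrow> z + 0 *\<^sub>R (x - z)) (at_right (0::real))" by (intro tendsto_intros)
  then show ?thesis using topological_tendstoD[OF _ open_dom, of _ _ "at_right (0::real)"] z(2) by simp
 qed
 then obtain r where r: "0 < r" "!!s. 0 < s ==> s < r ==> z + s *\<^sub>R (x - z) : \<Omega>"
  unfolding eventually_at_right_field by auto
 have cF: "convex F" using facet_of_imp_face_of[OF t(4)] face_of_imp_convex[of F T1] convex_T[OF t(1)] by blast
 have "poly P s = 0" if s: "0 < s" "s < min r 1" for s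
 proof -
  have "x - (1 - s) *\<^sub>R (x - z) : rel_interior F"
   by (rule rel_interior_convex_shrink[OF cF z(1) x]) (use s in auto)
  moreover have "x - (1 - s) *\<^sub>R (x - z) = z + s *\<^sub>R (x - z)" by (simp add: algebra_simps)
  ultimately show ?thesis using zero[of "z + s *\<^sub>R (x - z)"] r(2)[of s] s P[of s] by simp
 qed
 then have "{0<..<min r 1} \<subseteq> {s. poly P s = 0}" by auto
 moreover have "infinite {0<..<min r (1::real)}" using r(1) by (simp add: infinite_Ioo)
 ultimately have "infinite {s. poly P s = 0}" using finite_subset by blast
 then have "P = 0" using poly_roots_finite by blast
 then have "\<delta> x = 0" using P[of 1] by simp
 then show ?thesis unfolding oi \<delta>_def by simp
qed

end

subsection \<open>Trigonometric sums on a cube\<close>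

lemma integral_lborel_vec_prod:
 fixes f :: "'n::finite => real => real"
 assumes "!!i. integrable lborel (f i)"
 shows "(\<integral>x. (\<Prod>i\<in>UNIV. f i (x $ i)) \<partial>(lborel :: (real^'n) measure)) = (\<Prod>i\<in>UNIV. LBINT t. f i t)"
proof -
 interpret product_sigma_finite "%_::real^'n. lborel :: real measure" ..
 let ?ax = "%i::'n. axis i (1::real)"
 let ?h = "%b. f (inv ?ax b)"
 have inj: "inj ?ax" by (auto simp: inj_on_def axis_eq_axis)
 have Basis: "(Basis :: (real^'n) set) = range ?ax" by (auto simp: Basis_vec_def)
 have h: "?h (?ax i) = f i" for i by (simp add: inv_f_f[OF inj])
 have [measurable]: "f i : borel_measurable borel" for i using borel_measurable_integrable[OF assms[of i]] by simp
 have "(\<integral>x. (\<Prod>i\<in>UNIV. f i (x $ i)) \<partial>(lborel :: (real^'n) measure)) = (\<integral>x. (\<Prod>b\<in>Basis. ?h b (x \<bullet> b)) \<partial>(lborel :: (real^'n) measure))"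
  unfolding Basis by (simp add: prod.reindex[OF inj] h inner_axis)
 also have "... = (\<integral>y. (\<Prod>b\<in>Basis. ?h b ((SUM c:Basis. y c *\<^sub>R c) \<bullet> b)) \<partial>(\<Pi>\<^sub>M b\<in>(Basis :: (real^'n) set). lborel))"
  by (subst lborel_eq, subst integral_distr) auto
 also have "... = (\<integral>y. (\<Prod>b\<in>Basis. ?h b (y b)) \<partial>(\<Pi>\<^sub>M b\<in>(Basis :: (real^'n) set). lborel))"
  by (simp add: inner_sum_left inner_Basis if_distrib cong: if_cong prod.cong_simp)
 also have "... = (\<Prod>b\<in>Basis. LBINT t. ?h b t)"
  by (rule product_integral_prod) (auto simp: assms)
 also have "... = (\<Prod>i\<in>UNIV. LBINT t. f i t)"
  unfolding Basis by (simp add: prod.reindex[OF inj] h)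
 finally show ?thesis .
qed

locale cube =
 fixes a b :: real
 assumes ab: "a < b"
begin

text \<open>Half a period of the lowest frequency fits the side, so all cosines have zero derivative
  at both ends: they are the Neumann eigenfunctions.\<close>

definition \<omega> :: real where "\<omega> = pi / (b - a)"

definition trig1 :: "bool => nat => real => real" where
 "trig1 s k t = (if s then sin (real k * (\<omega> * (t - a))) else cos (real k * (\<omega> * (t - a))))"

text \<open>\<open>I\<close> marks the coordinates with a sine. Differentiation in direction
  \<open>i\<close> only toggles \<open>i\<close>, so one family contains the cosine sums and all
  their derivatives.\<close>

definition trig :: "'n set => ('n => nat) => real^'n::finite => real" where
 "trig I m x = (\<Prod>i\<in>UNIV. trig1 (i : I) (m i) (x $ i))"

definition Q :: "(real^'n::finite) set" where
 "Q = {x. ALL i. a <= x $ i & x $ i <= b}"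

definition flip :: "'n => 'n set => 'n set" where
 "flip i I = (if i : I then I - {i} else insert i I)"

definition fsign :: "'n => 'n set => real" where
 "fsign i I = (if i : I then 1 else -1)"

lemma \<omega>_pos: "0 < \<omega>" using ab by (simp add: \<omega>_def)

lemma Q_cbox: "(Q :: (real^'n::finite) set) = cbox (\<chi> i. a) (\<chi> i. b)"
 by (auto simp: Q_def mem_box_cart)

lemma compact_Q: "compact (Q :: (real^'n::finite) set)" by (simp add: Q_cbox)

lemma Q_borel [measurable]: "(Q :: (real^'n::finite) set) : sets borel" by (simp add: Q_cbox)

lemma trig1_deriv: "(trig1 s k has_real_derivative (if s then 1 else -1) * (real k * \<omega>) * trig1 (~ s) k t) (at t)"
proof (cases s)
 case True
 have "((%t. sin (real k * (\<omega> * (t - a)))) has_real_derivative real k * \<omega> * cos (real k * (\<omega> * (t - a)))) (at t)"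
  by (auto intro!: derivative_eq_intros)
 then show ?thesis using True by (simp add: trig1_def[abs_def])
next
 case False
 have "((%t. cos (real k * (\<omega> * (t - a)))) has_real_derivative - (real k * \<omega>) * sin (real k * (\<omega> * (t - a)))) (at t)"
  by (auto intro!: derivative_eq_intros)
 then show ?thesis using False by (simp add: trig1_def[abs_def])
qed

lemma trig1_coord_C1: "C1 (%x::real^'n::finite. trig1 s k (x $ i))"
proof -
 have d: "((%x::real^'n. trig1 s k (x $ i)) has_derivative
   (%h. ((if s then 1 else -1) * (real k * \<omega>) * trig1 (~ s) k (x $ i)) * (h $ i))) (at x)" for x
  using has_derivative_compose[OF bounded_linear_imp_has_derivative[OF bounded_linear_vec_nth[of i], of "at x"]
   trig1_deriv[of s k "x $ i", unfolded has_field_derivative_def]] by simp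
 have "partial j (%x::real^'n. trig1 s k (x $ i)) = (%x. ((if s then 1 else -1) * (real k * \<omega>) * trig1 (~ s) k (x $ i)) * (axis j 1 $ i))" for j
  by (rule ext) (rule partial_eqI[OF d])
 moreover have "cont (%x::real^'n. trig1 (~ s) k (x $ i))"
  by (cases s) (auto simp: trig1_def intro!: continuous_intros)
 moreover have "(%x::real^'n. trig1 s k (x $ i)) differentiable (at x)" for x
  by (rule differentiableI[OF d])
 ultimately show ?thesis by (auto intro!: continuous_intros)
qed

lemma trig_C1: "C1 (trig I m)"
 unfolding trig_def[abs_def] by (rule C1_prod) (rule trig1_coord_C1)

lemma partial_trig: "partial i (trig I m) x = fsign i I * (real (m i) * \<omega>) * trig (flip i I) m x"
proof (rule partial_eq_line_deriv)
 show "trig I m differentiable (at x)" using trig_C1[of I m] by simp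
 have sp: "trig J m y = trig1 (i : J) (m i) (y $ i) * (\<Prod>j\<in>UNIV-{i}. trig1 (j : J) (m j) (y $ j))" for J y
  unfolding trig_def by (subst prod.remove[of _ i]) auto
 have fl: "(\<Prod>j\<in>UNIV-{i}. trig1 (j : flip i I) (m j) (x $ j)) = (\<Prod>j\<in>UNIV-{i}. trig1 (j : I) (m j) (x $ j))"
  by (rule prod.cong) (auto simp: flip_def)
 have fi: "i : flip i I \<longleftrightarrow> i \<notin> I" by (auto simp: flip_def)
 have line: "trig I m (x + t *\<^sub>R axis i 1) = trig1 (i : I) (m i) (x $ i + t) * (\<Prod>j\<in>UNIV-{i}. trig1 (j : I) (m j) (x $ j))" for t
  unfolding sp by (auto simp: axis_def intro!: prod.cong)
 have "((%t. trig1 (i : I) (m i) (x $ i + t)) has_real_derivative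
   (if i : I then 1 else -1) * (real (m i) * \<omega>) * trig1 (i \<notin> I) (m i) (x $ i + 0)) (at 0)"
  using trig1_deriv[of "i : I" "m i" "x $ i + 0"] DERIV_shift[of "trig1 (i : I) (m i)" _ 0 "x $ i"]
  by (simp add: add.commute)
 from DERIV_cmult_right[OF this, of "\<Prod>j\<in>UNIV-{i}. trig1 (j : I) (m j) (x $ j)"]
 show "((%t. trig I m (x + t *\<^sub>R axis i 1)) has_real_derivative fsign i I * (real (m i) * \<omega>) * trig (flip i I) m x) (at 0)"
  by (simp add: line sp[of "flip i I"] fl fi fsign_def mult.assoc)
qed

definition cosint :: "int => real" where "cosint p = (if p = 0 then b - a else 0)"

lemma integral_cos: "integrable lborel (%t. indicator {a..b} t * cos (real_of_int p * (\<omega> * (t - a))))"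
 "(LBINT t. indicator {a..b} t * cos (real_of_int p * (\<omega> * (t - a)))) = cosint p"
proof -
 have i: "integrable lborel (%t. indicator {a..b} t *\<^sub>R cos (real_of_int p * (\<omega> * (t - a))))"
  by (rule borel_integrable_compact) (auto intro!: continuous_intros)
 then show "integrable lborel (%t. indicator {a..b} t * cos (real_of_int p * (\<omega> * (t - a))))" by simp
 show "(LBINT t. indicator {a..b} t * cos (real_of_int p * (\<omega> * (t - a)))) = cosint p"
 proof (cases "p = 0")
  case True
  then show ?thesis using ab by (simp add: cosint_def)
 next
  case False
  let ?F = "%t. sin (real_of_int p * (\<omega> * (t - a))) / (real_of_int p * \<omega>)"
  have "(LBINT t. cos (real_of_int p * (\<omega> * (t - a))) * indicator {a..b} t) = ?F b - ?F a"
  proof (rule integral_FTC_Icc_real)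
   show "(?F has_real_derivative cos (real_of_int p * (\<omega> * (t - a)))) (at t)" for t
    using False \<omega>_pos by (auto intro!: derivative_eq_intros)
  qed (use ab in \<open>auto intro!: continuous_intros\<close>)
  moreover have "real_of_int p * (\<omega> * (b - a)) = real_of_int p * pi" using ab by (simp add: \<omega>_def)
  moreover have "sin (real_of_int p * pi) = 0" using sin_integer_2pi sin_zero_iff_int2 by auto
  ultimately show ?thesis using False by (simp add: cosint_def mult.commute)
 qed
qed

lemma integral_trig1:
 "integrable lborel (%t. indicator {a..b} t * (trig1 s k t * trig1 s k' t))"
 "(LBINT t. indicator {a..b} t * (trig1 s k t * trig1 s k' t)) =
   (cosint (int k - int k') + (if s then -1 else 1) * cosint (int k + int k')) / 2"
proof -
 have e: "indicator {a..b} t * (trig1 s k t * trig1 s k' t) =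
  (1/2) * (indicator {a..b} t * cos (real_of_int (int k - int k') * (\<omega> * (t - a)))) +
  (if s then -1/2 else 1/2) * (indicator {a..b} t * cos (real_of_int (int k + int k') * (\<omega> * (t - a))))" for t
 proof -
  define u where "u = \<omega> * (t - a)"
  have cd: "cos (real_of_int (int k - int k') * u) = cos (real k * u) * cos (real k' * u) + sin (real k * u) * sin (real k' * u)"
   by (simp add: left_diff_distrib cos_diff)
  have cs: "cos (real_of_int (int k + int k') * u) = cos (real k * u) * cos (real k' * u) - sin (real k * u) * sin (real k' * u)"
   by (simp add: distrib_right cos_add)
  show ?thesis unfolding trig1_def u_def[symmetric] cd cs by (simp add: field_simps)
 qed
 show "integrable lborel (%t. indicator {a..b} t * (trig1 s k t * trig1 s k' t))"
  unfolding e by (intro Bochner_Integration.integrable_add integrable_mult_right integral_cos(1))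
 show "(LBINT t. indicator {a..b} t * (trig1 s k t * trig1 s k' t)) =
   (cosint (int k - int k') + (if s then -1 else 1) * cosint (int k + int k')) / 2"
  unfolding e using integral_cos[of "int k - int k'"] integral_cos[of "int k + int k'"]
  by (subst Bochner_Integration.integral_add) (auto intro!: integrable_mult_right)
qed

text \<open>The squared norm of \<open>trig I m\<close>. A nonzero frequency gives the factor
  \<open>(b - a) / 2\<close>; frequency zero gives \<open>b - a\<close> for a cosine and 0 for a
  sine, so sines are never larger.\<close>

definition gam :: "'n set => ('n::finite => nat) => real" where
 "gam I m = (\<Prod>i\<in>UNIV. (b - a + (if i : I then -1 else 1) * cosint (2 * int (m i))) / 2)"

lemma gam_nonneg: "0 <= gam I m" and gam_le: "gam I m <= gam {} m"
 using ab unfolding gam_def by (auto intro!: prod_nonneg prod_mono simp: cosint_def)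

lemma trig_orthogonal:
 fixes m m' :: "'n::finite => nat"
 shows "(LBINT x:Q. trig I m x * trig I m' x) = (if m = m' then gam I m else 0)"
proof -
 let ?f = "%i t. indicator {a..b} t * (trig1 (i : I) (m i) t * trig1 (i : I) (m' i) t)"
 have ind: "indicator Q x = (\<Prod>i\<in>UNIV. indicator {a..b} (x $ i) :: real)" for x :: "real^'n"
 proof (cases "x : Q")
  case True
  then show ?thesis by (simp add: Q_def)
 next
  case False
  then obtain i where "x $ i \<notin> {a..b}" by (auto simp: Q_def)
  then have "indicator {a..b} (x $ i) = (0::real)" by simp
  then have "(\<Prod>i\<in>UNIV. indicator {a..b} (x $ i) :: real) = 0" by (intro prod_zero bexI[of _ i]) simp_all
  then show ?thesis using False by simp
 qed
 have "(LBINT x:Q. trig I m x * trig I m' x) = (LBINT x. (\<Prod>i\<in>UNIV. ?f i (x $ i)))"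
  by (simp add: set_lebesgue_integral_def ind trig_def prod.distrib)
 also have "... = (\<Prod>i\<in>UNIV. LBINT t. ?f i t)"
  by (rule integral_lborel_vec_prod) (rule integral_trig1)
 also have "... = (\<Prod>i\<in>UNIV. (cosint (int (m i) - int (m' i)) + (if i : I then -1 else 1) * cosint (int (m i) + int (m' i))) / 2)"
  by (simp only: integral_trig1(2))
 also have "... = (if m = m' then gam I m else 0)"
 proof (cases "m = m'")
  case True
  show ?thesis unfolding True[symmetric] gam_def by (simp add: cosint_def)
 next
  case False
  then obtain i where "m i ~= m' i" by auto
  then have "cosint (int (m i) - int (m' i)) = 0" "cosint (int (m i) + int (m' i)) = 0" by (auto simp: cosint_def)
  then have "(\<Prod>i\<in>UNIV. (cosint (int (m i) - int (m' i)) + (if i : I then -1 else 1) * cosint (int (m i) + int (m' i))) / 2) = 0"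
   by (intro prod_zero bexI[of _ i]) simp_all
  then show ?thesis using False by simp
 qed
 finally show ?thesis .
qed

definition tsum :: "'n set => ('n => nat) set => (('n => nat) => real) => real^'n::finite => real" where
 "tsum I E d x = (SUM m:E. d m * trig I m x)"

lemma tsum_C1: "C1 (tsum I E d)"
 unfolding tsum_def[abs_def] by (intro C1_sum C1_mult C1_const trig_C1)

lemma partial_tsum: "partial i (tsum I E d) = tsum (flip i I) E (%m. fsign i I * (real (m i) * \<omega>) * d m)"
proof
 fix x
 have t: "trig I m differentiable (at x)" for m using trig_C1[of I m] by simp
 have "(%x. d m * trig I m x) differentiable (at x)" for m using t by simp
 then show "partial i (tsum I E d) x = tsum (flip i I) E (%m. fsign i I * (real (m i) * \<omega>) * d m) x"
  unfolding tsum_def[abs_def] by (simp add: partial_sum partial_cmult[OF t] partial_trig mult_ac)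
qed

lemma tsum_norm:
 fixes E :: "('n::finite => nat) set"
 assumes "finite E"
 shows "(LBINT x:Q. (tsum I E d x)^2) = (SUM m:E. (d m)^2 * gam I m)"
proof -
 have tc: "cont (trig I m)" for m :: "'n => nat" using C1_cont[OF trig_C1] .
 have int: "set_integrable lborel Q (%x. (d m * d m') * (trig I m x * trig I m' x))" for m m'
  by (rule cont_set_integrable[OF _ compact_imp_bounded[OF compact_Q] Q_borel]) (intro continuous_intros tc)
 have "(LBINT x:Q. (tsum I E d x)^2) = (LBINT x:Q. SUM m:E. SUM m':E. (d m * d m') * (trig I m x * trig I m' x))"
  by (simp add: tsum_def power2_eq_square sum_product mult_ac)
 also have "... = (SUM m:E. SUM m':E. LBINT x:Q. (d m * d m') * (trig I m x * trig I m' x))"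
  by (simp only: set_integral_sum[OF set_integrable_sum[OF int]] set_integral_sum[OF int])
 also have "... = (SUM m:E. SUM m':E. (d m * d m') * (if m = m' then gam I m else 0))"
  by (simp add: trig_orthogonal)
 also have "... = (SUM m:E. (d m)^2 * gam I m)"
  using assms by (simp add: if_distrib power2_eq_square cong: if_cong)
 finally show ?thesis .
qed

text \<open>Parseval's identity: an estimate of the coefficients is an estimate of the norms, also
  between a sum with sines and a pure cosine sum.\<close>

lemma tsum_norm_mono:
 fixes E :: "('n::finite => nat) set"
 assumes "finite E" "!!m. m : E ==> (d m)^2 <= r * (d' m)^2"
 shows "(LBINT x:Q. (tsum I E d x)^2) <= r * (LBINT x:Q. (tsum {} E d' x)^2)"
proof -
 have "(SUM m:E. (d m)^2 * gam I m) <= (SUM m:E. r * (d' m)^2 * gam {} m)"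
  by (intro sum_mono mult_mono assms(2) gam_le gam_nonneg order_trans[OF zero_le_power2 assms(2)])
 then show ?thesis by (simp add: tsum_norm[OF assms(1)] sum_distrib_left mult.assoc)
qed

text \<open>Termwise solution of Poisson's equation with Neumann conditions; by orthogonality the Hessian is
 bounded by the Laplacian.\<close>

lemma poisson_tsum:
 fixes E :: "('n::finite => nat) set"
 assumes E: "finite E"
 shows "EX p c0. (ALL j. C1 (p j)) &
  (ALL x. tsum {} E d x = c0 + (SUM j:UNIV. partial j (p j) x)) &
  (ALL j. (LBINT x:Q. (p j x)^2) <= (1 / \<omega>^2) * (LBINT x:Q. (tsum {} E d x)^2)) &
  (ALL i j. (LBINT x:Q. (partial i (p j) x)^2) <= (LBINT x:Q. (tsum {} E d x)^2))"
proof -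
 define nn where "nn m = (SUM i:UNIV. (real (m i))^2)" for m :: "'n => nat"
 have nn0: "nn m = 0 \<longleftrightarrow> m = (%_. 0)" for m unfolding nn_def by (subst sum_nonneg_eq_0_iff) auto
 have nnle: "(real (m i))^2 <= nn m" for m i unfolding nn_def by (rule member_le_sum) auto
 have nnpos: "0 <= nn m" for m unfolding nn_def by (simp add: sum_nonneg)
 have nn1: "1 <= nn m" if "m ~= (%_. 0)" for m
 proof -
  obtain i where "m i ~= 0" using \<open>m ~= (%_. 0)\<close> by auto
  then have "1 <= (real (m i))^2" by simp
  then show ?thesis using nnle[of m i] by linarith
 qed
 \<comment> \<open>\<open>p j\<close> is the partial derivative of the potential with coefficients
   \<open>- d m / (\<omega>\<^sup>2 * nn m)\<close>. At frequency zero the division yields 0, and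
   the mean goes into \<open>c0\<close>.\<close>
 define e where "e j m = d m * real (m j) / (\<omega> * nn m)" for j m
 define p where "p j = tsum {j} E (e j)" for j
 define c0 where "c0 = (if (%_. 0) : E then d (%_. 0) else 0)"
 have pp: "partial i (p j) = tsum (flip i {j}) E (%m. fsign i {j} * (real (m i) * \<omega>) * e j m)" for i j
  unfolding p_def by (rule partial_tsum)
 have fj: "flip j {j} = {}" "fsign j {j} = 1" for j :: 'n by (auto simp: flip_def fsign_def)
 have ml: "(real (m i) * real (m j))^2 <= (nn m)^2" for m i j
  using mult_mono[OF nnle[of m i] nnle[of m j] nnpos zero_le_power2]
  by (simp add: power_mult_distrib power2_eq_square[of "nn m"])
 show ?thesis
 proof (intro exI[of _ p] exI[of _ c0] conjI allI)
  show "C1 (p j)" for j unfolding p_def by (rule tsum_C1)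
  show "tsum {} E d x = c0 + (SUM j:UNIV. partial j (p j) x)" for x
  proof -
   have "(SUM j:UNIV. partial j (p j) x) = (SUM m:E. SUM j:UNIV. (real (m j) * \<omega>) * e j m * trig {} m x)"
    unfolding pp fj tsum_def by (subst sum.swap) simp
   also have "... = (SUM m:E. (if m = (%_. 0) then 0 else d m * trig {} m x))"
   proof (rule sum.cong[OF refl])
    fix m assume "m : E"
    have "(SUM j:UNIV. (real (m j) * \<omega>) * e j m * trig {} m x) = (SUM j:UNIV. (real (m j))^2) * (d m / nn m * trig {} m x)"
     unfolding e_def sum_distrib_right using \<omega>_pos by (intro sum.cong) (auto simp: power2_eq_square)
    then show "(SUM j:UNIV. (real (m j) * \<omega>) * e j m * trig {} m x) = (if m = (%_. 0) then 0 else d m * trig {} m x)"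
     using nn0[of m] by (simp add: nn_def[symmetric])
   qed
   finally have s: "(SUM j:UNIV. partial j (p j) x) = (SUM m:E. (if m = (%_. 0) then 0 else d m * trig {} m x))" .
   have t0: "trig {} (%_. 0) x = 1" by (simp add: trig_def trig1_def)
   have "tsum {} E d x = (SUM m:E. (if m = (%_. 0) then d m * trig {} m x else 0) + (if m = (%_. 0) then 0 else d m * trig {} m x))"
    unfolding tsum_def by (rule sum.cong) auto
   also have "... = c0 + (SUM j:UNIV. partial j (p j) x)"
    using E by (simp add: sum.distrib s c0_def t0)
   finally show ?thesis .
  qed
  show "(LBINT x:Q. (p j x)^2) <= (1 / \<omega>^2) * (LBINT x:Q. (tsum {} E d x)^2)" for j
   unfolding p_def
  proof (rule tsum_norm_mono[OF E])
   fix m assume "m : E"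
   show "(e j m)^2 <= 1 / \<omega>^2 * (d m)^2"
   proof (cases "m = (%_. 0)")
    case False
    have "(real (m j))^2 <= nn m * 1" using nnle by simp
    also have "... <= nn m * nn m" using nn1[OF False] by (intro mult_left_mono) auto
    finally have "(real (m j))^2 / (nn m)^2 <= 1" using nn1[OF False] by (simp add: power2_eq_square)
    then have "(d m)^2 / \<omega>^2 * ((real (m j))^2 / (nn m)^2) <= (d m)^2 / \<omega>^2 * 1" by (intro mult_left_mono) auto
    then show ?thesis by (simp add: e_def power_divide power_mult_distrib)
   qed (simp add: e_def)
  qed
  show "(LBINT x:Q. (partial i (p j) x)^2) <= (LBINT x:Q. (tsum {} E d x)^2)" for i j
  proof -
   have "(LBINT x:Q. (partial i (p j) x)^2) <= 1 * (LBINT x:Q. (tsum {} E d x)^2)"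
    unfolding pp
   proof (rule tsum_norm_mono[OF E])
    fix m assume "m : E"
    have "(fsign i {j} * (real (m i) * \<omega>) * e j m)^2 = (d m)^2 * ((real (m i) * real (m j))^2 / (nn m)^2)"
     using \<omega>_pos by (simp add: e_def fsign_def power_divide power_mult_distrib)
    also have "... <= (d m)^2 * 1"
     using ml[of m i j] by (intro mult_left_mono) (auto simp: divide_le_eq)
    finally show "(fsign i {j} * (real (m i) * \<omega>) * e j m)^2 <= 1 * (d m)^2" by simp
   qed
   then show ?thesis by simp
  qed
 qed
qed

text \<open>Generated by single modes and sums, so that the closure properties for the
  Stone-Weierstrass theorem are inductions; \<open>cosines_tsum\<close> recovers the normal
  form.\<close>

inductive_set cosines :: "(real^'n::finite => real) set" where
 base: "(%x. c * trig {} m x) : cosines"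
| add: "f : cosines ==> h : cosines ==> (%x. f x + h x) : cosines"

lemma cosines_tsum: "f : cosines ==> EX E d. finite E & f = tsum {} E d"
proof (induction rule: cosines.induct)
 case (base c m)
 show ?case by (rule exI[of _ "{m}"], rule exI[of _ "%_. c"]) (simp add: tsum_def[abs_def])
next
 case (add f h)
 then obtain E d E' d' where e: "finite E" "f = tsum {} E d" "finite E'" "h = tsum {} E' d'" by blast
 let ?d = "%m. (if m : E then d m else 0) + (if m : E' then d' m else 0)"
 have "f x + h x = tsum {} (E \<union> E') ?d x" for x
 proof -
  have "tsum {} (E \<union> E') ?d x = (SUM m:E \<union> E'. if m : E then d m * trig {} m x else 0) + (SUM m:E \<union> E'. if m : E' then d' m * trig {} m x else 0)"
   unfolding tsum_def sum.distrib[symmetric] by (rule sum.cong) (auto simp: distrib_right)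
  also have "(SUM m:E \<union> E'. if m : E then d m * trig {} m x else 0) = f x"
   using e(1,3) by (simp add: sum.inter_restrict[symmetric] e(2) tsum_def Int_absorb1 Int_commute)
  also have "(SUM m:E \<union> E'. if m : E' then d' m * trig {} m x else 0) = h x"
   using e(1,3) by (simp add: sum.inter_restrict[symmetric] e(4) tsum_def Int_absorb1 Int_commute)
  finally show ?thesis by simp
 qed
 then show ?case using e by (intro exI[of _ "E \<union> E'"] exI[of _ ?d]) auto
qed

lemma cosines_sum: "(!!i. i : I ==> f i : cosines) ==> (%x. SUM i:I. f i x) : cosines"
proof (induction I rule: infinite_finite_induct)
 case (insert i I)
 then show ?case by (simp add: cosines.add)
qed (use cosines.base[of 0 "%_. 0"] in simp_all)

text \<open>The product-to-sum formula in each coordinate; multiplying out gives one summand for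
  each set of coordinates in which the sum of the frequencies is chosen.\<close>

lemma trig_mult:
 fixes m m' :: "'n::finite => nat"
 shows "(%x. trig {} m x * trig {} m' x) : cosines"
proof -
 let ?c = "%k t. cos (real k * (\<omega> * (t - a)))"
 define dif where "dif i = (if m' i <= m i then m i - m' i else m' i - m i)" for i
 have pr: "?c (m i) t * ?c (m' i) t = (1/2) * ?c (m i + m' i) t + (1/2) * ?c (dif i) t" for i t
 proof -
  have "?c (dif i) t = cos (real (m i) * (\<omega> * (t - a)) - real (m' i) * (\<omega> * (t - a)))"
  proof (cases "m' i <= m i")
   case True
   then show ?thesis by (simp add: dif_def of_nat_diff left_diff_distrib)
  next
   case False
   then have "cos (real (m i) * (\<omega> * (t - a)) - real (m' i) * (\<omega> * (t - a))) = cos (- (real (dif i) * (\<omega> * (t - a))))"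
    by (simp add: dif_def of_nat_diff left_diff_distrib)
   then show ?thesis by simp
  qed
  then show ?thesis by (simp add: cos_diff cos_add distrib_right add_divide_distrib diff_divide_distrib)
 qed
 have "trig {} m x * trig {} m' x = (SUM X:Pow UNIV. (1/2) ^ CARD('n) * trig {} (%i. if i : X then m i + m' i else dif i) x)" for x
 proof -
  have "trig {} m x * trig {} m' x = (\<Prod>i\<in>UNIV. (1/2) * ?c (m i + m' i) (x $ i) + (1/2) * ?c (dif i) (x $ i))"
   by (simp only: trig_def trig1_def empty_iff if_False prod.distrib[symmetric] pr)
  also have "... = (SUM X:Pow UNIV. (\<Prod>i\<in>X. (1/2) * ?c (m i + m' i) (x $ i)) * (\<Prod>i\<in>UNIV - X. (1/2) * ?c (dif i) (x $ i)))"
   by (rule prod_add) simp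
  also have "... = (SUM X:Pow UNIV. (1/2) ^ CARD('n) * trig {} (%i. if i : X then m i + m' i else dif i) x)"
  proof (rule sum.cong[OF refl])
   fix X :: "'n set"
   let ?h = "%i. (1/2) * ?c (if i : X then m i + m' i else dif i) (x $ i)"
   have "(\<Prod>i\<in>X. (1/2) * ?c (m i + m' i) (x $ i)) * (\<Prod>i\<in>UNIV - X. (1/2) * ?c (dif i) (x $ i)) = (\<Prod>i\<in>X. ?h i) * (\<Prod>i\<in>UNIV - X. ?h i)"
    by simp
   also have "... = (\<Prod>i\<in>UNIV. ?h i)"
    using prod.subset_diff[of X UNIV ?h] by (simp add: mult.commute)
   also have "... = (1/2) ^ CARD('n) * trig {} (%i. if i : X then m i + m' i else dif i) x"
    by (simp only: trig_def trig1_def empty_iff if_False prod.distrib prod_constant)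
   finally show "(\<Prod>i\<in>X. (1/2) * ?c (m i + m' i) (x $ i)) * (\<Prod>i\<in>UNIV - X. (1/2) * ?c (dif i) (x $ i))
    = (1/2) ^ CARD('n) * trig {} (%i. if i : X then m i + m' i else dif i) x" .
  qed
  finally show ?thesis .
 qed
 then show ?thesis by (simp add: cosines_sum cosines.base)
qed

lemma cosines_mult: "f : cosines ==> h : cosines ==> (%x. f x * h x) : cosines"
proof (induction rule: cosines.induct)
 case (base c m)
 from base show ?case
 proof (induction rule: cosines.induct)
  case (base c' m')
  obtain E d where e: "finite E" "(%x. trig {} m x * trig {} m' x) = tsum {} E d"
   using cosines_tsum[OF trig_mult] by blast
  have "c * trig {} m x * (c' * trig {} m' x) = (SUM k:E. (c * c' * d k) * trig {} k x)" for x
   using fun_cong[OF e(2), of x] by (simp add: tsum_def sum_distrib_left mult_ac)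
  then show ?case by (simp add: cosines_sum cosines.base)
 next
  case (add f h)
  then show ?case by (simp add: distrib_left cosines.add)
 qed
next
 case (add f1 f2)
 then show ?case by (simp add: distrib_right cosines.add)
qed

text \<open>Stone-Weierstrass. Points are separated by a single cosine of lowest frequency, whose
  argument stays in the interval from 0 to \<pi>, where cosine is injective.\<close>

lemma cosines_dense:
 fixes h :: "real^'n::finite => real"
 assumes "continuous_on Q h" "0 < e"
 shows "EX f:cosines. ALL x:Q. \<bar>h x - f x\<bar> < e"
proof -
 interpret function_ring_on "cosines :: (real^'n => real) set" Q
 proof
  show "compact (Q :: (real^'n) set)" by (rule compact_Q)
  show "continuous_on Q f" if "f : cosines" for f :: "real^'n => real"
  proof -
   obtain E d where "f = tsum {} E d" using cosines_tsum[OF \<open>f : cosines\<close>] by blast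
   then show ?thesis using C1_cont[OF tsum_C1] by simp
  qed
  show "(%x. f x + k x) : cosines" if "f : cosines" "k : cosines" for f k :: "real^'n => real"
   using that by (rule cosines.add)
  show "(%x. f x * k x) : cosines" if "f : cosines" "k : cosines" for f k :: "real^'n => real"
   using that by (rule cosines_mult)
  show "(%_. c) : cosines" for c
   using cosines.base[of c "%_. 0"] by (simp add: trig_def trig1_def)
  show "EX f:cosines. f x ~= f y" if xy: "x : Q" "y : Q" "x ~= y" for x y :: "real^'n"
  proof -
   obtain i where i: "x $ i ~= y $ i" using xy(3) by (auto simp: vec_eq_iff)
   define m :: "'n => nat" where "m j = (if j = i then 1 else 0)" for j
   have tr: "trig {} m z = cos (\<omega> * (z $ i - a))" for z
    unfolding trig_def by (subst prod.remove[of _ i]) (auto simp: m_def trig1_def)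
   have rng: "0 <= \<omega> * (z $ i - a) & \<omega> * (z $ i - a) <= pi" if "z : Q" for z :: "real^'n"
   proof -
    have "a <= z $ i" "z $ i <= b" using \<open>z : Q\<close> by (auto simp: Q_def)
    then have "\<omega> * (z $ i - a) <= \<omega> * (b - a)" using \<omega>_pos by (intro mult_left_mono) auto
    also have "\<omega> * (b - a) = pi" using ab by (simp add: \<omega>_def)
    finally show ?thesis using \<open>a <= z $ i\<close> \<omega>_pos by simp
   qed
   have "cos (\<omega> * (x $ i - a)) ~= cos (\<omega> * (y $ i - a))"
   proof
    assume "cos (\<omega> * (x $ i - a)) = cos (\<omega> * (y $ i - a))"
    then have "\<omega> * (x $ i - a) = \<omega> * (y $ i - a)" using rng[OF xy(1)] rng[OF xy(2)] cos_inj_pi by blast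
    then show False using i \<omega>_pos by simp
   qed
   then show ?thesis using cosines.base[of 1 m] tr by (intro bexI[of _ "%x. 1 * trig {} m x"]) auto
  qed
 qed
 show ?thesis using Stone_Weierstrass_basic[OF assms] by simp
qed

text \<open>Continuous functions converging almost everywhere are truncated at \<open>B\<close>;
  this does not disturb the limit and provides the dominating constant.\<close>

lemma continuous_L2_dense:
 fixes f :: "real^'n::finite => real"
 assumes f [measurable]: "f : borel_measurable borel" and B: "!!x. \<bar>f x\<bar> <= B" and e: "0 < e"
 shows "EX h. cont h & (ALL x. \<bar>h x\<bar> <= B) & (LBINT x:Q. (f x - h x)^2) < e"
proof -
 have B0: "0 <= B" using B[of 0] by linarith
 have "f : borel_measurable lebesgue" using f by (simp add: measurable_completion)
 then have "f measurable_on UNIV"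
  using lebesgue_measurable_imp_measurable_on[of f UNIV] by (simp add: lebesgue_on_UNIV_eq)
 then obtain N g where N: "negligible N" and g: "!!n. cont (g n)"
  and lim: "!!x. x \<notin> N ==> (%n. g n x) \<longlonglongrightarrow> f x"
  unfolding measurable_on_def by auto
 define h where "h n x = max (- B) (min B (g n x))" for n x
 have hc: "cont (h n)" for n unfolding h_def[abs_def] by (intro continuous_intros g)
 have [measurable]: "h n : borel_measurable borel" for n using hc by (rule borel_measurable_continuous_onI)
 have hB: "\<bar>h n x\<bar> <= B" for n x using B0 by (auto simp: h_def)
 have hlim: "(%n. h n x) \<longlonglongrightarrow> f x" if "x \<notin> N" for x
 proof -
  have "(%n. max (- B) (min B (g n x))) \<longlonglongrightarrow> max (- B) (min B (f x))"
   by (intro tendsto_intros lim that)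
  moreover have "max (- B) (min B (f x)) = f x" using B[of x] by auto
  ultimately show ?thesis by (simp add: h_def)
 qed
 have intc: "integrable lborel (%x::real^'n. indicator Q x * (2 * B)^2)"
  using cont_set_integrable[of "%_::real^'n. (2 * B)^2", OF _ compact_imp_bounded[OF compact_Q] Q_borel]
  by (simp add: set_integrable_def)
 have "(%n. \<integral>x. indicator Q x * (f x - h n x)^2 \<partial>lebesgue) \<longlonglongrightarrow> (\<integral>x. 0 \<partial>(lebesgue :: (real^'n) measure))"
 proof (rule integral_dominated_convergence)
  show "integrable lebesgue (%x::real^'n. indicator Q x * (2 * B)^2)"
   using intc integrable_completion[of "%x::real^'n. indicator Q x * (2 * B)^2" lborel] by simp
  show "AE x in lebesgue. (%n. indicator Q x * (f x - h n x)^2) \<longlonglongrightarrow> 0"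
  proof (rule AE_mp[OF AE_not_in], rule N[unfolded negligible_iff_null_sets], rule AE_I2, rule impI)
   fix x assume "x \<notin> N"
   have "(%n. indicator Q x * (f x - h n x)^2) \<longlonglongrightarrow> indicator Q x * (f x - f x)^2"
    by (intro tendsto_intros hlim \<open>x \<notin> N\<close>)
   then show "(%n. indicator Q x * (f x - h n x)^2) \<longlonglongrightarrow> 0" by simp
  qed
  show "AE x in lebesgue. norm (indicator Q x * (f x - h n x)^2) <= indicator Q x * (2 * B)^2" for n
  proof (rule AE_I2)
   fix x :: "real^'n"
   have "\<bar>f x - h n x\<bar> <= \<bar>2 * B\<bar>" using B[of x] hB[of n x] by linarith
   then have "(f x - h n x)^2 <= (2 * B)^2" by (simp only: abs_le_square_iff)
   then show "norm (indicator Q x * (f x - h n x)^2) <= indicator Q x * (2 * B)^2"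
    by (simp add: indicator_def)
  qed
  show "(%x. indicator Q x * (f x - h n x)^2) : borel_measurable lebesgue" for n
   by (rule measurable_completion) measurable
 qed simp
 then have "(%n. LBINT x:Q. (f x - h n x)^2) \<longlonglongrightarrow> 0"
  by (simp add: set_lebesgue_integral_def integral_completion)
 then have "eventually (%n. (LBINT x:Q. (f x - h n x)^2) < e) sequentially"
  using e by (rule order_tendstoD)
 then obtain n where "(LBINT x:Q. (f x - h n x)^2) < e" using eventually_happens'[OF sequentially_bot] by blast
 then show ?thesis using hc hB by blast
qed

lemma bounded_set_integrable:
 fixes f :: "real^'n::finite => real"
 assumes "f : borel_measurable borel" "!!x. x : Q ==> \<bar>f x\<bar> <= B"
 shows "set_integrable lborel Q f"
proof -
 have "set_integrable lborel Q (%_::real^'n. B)"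
  by (rule cont_set_integrable[OF _ compact_imp_bounded[OF compact_Q] Q_borel]) auto
 then show ?thesis unfolding set_integrable_def
  by (rule Bochner_Integration.integrable_bound) (use assms in \<open>auto simp: indicator_def intro!: AE_I2 order_trans[OF _ abs_ge_self]\<close>)
qed

text \<open>Only the norm of \<open>f\<close> enters the bounds. The number of modes, which depends
  on \<open>f\<close> and \<open>e\<close>, does not, because the estimates for Poisson's equation
  hold mode by mode.\<close>

theorem cosine_potential:
 fixes f :: "real^'n::finite => real"
 assumes f [measurable]: "f : borel_measurable borel" and B: "!!x. \<bar>f x\<bar> <= B" and e: "0 < e"
 shows "EX p c0. (ALL j. C1 (p j)) &
  (LBINT x:Q. (f x - (c0 + (SUM j:UNIV. partial j (p j) x)))^2) <= e &
  (ALL j. (LBINT x:Q. (p j x)^2) <= (1 / \<omega>^2) * (2 * (LBINT x:Q. (f x)^2) + 2 * e)) &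
  (ALL i j. (LBINT x:Q. (partial i (p j) x)^2) <= 2 * (LBINT x:Q. (f x)^2) + 2 * e)"
proof -
 obtain h where hc: "cont h" and hB: "!!x. \<bar>h x\<bar> <= B" and h: "(LBINT x:Q. (f x - h x)^2) < e / 4"
  using continuous_L2_dense[OF f B, of "e / 4"] e by auto
 have [measurable]: "h : borel_measurable borel" using hc by (rule borel_measurable_continuous_onI)
 define vol where "vol = measure lborel (Q :: (real^'n) set)"
 have vol: "0 <= vol" by (simp add: vol_def)
 \<comment> \<open>Chosen so that the uniform error contributes at most \<open>e / 4\<close> to the
   squared norm; adding two errors of \<open>e / 4\<close> under the square costs a factor 2 and
   gives \<open>e\<close>. The \<open>+ 1\<close> guards against division by zero.\<close>
 define r where "r = sqrt (e / (4 * (vol + 1)))"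
 have r: "0 < r" "r^2 = e / (4 * (vol + 1))" using e vol by (auto simp: r_def)
 obtain g where gc: "g : cosines" and g: "!!x. x : Q ==> \<bar>h x - g x\<bar> < r"
  using cosines_dense[OF continuous_on_subset[OF hc] r(1)] by blast
 obtain E d where E: "finite E" "g = tsum {} E d" using cosines_tsum[OF gc] by blast
 have gcont: "cont g" unfolding E(2) by (rule C1_cont[OF tsum_C1])
 have [measurable]: "g : borel_measurable borel" using gcont by (rule borel_measurable_continuous_onI)
 have iff: "set_integrable lborel Q (%x. (f x)^2)"
  by (rule bounded_set_integrable[where B = "B^2"]) (use B in \<open>auto simp: abs_le_square_iff[symmetric] order_trans[OF B]\<close>)
 have ifh: "set_integrable lborel Q (%x. (f x - h x)^2)"
 proof (rule bounded_set_integrable[where B = "(2 * B)^2"])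
  show "\<bar>(f x - h x)^2\<bar> <= (2 * B)^2" for x
  proof -
   have "\<bar>f x - h x\<bar> <= \<bar>2 * B\<bar>" using B[of x] hB[of x] by linarith
   then show ?thesis by (simp only: abs_le_square_iff abs_power2)
  qed
 qed measurable
 have ihg: "set_integrable lborel Q (%x. (h x - g x)^2)" and igg: "set_integrable lborel Q (%x. (g x)^2)"
  by (rule cont_set_integrable[OF _ compact_imp_bounded[OF compact_Q] Q_borel], intro continuous_intros hc gcont)+
 have ifg: "set_integrable lborel Q (%x. (f x - g x)^2)"
 proof -
  have "set_integrable lborel Q (%x. 2 * (f x - h x)^2 + 2 * (h x - g x)^2)"
   using ifh ihg by (intro set_integral_add set_integrable_mult_right) auto
  then show ?thesis unfolding set_integrable_def
  proof (rule Bochner_Integration.integrable_bound)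
   have "(f x - g x)^2 <= 2 * (f x - h x)^2 + 2 * (h x - g x)^2" for x
    using sum_squares_bound[of "f x - h x" "h x - g x"] by (simp add: power2_eq_square algebra_simps)
   then show "AE x in lborel. norm (indicator Q x *\<^sub>R (f x - g x)^2) <= norm (indicator Q x *\<^sub>R (2 * (f x - h x)^2 + 2 * (h x - g x)^2))"
    by (intro AE_I2) (auto simp: indicator_def)
  qed measurable
 qed
 have hg: "(LBINT x:Q. (h x - g x)^2) <= e / 4"
 proof -
  have "(LBINT x:Q. (h x - g x)^2) <= (LBINT x:(Q :: (real^'n) set). r^2)"
  proof (rule set_integral_mono[OF ihg])
   show "set_integrable lborel Q (%x::real^'n. r^2)"
    by (rule cont_set_integrable[OF _ compact_imp_bounded[OF compact_Q] Q_borel]) auto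
   show "(h x - g x)^2 <= r^2" if "x : Q" for x
    using g[OF that] r(1) by (subst abs_le_square_iff[symmetric]) simp
  qed
  also have "(LBINT x:(Q :: (real^'n) set). r^2) = r^2 * vol"
   by (simp add: set_lebesgue_integral_def vol_def)
  also have "r^2 * vol <= e / 4"
  proof -
   have "e * vol <= e * (vol + 1)" using e by simp
   then show ?thesis using vol by (simp add: r(2) field_simps)
  qed
  finally show ?thesis .
 qed
 have fg: "(LBINT x:Q. (f x - g x)^2) <= e"
 proof -
  have "(LBINT x:Q. (f x - g x)^2) <= (LBINT x:Q. 2 * (f x - h x)^2 + 2 * (h x - g x)^2)"
  proof (rule set_integral_mono[OF ifg])
   show "set_integrable lborel Q (%x. 2 * (f x - h x)^2 + 2 * (h x - g x)^2)"
    using ifh ihg by (intro set_integral_add set_integrable_mult_right) auto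
   show "(f x - g x)^2 <= 2 * (f x - h x)^2 + 2 * (h x - g x)^2" for x
    using sum_squares_bound[of "f x - h x" "h x - g x"] by (simp add: power2_eq_square algebra_simps)
  qed
  also have "... = 2 * (LBINT x:Q. (f x - h x)^2) + 2 * (LBINT x:Q. (h x - g x)^2)"
   using ifh ihg by (subst set_integral_add) auto
  finally show ?thesis using h hg by simp
 qed
 have gg: "(LBINT x:Q. (g x)^2) <= 2 * (LBINT x:Q. (f x)^2) + 2 * e"
 proof -
  have "(LBINT x:Q. (g x)^2) <= (LBINT x:Q. 2 * (f x)^2 + 2 * (f x - g x)^2)"
  proof (rule set_integral_mono[OF igg])
   show "set_integrable lborel Q (%x. 2 * (f x)^2 + 2 * (f x - g x)^2)"
    using iff ifg by (intro set_integral_add set_integrable_mult_right) auto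
   show "(g x)^2 <= 2 * (f x)^2 + 2 * (f x - g x)^2" for x
    using sum_squares_bound[of "f x" "f x - g x"] zero_le_power2[of "2 * f x - g x"] by (simp add: power2_eq_square algebra_simps)
  qed
  also have "... = 2 * (LBINT x:Q. (f x)^2) + 2 * (LBINT x:Q. (f x - g x)^2)"
   using iff ifg by (subst set_integral_add) auto
  finally show ?thesis using fg by simp
 qed
 obtain p c0 where p: "ALL j. C1 (p j)"
  "ALL x. tsum {} E d x = c0 + (SUM j:UNIV. partial j (p j) x)"
  "ALL j. (LBINT x:Q. (p j x)^2) <= (1 / \<omega>^2) * (LBINT x:Q. (tsum {} E d x)^2)"
  "ALL i j. (LBINT x:Q. (partial i (p j) x)^2) <= (LBINT x:Q. (tsum {} E d x)^2)"
  using poisson_tsum[OF E(1), of d] by (elim exE conjE) (rule that)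
 show ?thesis
 proof (intro exI[of _ p] exI[of _ c0] conjI allI)
  show "C1 (p j)" for j using p(1) by blast
  show "(LBINT x:Q. (f x - (c0 + (SUM j:UNIV. partial j (p j) x)))^2) <= e"
   using fg unfolding E(2) p(2)[rule_format, symmetric] .
  show "(LBINT x:Q. (p j x)^2) <= (1 / \<omega>^2) * (2 * (LBINT x:Q. (f x)^2) + 2 * e)" for j
   using gg unfolding E(2) by (intro order_trans[OF p(3)[rule_format]] mult_left_mono) auto
  show "(LBINT x:Q. (partial i (p j) x)^2) <= 2 * (LBINT x:Q. (f x)^2) + 2 * e" for i j
   using gg unfolding E(2) by (intro order_trans[OF p(4)[rule_format]])
 qed
qed

end

subsection \<open>Poincare and trace inequalities on simplices\<close>

lemma set_integral_Cauchy_Schwarz: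
 fixes f h :: "'a => 'b::euclidean_space"
 assumes ff: "set_integrable M S (%x. (norm (f x))^2)" and hh: "set_integrable M S (%x. (norm (h x))^2)"
  and fh: "set_integrable M S (%x. f x \<bullet> h x)"
 shows "(LINT x:S|M. f x \<bullet> h x)^2 <= (LINT x:S|M. (norm (f x))^2) * (LINT x:S|M. (norm (h x))^2)"
proof -
 define a where "a = (LINT x:S|M. (norm (f x))^2)"
 define b where "b = (LINT x:S|M. f x \<bullet> h x)"
 define c where "c = (LINT x:S|M. (norm (h x))^2)"
 have quad: "0 <= s^2 * a - 2 * s * t * b + t^2 * c" for s t
 proof -
  have i1: "set_integrable M S (%x. s^2 * (norm (f x))^2)" and i2: "set_integrable M S (%x. (- 2 * s * t) * (f x \<bullet> h x))"
   and i3: "set_integrable M S (%x. t^2 * (norm (h x))^2)"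
   by (rule set_integrable_mult_right, rule ff fh hh)+
  have "0 <= (LINT x:S|M. (norm (s *\<^sub>R f x - t *\<^sub>R h x))^2)"
   unfolding set_lebesgue_integral_def by (intro integral_nonneg_AE) auto
  also have "(%x. (norm (s *\<^sub>R f x - t *\<^sub>R h x))^2) = (%x. s^2 * (norm (f x))^2 + ((- 2 * s * t) * (f x \<bullet> h x) + t^2 * (norm (h x))^2))"
  proof (rule ext)
   fix x
   have "(norm (s *\<^sub>R f x - t *\<^sub>R h x))^2 = s * (s * (f x \<bullet> f x)) - s * (t * (f x \<bullet> h x)) - (t * (s * (f x \<bullet> h x)) - t * (t * (h x \<bullet> h x)))"
    unfolding power2_norm_eq_inner inner_diff_left inner_diff_right inner_scaleR_left inner_scaleR_right inner_commute[of "h x" "f x"]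
    by (simp add: right_diff_distrib)
   then show "(norm (s *\<^sub>R f x - t *\<^sub>R h x))^2 = s^2 * (norm (f x))^2 + ((- 2 * s * t) * (f x \<bullet> h x) + t^2 * (norm (h x))^2)"
    unfolding power2_norm_eq_inner by (simp only: power2_eq_square) (simp add: algebra_simps)
  qed
  also have "(LINT x:S|M. s^2 * (norm (f x))^2 + ((- 2 * s * t) * (f x \<bullet> h x) + t^2 * (norm (h x))^2)) = s^2 * a + ((- 2 * s * t) * b + t^2 * c)"
   unfolding set_integral_add(2)[OF i1 set_integral_add(1)[OF i2 i3]] set_integral_add(2)[OF i2 i3] set_integral_mult_right a_def b_def c_def ..
  finally show ?thesis by simp
 qed
 have c0: "0 <= c" unfolding c_def set_lebesgue_integral_def by (intro integral_nonneg_AE) auto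
 have "b^2 <= a * c"
 proof (cases "c = 0")
  case True
  have "b = 0"
  proof (rule ccontr)
   assume "b ~= 0"
   then show False using quad[of 1 "(a + 1) / (2 * b)"] True by simp
  qed
  then show ?thesis using True by simp
 next
  case False
  then have "0 < c" using c0 by simp
  have "0 <= c * (a * c - b^2)" using quad[of c b] by (simp add: power2_eq_square algebra_simps)
  then have "0 <= a * c - b^2" using \<open>0 < c\<close> by (simp add: zero_le_mult_iff)
  then show ?thesis by simp
 qed
 then show ?thesis by (simp add: a_def b_def c_def)
qed

lemma integral_square_mean:
 fixes f :: "'a => real"
 assumes "set_integrable M A f" "set_integrable M A (%x. (f x)^2)" "set_integrable M A (%x. 1::real)"
 shows "(LINT x:A|M. f x)^2 <= (LINT x:A|M. 1) * (LINT x:A|M. (f x)^2)"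
 using set_integral_Cauchy_Schwarz[of M A f "%x. 1::real"] assms by (simp add: mult.commute)

lemma line_difference_square:
 fixes g :: "real^'n::finite => real"
 assumes g: "C1 g"
 shows "(g x - g y)^2 <= (norm (x - y))^2 * (LBINT s:{0..1}. (norm (gradient g (y + s *\<^sub>R (x - y))))^2)"
proof -
 let ?u = "x - y"
 have pc: "cont (partial i g)" for i using g by simp
 have gc: "cont (gradient g)"
  unfolding gradient_def[abs_def] by (intro continuous_on_vec_lambda pc)
 have gl: "cont (%s. gradient g (y + s *\<^sub>R ?u))"
  by (rule continuous_on_compose2[OF gc]) (auto intro!: continuous_intros)
 let ?\<phi> = "%s. ?u \<bullet> gradient g (y + s *\<^sub>R ?u)"
 have cc: "cont ?\<phi>" by (intro continuous_intros gl)
 have int: "set_integrable lborel {0..1} f" if "cont f" for f :: "real => real"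
  by (rule cont_set_integrable[OF that]) auto
 have "(LBINT s. ?\<phi> s * indicator {0..1} s) = g (y + 1 *\<^sub>R ?u) - g (y + 0 *\<^sub>R ?u)"
 proof (rule integral_FTC_Icc_real)
  show "((%s. g (y + s *\<^sub>R ?u)) has_real_derivative ?\<phi> s) (at s)" for s
   using partial_line_deriv[of g y s ?u] g by (simp add: gradient_def inner_vec_def)
  show "isCont ?\<phi> s" for s using cc by (simp add: continuous_on_eq_continuous_at)
 qed simp
 then have "(g x - g y)^2 = (LBINT s:{0..1}. ?\<phi> s)^2"
  by (simp add: set_lebesgue_integral_def mult.commute)
 also have "... <= (LBINT s:{0..1::real}. 1) * (LBINT s:{0..1}. (?\<phi> s)^2)"
  by (rule integral_square_mean) (intro int continuous_intros cc)+
 also have "... = (LBINT s:{0..1}. (?\<phi> s)^2)" by (simp add: set_lebesgue_integral_def)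
 also have "... <= (LBINT s:{0..1}. (norm ?u)^2 * (norm (gradient g (y + s *\<^sub>R ?u)))^2)"
 proof (rule set_integral_mono)
  show "(?\<phi> s)^2 <= (norm ?u)^2 * (norm (gradient g (y + s *\<^sub>R ?u)))^2" for s
   using Cauchy_Schwarz_ineq[of ?u "gradient g (y + s *\<^sub>R ?u)"] by (simp add: power2_norm_eq_inner)
 qed (intro int continuous_intros cc gl)+
 also have "... = (norm ?u)^2 * (LBINT s:{0..1}. (norm (gradient g (y + s *\<^sub>R ?u)))^2)" by simp
 finally show ?thesis .
qed

lemma set_nn_integral_eq:
 fixes f :: "'a => real"
 assumes "set_integrable M A f" "!!x. x : A ==> 0 <= f x"
 shows "(\<integral>\<^sup>+x. indicator A x * ennreal (f x) \<partial>M) = ennreal (LINT x:A|M. f x)"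
proof -
 have "(\<integral>\<^sup>+x. indicator A x * ennreal (f x) \<partial>M) = (\<integral>\<^sup>+x. ennreal (indicator A x *\<^sub>R f x) \<partial>M)"
  by (intro nn_integral_cong) (auto simp: indicator_def)
 also have "... = ennreal (\<integral>x. indicator A x *\<^sub>R f x \<partial>M)"
  using assms by (intro nn_integral_eq_integral) (auto simp: set_integrable_def indicator_def)
 finally show ?thesis by (simp add: set_lebesgue_integral_def)
qed

text \<open>Used with the larger of the two weights of a convex combination, which is at least one
  half.\<close>

lemma nn_integral_affine_le:
 fixes F :: "'a::euclidean_space => ennreal"
 assumes [measurable]: "F : borel_measurable borel" and s: "1/2 <= s"
 shows "(NN x. F (t + s *\<^sub>R x)) <= ennreal (2 ^ DIM('a)) * (NN x. F x)"
proof -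
 have s0: "0 < s" using s by simp
 have "1 <= 2 ^ DIM('a) * s ^ DIM('a)"
  using one_le_power[of "2 * s" "DIM('a)"] s by (simp add: power_mult_distrib)
 then have "ennreal 1 <= ennreal (2 ^ DIM('a) * s ^ DIM('a))" by (rule ennreal_leI)
 then have "1 * (NN x. F (t + s *\<^sub>R x)) <= ennreal (2 ^ DIM('a) * s ^ DIM('a)) * (NN x. F (t + s *\<^sub>R x))"
  by (intro mult_right_mono) auto
 also have "... = ennreal (2 ^ DIM('a)) * (ennreal (s ^ DIM('a)) * (NN x. F (t + s *\<^sub>R x)))"
  using s0 by (simp add: ennreal_mult mult.assoc)
 also have "ennreal (s ^ DIM('a)) * (NN x. F (t + s *\<^sub>R x)) = (NN x. F x)"
  using nn_integral_lborel_affine[OF assms(1), of s t] s0 by simp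
 finally show ?thesis by simp
qed

text \<open>The deviation from the mean is bounded by differences \<open>g x - g y\<close>, and
  these by the gradient along the segment, which stays in \<open>T\<close> by convexity. For each
  parameter on the segment a change of variables in one of the two end points returns to the
  integral over \<open>T\<close>; this explains the factor \<open>2 ^ CARD('n)\<close>.\<close>

lemma poincare:
 fixes g :: "real^'n::finite => real" and T :: "(real^'n) set"
 assumes g: "C1 g" and T: "convex T" "compact T" and h: "!!x y. x : T ==> y : T ==> norm (x - y) <= h"
  and vol: "0 < (LBINT x:T. (1::real))"
 shows "EX c. (LBINT x:T. (g x - c)^2) <= 2 ^ CARD('n) * h^2 * (LBINT x:T. (norm (gradient g x))^2)
      & c = (LBINT x:T. g x) / (LBINT x:T. 1)"
proof -
 have [measurable]: "T : sets borel" using T(2) by (simp add: borel_compact)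
 have gcont: "cont g" using g C1_cont by blast
 have pc: "cont (partial i g)" for i using g by simp
 have gc: "cont (gradient g)"
  unfolding gradient_def[abs_def] by (intro continuous_on_vec_lambda pc)
 have [measurable]: "g : borel_measurable borel" "gradient g : borel_measurable borel"
  using gcont gc by (auto intro: borel_measurable_continuous_onI)
 have int: "set_integrable lborel T f" if "cont f" for f :: "real^'n => real"
  by (rule cont_set_integrable[OF that compact_imp_bounded[OF T(2)]]) measurable
 define V where "V = (LBINT x:T. (1::real))"
 define c where "c = (LBINT x:T. g x) / V"
 define N where "N x = (norm (gradient g x))^2" for x
 define NT where "NT x = indicator T x * ennreal (N x)" for x
 define D where "D = (LBINT x:T. N x)"
 let ?w = "%s x y. NT ((1 - s) *\<^sub>R y + s *\<^sub>R x)" and ?C = "ennreal (2 ^ CARD('n)) * ennreal D"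
 have [measurable]: "N : borel_measurable borel" unfolding N_def by measurable
 have [measurable]: "NT : borel_measurable borel" unfolding NT_def by measurable
 have D: "(NN x. NT x) = ennreal D" unfolding NT_def D_def N_def
  by (rule set_nn_integral_eq) (auto intro!: int continuous_intros gc)
 have V0: "0 < V" using vol by (simp add: V_def)
 have D0: "0 <= D" unfolding D_def N_def set_lebesgue_integral_def by (intro integral_nonneg_AE) auto
 have hh: "0 <= h"
 proof -
  have "T ~= {}" using vol by (auto simp: set_lebesgue_integral_def)
  then obtain x where "x : T" by blast
  then show ?thesis using h[of x x] by simp
 qed
 have VT: "(\<integral>\<^sup>+x. indicator T x \<partial>(lborel :: (real^'n) measure)) = ennreal V"
  using set_nn_integral_eq[of lborel T "%_. 1"] int[of "%_. 1"] by (simp add: V_def)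
 have step1: "V * (g x - c)^2 <= (LBINT y:T. (g x - g y)^2)" for x
 proof -
  have "(LBINT y:T. g x - g y) = V * (g x - c)"
  proof -
   have "(LBINT y:T. g x * 1 - g y) = g x * V - (LBINT y:T. g y)"
   proof -
    have i1: "set_integrable lborel T (%_. g x * 1)" by (rule int) (intro continuous_intros)
    show ?thesis unfolding set_integral_diff(2)[OF i1 int[OF gcont]] set_integral_mult_right V_def ..
   qed
   then show ?thesis using V0 by (simp add: c_def algebra_simps)
  qed
  then have "V * (V * (g x - c)^2) <= V * (LBINT y:T. (g x - g y)^2)"
   using integral_square_mean[of lborel T "%y. g x - g y"] int[of "%y. g x - g y"] int[of "%y. (g x - g y)^2"] int[of "%_. 1"] gcont
   by (simp add: V_def[symmetric] power_mult_distrib power2_eq_square[of V] mult.assoc continuous_intros)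
  then show ?thesis using V0 by simp
 qed
 have step2: "indicator T x * (indicator T y * ennreal ((g x - g y)^2))
   <= indicator T x * (indicator T y * (ennreal (h^2) * (NN s. indicator {0..1} s * ?w s x y)))" for x y
 proof (cases "x : T & y : T")
  case True
  have gl: "cont (%s. gradient g (y + s *\<^sub>R (x - y)))"
   by (rule continuous_on_compose2[OF gc]) (auto intro!: continuous_intros)
  let ?I = "LBINT s:{0..1}. N (y + s *\<^sub>R (x - y))"
  have I0: "0 <= ?I" unfolding N_def set_lebesgue_integral_def by (intro integral_nonneg_AE) auto
  have "(g x - g y)^2 <= (norm (x - y))^2 * ?I" using line_difference_square[OF g] by (simp add: N_def)
  also have "... <= h^2 * ?I" using h True I0 by (intro mult_right_mono power_mono) auto
  finally have "ennreal ((g x - g y)^2) <= ennreal (h^2) * ennreal ?I" using I0 by (simp add: ennreal_mult[symmetric] ennreal_leI)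
  also have "ennreal ?I = (NN s. indicator {0..1} s * ennreal (N (y + s *\<^sub>R (x - y))))"
  proof (rule set_nn_integral_eq[symmetric])
   have "cont (%s. N (y + s *\<^sub>R (x - y)))" unfolding N_def by (intro continuous_intros gl)
   then show "set_integrable lborel {0..1} (%s. N (y + s *\<^sub>R (x - y)))"
    by (rule cont_set_integrable) auto
  qed (simp add: N_def)
  also have "... = (NN s. indicator {0..1} s * ?w s x y)"
  proof (rule nn_integral_cong)
   fix s :: real
   show "indicator {0..1} s * ennreal (N (y + s *\<^sub>R (x - y))) = indicator {0..1} s * ?w s x y"
   proof (cases "s : {0..1}")
    case s: True
    have "(1 - s) *\<^sub>R y + s *\<^sub>R x : T" using True s by (intro convexD[OF T(1)]) auto
    moreover have "y + s *\<^sub>R (x - y) = (1 - s) *\<^sub>R y + s *\<^sub>R x" by (simp add: algebra_simps)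
    ultimately show ?thesis by (simp add: NT_def)
   qed simp
  qed
  finally show ?thesis using True by simp
 qed auto
 \<comment> \<open>For \<open>s\<close> at least one half the inner integral is taken over
   \<open>x\<close>, otherwise over \<open>y\<close>, so that the Jacobian never
   degenerates.\<close>
 have slice: "(NN x. NN y. indicator T x * (indicator T y * ?w s x y)) <= ennreal (2 ^ CARD('n) * V * D)"
  (is "?L <= _") if s: "s : {0..1}" for s
 proof (cases "1/2 <= s")
  case True
  have "?L = (NN y. NN x. indicator T x * (indicator T y * ?w s x y))"
   by (rule nn_integral_lborel_swap) measurable
  also have "... <= (\<integral>\<^sup>+y. indicator T y * ?C \<partial>(lborel :: (real^'n) measure))"
  proof (rule nn_integral_mono)
   fix y :: "real^'n"
   have "(NN x. indicator T x * (indicator T y * ?w s x y)) <= (NN x. indicator T y * ?w s x y)"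
    by (intro nn_integral_mono) (auto simp: indicator_def)
   also have "... = indicator T y * (NN x. ?w s x y)" by (rule nn_integral_cmult) measurable
   also have "... <= indicator T y * ?C"
    using nn_integral_affine_le[of NT s "(1 - s) *\<^sub>R y"] True by (intro mult_left_mono) (simp_all add: D)
   finally show "(NN x. indicator T x * (indicator T y * ?w s x y)) <= indicator T y * ?C" .
  qed
  also have "... = ennreal V * ?C"
   by (subst nn_integral_multc) (measurable, simp only: VT)
  also have "... = ennreal (2 ^ CARD('n) * V * D)" using V0 D0
   by (simp add: ennreal_mult[symmetric] mult_ac)
  finally show ?thesis .
 next
  case False
  then have s': "1/2 <= 1 - s" by simp
  have "?L <= (\<integral>\<^sup>+x. indicator T x * ?C \<partial>(lborel :: (real^'n) measure))"
  proof (rule nn_integral_mono)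
   fix x :: "real^'n"
   have "(NN y. indicator T x * (indicator T y * ?w s x y)) <= (NN y. indicator T x * NT (s *\<^sub>R x + (1 - s) *\<^sub>R y))"
    by (intro nn_integral_mono) (auto simp: indicator_def add.commute)
   also have "... = indicator T x * (NN y. NT (s *\<^sub>R x + (1 - s) *\<^sub>R y))" by (rule nn_integral_cmult) measurable
   also have "... <= indicator T x * ?C"
    using nn_integral_affine_le[of NT "1 - s" "s *\<^sub>R x"] s' by (intro mult_left_mono) (simp_all add: D)
   finally show "(NN y. indicator T x * (indicator T y * ?w s x y)) <= indicator T x * ?C" .
  qed
  also have "... = ennreal V * ?C"
   by (subst nn_integral_multc) (measurable, simp only: VT)
  also have "... = ennreal (2 ^ CARD('n) * V * D)" using V0 D0
   by (simp add: ennreal_mult[symmetric] mult_ac)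
  finally show ?thesis .
 qed
 let ?A = "%s x y. indicator {0..1} s * (indicator T x * (indicator T y * ?w s x y))"
 have pull: "indicator T x * (indicator T y * (ennreal (h^2) * (NN s. indicator {0..1} s * ?w s x y)))
   = ennreal (h^2) * (NN s. ?A s x y)" for x y
  by (auto simp: indicator_def)
 have "ennreal (V * (LBINT x:T. (g x - c)^2)) = (NN x. indicator T x * ennreal (V * (g x - c)^2))"
  using V0 by (subst set_nn_integral_eq) (auto intro!: int continuous_intros gcont)
 also have "... <= (NN x. indicator T x * ennreal (LBINT y:T. (g x - g y)^2))"
  by (intro nn_integral_mono mult_left_mono ennreal_leI step1) auto
 also have "... = (NN x. NN y. indicator T x * (indicator T y * ennreal ((g x - g y)^2)))"
 proof (rule nn_integral_cong)
  fix x
  have "ennreal (LBINT y:T. (g x - g y)^2) = (NN y. indicator T y * ennreal ((g x - g y)^2))"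
   by (rule set_nn_integral_eq[symmetric]) (auto intro!: int continuous_intros gcont)
  then show "indicator T x * ennreal (LBINT y:T. (g x - g y)^2) = (NN y. indicator T x * (indicator T y * ennreal ((g x - g y)^2)))"
   by (simp add: nn_integral_cmult)
 qed
 also have "... <= (NN x. NN y. ennreal (h^2) * (NN s. ?A s x y))"
  unfolding pull[symmetric] by (intro nn_integral_mono step2)
 also have "... = ennreal (h^2) * (NN x. NN y. NN s. ?A s x y)"
  by (simp add: nn_integral_cmult)
 finally have fin1: "ennreal (V * (LBINT x:T. (g x - c)^2)) <= ennreal (h^2) * (NN x. NN y. NN s. ?A s x y)" .
 have "(NN x. NN y. NN s. ?A s x y) = (NN x. NN s. NN y. ?A s x y)"
  by (rule nn_integral_cong) (rule nn_integral_lborel_swap, measurable)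
 also have "... = (NN s. NN x. NN y. ?A s x y)"
  by (rule nn_integral_lborel_swap) measurable
 also have "... = (NN s. indicator {0..1} s * (NN x. NN y. indicator T x * (indicator T y * ?w s x y)))"
  by (simp add: nn_integral_cmult)
 also have "... <= (\<integral>\<^sup>+s. indicator {0..1} s * ennreal (2 ^ CARD('n) * V * D) \<partial>(lborel :: real measure))"
 proof (rule nn_integral_mono)
  fix s :: real
  show "indicator {0..1} s * (NN x. NN y. indicator T x * (indicator T y * ?w s x y))
    <= indicator {0..1} s * ennreal (2 ^ CARD('n) * V * D)"
   using slice[of s] by (cases "s : {0..1}") simp_all
 qed
 also have "... = ennreal (2 ^ CARD('n) * V * D)" by (simp add: nn_integral_multc)
 finally have "(NN x. NN y. NN s. ?A s x y) <= ennreal (2 ^ CARD('n) * V * D)" .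
 then have "ennreal (V * (LBINT x:T. (g x - c)^2)) <= ennreal (h^2) * ennreal (2 ^ CARD('n) * V * D)"
  by (intro order_trans[OF fin1] mult_left_mono) auto
 then have "ennreal (V * (LBINT x:T. (g x - c)^2)) <= ennreal (V * (2 ^ CARD('n) * h^2 * D))"
  using V0 D0 by (simp add: ennreal_mult[symmetric] mult_ac)
 then have "V * (LBINT x:T. (g x - c)^2) <= V * (2 ^ CARD('n) * h^2 * D)"
  using V0 D0 by (subst (asm) ennreal_le_iff) auto
 then have "(LBINT x:T. (g x - c)^2) <= 2 ^ CARD('n) * h^2 * D" using V0 by simp
 then show ?thesis unfolding D_def N_def c_def V_def by blast
qed

section \<open>Traces on faces, approximation by means, and discs inside faces\<close>

context bary begin

text \<open>The field \<open>x - a\<close> has constant normal component on the face opposite to \<open>a\<close> and vanishing normal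
 component on the other faces.\<close>

lemma cone_formula:
 fixes f :: "real^'n => real"
 assumes a: "a : C" and f: "C1 f"
 shows "(LINT x:face a|surf a. f x) = (LBINT x:T. real CARD('n) * f x + (x - a) \<bullet> gradient f x)"
proof -
 have id: "C1 (%x. (x - a) $ i)" for i
  by (simp only: vector_minus_component) (intro C1_diff C1_coord C1_const)
 have V: "C1 (%x. (f x *\<^sub>R (x - a)) $ i)" for i
  unfolding vector_scaleR_component real_scaleR_def by (rule C1_mult[OF f id])
 have "divergence (%x. x - a) x = real CARD('n)" for x :: "real^'n"
  unfolding divergence_def by (simp add: partial_diff partial_coord)
 then have div: "divergence (%x. f x *\<^sub>R (x - a)) x = real CARD('n) * f x + (x - a) \<bullet> gradient f x" for x
  using divergence_scale[of f x "%x. x - a"] f by simp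
 have "(LBINT x:T. divergence (%x. f x *\<^sub>R (x - a)) x) = - (SUM b:C. LINT x:face b|surf b. g b \<bullet> (f x *\<^sub>R (x - a)))"
  by (rule divergence_theorem[OF V])
 also have "... = - (SUM b:C. if b = a then - (LINT x:face a|surf a. f x) else 0)"
 proof -
  have "(LINT x:face b|surf b. g b \<bullet> (f x *\<^sub>R (x - a))) = (if b = a then - (LINT x:face a|surf a. f x) else 0)" if b: "b : C" for b
  proof -
   have e: "indicator (face b) x *\<^sub>R (g b \<bullet> (f x *\<^sub>R (x - a))) = (if b = a then - 1 else 0) * (indicator (face b) x *\<^sub>R f x)" for x
   proof (cases "x : face b")
    case True
    then have "g b \<bullet> (x - a) = (if b = a then - 1 else 0)"
     using face_iff[OF b] delta[OF b a] by (simp add: inner_diff_right) (auto split: if_splits)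
    then show ?thesis using True by simp
   qed simp
   show ?thesis unfolding set_lebesgue_integral_def e by (cases "b = a") simp_all
  qed
  then show ?thesis by (simp cong: sum.cong)
 qed
 also have "... = (LINT x:face a|surf a. f x)" using fin a by simp
 finally show ?thesis by (simp add: div)
qed

lemma T_integrable:
 fixes f :: "real^'n => 'b::{banach, second_countable_topology}"
 assumes "cont f"
 shows "set_integrable lborel T f"
 by (rule cont_set_integrable[OF assms compact_imp_bounded[OF compact_T] T_borel])

lemma T_volume_pos: "0 < (LBINT x:T. (1::real))"
proof (rule set_integral_pos)
 show "set_integrable lborel T (%_. 1 :: real)" by (rule T_integrable) auto
 have "(SUM a:C. lam b a) = 1" if "b : C" for b using that fin by (simp add: delta)
 let ?w = "(1 / real (card C)) *\<^sub>R (SUM a:C. a)"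
 have "lam b ?w = 1 / real (card C)" if b: "b : C" for b
 proof -
  have "(SUM a:C. g b \<bullet> a) + real (card C) * \<beta> b = 1" using \<open>(!!b. b : C ==> (SUM a:C. lam b a) = 1)\<close>[OF b] by (simp add: sum.distrib)
  then show ?thesis using card_C by (simp add: inner_sum_right field_simps)
 qed
 then have "?w : interior T" unfolding interior_T using card_C by simp
 then show "interior T ~= {}" by blast
qed (auto intro: interior_subset[THEN subsetD])

text \<open>\<open>cone_formula\<close> for the square of \<open>f\<close>, with the mixed term
  split by Young's inequality. No shape constant appears, because \<open>surf\<close> is the area
  scaled by the height.\<close>

lemma trace_inequality:
 fixes f :: "real^'n => real"
 assumes a: "a : C" and f: "C1 f"
 shows "(LINT x:face a|surf a. (f x)^2) <= (real CARD('n) + 1) * (LBINT x:T. (f x)^2) + (diameter T)^2 * (LBINT x:T. (norm (gradient f x))^2)"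
proof -
 have fc: "cont f" using f C1_cont by blast
 have pc: "cont (partial i f)" for i using f by simp
 have gc: "cont (gradient f)"
  unfolding gradient_def[abs_def] by (intro continuous_on_vec_lambda pc)
 have ff: "C1 (%x. f x * f x)" by (rule C1_mult[OF f f])
 have gr: "gradient (%x. f x * f x) x = (2 * f x) *\<^sub>R gradient f x" for x
  using f by (simp add: gradient_def vec_eq_iff partial_mult)
 have "(LINT x:face a|surf a. (f x)^2) = (LBINT x:T. real CARD('n) * (f x)^2 + 2 * f x * ((x - a) \<bullet> gradient f x))"
  using cone_formula[OF a ff] by (simp add: gr power2_eq_square)
 also have "... <= (LBINT x:T. (real CARD('n) + 1) * (f x)^2 + (diameter T)^2 * (norm (gradient f x))^2)"
 proof (rule set_integral_mono)
  fix x assume x: "x : T"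
  have "a : T" using a by (rule hull_inc)
  have "\<bar>(x - a) \<bullet> gradient f x\<bar> <= norm (x - a) * norm (gradient f x)" by (rule Cauchy_Schwarz_ineq2)
  also have "... <= diameter T * norm (gradient f x)" using edge_le_diameter[OF x \<open>a : T\<close>] by (intro mult_right_mono) auto
  finally have "\<bar>(x - a) \<bullet> gradient f x\<bar>^2 <= (diameter T * norm (gradient f x))^2" by (rule power_mono) simp
  then have "((x - a) \<bullet> gradient f x)^2 <= (diameter T)^2 * (norm (gradient f x))^2" by (simp add: power_mult_distrib)
  moreover have "2 * f x * ((x - a) \<bullet> gradient f x) <= (f x)^2 + ((x - a) \<bullet> gradient f x)^2" by (rule sum_squares_bound)
  ultimately show "real CARD('n) * (f x)^2 + 2 * f x * ((x - a) \<bullet> gradient f x) <= (real CARD('n) + 1) * (f x)^2 + (diameter T)^2 * (norm (gradient f x))^2"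
   by (simp add: distrib_right)
 qed (intro T_integrable continuous_intros fc gc)+
 also have "... = (real CARD('n) + 1) * (LBINT x:T. (f x)^2) + (diameter T)^2 * (LBINT x:T. (norm (gradient f x))^2)"
  by (subst set_integral_add) (auto intro!: T_integrable continuous_intros fc gc)
 finally show ?thesis .
qed

lemma constant_approximation:
 fixes f :: "real^'n => real"
 assumes f: "C1 f"
 defines "c \<equiv> (LBINT x:T. f x) / (LBINT x:T. 1)"
 defines "D \<equiv> (LBINT x:T. (norm (gradient f x))^2)"
 shows "(LBINT x:T. (f x - c)^2) <= 2 ^ CARD('n) * (diameter T)^2 * D"
  and "a : C ==> (LINT x:face a|surf a. (f x - c)^2) <= ((real CARD('n) + 1) * 2 ^ CARD('n) + 1) * (diameter T)^2 * D"
proof -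
 show 1: "(LBINT x:T. (f x - c)^2) <= 2 ^ CARD('n) * (diameter T)^2 * D"
  using poincare[OF f convex_convex_hull compact_T edge_le_diameter T_volume_pos] unfolding c_def D_def by simp
 assume a: "a : C"
 have fc: "C1 (%x. f x - c)" by (rule C1_diff[OF f C1_const])
 have gr: "gradient (%x. f x - c) x = gradient f x" for x
  using f by (simp add: gradient_def partial_diff)
 have "(LINT x:face a|surf a. (f x - c)^2) <= (real CARD('n) + 1) * (LBINT x:T. (f x - c)^2) + (diameter T)^2 * D"
  using trace_inequality[OF a fc] by (simp add: gr D_def)
 also have "... <= (real CARD('n) + 1) * (2 ^ CARD('n) * (diameter T)^2 * D) + (diameter T)^2 * D"
  by (intro add_right_mono mult_left_mono 1) auto
 finally show "(LINT x:face a|surf a. (f x - c)^2) <= ((real CARD('n) + 1) * 2 ^ CARD('n) + 1) * (diameter T)^2 * D"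
  by (simp add: algebra_simps)
qed

lemma slab_integral_scale:
 fixes f :: "real^'n => real"
 assumes a: "a : C" and [measurable]: "f : borel_measurable borel" and s: "0 < s"
 shows "(LBINT x. indicator {- s..s} (lam a x) * f (x - lam a x *\<^sub>R (g a /\<^sub>R (g a \<bullet> g a)))) = 2 * s * (\<integral>x. f x \<partial>surf a)"
  and "integrable (surf a) f ==> integrable lborel (%x. indicator {- s..s} (lam a x) * f (x - lam a x *\<^sub>R (g a /\<^sub>R (g a \<bullet> g a))))"
proof -
 let ?w = "g a /\<^sub>R (g a \<bullet> g a)"
 have eq: "slab_measure (g a) (\<beta> a) ?w {- s..s} = density (surf a) (%_. ennreal (2 * s))"
 proof (rule measure_eqI)
  fix A assume "A : sets (slab_measure (g a) (\<beta> a) ?w {- s..s})"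
  then have "A : sets (surf a)" by simp
  then have "emeasure (density (surf a) (%_. ennreal (2 * s))) A = ennreal (2 * s) * emeasure (surf a) A"
   by (simp add: emeasure_density nn_integral_cmult)
  then show "emeasure (slab_measure (g a) (\<beta> a) ?w {- s..s}) A = emeasure (density (surf a) (%_. ennreal (2 * s))) A"
   using slab_measure_scale[of "{- s..s}" "{0..<1}" "g a" ?w "\<beta> a" A] g_u[OF a] s by (simp add: surf_def)
 qed simp
 have "(LBINT x. indicator {- s..s} (lam a x) * f (x - lam a x *\<^sub>R ?w)) = (\<integral>x. f x \<partial>slab_measure (g a) (\<beta> a) ?w {- s..s})"
  by (rule integral_slab_measure[symmetric]) measurable
 also have "... = 2 * s * (\<integral>x. f x \<partial>surf a)" unfolding eq using s by (subst integral_density) auto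
 finally show "(LBINT x. indicator {- s..s} (lam a x) * f (x - lam a x *\<^sub>R ?w)) = 2 * s * (\<integral>x. f x \<partial>surf a)" .
 assume "integrable (surf a) f"
 then have "integrable (slab_measure (g a) (\<beta> a) ?w {- s..s}) f" unfolding eq using s by (subst integrable_density) auto
 then show "integrable lborel (%x. indicator {- s..s} (lam a x) * f (x - lam a x *\<^sub>R ?w))"
  by (subst (asm) integrable_slab_measure) auto
qed

text \<open>The homothety with centre \<open>a\<close> that maps the section of the simplex through the centre of the
 inball onto the face opposite to \<open>a\<close> is expanding; hence the face contains a disc of the same radius.\<close>

lemma face_contains_disc:
 assumes a: "a : C" and r: "0 < r" "cball z r \<subseteq> T"
 obtains y where "y : face a" "!!w. g a \<bullet> w = 0 ==> norm w <= r ==> y + w : face a"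
proof -
 obtain b where b: "b : C" "b ~= a" using exists_other[OF a] by blast
 define L where "L = lam a z"
 have zT: "z : T" using r by auto
 have "0 < r * norm (g b)" using r(1) g_nonzero[OF b(1)] by simp
 then have lb: "0 < lam b z" using norm_g_le(1)[OF b(1) r] by linarith
 have "lam a z + lam b z <= (SUM c:C. lam c z)"
 proof -
  have "(SUM c:{a, b}. lam c z) <= (SUM c:C. lam c z)"
   by (rule sum_mono2) (use fin a b zT T_iff in auto)
  then show ?thesis using b(2) by simp
 qed
 then have L1: "L < 1" using sum1[of z] lb by (simp add: L_def)
 have L0: "0 <= L" using zT T_iff a by (simp add: L_def)
 define y where "y = a + (1 / (1 - L)) *\<^sub>R (z - a)"
 have "y + w : face a" if w: "g a \<bullet> w = 0" "norm w <= r" for w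
 proof -
  \<comment> \<open>The preimage of \<open>y + w\<close> under the homothety. It lies in the inball
    because the homothety expands by \<open>1 / (1 - L)\<close>.\<close>
  define p where "p = z + (1 - L) *\<^sub>R w"
  have "norm ((1 - L) *\<^sub>R w) <= 1 * r"
   using L0 L1 w(2) by (simp only: norm_scaleR) (intro mult_mono, auto)
  then have "p : cball z r" by (simp add: p_def dist_norm)
  then have pT: "p : T" using r(2) by blast
  have yw: "y + w = a + (1 / (1 - L)) *\<^sub>R (p - a)"
   using L1 by (simp add: y_def p_def scaleR_add_right scaleR_diff_right)
  have l: "lam c (y + w) = lam c a + (1 / (1 - L)) * (lam c p - lam c a)" for c
   unfolding yw by (simp add: inner_add_right inner_diff_right algebra_simps)
  have lp: "lam a p = L" using w(1) by (simp add: p_def L_def inner_add_right)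
  have l1: "lam a a = 1" using delta[OF a a] by simp
  have "(1 / (1 - L)) * (L - 1) = - 1" using L1 by (simp add: field_simps)
  then have la: "lam a (y + w) = 0" using l[of a] unfolding lp l1 by simp
  have "0 <= lam c (y + w)" if c: "c : C" for c
  proof (cases "c = a")
   case False
   then have "lam c (y + w) = (1 / (1 - L)) * lam c p" using l[of c] delta[OF c a] by simp
   then show ?thesis using pT T_iff c L1 by simp
  qed (use la in simp)
  then show ?thesis using la face_iff[OF a] T_iff by blast
 qed
 moreover from this[of 0] have "y : face a" using r by simp
 ultimately show ?thesis using that by blast
qed

text \<open>The ball around the centre of the disc lies in the slab of half-thickness
  \<open>r\<close> over the face, and \<open>q\<close> does not change along the normal. This brings
  polynomials on a face within reach of bounds by solid balls.\<close>

lemma face_ball_integral: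
 fixes q :: "real^'n => real"
 assumes a: "a : C" and r: "0 < r" "cball z r \<subseteq> T" and q: "cont q" and inv: "!!x t. q (x + t *\<^sub>R g a) = q x"
 obtains y where "y : face a" "(LBINT x:ball y r. (q x)^2) <= 2 * r * norm (g a) * (LINT x:face a|surf a. (q x)^2)"
proof -
 obtain y where y: "y : face a" and disc: "!!w. g a \<bullet> w = 0 ==> norm w <= r ==> y + w : face a"
  by (rule face_contains_disc[OF a r]) blast
 let ?w = "g a /\<^sub>R (g a \<bullet> g a)"
 let ?f = "%x. indicator (face a) x * (q x)^2"
 have [measurable]: "q : borel_measurable borel" using q by (rule borel_measurable_continuous_onI)
 have ng: "0 < norm (g a)" using g_nonzero[OF a] by simp
 define s where "s = r * norm (g a)"
 have s: "0 < s" using r ng by (simp add: s_def)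
 have qp: "q (x - lam a x *\<^sub>R ?w) = q x" for x
  using inv[of x "- (lam a x / (g a \<bullet> g a))"] by (simp add: divide_inverse)
 have ly: "lam a y = 0" using y face_iff[OF a] by simp
 have sub: "lam a x : {- s..s} & x - lam a x *\<^sub>R ?w : face a" if "x : ball y r" for x
 proof -
  have n: "norm (x - y) <= r" using that by (simp add: dist_norm norm_minus_commute)
  have lx: "lam a x = g a \<bullet> (x - y)" using ly by (simp add: inner_diff_right)
  have "\<bar>lam a x\<bar> <= norm (g a) * norm (x - y)" unfolding lx by (rule Cauchy_Schwarz_ineq2)
  also have "... <= norm (g a) * r" by (intro mult_left_mono n) simp
  also have "... = s" by (simp add: s_def)
  finally have 1: "lam a x : {- s..s}" by auto
  let ?v = "(x - y) - lam a x *\<^sub>R ?w"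
  have gg: "g a \<bullet> g a ~= 0" using ng by simp
  have gv: "g a \<bullet> ?v = 0"
   by (simp only: inner_diff_right inner_scaleR_right[of _ "lam a x" ?w] g_u[OF a] lx) (use gg in simp)
  have "(norm (x - y))^2 = (norm ?v)^2 + (norm (lam a x *\<^sub>R ?w))^2"
  proof -
   have "?v \<bullet> (lam a x *\<^sub>R ?w) = 0" using gv by (simp add: inner_commute)
   then have "orthogonal ?v (lam a x *\<^sub>R ?w)" by (simp add: orthogonal_def)
   then have "(norm (?v + lam a x *\<^sub>R ?w))^2 = (norm ?v)^2 + (norm (lam a x *\<^sub>R ?w))^2" by (rule norm_add_Pythagorean)
   then show ?thesis by simp
  qed
  then have "(norm ?v)^2 <= (norm (x - y))^2" by simp
  then have "norm ?v <= norm (x - y)" by (rule power2_le_imp_le) simp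
  then have "y + ?v : face a" using disc[OF gv] n by simp
  then show ?thesis using 1 by (simp add: algebra_simps)
 qed
 have cs: "cont (%x. (q x)^2)" by (intro continuous_intros q)
 have fi: "integrable (surf a) ?f" using surf_integrable[OF cs, of a] by (simp add: set_integrable_def)
 have "(LBINT x:ball y r. (q x)^2) <= (LBINT x. indicator {- s..s} (lam a x) * ?f (x - lam a x *\<^sub>R ?w))"
  unfolding set_lebesgue_integral_def
 proof (rule integral_mono)
  show "integrable lborel (%x. indicator (ball y r) x *\<^sub>R (q x)^2)"
   using cont_set_integrable[OF cs, of "ball y r"] by (simp add: set_integrable_def)
  show "integrable lborel (%x. indicator {- s..s} (lam a x) * ?f (x - lam a x *\<^sub>R ?w))"
   by (rule slab_integral_scale(2)[OF a _ s fi]) measurable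
  show "indicator (ball y r) x *\<^sub>R (q x)^2 <= indicator {- s..s} (lam a x) * ?f (x - lam a x *\<^sub>R ?w)" for x
  proof (cases "x : ball y r")
   case True
   then show ?thesis using sub[OF True] by (simp only: qp) simp
  qed (simp add: indicator_def)
 qed
 also have "... = 2 * s * (\<integral>x. ?f x \<partial>surf a)"
  by (rule slab_integral_scale(1)[OF a _ s]) measurable
 finally have "(LBINT x:ball y r. (q x)^2) <= 2 * r * norm (g a) * (LINT x:face a|surf a. (q x)^2)"
  by (simp add: s_def set_lebesgue_integral_def)
 then show ?thesis using that y by blast
qed

end

subsection \<open>Rank-one matrices\<close>

definition outer :: "real^'n => real^'n => real^'n^'n::finite" where
 "outer u w = (\<chi> i j. u $ i * w $ j)"

lemma outer_mv: "outer u w *v x = (w \<bullet> x) *\<^sub>R u"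
 by (simp add: outer_def matrix_vector_mult_def vec_eq_iff inner_vec_def sum_distrib_left mult_ac)

lemma outer_inner: "outer u w \<bullet> M = u \<bullet> (M *v w)"
 by (simp add: outer_def inner_vec_def matrix_vector_mult_def sum_distrib_left mult_ac)

lemma trace_outer: "trace (outer u w) = u \<bullet> w"
 by (simp add: outer_def trace_def inner_vec_def)

lemma norm_outer: "norm (outer u w) = norm u * norm w"
proof -
 have "(norm (outer u w))^2 = (norm u * norm w)^2"
  by (simp add: power2_norm_eq_inner outer_inner outer_mv power_mult_distrib mult.commute)
 then show ?thesis by (rule power2_eq_imp_eq) auto
qed

lemma trace_scaleR: "trace (c *\<^sub>R A) = c * trace A"
 by (simp add: trace_def sum_distrib_left)

lemma trace_sum: "trace (SUM a:S. A a) = (SUM a:S. trace (A a))"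
 by (simp add: trace_def) (rule sum.swap)

lemma matrix_vector_sum_left: "(SUM a:S. A a) *v x = (SUM a:S. A a *v x)"
 by (induction S rule: infinite_finite_induct) (auto simp: matrix_vector_mult_add_rdistrib)

lemma matrix_vector_scaleR_left: "(c *\<^sub>R A) *v x = c *\<^sub>R (A *v (x :: real^'n::finite))"
 by (simp add: matrix_vector_mult_def vec_eq_iff sum_distrib_left mult.assoc)

lemma norm_matrix_square: "(norm (A :: real^'n^'n::finite))^2 = (SUM i:UNIV. SUM j:UNIV. (A $ i $ j)^2)"
 unfolding power2_norm_eq_inner inner_vec_def inner_real_def power2_eq_square[symmetric] ..

lemma continuous_on_vecI:
 fixes f :: "'a::topological_space => 'b::topological_space^'n"
 assumes "!!i. continuous_on S (%x. f x $ i)"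
 shows "continuous_on S f"
 using continuous_on_vec_lambda[of S "%i x. f x $ i"] assms by simp

lemma poly_matrix_continuous:
 fixes A :: "real^'n::finite => real^'n^'n"
 assumes "!!i j. (%x. A x $ i $ j) : poly_space m"
 shows "continuous_on S A"
 by (intro continuous_on_vecI ps_continuous[OF assms])

subsection \<open>Traceless matrices and the faces of a simplex\<close>

context bary begin

lemma dual_repr: "(SUM a:C. ((a - i) \<bullet> w) *\<^sub>R g a) = w"
proof -
 have "(SUM a:C. ((a - i) \<bullet> w) *\<^sub>R g a) \<bullet> y = w \<bullet> y" for y
 proof -
  have "(SUM a:C. ((a - i) \<bullet> w) *\<^sub>R g a) \<bullet> y = (SUM a:C. (g a \<bullet> y) *\<^sub>R (a - i)) \<bullet> w"
   unfolding inner_sum_left inner_scaleR_left by (rule sum.cong) (rule refl, rule mult.commute)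
  also have "(SUM a:C. (g a \<bullet> y) *\<^sub>R (a - i)) = y" by (rule vec_repr)
  finally show ?thesis by (simp only: inner_commute)
 qed
 then show ?thesis by (metis vector_eq_rdot)
qed

text \<open>The edges from \<open>i\<close> and the gradients of the other vertices are dual bases,
  and the trace may be computed in any such pair.\<close>

lemma trace_repr: "trace M = (SUM a:C. g a \<bullet> (M *v (a - i)))"
proof -
 have "trace M = (SUM e:UNIV. (M *v axis e 1) $ e)"
  by (simp add: trace_def matrix_vector_mult_basis column_def)
 also have "... = (SUM e:UNIV. SUM a:C. g a $ e * (M *v (a - i)) $ e)"
 proof (rule sum.cong[OF refl])
  fix e
  have "M *v axis e 1 = (SUM a:C. (g a $ e) *\<^sub>R (M *v (a - i)))"
   by (subst vec_repr[of "axis e 1" i, symmetric]) (simp add: inner_axis matrix_vector_mult_scaleR linear_sum[OF matrix_vector_mul_linear])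
  then show "(M *v axis e 1) $ e = (SUM a:C. g a $ e * (M *v (a - i)) $ e)" by simp
 qed
 also have "... = (SUM a:C. g a \<bullet> (M *v (a - i)))"
  by (subst sum.swap) (simp add: inner_vec_def)
 finally show ?thesis .
qed

lemma parallel_to_normal:
 assumes a: "a : C" and i: "i : C" "i ~= a" and w: "!!l m. l : C - {a} ==> m : C - {a} ==> (l - m) \<bullet> w = 0"
 shows "w = ((a - i) \<bullet> w) *\<^sub>R g a"
proof -
 have "w = (SUM b:C. ((b - i) \<bullet> w) *\<^sub>R g b)" by (rule dual_repr[symmetric])
 also have "... = (SUM b:C. if b = a then ((a - i) \<bullet> w) *\<^sub>R g a else 0)"
  using w i by (intro sum.cong) auto
 finally show ?thesis using fin a by simp
qed

lemma edge_normal: "a : C ==> l : C ==> m : C ==> (l - m) \<bullet> g a = (if a = l then 1 else 0) - (if a = m then 1 else 0)"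
 using g_edge[of a l m] by (simp add: inner_commute)

text \<open>A matrix without tangential-normal components on any face has all \<open>g a\<close> as eigenvectors; as they
 add up to zero, the eigenvalues coincide.\<close>

lemma traceless_unique:
 assumes tr: "trace D = 0" and D: "!!a l m. a : C ==> l : C - {a} ==> m : C - {a} ==> (l - m) \<bullet> (D *v g a) = 0"
 shows "D = 0"
proof -
 have "EX k. D *v g a = k *\<^sub>R g a" if a: "a : C" for a
 proof -
  obtain i where i: "i : C" "i ~= a" using exists_other[OF a] by blast
  show ?thesis using parallel_to_normal[OF a i D[OF a]] by blast
 qed
 then obtain k where k: "!!a. a : C ==> D *v g a = k a *\<^sub>R g a" by metis
 have "(SUM a:C. k a *\<^sub>R g a) = D *v (SUM a:C. g a)"
  using k by (simp add: linear_sum[OF matrix_vector_mul_linear])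
 then have ks: "(SUM a:C. k a *\<^sub>R g a) = 0" using sum_g by simp
 obtain i where i: "i : C" using card_C by fastforce
 have eqk: "k l = k i" if l: "l : C" for l
 proof -
  have "0 = (l - i) \<bullet> (SUM a:C. k a *\<^sub>R g a)" using ks by simp
  also have "... = (SUM a:C. k a * ((if a = l then 1 else 0) - (if a = i then 1 else 0)))"
   by (simp add: inner_sum_right edge_normal l i)
  also have "... = (SUM a:C. if a = l then k l else 0) - (SUM a:C. if a = i then k i else 0)"
   unfolding sum_subtractf[symmetric] by (rule sum.cong) auto
  also have "... = k l - k i" using fin l i by simp
  finally show ?thesis by simp
 qed
 have "D *v w = k i *\<^sub>R w" for w
 proof -
  have "D *v w = D *v (SUM a:C. ((a - i) \<bullet> w) *\<^sub>R g a)" by (simp add: dual_repr)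
  also have "... = (SUM a:C. ((a - i) \<bullet> w) *\<^sub>R (k i *\<^sub>R g a))"
   using k eqk by (simp add: linear_sum[OF matrix_vector_mul_linear] matrix_vector_mult_scaleR)
  also have "... = k i *\<^sub>R (SUM a:C. ((a - i) \<bullet> w) *\<^sub>R g a)" by (simp add: scaleR_sum_right mult.commute)
  finally show ?thesis by (simp add: dual_repr)
 qed
 then have "D = k i *\<^sub>R mat 1" by (simp add: matrix_eq matrix_vector_scaleR_left)
 moreover from this have "k i = 0" using tr by (simp add: trace_scaleR trace_I)
 ultimately show ?thesis by simp
qed

definition cen :: "real^'n => real^'n" where "cen a = (1 / real CARD('n)) *\<^sub>R (SUM j:C - {a}. j)"

text \<open>For \<open>m ~= a\<close> the matrix \<open>outer (g j) (j - a)\<close> sends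
  \<open>g m\<close> to \<open>g m\<close> or to 0, hence has no tangential part on the other faces,
  and it sends \<open>g a\<close> to \<open>- g j\<close>. Each has trace one; measuring
  \<open>j\<close> from the centre \<open>cen a\<close> makes the coefficients add up to zero.
  \<kappa> is the factor that turns \<open>g a\<close> into the unit normal.\<close>

definition face_lift :: "real^'n => real => real^'n => real^'n^'n" where
 "face_lift a \<kappa> q = (SUM j:C - {a}. (- (1 / \<kappa>) * ((j - cen a) \<bullet> q)) *\<^sub>R outer (g j) (j - a))"

lemma card_C': "a : C ==> card (C - {a}) = CARD('n)"
 using card_C fin by simp

lemma face_lift_trace: "a : C ==> trace (face_lift a \<kappa> q) = 0"
proof -
 assume a: "a : C"
 have "trace (face_lift a \<kappa> q) = (SUM j:C - {a}. - (1 / \<kappa>) * ((j - cen a) \<bullet> q))"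
  unfolding face_lift_def trace_sum trace_scaleR trace_outer
 proof (rule sum.cong[OF refl])
  fix j assume "j : C - {a}"
  then have "g j \<bullet> (j - a) = 1" using edge_normal[of j j a] a by (simp add: inner_commute)
  then show "- (1 / \<kappa>) * ((j - cen a) \<bullet> q) * (g j \<bullet> (j - a)) = - (1 / \<kappa>) * ((j - cen a) \<bullet> q)" by simp
 qed
 also have "... = - (1 / \<kappa>) * ((SUM j:C - {a}. j - cen a) \<bullet> q)"
  by (simp only: sum_distrib_left inner_sum_left)
 also have "(SUM j:C - {a}. j - cen a) = 0"
  using card_C'[OF a] by (simp add: sum_subtractf cen_def sum_constant_scaleR del: sum_constant)
 finally show ?thesis by simp
qed

lemma face_lift_other:
 assumes "a : C" "m : C" "m ~= a"
 shows "face_lift a \<kappa> q *v g m = (- (1 / \<kappa>) * ((m - cen a) \<bullet> q)) *\<^sub>R g m"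
proof -
 have "face_lift a \<kappa> q *v g m = (SUM j:C - {a}. if j = m then (- (1 / \<kappa>) * ((m - cen a) \<bullet> q)) *\<^sub>R g m else 0)"
  unfolding face_lift_def matrix_vector_sum_left matrix_vector_scaleR_left outer_mv
 proof (rule sum.cong[OF refl])
  fix j assume "j : C - {a}"
  then have "(j - a) \<bullet> g m = (if j = m then 1 else 0)" using edge_normal[of m j a] assms by auto
  then show "(- (1 / \<kappa>) * ((j - cen a) \<bullet> q)) *\<^sub>R ((j - a) \<bullet> g m) *\<^sub>R g j
    = (if j = m then (- (1 / \<kappa>) * ((m - cen a) \<bullet> q)) *\<^sub>R g m else 0)" by simp
 qed
 then show ?thesis using fin assms by simp
qed

lemma face_lift_own:
 assumes a: "a : C" and l: "l : C - {a}" and m: "m : C - {a}" and k: "\<kappa> ~= 0"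
 shows "(l - m) \<bullet> (face_lift a \<kappa> q *v (\<kappa> *\<^sub>R g a)) = (l - m) \<bullet> q"
proof -
 define \<mu> where "\<mu> j = - (1 / \<kappa>) * ((j - cen a) \<bullet> q)" for j
 have "face_lift a \<kappa> q *v g a = (SUM j:C - {a}. (- \<mu> j) *\<^sub>R g j)"
  unfolding face_lift_def matrix_vector_sum_left matrix_vector_scaleR_left outer_mv \<mu>_def[symmetric]
 proof (rule sum.cong[OF refl])
  fix j assume "j : C - {a}"
  then have "(j - a) \<bullet> g a = - 1" using edge_normal[of a j a] a by auto
  then show "\<mu> j *\<^sub>R ((j - a) \<bullet> g a) *\<^sub>R g j = (- \<mu> j) *\<^sub>R g j" by simp
 qed
 then have "(l - m) \<bullet> (face_lift a \<kappa> q *v g a) = (SUM j:C - {a}. - \<mu> j * ((l - m) \<bullet> g j))"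
  by (simp only: inner_sum_right inner_scaleR_right)
 also have "... = (SUM j:C - {a}. if j = m then \<mu> m else 0) - (SUM j:C - {a}. if j = l then \<mu> l else 0)"
  unfolding sum_subtractf[symmetric] using l m by (intro sum.cong) (auto simp: edge_normal)
 also have "... = \<mu> m - \<mu> l" using fin l m by simp
 also have "... = (1 / \<kappa>) * ((l - m) \<bullet> q)" by (simp add: \<mu>_def inner_diff_left algebra_simps)
 finally show ?thesis using k by (simp add: matrix_vector_mult_scaleR)
qed

lemma face_lift_diff: "face_lift a \<kappa> p - face_lift a \<kappa> q = face_lift a \<kappa> (p - q)"
 unfolding face_lift_def sum_subtractf[symmetric] scaleR_diff_left[symmetric]
 by (rule sum.cong) (simp_all add: inner_diff_right algebra_simps)

text \<open>The difference has no tangential-normal component on any face, so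
  \<open>traceless_unique\<close> applies. Since constants are reproduced, the error of the lifting
  is bounded by the error of the face data alone.\<close>

lemma face_lift_reconstruct:
 assumes tr: "trace M = 0" and k: "!!a. a : C ==> \<kappa> a ~= 0"
 shows "(SUM a:C. face_lift a (\<kappa> a) (\<kappa> a *\<^sub>R (M *v g a))) = M"
proof -
 let ?q = "%a. \<kappa> a *\<^sub>R (M *v g a)"
 let ?D = "M - (SUM a:C. face_lift a (\<kappa> a) (?q a))"
 have "trace ?D = 0" using tr face_lift_trace by (simp add: trace_sub trace_sum)
 moreover have "(l - m) \<bullet> (?D *v g a) = 0" if a: "a : C" and l: "l : C - {a}" and m: "m : C - {a}" for a l m
 proof -
  have own: "(l - m) \<bullet> (face_lift a (\<kappa> a) (?q a) *v g a) = (l - m) \<bullet> (M *v g a)"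
   using face_lift_own[OF a l m k[OF a], of "?q a"] k[OF a] by (simp add: matrix_vector_mult_scaleR)
  have oth: "(l - m) \<bullet> (face_lift b (\<kappa> b) (?q b) *v g a) = 0" if b: "b : C - {a}" for b
   using face_lift_other[of b a "\<kappa> b" "?q b"] a b l m by (auto simp: edge_normal)
  have "(l - m) \<bullet> (?D *v g a) = (l - m) \<bullet> (M *v g a) - (SUM b:C. (l - m) \<bullet> (face_lift b (\<kappa> b) (?q b) *v g a))"
   by (simp add: matrix_vector_mult_diff_rdistrib matrix_vector_sum_left inner_diff_right inner_sum_right)
  also have "(SUM b:C. (l - m) \<bullet> (face_lift b (\<kappa> b) (?q b) *v g a)) = (l - m) \<bullet> (face_lift a (\<kappa> a) (?q a) *v g a)"
   using oth by (subst sum.remove[OF fin a]) simp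
  finally show ?thesis using own by simp
 qed
 ultimately have "?D = 0" by (rule traceless_unique)
 then show ?thesis by simp
qed

text \<open>The matrices \<open>Smat i j m\<close> have no tangential-normal components on any face but the one opposite to \<open>i\<close>,
 where the factor \<open>lam i\<close> of the bubble vanishes.\<close>

definition Smat :: "real^'n => real^'n => real^'n => real^'n^'n" where
 "Smat i j m = outer (g j) (j - i) - outer (g m) (m - i)"

definition triples :: "((real^'n) \<times> (real^'n) \<times> (real^'n)) set" where
 "triples = {(i, j, m). i : C & j : C - {i} & m : C - {i}}"

lemma finite_triples: "finite triples"
 by (rule finite_subset[of _ "C \<times> C \<times> C"]) (auto simp: triples_def fin)

lemma card_triples: "card triples <= (CARD('n) + 1) ^ 3"
proof -
 have "card triples <= card (C \<times> C \<times> C)" by (rule card_mono) (auto simp: triples_def fin)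
 then show ?thesis by (simp add: card_cartesian_product card_C power3_eq_cube mult.assoc del: add_mult_distrib add_mult_distrib2 mult_Suc mult_Suc_right)
qed

text \<open>The weights \<open>Smat i j m \<bullet> \<rho> x\<close> make the pairing with \<rho> a
  sum of squares with nonnegative factors, and the factor \<open>lam i\<close> raises the degree by
  just one.\<close>

definition bubble :: "(real^'n => real^'n^'n) => real^'n => real^'n^'n" where
 "bubble \<rho> x = (\<Sum>(i, j, m)\<in>triples. (lam i x * (Smat i j m \<bullet> \<rho> x)) *\<^sub>R Smat i j m)"

lemma Smat_trace: "(i, j, m) : triples ==> trace (Smat i j m) = 0"
 using g_edge by (auto simp: triples_def Smat_def trace_sub trace_outer)

lemma bubble_trace: "trace (bubble \<rho> x) = 0"
 unfolding bubble_def trace_sum by (rule sum.neutral) (auto simp: trace_scaleR Smat_trace)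

lemma bubble_face:
 assumes a: "a : C" and x: "x : face a" and l: "l : C - {a}" and m': "m' : C - {a}"
 shows "(l - m') \<bullet> (bubble \<rho> x *v g a) = 0"
proof -
 have "(l - m') \<bullet> (((lam i x * (Smat i j m \<bullet> \<rho> x)) *\<^sub>R Smat i j m) *v g a) = 0" if t: "(i, j, m) : triples" for i j m
 proof (cases "i = a")
  case True
  then show ?thesis using x face_iff[OF a] by simp
 next
  case False
  have ijm: "i : C" "j : C" "m : C" using t by (auto simp: triples_def)
  have "(l - m') \<bullet> (Smat i j m *v g a) = ((j - i) \<bullet> g a) * ((l - m') \<bullet> g j) - ((m - i) \<bullet> g a) * ((l - m') \<bullet> g m)"
   by (simp add: Smat_def matrix_vector_mult_diff_rdistrib outer_mv inner_diff_right)
  also have "... = 0" using False ijm a l m' by (auto simp: edge_normal)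
  finally show ?thesis by (simp add: matrix_vector_scaleR_left)
 qed
 then show ?thesis unfolding bubble_def
  unfolding matrix_vector_sum_left inner_sum_right by (intro sum.neutral) auto
qed

lemma bubble_inner: "bubble \<rho> x \<bullet> \<rho> x = (\<Sum>(i, j, m)\<in>triples. lam i x * (Smat i j m \<bullet> \<rho> x)^2)"
 unfolding bubble_def inner_sum_left by (rule sum.cong) (auto simp: power2_eq_square)

lemma matrix_repr: "M = (SUM j:C. SUM m:C. (g j \<bullet> (M *v (m - i))) *\<^sub>R outer (j - i) (g m))"
proof -
 have "(SUM j:C. SUM m:C. (g j \<bullet> (M *v (m - i))) *\<^sub>R outer (j - i) (g m)) *v x = M *v x" for x
 proof -
  have "(SUM m:C. (g m \<bullet> x) *\<^sub>R (M *v (m - i))) = M *v (SUM m:C. (g m \<bullet> x) *\<^sub>R (m - i))"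
   by (simp add: linear_sum[OF matrix_vector_mul_linear] matrix_vector_mult_scaleR)
  then have s: "(SUM m:C. (g m \<bullet> x) * (g j \<bullet> (M *v (m - i)))) = g j \<bullet> (M *v x)" for j
   by (simp add: vec_repr) (metis (mono_tags, lifting) inner_scaleR_right inner_sum_right sum.cong)
  have "(SUM j:C. SUM m:C. (g j \<bullet> (M *v (m - i))) *\<^sub>R outer (j - i) (g m)) *v x
    = (SUM j:C. (SUM m:C. (g m \<bullet> x) * (g j \<bullet> (M *v (m - i)))) *\<^sub>R (j - i))"
   by (simp add: matrix_vector_sum_left matrix_vector_scaleR_left outer_mv scaleR_sum_left mult.commute)
  also have "... = (SUM j:C. (g j \<bullet> (M *v x)) *\<^sub>R (j - i))" by (simp only: s)
  finally show ?thesis by (simp add: vec_repr)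
 qed
 then show ?thesis by (simp add: matrix_eq)
qed

end

section \<open>Bounds that depend only on the ratio of diameter and inradius\<close>

locale shape_bary = bary C g \<beta> for C :: "(real^'n::finite) set" and g \<beta> +
 fixes z :: "real^'n" and r K :: real
 assumes r: "0 < r" and ball_T: "cball z r \<subseteq> T" and diam: "diameter T <= K * r"
begin

lemma K_pos: "0 < K"
 using diameter_pos diam r by (metis less_le_trans zero_less_mult_pos2)

lemma norm_g: "a : C ==> norm (g a) <= 1 / r"
 by (rule norm_g_le(2)[OF _ r ball_T])

lemma norm_edge: "a : T ==> b : T ==> norm (a - b) <= K * r"
 using edge_le_diameter diam by (meson order_trans)

lemma norm_edge_C: "a : C ==> b : C ==> norm (a - b) <= K * r"
 by (intro norm_edge hull_inc)

lemma norm_outer_edge: "j : C ==> a : C ==> b : C ==> norm (outer (g j) (a - b)) <= K"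
proof -
 assume h: "j : C" "a : C" "b : C"
 have "norm (outer (g j) (a - b)) <= (1 / r) * (K * r)"
  unfolding norm_outer using norm_g[OF h(1)] norm_edge_C[OF h(2,3)] r by (intro mult_mono) auto
 then show ?thesis using r by simp
qed

lemma norm_Smat: "(i, j, m) : triples ==> norm (Smat i j m) <= 2 * K"
proof -
 assume "(i, j, m) : triples"
 then have h: "i : C" "j : C" "m : C" by (auto simp: triples_def)
 have "norm (Smat i j m) <= norm (outer (g j) (j - i)) + norm (outer (g m) (m - i))"
  unfolding Smat_def by (rule norm_triangle_ineq4)
 also have "... <= K + K" by (intro add_mono norm_outer_edge h)
 finally show ?thesis by simp
qed

text \<open>Gradients are at most \<open>1 / r\<close> and edges at most \<open>K * r\<close>, so
  the products in the lifting are free of scale.\<close>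

lemma face_lift_norm:
 assumes a: "a : C" and k: "\<bar>\<kappa>\<bar> * norm (g a) = 1"
 shows "norm (face_lift a \<kappa> q) <= real CARD('n) * K^2 * norm q"
proof -
 have cen: "norm (j - cen a) <= K * r" if j: "j : C - {a}" for j
 proof -
  have "j - cen a = (1 / real CARD('n)) *\<^sub>R (SUM m:C - {a}. j - m)"
   using card_C'[OF a] by (simp add: cen_def sum_subtractf scaleR_diff_right sum_constant_scaleR del: sum_constant)
  also have "norm ... <= (1 / real CARD('n)) * (SUM m:C - {a}. K * r)"
   using j by (simp only: norm_scaleR) (intro mult_mono sum_norm_le norm_edge_C; simp add: sum_nonneg)
  also have "... = K * r" using card_C'[OF a] by simp
  finally show ?thesis .
 qed
 have k0: "\<bar>1 / \<kappa>\<bar> = norm (g a)" 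
 proof -
  have "\<bar>\<kappa>\<bar> ~= 0" using k by auto
  then have "1 / \<bar>\<kappa>\<bar> = norm (g a)" using k by (simp add: divide_eq_eq mult.commute)
  then show ?thesis by (simp only: abs_divide abs_1)
 qed
 have "norm (face_lift a \<kappa> q) <= (SUM j:C - {a}. K^2 * norm q)"
  unfolding face_lift_def
 proof (rule sum_norm_le)
  fix j assume j: "j : C - {a}"
  have "\<bar>(j - cen a) \<bullet> q\<bar> <= norm (j - cen a) * norm q" by (rule Cauchy_Schwarz_ineq2)
  also have "... <= (K * r) * norm q" by (intro mult_right_mono cen j) simp
  finally have 1: "\<bar>(j - cen a) \<bullet> q\<bar> <= (K * r) * norm q" .
  have "\<bar>- (1 / \<kappa>) * ((j - cen a) \<bullet> q)\<bar> = norm (g a) * \<bar>(j - cen a) \<bullet> q\<bar>" by (simp only: abs_mult abs_minus_cancel k0)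
  also have "... <= (1 / r) * ((K * r) * norm q)" using 1 norm_g[OF a] r by (intro mult_mono) auto
  also have "... = K * norm q" using r by simp
  finally have 2: "\<bar>- (1 / \<kappa>) * ((j - cen a) \<bullet> q)\<bar> <= K * norm q" .
  have "norm ((- (1 / \<kappa>) * ((j - cen a) \<bullet> q)) *\<^sub>R outer (g j) (j - a)) <= (K * norm q) * K"
   unfolding norm_scaleR using 2 j a K_pos by (intro mult_mono norm_outer_edge) auto
  then show "norm ((- (1 / \<kappa>) * ((j - cen a) \<bullet> q)) *\<^sub>R outer (g j) (j - a)) <= K^2 * norm q"
   by (simp add: power2_eq_square mult_ac)
 qed
 then show ?thesis using card_C'[OF a] by (simp add: mult.assoc)
qed

lemma bubble_norm:
 assumes x: "x : T"
 shows "norm (bubble \<rho> x) <= real ((CARD('n) + 1) ^ 3) * (4 * K^2) * norm (\<rho> x)"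
proof -
 have "norm (bubble \<rho> x) <= (SUM t:triples. 4 * K^2 * norm (\<rho> x))"
  unfolding bubble_def
 proof (rule sum_norm_le)
  fix t assume t: "t : triples"
  obtain i j m where ijm: "t = (i, j, m)" by (cases t)
  have i: "i : C" using t by (auto simp: triples_def ijm)
  have l: "0 <= lam i x" "lam i x <= 1"
   using x T_iff i sum1[of x] member_le_sum[of i C "%a. lam a x"] fin by auto
  have S: "norm (Smat i j m) <= 2 * K" using norm_Smat t ijm by blast
  have "\<bar>Smat i j m \<bullet> \<rho> x\<bar> <= norm (Smat i j m) * norm (\<rho> x)" by (rule Cauchy_Schwarz_ineq2)
  also have "... <= (2 * K) * norm (\<rho> x)" by (intro mult_right_mono S) simp
  finally have "\<bar>lam i x\<bar> * \<bar>Smat i j m \<bullet> \<rho> x\<bar> <= 1 * ((2 * K) * norm (\<rho> x))"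
   using l by (intro mult_mono) auto
  then have "norm ((lam i x * (Smat i j m \<bullet> \<rho> x)) *\<^sub>R Smat i j m) <= ((2 * K) * norm (\<rho> x)) * (2 * K)"
   unfolding norm_scaleR abs_mult[of "lam i x"] using S K_pos by (intro mult_mono[of _ "2 * K * norm (\<rho> x)"]) auto
  then show "norm (case t of (i, j, m) => (lam i x * (Smat i j m \<bullet> \<rho> x)) *\<^sub>R Smat i j m) <= 4 * K^2 * norm (\<rho> x)"
   by (simp add: ijm power2_eq_square mult_ac)
 qed
 also have "... = real (card triples) * (4 * K^2) * norm (\<rho> x)" by simp
 also have "... <= real ((CARD('n) + 1) ^ 3) * (4 * K^2) * norm (\<rho> x)"
  using card_triples by (intro mult_right_mono of_nat_mono) auto
 finally show ?thesis .
qed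

text \<open>The pairings are the differences of the numbers \<open>X j i\<close>. For fixed
  \<open>i\<close> these add up to the trace, which is zero, so each of them is an average of
  differences; together they determine all entries of \<open>M\<close> in the dual bases.\<close>

lemma Smat_coercive:
 assumes tr: "trace M = 0"
 shows "(norm M)^2 <= (2 * K * (real CARD('n) + 1)^2)^2 * (\<Sum>(i, j, m)\<in>triples. (Smat i j m \<bullet> M)^2)"
proof -
 define e2 where "e2 = (\<Sum>(i, j, m)\<in>triples. (Smat i j m \<bullet> M)^2)"
 have e20: "0 <= e2" unfolding e2_def by (rule sum_nonneg) auto
 define e where "e = sqrt e2"
 have e0: "0 <= e" "e^2 = e2" using e20 by (auto simp: e_def)
 define X where "X j i = g j \<bullet> (M *v (j - i))" for i j
 have S: "\<bar>X j i - X m i\<bar> <= e" if "(i, j, m) : triples" for i j m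
 proof -
  have "(case (i, j, m) of (i, j, m) => (Smat i j m \<bullet> M)^2) <= e2"
   unfolding e2_def by (rule member_le_sum[OF that]) (auto simp: finite_triples)
  then have "(Smat i j m \<bullet> M)^2 <= e^2" using e0 by simp
  then have "\<bar>Smat i j m \<bullet> M\<bar> <= \<bar>e\<bar>" by (simp only: abs_le_square_iff)
  moreover have "Smat i j m \<bullet> M = X j i - X m i" by (simp add: Smat_def inner_diff_left outer_inner X_def)
  ultimately show ?thesis using e0 by simp
 qed
 have n0: "0 < real CARD('n)" by simp
 have X: "\<bar>X j i\<bar> <= e" if i: "i : C" and j: "j : C - {i}" for i j
 proof -
  have "(SUM m:C - {i}. X m i) = 0"
   using trace_repr[of M i] tr i by (simp add: X_def sum.remove[OF fin i])
  then have "real CARD('n) * X j i = (SUM m:C - {i}. X j i - X m i)"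
   using card_C'[OF i] by (simp add: sum_subtractf)
  then have "real CARD('n) * \<bar>X j i\<bar> = \<bar>SUM m:C - {i}. X j i - X m i\<bar>" by (metis abs_mult abs_of_nat)
  also have "... <= (SUM m:C - {i}. e)"
   using i j by (intro order_trans[OF sum_abs] sum_mono S) (auto simp: triples_def)
  also have "... = real CARD('n) * e" using card_C'[OF i] by simp
  finally show ?thesis using n0 by simp
 qed
 obtain i where i: "i : C" using card_C by fastforce
 have entry: "\<bar>g j \<bullet> (M *v (m - i))\<bar> <= 2 * e" if j: "j : C" and m: "m : C" for j m
 proof -
  consider "m = i" | "m ~= i" "j = m" | "m ~= i" "j = i" | "m ~= i" "j ~= m" "j ~= i" by blast
  then show ?thesis
  proof cases
   case 1
   then show ?thesis using e0 by simp
  next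
   case 2
   then show ?thesis using X[OF i, of m] m e0 by (simp add: X_def)
  next
   case 3
   have "g i \<bullet> (M *v (m - i)) = - X i m" by (simp add: X_def matrix_vector_mult_diff_distrib inner_diff_right)
   then show ?thesis using X[OF m, of i] 3 i e0 by simp
  next
   case 4
   have "g j \<bullet> (M *v (m - i)) = X j i - X j m" by (simp add: X_def matrix_vector_mult_diff_distrib inner_diff_right)
   then show ?thesis using X[OF i, of j] X[OF m, of j] 4 j by auto
  qed
 qed
 have "norm M <= (SUM j:C. SUM m:C. norm ((g j \<bullet> (M *v (m - i))) *\<^sub>R outer (j - i) (g m)))"
  by (subst matrix_repr[of M i]) (intro order_trans[OF norm_sum] sum_mono norm_sum)
 also have "... <= (SUM j:C. SUM m:C. (2 * e) * K)"
 proof (intro sum_mono)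
  fix j m assume j: "j : C" and m: "m : C"
  have "norm (outer (j - i) (g m)) <= (K * r) * (1 / r)"
   unfolding norm_outer using norm_g[OF m] norm_edge_C[OF j i] r K_pos by (intro mult_mono) auto
  then have "norm (outer (j - i) (g m)) <= K" using r by simp
  then show "norm ((g j \<bullet> (M *v (m - i))) *\<^sub>R outer (j - i) (g m)) <= (2 * e) * K"
   unfolding norm_scaleR using entry[OF j m] e0 by (intro mult_mono) auto
 qed
 also have "... = (2 * K * (real CARD('n) + 1)^2) * e" by (simp add: card_C power2_eq_square algebra_simps)
 finally have "(norm M)^2 <= ((2 * K * (real CARD('n) + 1)^2) * e)^2" by (rule power_mono) simp
 then show ?thesis by (simp add: power_mult_distrib e0(2) e2_def)
qed

text \<open>At the centre each coordinate is at least \<open>r * norm (g a)\<close>. Half of this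
  can be lost in the half ball, and \<open>norm (g a)\<close> is at least
  \<open>1 / (K * r)\<close>.\<close>

lemma lam_half_ball: "a : C ==> y : ball z (r / 2) ==> 1 / (2 * K) <= lam a y"
proof -
 assume a: "a : C" and y: "y : ball z (r / 2)"
 have n: "norm (z - y) <= r / 2" using y by (simp add: dist_norm)
 have "lam a z - lam a y = g a \<bullet> (z - y)" by (simp add: inner_diff_right)
 also have "... <= norm (g a) * norm (z - y)" by (rule norm_cauchy_schwarz)
 also have "... <= norm (g a) * (r / 2)" by (intro mult_left_mono n) simp
 finally have 1: "norm (g a) * (r / 2) <= lam a y" using norm_g_le(1)[OF a r ball_T] by (simp add: mult.commute)
 have "1 <= norm (g a) * (K * r)" using norm_g_ge[OF a] diam by (meson mult_left_mono norm_ge_zero order_trans)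
 then have "1 / (2 * K) <= norm (g a) * (r / 2)" using K_pos by (simp add: field_simps)
 then show ?thesis using 1 by linarith
qed

lemma T_volume_le: "(LBINT x:T. 1) <= (2 * K) ^ CARD('n) * measure lborel (ball (0::real^'n) 1) * r ^ CARD('n)"
proof -
 have zT: "z : T" using ball_T r by auto
 have Kr: "0 < K * r" using K_pos r by simp
 have "T \<subseteq> ball z (2 * K * r)"
 proof
  fix x assume "x : T"
  then have "norm (z - x) <= K * r" using norm_edge[OF zT] by blast
  then show "x : ball z (2 * K * r)" using Kr by (simp add: dist_norm)
 qed
 then have "(LBINT x:T. (1::real)) <= (LBINT x:ball z (2 * K * r). 1)"
  by (intro set_lebesgue_integral_mono_set cont_set_integrable) auto
 also have "... = measure lborel (ball z (2 * K * r))" by (simp add: set_lebesgue_integral_def)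
 also have "... = (2 * K * r) ^ CARD('n) * measure lborel (ball (0::real^'n) 1)"
  using measure_lborel_ball[of "2 * K * r" z] Kr by simp
 finally show ?thesis by (simp add: power_mult_distrib mult_ac)
qed

end

subsection \<open>Stresses with prescribed tangential-normal components\<close>

lemma norm_add_square_le: "(norm (u + w))^2 <= 2 * (norm u)^2 + 2 * (norm (w :: 'a::real_inner))^2"
proof -
 have "(norm (u + w))^2 + (norm (u - w))^2 = 2 * (norm u)^2 + 2 * (norm w)^2"
  unfolding power2_norm_eq_inner inner_add_left inner_add_right inner_diff_left inner_diff_right by simp
 then show ?thesis using zero_le_power2[of "norm (u - w)"] by linarith
qed

lemma norm_diff_square_le: "(norm (u - w))^2 <= 2 * (norm u)^2 + 2 * (norm (w :: 'a::real_inner))^2"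
 using norm_add_square_le[of u "- w"] by simp

lemma poly_matrix_sup:
 fixes A :: "real^'n::finite => real^'n^'n"
 assumes Cs: "!!p::real^'n => real. p : poly_space m ==> (p y)^2 <= c * (LBINT x:ball z s. (p x)^2)"
  and A: "!!i j. (%x. A x $ i $ j) : poly_space m"
 shows "(norm (A y))^2 <= c * (LBINT x:ball z s. (norm (A x))^2)"
proof -
 have i: "set_integrable lborel (ball z s) (%x. (A x $ i $ j)^2)" for i j
  by (intro cont_set_integrable continuous_on_power ps_continuous[OF A]) auto
 have "(norm (A y))^2 <= (SUM i:UNIV. SUM j:UNIV. c * (LBINT x:ball z s. (A x $ i $ j)^2))"
  unfolding norm_matrix_square by (intro sum_mono Cs A)
 also have "... = c * (LBINT x:ball z s. (norm (A x))^2)"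
  unfolding norm_matrix_square by (simp add: set_integral_sum set_integrable_sum i sum_distrib_left)
 finally show ?thesis .
qed

context bary begin

lemma face_lift_poly:
 assumes q: "!!i. (%x. q x $ i) : poly_space m"
 shows "(%x. face_lift a \<kappa> (q x) $ i $ j) : poly_space m"
proof -
 have "(%x. SUM b:C - {a}. (- (1 / \<kappa>) * outer (g b) (b - a) $ i $ j) * (SUM e:UNIV. (b - cen a) $ e * q x $ e)) : poly_space m"
  by (intro ps_sum ps_cmult q)
 moreover have "(%x. SUM b:C - {a}. (- (1 / \<kappa>) * outer (g b) (b - a) $ i $ j) * (SUM e:UNIV. (b - cen a) $ e * q x $ e))
   = (%x. face_lift a \<kappa> (q x) $ i $ j)"
  unfolding face_lift_def inner_vec_def inner_real_def sum_component vector_scaleR_component real_scaleR_def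
  by (intro ext sum.cong refl) (simp only: mult_ac)
 ultimately show ?thesis by simp
qed

lemma bubble_poly:
 assumes \<rho>: "!!i j. (%x. \<rho> x $ i $ j) : poly_space (m - 1)"
 shows "(%x. bubble \<rho> x $ i $ j) : poly_space m"
proof -
 have s: "(%x. lam a x * (S \<bullet> \<rho> x) * e) : poly_space m" for a e and S :: "real^'n^'n"
 proof -
  have "(%x. S \<bullet> \<rho> x) : poly_space (m - 1)"
   unfolding inner_vec_def inner_real_def by (intro ps_sum ps_cmult \<rho>)
  from ps_cmult[OF ps_mult[OF ps_affine[OF order_refl] this], of e "g a" "\<beta> a"]
  show ?thesis by (simp add: mult.commute)
 qed
 have "(%x. bubble \<rho> x $ i $ j) = (%x. SUM t:triples. lam (fst t) x * (Smat (fst t) (fst (snd t)) (snd (snd t)) \<bullet> \<rho> x) * Smat (fst t) (fst (snd t)) (snd (snd t)) $ i $ j)"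
  unfolding bubble_def by (simp add: case_prod_unfold)
 then show ?thesis by (simp only:) (intro ps_sum s)
qed

end

text \<open>The weights of the bubble vanish towards the faces, so coercivity is claimed only on the
  half ball, where they are at least \<open>1 / (2 * K)\<close>; the pairing is nonnegative
  elsewhere. For polynomials the half ball controls the whole simplex.\<close>

lemma (in shape_bary) bubble_coercive:
 assumes \<rho>: "!!i j. (%x. \<rho> x $ i $ j) : poly_space m" and tr: "!!x. x : T ==> trace (\<rho> x) = 0"
  and bc: "cont (bubble \<rho>)"
 shows "(LBINT x:ball z (r / 2). (norm (\<rho> x))^2)
  <= (2 * K) * (2 * K * (real CARD('n) + 1)^2)^2 * (LBINT x:T. bubble \<rho> x \<bullet> \<rho> x)"
proof -
 let ?c = "(2 * K) * (2 * K * (real CARD('n) + 1)^2)^2"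
 have \<rho>c: "cont \<rho>" by (rule poly_matrix_continuous[OF \<rho>])
 have sub: "ball z (r / 2) \<subseteq> T" using ball_T r by (auto simp: subset_iff)
 have pt: "(norm (\<rho> x))^2 <= ?c * (bubble \<rho> x \<bullet> \<rho> x)" if x: "x : ball z (r / 2)" for x
 proof -
  have "(\<Sum>(i, j, m)\<in>triples. (Smat i j m \<bullet> \<rho> x)^2) <= (\<Sum>(i, j, m)\<in>triples. (2 * K) * (lam i x * (Smat i j m \<bullet> \<rho> x)^2))"
  proof (rule sum_mono, clarify)
   fix i j m assume t: "(i, j, m) : triples"
   then have "1 / (2 * K) <= lam i x" using lam_half_ball[OF _ x] by (auto simp: triples_def)
   then have "1 <= (2 * K) * lam i x" using K_pos by (simp add: field_simps)
   then have "1 * (Smat i j m \<bullet> \<rho> x)^2 <= ((2 * K) * lam i x) * (Smat i j m \<bullet> \<rho> x)^2" by (intro mult_right_mono) auto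
   then show "(Smat i j m \<bullet> \<rho> x)^2 <= (2 * K) * (lam i x * (Smat i j m \<bullet> \<rho> x)^2)" by (simp add: mult.assoc)
  qed
  also have "... = (2 * K) * (bubble \<rho> x \<bullet> \<rho> x)" unfolding bubble_inner sum_distrib_left by (rule sum.cong) auto
  finally have 1: "(\<Sum>(i, j, m)\<in>triples. (Smat i j m \<bullet> \<rho> x)^2) <= (2 * K) * (bubble \<rho> x \<bullet> \<rho> x)" .
  have xT: "x : T" using x sub by (rule set_rev_mp)
  have "(norm (\<rho> x))^2 <= (2 * K * (real CARD('n) + 1)^2)^2 * (\<Sum>(i, j, m)\<in>triples. (Smat i j m \<bullet> \<rho> x)^2)"
   by (rule Smat_coercive[OF tr[OF xT]])
  also have "... <= (2 * K * (real CARD('n) + 1)^2)^2 * ((2 * K) * (bubble \<rho> x \<bullet> \<rho> x))"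
   by (intro mult_left_mono 1) simp
  finally show ?thesis by (simp add: mult_ac)
 qed
 have nn: "0 <= bubble \<rho> x \<bullet> \<rho> x" if "x : T" for x
  unfolding bubble_inner using that T_iff by (intro sum_nonneg) (auto simp: triples_def)
 have c1: "cont (%x. ?c * (bubble \<rho> x \<bullet> \<rho> x))" by (intro continuous_intros bc \<rho>c)
 have "(LBINT x:ball z (r / 2). (norm (\<rho> x))^2) <= (LBINT x:ball z (r / 2). ?c * (bubble \<rho> x \<bullet> \<rho> x))"
  by (intro set_integral_mono cont_set_integrable c1 pt) (auto intro!: continuous_intros \<rho>c)
 also have "... <= (LBINT x:T. ?c * (bubble \<rho> x \<bullet> \<rho> x))"
  using nn K_pos by (intro set_lebesgue_integral_mono_set T_integrable c1 sub) auto
 finally show ?thesis by simp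
qed

text \<open>A closed expression, so that its arguments show the independence of element and mesh;
  \<open>w\<close> stands for the volume of the unit ball. \<open>E1\<close> stems from the lifting,
  \<open>Cc\<close> from coercivity, \<open>E3\<close> from the volume, \<open>Ct\<close> from the
  bound on values and \<open>E4\<close> from the bubble.\<close>

definition local_const :: "nat => real => real => real => real" where
 "local_const n w K Cs = (let N = real n; E1 = ((N + 1) * (N * K^2))^2; Cc = (2 * K) * (2 * K * (N + 1)^2)^2;
   E3 = (2 * K) ^ n * w; Ct = Cs * 2 ^ n; E4 = real ((n + 1) ^ 3) * (4 * K^2); E5 = E3 * Ct * Cc^2 * E4^2 * Ct
   in 2 * E1 + 4 * E5 * (E1 * E3 + 1) + 1)"

text \<open>The constants of the norm equivalences are parameters, to be fixed once for all elements
  of all meshes.\<close>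

locale shape_poly = shape_bary C g \<beta> z r K for C :: "(real^'n::finite) set" and g \<beta> z r K +
 fixes k :: nat and Cs Cp :: real
 assumes Cs0: "0 < Cs" and Cp0: "0 < Cp"
  and Cs: "!!(p::real^'n => real) c y s. p : poly_space (int k) ==> 0 < s ==> norm (y - c) <= (2 * K) * s ==>
   (p y)^2 <= Cs / s ^ CARD('n) * (LBINT x:ball c s. (p x)^2)"
  and Cp: "!!(p::real^'n => real) c y s i. p : poly_space (int k) ==> 0 < s ==> norm (y - c) <= (2 * K) * s ==>
   (partial i p y)^2 <= Cp / (s^2 * s ^ CARD('n)) * (LBINT x:ball c s. (p x)^2)"
begin

lemma K0: "0 < K" by (rule K_pos)

text \<open>The stress is the lifting \<open>A\<close> of the face data plus \<theta> times the
  bubble of \<rho>. Both \<open>W\<close> and the average of the squared deviation of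
  \<open>G\<close> scale like squared values, which is why the constant is free of
  \<open>r\<close>.\<close>

lemma local_stress:
 assumes \<kappa>: "ALL a:C. \<bar>\<kappa> a\<bar> * norm (g a) = 1"
  and q: "ALL a:C. ALL i. (%x. q a x $ i) : poly_space (int k)" and G: "cont G" and M: "trace M = 0"
  and \<rho>: "ALL i j. (%x. \<rho> x $ i $ j) : poly_space (int k - 1)" and tr: "ALL x:T. trace (\<rho> x) = 0"
  and W: "ALL a:C. ALL x:T. (norm (q a x - \<kappa> a *\<^sub>R (M *v g a)))^2 <= W"
 shows "EX \<tau>. (ALL i j. (%x. \<tau> x $ i $ j) : poly_space (int k)) & (ALL x. trace (\<tau> x) = 0) &
  (ALL a:C. ALL x:face a. ALL l:C - {a}. ALL m:C - {a}. (l - m) \<bullet> (\<tau> x *v (\<kappa> a *\<^sub>R g a) - q a x) = 0) &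
  (LBINT x:T. \<tau> x \<bullet> \<rho> x) = (LBINT x:T. G x \<bullet> \<rho> x) &
  (ALL x:T. (norm (\<tau> x - M))^2 <= local_const CARD('n) (measure lborel (ball (0::real^'n) 1)) K Cs *
   (W + 1 / r ^ CARD('n) * (LBINT x:T. (norm (G x - M))^2)))"
proof -
 define N where "N = real CARD('n)"
 define E1 where "E1 = ((N + 1) * (N * K^2))^2"
 define Cc where "Cc = (2 * K) * (2 * K * (N + 1)^2)^2"
 define E3 where "E3 = (2 * K) ^ CARD('n) * measure lborel (ball (0::real^'n) 1)"
 define Ct where "Ct = Cs * 2 ^ CARD('n)"
 define E4 where "E4 = real ((CARD('n) + 1) ^ 3) * (4 * K^2)"
 define E5 where "E5 = E3 * Ct * Cc^2 * E4^2 * Ct"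
 define B where "B = 2 * E1 + 4 * E5 * (E1 * E3 + 1) + 1"
 have nn: "0 <= N" "0 <= E1" "0 < Cc" "0 <= E3" "0 < Ct" "0 <= E4" "0 <= E5"
  using K0 Cs0 by (auto simp: N_def E1_def Cc_def E3_def Ct_def E4_def E5_def)
 have B0: "0 < B" unfolding B_def using nn by (intro add_nonneg_pos) auto
 have \<kappa>0: "\<kappa> a ~= 0" if "a : C" for a using \<kappa> that by fastforce
 define A where "A x = (SUM a:C. face_lift a (\<kappa> a) (q a x))" for x
 define b where "b = bubble \<rho>"
 \<comment> \<open>All norms of \<rho> are compared with \<open>P\<close>: the numerator of \<theta>
   is at most of order \<open>sqrt P\<close>, its denominator at least of order \<open>P\<close>,
   and the bubble of order \<open>sqrt P\<close>, so \<open>P\<close> cancels in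
   \<open>\<theta> *\<^sub>R b x\<close>.\<close>
 define P where "P = (LBINT x:ball z (r / 2). (norm (\<rho> x))^2)"
 define Ib where "Ib = (LBINT x:T. b x \<bullet> \<rho> x)"
 define Nn where "Nn = (LBINT x:T. (G x - A x) \<bullet> \<rho> x)"
 \<comment> \<open>If \<open>Ib = 0\<close>, this is 0 by division by zero; then \<open>PI\<close>
   gives \<open>P = 0\<close> and \<open>Nn2\<close> gives \<open>Nn = 0\<close>, so there is
   nothing to correct.\<close>
 define \<theta> where "\<theta> = Nn / Ib"
 define \<tau> where "\<tau> x = A x + \<theta> *\<^sub>R b x" for x
 define S where "S = (LBINT x:T. (norm (G x - M))^2)"
 have zT: "z : T" using ball_T r by auto
 have W0: "0 <= W"
 proof -
  obtain a where a: "a : C" using card_C by fastforce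
  have "0 <= (norm (q a z - \<kappa> a *\<^sub>R (M *v g a)))^2" by simp
  also have "... <= W" using W a zT by blast
  finally show ?thesis .
 qed
 have S0: "0 <= S" unfolding S_def set_lebesgue_integral_def by (intro integral_nonneg_AE) auto
 have P0: "0 <= P" unfolding P_def set_lebesgue_integral_def by (intro integral_nonneg_AE) auto
 have Ap: "(%x. A x $ i $ j) : poly_space (int k)" for i j
  unfolding A_def sum_component using q by (intro ps_sum face_lift_poly) auto
 have bp: "(%x. b x $ i $ j) : poly_space (int k)" for i j
  unfolding b_def using \<rho> by (intro bubble_poly) auto
 have \<rho>p: "(%x. \<rho> x $ i $ j) : poly_space (int k)" for i j
  using \<rho> by (intro ps_mono[of "int k - 1" "int k"]) auto
 have Ac: "cont A" and bc: "cont b" and \<rho>c: "cont \<rho>"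
  by (rule poly_matrix_continuous, rule Ap bp \<rho>p)+
 have \<tau>p: "(%x. \<tau> x $ i $ j) : poly_space (int k)" for i j
  unfolding \<tau>_def using ps_add[OF Ap ps_cmult[OF bp]] by simp
 have \<tau>tr: "trace (\<tau> x) = 0" for x
  unfolding \<tau>_def A_def b_def by (simp add: trace_add trace_sum trace_scaleR bubble_trace face_lift_trace)
 have bound_A: "(norm (A x - M))^2 <= E1 * W" if x: "x : T" for x
 proof -
  have "A x - M = (SUM a:C. face_lift a (\<kappa> a) (q a x - \<kappa> a *\<^sub>R (M *v g a)))"
  proof -
   have "A x - M = (SUM a:C. face_lift a (\<kappa> a) (q a x)) - (SUM a:C. face_lift a (\<kappa> a) (\<kappa> a *\<^sub>R (M *v g a)))"
    unfolding A_def using face_lift_reconstruct[where M=M and \<kappa>=\<kappa>] M \<kappa>0 by simp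
   also have "... = (SUM a:C. face_lift a (\<kappa> a) (q a x) - face_lift a (\<kappa> a) (\<kappa> a *\<^sub>R (M *v g a)))"
    by (rule sum_subtractf[symmetric])
   finally show ?thesis by (simp only: face_lift_diff)
  qed
  also have "norm ... <= (SUM a:C. N * K^2 * sqrt W)"
  proof (rule sum_norm_le)
   fix a assume a: "a : C"
   have "norm (q a x - \<kappa> a *\<^sub>R (M *v g a)) <= sqrt W" using W a x by (intro real_le_rsqrt) blast
   then have "N * K^2 * norm (q a x - \<kappa> a *\<^sub>R (M *v g a)) <= N * K^2 * sqrt W" by (intro mult_left_mono) (auto simp: N_def)
   moreover have "norm (face_lift a (\<kappa> a) (q a x - \<kappa> a *\<^sub>R (M *v g a))) <= N * K^2 * norm (q a x - \<kappa> a *\<^sub>R (M *v g a))"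
    unfolding N_def using \<kappa> a by (intro face_lift_norm) auto
   ultimately show "norm (face_lift a (\<kappa> a) (q a x - \<kappa> a *\<^sub>R (M *v g a))) <= N * K^2 * sqrt W" by linarith
  qed
  also have "... = (N + 1) * (N * K^2) * sqrt W" by (simp add: card_C N_def algebra_simps)
  finally have "(norm (A x - M))^2 <= ((N + 1) * (N * K^2) * sqrt W)^2" by (rule power_mono) simp
  then show ?thesis using W0 by (simp add: E1_def power_mult_distrib)
 qed
 have bound_b: "(norm (b x))^2 <= E4^2 * (norm (\<rho> x))^2" if x: "x : T" for x
  using power_mono[OF bubble_norm[OF x, of \<rho>], of 2] by (simp add: b_def E4_def power_mult_distrib)
 have bound_\<rho>: "(norm (\<rho> x))^2 <= Ct / r ^ CARD('n) * P" if x: "x : T" for x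
 proof -
  have "norm (x - z) <= (2 * K) * (r / 2)" using norm_edge[OF x zT] by simp
  then have "(norm (\<rho> x))^2 <= Cs / (r / 2) ^ CARD('n) * P"
   unfolding P_def using r by (intro poly_matrix_sup[where m="int k"] Cs \<rho>p) auto
  then show ?thesis by (simp add: Ct_def power_divide)
 qed
 have vol: "(LBINT x:T. 1) <= E3 * r ^ CARD('n)" using T_volume_le by (simp add: E3_def)
 have PI: "P <= Cc * Ib"
  using bubble_coercive[OF \<rho>p] tr bc unfolding P_def Ib_def b_def Cc_def N_def by simp
 have ints: "(LBINT x:T. \<tau> x \<bullet> \<rho> x) = (LBINT x:T. A x \<bullet> \<rho> x) + \<theta> * Ib"
 proof -
  have "(LBINT x:T. \<tau> x \<bullet> \<rho> x) = (LBINT x:T. A x \<bullet> \<rho> x + \<theta> * (b x \<bullet> \<rho> x))"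
   by (simp add: \<tau>_def inner_add_left)
  also have "... = (LBINT x:T. A x \<bullet> \<rho> x) + (LBINT x:T. \<theta> * (b x \<bullet> \<rho> x))"
   by (intro set_integral_add(2) T_integrable continuous_intros Ac bc \<rho>c)
  finally show ?thesis by (simp add: Ib_def)
 qed
 have NnE: "Nn = (LBINT x:T. G x \<bullet> \<rho> x) - (LBINT x:T. A x \<bullet> \<rho> x)"
  unfolding Nn_def inner_diff_left by (intro set_integral_diff(2) T_integrable continuous_intros Ac G \<rho>c)
 have int\<rho>: "(LBINT x:T. (norm (\<rho> x))^2) <= E3 * Ct * P"
 proof -
  have "(LBINT x:T. (norm (\<rho> x))^2) <= (LBINT x:T. Ct / r ^ CARD('n) * P)"
   by (intro set_integral_mono T_integrable bound_\<rho>) (auto intro!: continuous_intros \<rho>c)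
  also have "... = (Ct / r ^ CARD('n) * P) * (LBINT x:T. 1)" by (simp add: set_lebesgue_integral_def)
  also have "... <= (Ct / r ^ CARD('n) * P) * (E3 * r ^ CARD('n))"
   using nn P0 r by (intro mult_left_mono vol) auto
  also have "... = E3 * Ct * P" using r by simp
  finally show ?thesis .
 qed
 have intGA: "(LBINT x:T. (norm (G x - A x))^2) <= 2 * S + 2 * (E1 * W * (E3 * r ^ CARD('n)))"
 proof -
  have "(LBINT x:T. (norm (G x - A x))^2) <= (LBINT x:T. 2 * (norm (G x - M))^2 + 2 * (E1 * W))"
  proof (intro set_integral_mono T_integrable)
   fix x assume x: "x : T"
   have "(norm (G x - A x))^2 <= 2 * (norm (G x - M))^2 + 2 * (norm (A x - M))^2"
    using norm_diff_square_le[of "G x - M" "A x - M"] by simp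
   then show "(norm (G x - A x))^2 <= 2 * (norm (G x - M))^2 + 2 * (E1 * W)" using bound_A[OF x] by linarith
  qed (intro continuous_intros G Ac)+
  also have "... = (LBINT x:T. 2 * (norm (G x - M))^2) + (LBINT x:T. (2 * (E1 * W)) * 1)"
   by (subst set_integral_add(2)) (auto intro!: T_integrable continuous_intros G)
  also have "... = 2 * S + 2 * (E1 * W) * (LBINT x:T. 1)"
   unfolding set_integral_mult_right S_def ..
  also have "... <= 2 * S + 2 * (E1 * W) * (E3 * r ^ CARD('n))"
   using nn W0 by (intro add_left_mono mult_left_mono vol) auto
  finally show ?thesis by simp
 qed
 have Nn2: "Nn^2 <= (2 * S + 2 * (E1 * W * (E3 * r ^ CARD('n)))) * (E3 * Ct * P)"
 proof -
  have "Nn^2 <= (LBINT x:T. (norm (G x - A x))^2) * (LBINT x:T. (norm (\<rho> x))^2)"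
   unfolding Nn_def by (rule set_integral_Cauchy_Schwarz) (intro T_integrable continuous_intros G Ac \<rho>c)+
  also have "... <= (2 * S + 2 * (E1 * W * (E3 * r ^ CARD('n)))) * (E3 * Ct * P)"
   using nn S0 W0 r intGA int\<rho> by (intro mult_mono) (auto simp: set_lebesgue_integral_def intro!: integral_nonneg_AE)
  finally show ?thesis .
 qed
 have ortho: "(LBINT x:T. \<tau> x \<bullet> \<rho> x) = (LBINT x:T. G x \<bullet> \<rho> x)"
 proof (cases "Ib = 0")
  case True
  then have "P = 0" using PI P0 by simp
  then have "Nn = 0" using Nn2 by simp
  then show ?thesis using ints NnE True by simp
 next
  case False
  then show ?thesis using ints NnE by (simp add: \<theta>_def)
 qed
 have bound_\<theta>: "\<theta>^2 * (norm (b x))^2 <= E5 * (2 * (1 / r ^ CARD('n) * S) + 2 * (E1 * E3 * W))" if x: "x : T" for x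
 proof (cases "P = 0")
  case True
  then have "Nn = 0" using Nn2 by simp
  then have "\<theta> = 0" by (simp add: \<theta>_def)
  then show ?thesis using nn S0 W0 r by simp
 next
  case False
  then have P: "0 < P" using P0 by simp
  have Ib: "0 < Ib" using PI P nn by (metis less_le_trans zero_less_mult_pos)
  have "P / Cc <= Ib" using PI nn by (simp add: divide_le_eq mult.commute)
  then have "(P / Cc)^2 <= Ib^2" using P nn by (intro power_mono) auto
  then have "Nn^2 / Ib^2 <= Nn^2 / (P / Cc)^2" using P nn by (intro divide_left_mono) (auto intro!: mult_pos_pos simp: Ib)
  then have "\<theta>^2 <= Nn^2 / (P / Cc)^2" by (simp add: \<theta>_def power_divide)
  also have "... <= ((2 * S + 2 * (E1 * W * (E3 * r ^ CARD('n)))) * (E3 * Ct * P)) / (P / Cc)^2"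
   by (intro divide_right_mono Nn2) simp
  also have "... = (2 * S + 2 * (E1 * W * (E3 * r ^ CARD('n)))) * (E3 * Ct * Cc^2) / P"
   using P nn by (simp add: power2_eq_square field_simps)
  finally have 1: "\<theta>^2 <= (2 * S + 2 * (E1 * W * (E3 * r ^ CARD('n)))) * (E3 * Ct * Cc^2) / P" .
  have "(norm (b x))^2 <= E4^2 * (Ct / r ^ CARD('n) * P)"
   using bound_b[OF x] mult_left_mono[OF bound_\<rho>[OF x], of "E4^2"] by simp
  then have "\<theta>^2 * (norm (b x))^2 <= ((2 * S + 2 * (E1 * W * (E3 * r ^ CARD('n)))) * (E3 * Ct * Cc^2) / P) * (E4^2 * (Ct / r ^ CARD('n) * P))"
   using 1 nn S0 W0 r P by (intro mult_mono) auto
  also have "... = E5 * ((2 * S + 2 * (E1 * W * (E3 * r ^ CARD('n)))) / r ^ CARD('n))"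
   using P by (simp add: E5_def)
  also have "(2 * S + 2 * (E1 * W * (E3 * r ^ CARD('n)))) / r ^ CARD('n) = 2 * (1 / r ^ CARD('n) * S) + 2 * (E1 * E3 * W)"
   using r by (simp add: add_divide_distrib)
  finally show ?thesis .
 qed
 have bound_\<tau>: "(norm (\<tau> x - M))^2 <= B * (W + 1 / r ^ CARD('n) * S)" if x: "x : T" for x
 proof -
  have "(norm (\<tau> x - M))^2 <= 2 * (norm (A x - M))^2 + 2 * (norm (\<theta> *\<^sub>R b x))^2"
   using norm_add_square_le[of "A x - M" "\<theta> *\<^sub>R b x"] by (simp add: \<tau>_def algebra_simps)
  also have "(norm (\<theta> *\<^sub>R b x))^2 = \<theta>^2 * (norm (b x))^2" by (simp add: power_mult_distrib)
  finally have 1: "(norm (\<tau> x - M))^2 <= 2 * (E1 * W) + 2 * (E5 * (2 * (1 / r ^ CARD('n) * S) + 2 * (E1 * E3 * W)))"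
   using bound_A[OF x] bound_\<theta>[OF x] by linarith
  define Y where "Y = 1 / r ^ CARD('n) * S"
  have Y: "0 <= Y" using S0 r by (simp add: Y_def)
  have "B * (W + Y) - (2 * (E1 * W) + 2 * (E5 * (2 * Y + 2 * (E1 * E3 * W)))) = 2 * E1 * Y + 4 * E5 * (E1 * E3) * Y + 4 * E5 * W + W + Y"
   unfolding B_def by (simp add: algebra_simps)
  also have "... >= 0" using Y W0 nn by (intro add_nonneg_nonneg mult_nonneg_nonneg) auto
  finally show ?thesis using 1 by (simp add: Y_def)
 qed
 have tang: "(l - m) \<bullet> (\<tau> x *v (\<kappa> a *\<^sub>R g a) - q a x) = 0" if a: "a : C" and x: "x : face a" and l: "l : C - {a}" and m: "m : C - {a}" for a x l m
 proof -
  have oth: "(l - m) \<bullet> (face_lift c (\<kappa> c) (q c x) *v g a) = 0" if c: "c : C - {a}" for c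
   using face_lift_other[of c a "\<kappa> c" "q c x"] a c l m by (auto simp: edge_normal)
  have "(l - m) \<bullet> (A x *v g a) = (SUM c:C. (l - m) \<bullet> (face_lift c (\<kappa> c) (q c x) *v g a))"
   unfolding A_def matrix_vector_sum_left inner_sum_right ..
  also have "... = (l - m) \<bullet> (face_lift a (\<kappa> a) (q a x) *v g a)" using oth by (subst sum.remove[OF fin a]) simp
  finally have "(l - m) \<bullet> (A x *v (\<kappa> a *\<^sub>R g a)) = (l - m) \<bullet> q a x"
   using face_lift_own[OF a l m \<kappa>0[OF a], of "q a x"] by (simp add: matrix_vector_mult_scaleR)
  moreover have "(l - m) \<bullet> (b x *v g a) = 0" unfolding b_def by (rule bubble_face[OF a x l m])
  ultimately show ?thesis
   by (simp add: \<tau>_def matrix_vector_mult_add_rdistrib matrix_vector_scaleR_left matrix_vector_mult_scaleR inner_diff_right inner_add_right)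
 qed
 have "local_const CARD('n) (measure lborel (ball (0::real^'n) 1)) K Cs = B"
  by (simp add: local_const_def Let_def B_def E1_def E3_def E4_def E5_def Cc_def Ct_def N_def)
 then show ?thesis
  by (intro exI[of _ \<tau>]) (use \<tau>p \<tau>tr tang ortho bound_\<tau> in \<open>simp add: S_def\<close>)
qed

end

definition gradient_square :: "(real^'n::finite => real^'n^'n) => real^'n => real" where
 "gradient_square G x = (SUM i:UNIV. SUM j:UNIV. (norm (gradient (%y. G y $ i $ j) x))^2)"

lemma norm_matrix_vector_le: "norm (A *v x) <= norm (A :: real^'n^'n::finite) * norm x"
proof -
 have "(norm (A *v x))^2 = (SUM i:UNIV. (A $ i \<bullet> x)^2)"
  unfolding power2_norm_eq_inner[of "A *v x"] inner_vec_def[of "A *v x"] by (simp add: matrix_vector_mul_component power2_eq_square)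
 also have "... <= (SUM i:UNIV. (norm (A $ i))^2 * (norm x)^2)"
  unfolding power2_norm_eq_inner by (intro sum_mono Cauchy_Schwarz_ineq)
 also have "... = (norm A * norm x)^2"
  unfolding power_mult_distrib sum_distrib_right[symmetric] power2_norm_eq_inner[of A] inner_vec_def[of A] by (simp add: power2_norm_eq_inner)
 finally show ?thesis by (rule power2_le_imp_le) simp
qed

lemma matrix_continuousI:
 fixes A :: "'a::topological_space => real^'n^'m"
 shows "(!!i j. continuous_on S (%x. A x $ i $ j)) ==> continuous_on S A"
 by (intro continuous_on_vecI)

lemma continuous_on_matrix_vector [continuous_intros]:
 fixes A :: "'a::topological_space => real^'n^'n::finite"
 assumes "continuous_on S A" "continuous_on S w"
 shows "continuous_on S (%x. A x *v w x)"
proof (rule continuous_on_vecI)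
 fix i
 show "continuous_on S (%x. (A x *v w x) $ i)"
  unfolding matrix_vector_mul_component by (intro continuous_intros assms)
qed

lemma gradient_continuous: "C1 f ==> cont (gradient f)"
 unfolding gradient_def by (intro continuous_on_vec_lambda) simp

lemma tangential_diff: "tangential n (u - w) = tangential n u - tangential n w"
 by (simp add: tangential_def inner_diff_left scaleR_diff_left)

section \<open>Size of faces and approximation of a matrix field by its mean on a simplex\<close>

context shape_bary begin

lemma face_integral_continuous:
 assumes "a : C" "unit_normal \<nu> (face a)" "cont f"
 shows "face_integral \<nu> (face a) f = norm (g a) * (LINT x:face a|surf a. f x)"
 using assms by (intro face_integral_surf borel_measurable_continuous_onI)

lemma face_integral_le:
 assumes "a : C" "unit_normal \<nu> (face a)" "cont f" "cont h" "!!x. x : face a ==> f x <= h x"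
 shows "face_integral \<nu> (face a) f <= face_integral \<nu> (face a) h"
 using assms by (simp add: face_integral_continuous) (intro mult_left_mono set_integral_mono surf_integrable; simp)

text \<open>The disc in the face needs a direction inside the face, provided by two further
  vertices; this is where the dimension bound enters.\<close>

lemma diameter_face_ge:
 assumes n: "2 <= CARD('n)" and a: "a : C"
 shows "r <= diameter (face a)"
proof -
 obtain y where y: "y : face a" "!!w. g a \<bullet> w = 0 ==> norm w <= r ==> y + w : face a"
  using face_contains_disc[OF a r ball_T] by blast
 have "EX l m. l : C - {a} & m : C - {a} & l ~= m"
  using card_C'[OF a] n card_le_Suc0_iff_eq[of "C - {a}"] fin by fastforce
 then obtain l m where lm: "l : C - {a}" "m : C - {a}" "l ~= m" by blast
 define w where "w = (r / norm (l - m)) *\<^sub>R (l - m)"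
 have gw: "g a \<bullet> w = 0" using g_edge[of a l m] a lm by (auto simp: w_def)
 have nw: "norm w = r" using lm r by (simp add: w_def)
 have "dist (y + w) y <= diameter (face a)"
  using compact_face[of a] y(1) y(2)[OF gw] nw by (intro diameter_bounded_bound compact_imp_bounded) auto
 then show ?thesis using nw by (simp add: dist_norm)
qed

text \<open>\<open>cone_formula\<close> for the constant 1 gives the volume of a cone as height
  times base over dimension.\<close>

lemma face_area_le:
 assumes a: "a : C" and \<nu>: "unit_normal \<nu> (face a)"
 shows "face_integral \<nu> (face a) (%x. 1) <= real CARD('n) * ((2 * K) ^ CARD('n) * measure lborel (ball (0::real^'n) 1)) * r ^ CARD('n) / r"
proof -
 have grad: "gradient (%x::real^'n. 1::real) x = 0" for x by (simp add: gradient_def vec_eq_iff)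
 have "(LINT x:face a|surf a. 1) = (LBINT x:T. real CARD('n) * 1)"
  using cone_formula[OF a C1_const[of 1]] by (simp add: grad)
 also have "... = real CARD('n) * (LBINT x:T. 1)" by (rule set_integral_mult_right)
 also have "... <= real CARD('n) * ((2 * K) ^ CARD('n) * measure lborel (ball (0::real^'n) 1) * r ^ CARD('n))"
  by (intro mult_left_mono T_volume_le) simp
 finally have 1: "(LINT x:face a|surf a. 1) <= real CARD('n) * ((2 * K) ^ CARD('n) * measure lborel (ball (0::real^'n) 1) * r ^ CARD('n))" .
 have "norm (g a) * (LINT x:face a|surf a. 1) <= (1 / r) * (real CARD('n) * ((2 * K) ^ CARD('n) * measure lborel (ball (0::real^'n) 1) * r ^ CARD('n)))"
  using 1 norm_g[OF a] r by (intro mult_mono) (auto simp: set_lebesgue_integral_def intro!: integral_nonneg_AE)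
 then show ?thesis using face_integral_continuous[OF a \<nu>, of "%x. 1"] by simp
qed

context
 fixes G :: "real^'n => real^'n^'n" and c :: "real^'n^'n"
 assumes G: "!!i j. C1 (%x. G x $ i $ j)"
 defines "c \<equiv> (\<chi> i j. (LBINT x:T. G x $ i $ j) / (LBINT x:T. 1))"
begin

lemma G_cont: "cont G"
 by (intro matrix_continuousI C1_cont G)

lemma mean_trace: "(!!x. trace (G x) = 0) ==> trace c = 0"
proof -
 assume tr: "!!x. trace (G x) = 0"
 have "trace c = (SUM i:UNIV. LBINT x:T. G x $ i $ i) / (LBINT x:T. 1)"
  by (simp add: trace_def c_def sum_divide_distrib)
 also have "(SUM i:UNIV. LBINT x:T. G x $ i $ i) = (LBINT x:T. SUM i:UNIV. G x $ i $ i)"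
  by (intro set_integral_sum[symmetric] T_integrable C1_cont G)
 also have "... = 0" using tr by (simp add: trace_def)
 finally show ?thesis by simp
qed

lemma gradient_square_integral:
 "(LBINT x:T. gradient_square G x) = (SUM i:UNIV. SUM j:UNIV. LBINT x:T. (norm (gradient (%y. G y $ i $ j) x))^2)"
proof -
 have i: "set_integrable lborel T (%x. (norm (gradient (%y. G y $ i $ j) x))^2)" for i j
  by (intro T_integrable continuous_intros gradient_continuous G)
 show ?thesis unfolding gradient_square_def by (simp add: set_integral_sum set_integrable_sum i)
qed

lemma gradient_square_integral_nonneg: "0 <= (LBINT x:T. gradient_square G x)"
 unfolding set_lebesgue_integral_def by (intro integral_nonneg_AE) (auto simp: gradient_square_def intro!: AE_I2 mult_nonneg_nonneg sum_nonneg)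

lemma diam2: "(diameter T)^2 <= (K * r)^2"
 using diam diameter_pos by (intro power_mono) auto

lemma mean_square: "(LBINT x:T. (norm (G x - c))^2) <= 2 ^ CARD('n) * (K * r)^2 * (LBINT x:T. gradient_square G x)"
proof -
 have i: "set_integrable lborel T (%x. (G x $ i $ j - c $ i $ j)^2)" for i j
  by (intro T_integrable continuous_intros C1_cont G)
 have "(LBINT x:T. (norm (G x - c))^2) = (SUM i:UNIV. SUM j:UNIV. LBINT x:T. (G x $ i $ j - c $ i $ j)^2)"
  unfolding norm_matrix_square by (simp add: set_integral_sum set_integrable_sum i)
 also have "... <= (SUM i:UNIV. SUM j:UNIV. 2 ^ CARD('n) * (K * r)^2 * (LBINT x:T. (norm (gradient (%y. G y $ i $ j) x))^2))"
 proof (intro sum_mono)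
  fix i j
  have "(LBINT x:T. (G x $ i $ j - c $ i $ j)^2) <= 2 ^ CARD('n) * (diameter T)^2 * (LBINT x:T. (norm (gradient (%y. G y $ i $ j) x))^2)"
   using constant_approximation(1)[OF G] by (simp add: c_def)
  also have "... <= 2 ^ CARD('n) * (K * r)^2 * (LBINT x:T. (norm (gradient (%y. G y $ i $ j) x))^2)"
   by (intro mult_right_mono mult_left_mono diam2) (auto simp: set_lebesgue_integral_def intro!: integral_nonneg_AE)
  finally show "(LBINT x:T. (G x $ i $ j - c $ i $ j)^2) <= 2 ^ CARD('n) * (K * r)^2 * (LBINT x:T. (norm (gradient (%y. G y $ i $ j) x))^2)" .
 qed
 also have "... = 2 ^ CARD('n) * (K * r)^2 * (LBINT x:T. gradient_square G x)"
  unfolding gradient_square_integral by (simp only: sum_distrib_left)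
 finally show ?thesis .
qed

lemma mean_square_face:
 assumes a: "a : C" and \<nu>: "unit_normal \<nu> (face a)"
 shows "face_integral \<nu> (face a) (%x. (norm (G x *v \<nu> - c *v \<nu>))^2)
  <= ((real CARD('n) + 1) * 2 ^ CARD('n) + 1) * K^2 * r * (LBINT x:T. gradient_square G x)"
proof -
 define Cn where "Cn = (real CARD('n) + 1) * 2 ^ CARD('n) + 1"
 have Cn: "0 <= Cn" by (simp add: Cn_def)
 have n1: "norm \<nu> = 1" using \<nu> by (simp add: unit_normal_def)
 have i: "set_integrable (surf a) (face a) (%x. (G x $ i $ j - c $ i $ j)^2)" for i j
  by (intro surf_integrable continuous_intros C1_cont G)
 have "face_integral \<nu> (face a) (%x. (norm (G x *v \<nu> - c *v \<nu>))^2) <= face_integral \<nu> (face a) (%x. (norm (G x - c))^2)"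
 proof (intro face_integral_le a \<nu> continuous_intros G_cont power_mono)
  fix x
  show "norm (G x *v \<nu> - c *v \<nu>) <= norm (G x - c)"
   using norm_matrix_vector_le[of "G x - c" \<nu>] n1 by (simp add: matrix_vector_mult_diff_rdistrib)
 qed simp
 also have "... = norm (g a) * (LINT x:face a|surf a. (norm (G x - c))^2)"
  by (intro face_integral_continuous a \<nu> continuous_intros G_cont)
 also have "(LINT x:face a|surf a. (norm (G x - c))^2) = (SUM i:UNIV. SUM j:UNIV. LINT x:face a|surf a. (G x $ i $ j - c $ i $ j)^2)"
  unfolding norm_matrix_square by (simp add: set_integral_sum set_integrable_sum i)
 also have "norm (g a) * ... <= (1 / r) * (SUM i:UNIV. SUM j:UNIV. Cn * (K * r)^2 * (LBINT x:T. (norm (gradient (%y. G y $ i $ j) x))^2))"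
 proof (intro mult_mono sum_mono)
  fix i j
  have "(LINT x:face a|surf a. (G x $ i $ j - c $ i $ j)^2) <= Cn * (diameter T)^2 * (LBINT x:T. (norm (gradient (%y. G y $ i $ j) x))^2)"
   using constant_approximation(2)[OF G a] by (simp add: c_def Cn_def)
  also have "... <= Cn * (K * r)^2 * (LBINT x:T. (norm (gradient (%y. G y $ i $ j) x))^2)"
   by (intro mult_right_mono mult_left_mono diam2 Cn) (auto simp: set_lebesgue_integral_def intro!: integral_nonneg_AE)
  finally show "(LINT x:face a|surf a. (G x $ i $ j - c $ i $ j)^2) <= Cn * (K * r)^2 * (LBINT x:T. (norm (gradient (%y. G y $ i $ j) x))^2)" .
 qed (use norm_g[OF a] r in \<open>auto simp: set_lebesgue_integral_def intro!: sum_nonneg integral_nonneg_AE\<close>)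
 also have "... = (1 / r) * (Cn * (K * r)^2 * (LBINT x:T. gradient_square G x))"
  unfolding gradient_square_integral by (simp only: sum_distrib_left)
 also have "... = Cn * K^2 * r * (LBINT x:T. gradient_square G x)"
  using r by (simp add: power_mult_distrib power2_eq_square)
 finally show ?thesis by (simp add: Cn_def)
qed

end

end

text \<open>Invariance along the normal lets values in the element be bounded by the face. The bound
  is required for every constant \<open>w\<close>, because both neighbours use the datum, each with
  its own mean of \<open>G\<close>.\<close>

definition face_datum :: "nat => real^'n::finite => (real^'n => real^'n^'n) => (real^'n) set => (real^'n => real^'n) => bool" where
 "face_datum k n G F q \<longleftrightarrow> (ALL i. (%x. q x $ i) : poly_space (int k)) & (ALL x t. q (x + t *\<^sub>R n) = q x) &
   (ALL w. face_integral n F (%x. (norm (q x - w))^2) <= 10 * face_integral n F (%x. (norm (G x *v n - w))^2))"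

text \<open>In the last bound the normal trace is compared with that of \<open>G\<close>: as
  \<open>G\<close> is continuous, jumps of the stress are differences of such errors.\<close>

definition element_interpolant where
 "element_interpolant k B \<nu> q G \<rho> T \<tau> \<longleftrightarrow>
   (ALL i j. (%x. \<tau> x $ i $ j) : poly_space (int k)) & (ALL x. trace (\<tau> x) = 0) &
   (ALL F. F facet_of T --> (ALL x:F. tangential (\<nu> F) (\<tau> x *v \<nu> F) = tangential (\<nu> F) (q F x))) &
   (LBINT x:T. \<tau> x \<bullet> \<rho> x) = (LBINT x:T. G x \<bullet> \<rho> x) &
   (LBINT x:T. (norm (\<tau> x))^2) <= B * ((LBINT x:T. (norm (G x))^2) + (LBINT x:T. gradient_square G x)) &
   (LBINT x:T. (norm (mat_divergence \<tau> x))^2) <= B * (LBINT x:T. gradient_square G x) &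
   (ALL F. F facet_of T --> inverse (diameter F) * face_integral (\<nu> F) F (%x. (norm (\<tau> x *v \<nu> F - G x *v \<nu> F))^2)
    <= B * (LBINT x:T. gradient_square G x))"

text \<open>The bound \<open>R\<close> on the inradius is needed for the norm of the stress itself;
  the parts for divergence and jumps are free of scale.\<close>

definition element_const :: "nat => real => real => real => real => real => real" where
 "element_const n w K R Cs Cp = (let N = real n; E3 = (2 * K) ^ n * w; Cn = (N + 1) * 2 ^ n + 1;
   B2 = local_const n w K Cs * (20 * Cs * Cn * K^2 + 2 ^ n * K^2)
   in 2 + (4 * (B2 * R^2 * E3) + 4 * (2 ^ n * K^2 * R^2)) + N ^ 3 * (Cp * B2 * E3) * E3 + (2 * B2 * N * E3 + 2 * Cn * K^2))"

lemma local_const_pos: "0 <= w ==> 0 < K ==> 0 < Cs ==> 0 < local_const n w K Cs"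
 unfolding local_const_def Let_def by (intro add_nonneg_pos add_nonneg_nonneg mult_nonneg_nonneg) auto

lemma element_const_pos: "0 <= w ==> 0 < K ==> 0 < Cs ==> 0 < Cp ==> 0 < element_const n w K R Cs Cp"
 using local_const_pos[of w K Cs n] unfolding element_const_def Let_def
 by (intro add_pos_nonneg add_nonneg_nonneg mult_nonneg_nonneg) auto

context shape_poly begin

lemma norm_edge2: "a : T ==> b : T ==> norm (a - b) <= (2 * K) * r"
 using norm_edge[of a b] mult_pos_pos[OF K_pos r] by linarith

text \<open>Values are bounded by the integral over a ball centred on the face, and this ball by the
  face.\<close>

lemma invariant_poly_bound:
 fixes p :: "real^'n => real"
 assumes a: "a : C" and \<nu>: "unit_normal \<nu> (face a)" and p: "p : poly_space (int k)" and inv: "!!x t. p (x + t *\<^sub>R \<nu>) = p x" and x: "x : T"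
 shows "(p x)^2 <= Cs / r ^ CARD('n) * (2 * r * face_integral \<nu> (face a) (%x. (p x)^2))"
proof -
 obtain \<kappa> where \<kappa>: "\<nu> = \<kappa> *\<^sub>R g a" "\<bar>\<kappa>\<bar> * norm (g a) = 1" using unit_normal_parallel[OF a \<nu>] by metis
 have \<kappa>0: "\<kappa> ~= 0" using \<kappa>(2) by auto
 have inv': "p (x + t *\<^sub>R g a) = p x" for x t
  using inv[of x "t / \<kappa>"] \<kappa>0 by (simp add: \<kappa>(1))
 have pc: "cont p" by (rule ps_continuous[OF p])
 obtain y where y: "y : face a" "(LBINT x:ball y r. (p x)^2) <= 2 * r * norm (g a) * (LINT x:face a|surf a. (p x)^2)"
  by (rule face_ball_integral[OF a r ball_T pc inv'])
 have yT: "y : T" using y(1) face_iff[OF a] by simp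
 have "(p x)^2 <= Cs / r ^ CARD('n) * (LBINT x:ball y r. (p x)^2)"
  by (rule Cs[OF p r norm_edge2[OF x yT]])
 also have "... <= Cs / r ^ CARD('n) * (2 * r * norm (g a) * (LINT x:face a|surf a. (p x)^2))"
  using Cs0 r by (intro mult_left_mono y(2)) auto
 finally show ?thesis
  using face_integral_continuous[OF a \<nu>, of "%x. (p x)^2"] pc by (simp add: continuous_intros mult.assoc)
qed

text \<open>Everything follows from the pointwise bound of \<open>\<tau> x - c\<close> by
  \<open>Y\<close>, where \<open>c\<close> is the mean of \<open>G\<close>. Times the volume this is
  of order \<open>r\<^sup>2 * D\<close>; the inverse estimate for the divergence divides by
  \<open>r\<^sup>2\<close>. Times the area of a face it is of order \<open>r * D\<close>, and the
  inverse diameter removes \<open>r\<close>.\<close>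

theorem element_stress:
 assumes n2: "2 <= CARD('n)" and rR: "r <= R" and \<nu>: "ALL F. F facet_of T --> unit_normal (\<nu> F) F"
  and G: "ALL i j. C1 (%x. G x $ i $ j)" and Gtr: "ALL x. trace (G x) = 0"
  and q: "ALL F. F facet_of T --> face_datum k (\<nu> F) G F (q F)"
  and \<rho>: "ALL i j. (%x. \<rho> x $ i $ j) : poly_space (int k - 1)" and tr: "ALL x:T. trace (\<rho> x) = 0"
 shows "EX \<tau>. element_interpolant k (element_const CARD('n) (measure lborel (ball (0::real^'n) 1)) K R Cs Cp) \<nu> q G \<rho> T \<tau>"
proof -
 define B1 where "B1 = local_const CARD('n) (measure lborel (ball (0::real^'n) 1)) K Cs"
 have B1: "0 < B1" unfolding B1_def by (intro local_const_pos K0 Cs0) simp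
 define N where "N = real CARD('n)"
 define E3 where "E3 = (2 * K) ^ CARD('n) * measure lborel (ball (0::real^'n) 1)"
 define Cn where "Cn = (N + 1) * 2 ^ CARD('n) + 1"
 define B2 where "B2 = B1 * (20 * Cs * Cn * K^2 + 2 ^ CARD('n) * K^2)"
 define X1 where "X1 = 4 * (B2 * R^2 * E3) + 4 * (2 ^ CARD('n) * K^2 * R^2)"
 define X2 where "X2 = N ^ 3 * (Cp * B2 * E3) * E3"
 define X3 where "X3 = 2 * B2 * N * E3 + 2 * Cn * K^2"
 define B where "B = 2 + X1 + X2 + X3"
 have N0: "0 <= N" by (simp add: N_def)
 have E30: "0 <= E3" using K0 by (simp add: E3_def)
 have Cn0: "0 <= Cn" using N0 by (simp add: Cn_def)
 have B20: "0 <= B2" unfolding B2_def using B1 Cs0 Cn0 by (intro mult_nonneg_nonneg add_nonneg_nonneg) auto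
 have X0: "0 <= X1" "0 <= X2" "0 <= X3" unfolding X1_def X2_def X3_def using N0 E30 Cn0 B20 Cp0 by auto
 have B0: "0 < B" unfolding B_def using X0 by linarith
 have G': "!!i j. C1 (%x. G x $ i $ j)" using G by simp
 define D where "D = (LBINT x:T. gradient_square G x)"
 define c :: "real^'n^'n" where "c = (\<chi> i j. (LBINT x:T. G x $ i $ j) / (LBINT x:T. 1))"
 have Gc: "cont G" by (rule G_cont[OF G'])
 have D0: "0 <= D" unfolding D_def by (rule gradient_square_integral_nonneg[OF G'])
 have ctr: "trace c = 0" unfolding c_def by (rule mean_trace[OF G']) (use Gtr in simp)
 have ms: "(LBINT x:T. (norm (G x - c))^2) <= 2 ^ CARD('n) * (K * r)^2 * D"
  unfolding c_def D_def by (rule mean_square[OF G'])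
 have \<nu>a: "unit_normal (\<nu> (face a)) (face a)" if "a : C" for a using \<nu> facet_iff that by blast
 have msf: "face_integral (\<nu> (face a)) (face a) (%x. (norm (G x *v \<nu> (face a) - c *v \<nu> (face a)))^2) <= Cn * K^2 * r * D" if a: "a : C" for a
  unfolding c_def D_def Cn_def N_def by (rule mean_square_face[OF G' a \<nu>a[OF a]])
 have "EX \<kappa>. \<nu> (face a) = \<kappa> *\<^sub>R g a & \<bar>\<kappa>\<bar> * norm (g a) = 1" if a: "a : C" for a
  using unit_normal_parallel[OF a \<nu>a[OF a]] by metis
 then obtain \<kappa> where \<kappa>: "!!a. a : C ==> \<nu> (face a) = \<kappa> a *\<^sub>R g a" "!!a. a : C ==> \<bar>\<kappa> a\<bar> * norm (g a) = 1" by metis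
 \<comment> \<open>The factor 20 is 2 from the slab of thickness \<open>2 * r\<close> times 10 from
   \<open>face_datum\<close>. One power of \<open>r\<close> comes from that thickness, the other
   from the approximation of \<open>G\<close> on the face.\<close>
 define W where "W = 20 * Cs * Cn * K^2 * r^2 / r ^ CARD('n) * D"
 have qa: "!!i. (%x. q (face a) x $ i) : poly_space (int k)" "!!x t. q (face a) (x + t *\<^sub>R \<nu> (face a)) = q (face a) x"
  "!!w. face_integral (\<nu> (face a)) (face a) (%x. (norm (q (face a) x - w))^2) <= 10 * face_integral (\<nu> (face a)) (face a) (%x. (norm (G x *v \<nu> (face a) - w))^2)"
  if "a : C" for a using q[unfolded face_datum_def] facet_iff that by blast+
 have qW: "(norm (q (face a) x - \<kappa> a *\<^sub>R (c *v g a)))^2 <= W" if a: "a : C" and x: "x : T" for a x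
 proof -
  let ?n = "\<nu> (face a)"
  define p where "p i x = q (face a) x $ i - (c *v ?n) $ i" for i x
  have pp: "p i : poly_space (int k)" for i
   unfolding p_def by (intro ps_diff qa(1) a ps_const) simp
  have pinv: "p i (x + t *\<^sub>R ?n) = p i x" for i x t unfolding p_def using qa(2)[OF a] by simp
  have i1: "set_integrable (surf a) (face a) (%x. (p i x)^2)" for i
   by (intro surf_integrable continuous_intros ps_continuous[OF pp])
  have nsq: "(norm (q (face a) x - c *v ?n))^2 = (SUM i:UNIV. (p i x)^2)" for x
   unfolding power2_norm_eq_inner inner_vec_def by (simp add: p_def power2_eq_square)
  have "(norm (q (face a) x - c *v ?n))^2 <= (SUM i:UNIV. Cs / r ^ CARD('n) * (2 * r * face_integral ?n (face a) (%x. (p i x)^2)))"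
   unfolding nsq by (rule sum_mono, rule invariant_poly_bound[OF a \<nu>a[OF a] pp pinv x])
  also have "... = Cs / r ^ CARD('n) * (2 * r * (SUM i:UNIV. face_integral ?n (face a) (%x. (p i x)^2)))"
   by (simp only: sum_distrib_left)
  also have "(SUM i:UNIV. face_integral ?n (face a) (%x. (p i x)^2)) = (SUM i:UNIV. norm (g a) * (LINT x:face a|surf a. (p i x)^2))"
   by (intro sum.cong refl face_integral_continuous a \<nu>a continuous_intros ps_continuous[OF pp])
  also have "... = norm (g a) * (LINT x:face a|surf a. (SUM i:UNIV. (p i x)^2))"
   by (simp add: set_integral_sum i1 sum_distrib_left)
  also have "... = face_integral ?n (face a) (%x. (SUM i:UNIV. (p i x)^2))"
   by (intro face_integral_continuous[symmetric] a \<nu>a continuous_intros ps_continuous[OF pp])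
  also have "... = face_integral ?n (face a) (%x. (norm (q (face a) x - c *v ?n))^2)" by (simp only: nsq)
  also have "Cs / r ^ CARD('n) * (2 * r * ...) <= Cs / r ^ CARD('n) * (2 * r * (10 * (Cn * K^2 * r * D)))"
   using Cs0 r qa(3)[OF a, of "c *v ?n"] msf[OF a] by (intro mult_left_mono) auto
  also have "... = W" by (simp add: W_def power2_eq_square)
  finally show ?thesis by (simp add: \<kappa>(1)[OF a] matrix_vector_mult_scaleR)
 qed
 have k1: "ALL a:C. \<bar>\<kappa> a\<bar> * norm (g a) = 1" and k2: "ALL a:C. ALL i. (%x. q (face a) x $ i) : poly_space (int k)"
  and k3: "ALL a:C. ALL x:T. (norm (q (face a) x - \<kappa> a *\<^sub>R (c *v g a)))^2 <= W" using \<kappa>(2) qa(1) qW by simp_all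
 from local_stress[OF k1 k2 Gc ctr \<rho> tr k3, folded B1_def]
 obtain \<tau> where \<tau>p: "!!i j. (%x. \<tau> x $ i $ j) : poly_space (int k)" and \<tau>tr: "!!x. trace (\<tau> x) = 0"
  and \<tau>t: "!!a x l m. a : C ==> x : face a ==> l : C - {a} ==> m : C - {a} ==> (l - m) \<bullet> (\<tau> x *v (\<kappa> a *\<^sub>R g a) - q (face a) x) = 0"
  and \<tau>o: "(LBINT x:T. \<tau> x \<bullet> \<rho> x) = (LBINT x:T. G x \<bullet> \<rho> x)"
  and \<tau>b: "!!x. x : T ==> (norm (\<tau> x - c))^2 <= B1 * (W + 1 / r ^ CARD('n) * (LBINT x:T. (norm (G x - c))^2))"
  by (elim exE conjE) (rule that; blast)
 define Y where "Y = B2 * r^2 / r ^ CARD('n) * D"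
 have Y0: "0 <= Y" unfolding Y_def using B20 D0 r by simp
 have \<tau>Y: "(norm (\<tau> x - c))^2 <= Y" if x: "x : T" for x
 proof -
  have "(norm (\<tau> x - c))^2 <= B1 * (W + 1 / r ^ CARD('n) * (2 ^ CARD('n) * (K * r)^2 * D))"
   by (rule order_trans[OF \<tau>b[OF x]]) (intro mult_left_mono add_left_mono ms; use B1 r in simp)
  also have "... = Y" by (simp add: W_def Y_def B2_def power_mult_distrib add_divide_distrib algebra_simps)
  finally show ?thesis .
 qed
 have \<tau>c: "cont \<tau>" by (rule poly_matrix_continuous[OF \<tau>p])
 have vol: "(LBINT x:T. 1) <= E3 * r ^ CARD('n)" using T_volume_le by (simp add: E3_def)
 have Yvol: "Y * (LBINT x:T. 1) <= B2 * E3 * r^2 * D"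
 proof -
  have "Y * (LBINT x:T. 1) <= Y * (E3 * r ^ CARD('n))" by (intro mult_left_mono vol Y0)
  then show ?thesis using r by (simp add: Y_def mult_ac)
 qed
 have r2: "r^2 <= R^2" using r rR by (intro power_mono) auto
 have tang: "tangential (\<nu> (face a)) (\<tau> x *v \<nu> (face a)) = tangential (\<nu> (face a)) (q (face a) x)" if a: "a : C" and x: "x : face a" for a x
 proof -
  obtain i where i: "i : C" "i ~= a" using exists_other[OF a] by blast
  let ?w = "\<tau> x *v \<nu> (face a) - q (face a) x"
  have w: "?w = ((a - i) \<bullet> ?w) *\<^sub>R g a"
   by (rule parallel_to_normal[OF a i]) (use \<tau>t[OF a x] \<kappa>(1)[OF a] in simp)
  have \<kappa>0: "\<kappa> a ~= 0" using \<kappa>(2)[OF a] by auto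
  have "?w = (((a - i) \<bullet> ?w) / \<kappa> a) *\<^sub>R \<nu> (face a)" using w \<kappa>0 by (simp add: \<kappa>(1)[OF a])
  then obtain s where s: "?w = s *\<^sub>R \<nu> (face a)" by blast
  have "norm (\<nu> (face a)) = 1" using \<nu>a[OF a] by (simp add: unit_normal_def)
  then have "tangential (\<nu> (face a)) ?w = 0" unfolding s by (simp add: tangential_def dot_square_norm)
  then show ?thesis by (simp add: tangential_diff)
 qed
 have int\<tau>: "(LBINT x:T. (norm (\<tau> x))^2) <= B * ((LBINT x:T. (norm (G x))^2) + D)"
 proof -
  have "(LBINT x:T. (norm (\<tau> x))^2) <= (LBINT x:T. 2 * (norm (G x))^2 + (4 * Y * 1 + 4 * (norm (G x - c))^2))"
  proof (intro set_integral_mono T_integrable continuous_intros \<tau>c Gc)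
   fix x assume x: "x : T"
   have 1: "(norm (\<tau> x))^2 <= 2 * (norm (G x))^2 + 2 * (norm (\<tau> x - G x))^2"
    using norm_add_square_le[of "G x" "\<tau> x - G x"] by simp
   have 2: "(norm (\<tau> x - G x))^2 <= 2 * (norm (\<tau> x - c))^2 + 2 * (norm (G x - c))^2"
    using norm_diff_square_le[of "\<tau> x - c" "G x - c"] by simp
   show "(norm (\<tau> x))^2 <= 2 * (norm (G x))^2 + (4 * Y * 1 + 4 * (norm (G x - c))^2)" using 1 2 \<tau>Y[OF x] by linarith
  qed
  also have "... = (LBINT x:T. 2 * (norm (G x))^2) + ((LBINT x:T. 4 * Y * 1) + (LBINT x:T. 4 * (norm (G x - c))^2))"
   by (subst set_integral_add(2), (intro T_integrable continuous_intros Gc)+)+ simp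
  also have "... = 2 * (LBINT x:T. (norm (G x))^2) + (4 * (Y * (LBINT x:T. 1)) + 4 * (LBINT x:T. (norm (G x - c))^2))"
   unfolding set_integral_mult_right by simp
  also have "... <= 2 * (LBINT x:T. (norm (G x))^2) + (4 * (B2 * E3 * R^2 * D) + 4 * (2 ^ CARD('n) * K^2 * R^2 * D))"
  proof (intro add_left_mono add_mono mult_left_mono)
   show "Y * (LBINT x:T. 1) <= B2 * E3 * R^2 * D"
    by (rule order_trans[OF Yvol]) (intro mult_right_mono mult_left_mono r2; use B20 E30 D0 in simp)
   show "(LBINT x:T. (norm (G x - c))^2) <= 2 ^ CARD('n) * K^2 * R^2 * D"
    by (rule order_trans[OF ms]) (use r2 D0 in \<open>simp add: power_mult_distrib mult_left_mono mult_right_mono mult.assoc\<close>)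
  qed simp_all
  also have "... = 2 * (LBINT x:T. (norm (G x))^2) + X1 * D" by (simp add: X1_def algebra_simps)
  also have "... <= B * (LBINT x:T. (norm (G x))^2) + B * D"
   using X0 D0 by (intro add_mono mult_right_mono) (auto simp: B_def set_lebesgue_integral_def intro!: integral_nonneg_AE)
  finally show ?thesis by (simp add: distrib_left)
 qed
 have intdiv: "(LBINT x:T. (norm (mat_divergence \<tau> x))^2) <= B * D"
 proof -
  define Z where "Z = Cp * B2 * E3 / r ^ CARD('n) * D"
  have zb: "ball z r \<subseteq> T" using ball_T by (meson ball_subset_cball order_trans)
  have zT: "z : T" using ball_T r by auto
  have pb: "(partial j (%y. \<tau> y $ i $ j) x)^2 <= Z" if x: "x : T" for x i j
  proof -
   \<comment> \<open>Subtracting the mean leaves the derivative unchanged and gains the factor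
     \<open>r\<^sup>2\<close> that the inverse estimate loses.\<close>
   let ?p = "%y. \<tau> y $ i $ j - c $ i $ j"
   have pp: "?p : poly_space (int k)" by (intro ps_diff \<tau>p ps_const) simp
   have "partial j ?p x = partial j (%y. \<tau> y $ i $ j) x"
    by (simp add: partial_diff ps_differentiable[OF \<tau>p])
   then have "(partial j (%y. \<tau> y $ i $ j) x)^2 <= Cp / (r^2 * r ^ CARD('n)) * (LBINT x:ball z r. (?p x)^2)"
    using Cp[OF pp r norm_edge2[OF x zT], of j] by simp
   also have "... <= Cp / (r^2 * r ^ CARD('n)) * (B2 * E3 * r^2 * D)"
   proof (intro mult_left_mono)
    have "(LBINT x:ball z r. (?p x)^2) <= (LBINT x:T. (?p x)^2)"
     by (intro set_lebesgue_integral_mono_set T_integrable zb continuous_intros \<tau>c) auto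
    also have "... <= (LBINT x:T. Y * 1)"
    proof (intro set_integral_mono T_integrable continuous_intros \<tau>c)
     fix x assume x: "x : T"
     have "\<bar>(\<tau> x - c) $ i $ j\<bar> <= norm (\<tau> x - c)" using component_le_norm_cart[of "(\<tau> x - c) $ i" j] Finite_Cartesian_Product.norm_nth_le[of "\<tau> x - c" i] by linarith
     then have "(?p x)^2 <= (norm (\<tau> x - c))^2" by (intro abs_le_square_iff[THEN iffD1]) simp
     then show "(?p x)^2 <= Y * 1" using \<tau>Y[OF x] by simp
    qed
    also have "... = Y * (LBINT x:T. 1)" by (rule set_integral_mult_right)
    finally show "(LBINT x:ball z r. (?p x)^2) <= B2 * E3 * r^2 * D" using Yvol by linarith
   qed (use Cp0 r in simp)
   also have "... = Z" using r by (simp add: Z_def)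
   finally show ?thesis .
  qed
  have Z0: "0 <= Z" unfolding Z_def using Cp0 B20 E30 D0 r by simp
  have dvb: "(norm (mat_divergence \<tau> x))^2 <= N ^ 3 * Z * 1" if x: "x : T" for x
  proof -
   have "(norm (mat_divergence \<tau> x))^2 = (SUM i:UNIV. (SUM j:UNIV. partial j (%y. \<tau> y $ i $ j) x)^2)"
    unfolding power2_norm_eq_inner inner_vec_def by (simp add: mat_divergence_def divergence_def power2_eq_square)
   also have "... <= (SUM i:(UNIV::'n set). N * (SUM j:(UNIV::'n set). Z))"
   proof (intro sum_mono)
    fix i
    have "(SUM j:UNIV. partial j (%y. \<tau> y $ i $ j) x)^2 <= N * (SUM j:UNIV. (partial j (%y. \<tau> y $ i $ j) x)^2)"
     using sum_squared_le_sum_of_squares[of "%j. partial j (%y. \<tau> y $ i $ j) x" UNIV] by (simp add: N_def mult.commute)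
    also have "... <= N * (SUM j:(UNIV::'n set). Z)" by (intro mult_left_mono sum_mono pb x N0)
    finally show "(SUM j:UNIV. partial j (%y. \<tau> y $ i $ j) x)^2 <= N * (SUM j:(UNIV::'n set). Z)" .
   qed
   also have "... = N ^ 3 * Z * 1" by (simp add: N_def power3_eq_cube)
   finally show ?thesis .
  qed
  have "cont (mat_divergence \<tau>)"
   unfolding mat_divergence_def divergence_def
   by (intro continuous_on_vec_lambda continuous_on_sum ps_continuous[OF ps_partial[OF \<tau>p]])
  then have "(LBINT x:T. (norm (mat_divergence \<tau> x))^2) <= (LBINT x:T. N ^ 3 * Z * 1)"
   by (intro set_integral_mono T_integrable dvb continuous_intros)
  also have "... = N ^ 3 * Z * (LBINT x:T. 1)" by (rule set_integral_mult_right)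
  also have "... <= N ^ 3 * Z * (E3 * r ^ CARD('n))" by (intro mult_left_mono vol mult_nonneg_nonneg Z0) (simp add: N_def)
  also have "... = X2 * D" using r by (simp add: Z_def X2_def)
  also have "... <= B * D" using X0 D0 by (intro mult_right_mono) (auto simp: B_def)
  finally show ?thesis .
 qed
 have intface: "inverse (diameter (face a)) * face_integral (\<nu> (face a)) (face a) (%x. (norm (\<tau> x *v \<nu> (face a) - G x *v \<nu> (face a)))^2) <= B * D"
  if a: "a : C" for a
 proof -
  let ?n = "\<nu> (face a)"
  have n1: "norm ?n = 1" using \<nu>a[OF a] by (simp add: unit_normal_def)
  have lin: "face_integral ?n (face a) (%x. 2 * Y * 1 + 2 * (norm (G x *v ?n - c *v ?n))^2)
    = 2 * Y * face_integral ?n (face a) (%x. 1) + 2 * face_integral ?n (face a) (%x. (norm (G x *v ?n - c *v ?n))^2)"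
  proof -
   have "(LINT x:face a|surf a. 2 * Y * 1 + 2 * (norm (G x *v ?n - c *v ?n))^2) = (LINT x:face a|surf a. 2 * Y * 1) + (LINT x:face a|surf a. 2 * (norm (G x *v ?n - c *v ?n))^2)"
    by (intro set_integral_add(2) surf_integrable continuous_intros Gc)
   also have "... = 2 * Y * (LINT x:face a|surf a. 1) + 2 * (LINT x:face a|surf a. (norm (G x *v ?n - c *v ?n))^2)"
    unfolding set_integral_mult_right ..
   finally have e: "(LINT x:face a|surf a. 2 * Y * 1 + 2 * (norm (G x *v ?n - c *v ?n))^2) = ..." .
   have f1: "face_integral ?n (face a) (%x. 2 * Y * 1 + 2 * (norm (G x *v ?n - c *v ?n))^2) = norm (g a) * (LINT x:face a|surf a. 2 * Y * 1 + 2 * (norm (G x *v ?n - c *v ?n))^2)"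
    by (intro face_integral_continuous a \<nu>a continuous_intros Gc)
   have f2: "face_integral ?n (face a) (%x. 1) = norm (g a) * (LINT x:face a|surf a. 1)"
    by (intro face_integral_continuous a \<nu>a continuous_intros)
   have f3: "face_integral ?n (face a) (%x. (norm (G x *v ?n - c *v ?n))^2) = norm (g a) * (LINT x:face a|surf a. (norm (G x *v ?n - c *v ?n))^2)"
    by (intro face_integral_continuous a \<nu>a continuous_intros Gc)
   show ?thesis unfolding f1 f2 f3 e by (simp add: algebra_simps)
  qed
  have area: "face_integral ?n (face a) (%x. 1) <= N * E3 * r ^ CARD('n) / r"
   using face_area_le[OF a \<nu>a[OF a]] by (simp add: N_def E3_def)
  have "face_integral ?n (face a) (%x. (norm (\<tau> x *v ?n - G x *v ?n))^2) <= face_integral ?n (face a) (%x. 2 * Y * 1 + 2 * (norm (G x *v ?n - c *v ?n))^2)"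
  proof (intro face_integral_le a \<nu>a continuous_intros \<tau>c Gc)
   fix x assume x: "x : face a"
   have xT: "x : T" using x face_iff[OF a] by simp
   have 1: "(norm (\<tau> x *v ?n - G x *v ?n))^2 <= 2 * (norm (\<tau> x *v ?n - c *v ?n))^2 + 2 * (norm (G x *v ?n - c *v ?n))^2"
    using norm_diff_square_le[of "\<tau> x *v ?n - c *v ?n" "G x *v ?n - c *v ?n"] by simp
   have "norm (\<tau> x *v ?n - c *v ?n) <= norm (\<tau> x - c)"
    using norm_matrix_vector_le[of "\<tau> x - c" ?n] n1 by (simp add: matrix_vector_mult_diff_rdistrib)
   then have "(norm (\<tau> x *v ?n - c *v ?n))^2 <= (norm (\<tau> x - c))^2" by (intro power_mono) auto
   then show "(norm (\<tau> x *v ?n - G x *v ?n))^2 <= 2 * Y * 1 + 2 * (norm (G x *v ?n - c *v ?n))^2" using 1 \<tau>Y[OF xT] by linarith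
  qed
  also have "... <= 2 * Y * (N * E3 * r ^ CARD('n) / r) + 2 * (Cn * K^2 * r * D)"
   unfolding lin using Y0 by (intro add_mono mult_left_mono area msf a) auto
  also have "... = r * (X3 * D)" using r by (simp add: Y_def X3_def power2_eq_square algebra_simps)
  finally have 1: "face_integral ?n (face a) (%x. (norm (\<tau> x *v ?n - G x *v ?n))^2) <= r * (X3 * D)" .
  have d: "r <= diameter (face a)" by (rule diameter_face_ge[OF n2 a])
  have "inverse (diameter (face a)) * face_integral ?n (face a) (%x. (norm (\<tau> x *v ?n - G x *v ?n))^2) <= inverse r * (r * (X3 * D))"
   using 1 d r X0 D0 by (intro mult_mono' le_imp_inverse_le) (auto simp: face_integral_def set_lebesgue_integral_def intro!: integral_nonneg_AE)
  also have "... = X3 * D" using r by simp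
  also have "... <= B * D" using X0 D0 by (intro mult_right_mono) (auto simp: B_def)
  finally show ?thesis .
 qed
 have c: "element_const CARD('n) (measure lborel (ball (0::real^'n) 1)) K R Cs Cp = B"
  by (simp add: element_const_def Let_def B_def X1_def X2_def X3_def B1_def B2_def E3_def Cn_def N_def)
 show ?thesis unfolding c element_interpolant_def
 proof (rule exI[of _ \<tau>], intro conjI)
  show "ALL F. F facet_of T --> (ALL x:F. tangential (\<nu> F) (\<tau> x *v \<nu> F) = tangential (\<nu> F) (q F x))"
  proof (intro allI impI ballI)
   fix F x assume F: "F facet_of T" and x: "x : F"
   obtain a where a: "a : C" "F = face a" using F facet_iff by blast
   show "tangential (\<nu> F) (\<tau> x *v \<nu> F) = tangential (\<nu> F) (q F x)"
    unfolding a(2) by (rule tang[OF a(1)]) (use x a(2) in simp)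
  qed
  show "ALL F. F facet_of T --> inverse (diameter F) * face_integral (\<nu> F) F (%x. (norm (\<tau> x *v \<nu> F - G x *v \<nu> F))^2)
    <= B * (LBINT x:T. gradient_square G x)"
  proof (intro allI impI)
   fix F assume F: "F facet_of T"
   obtain a where a: "a : C" "F = face a" using F facet_iff by blast
   show "inverse (diameter F) * face_integral (\<nu> F) F (%x. (norm (\<tau> x *v \<nu> F - G x *v \<nu> F))^2) <= B * (LBINT x:T. gradient_square G x)"
    unfolding a(2) using intface[OF a(1)] by (simp only: D_def)
  qed
 qed (use int\<tau> intdiv \<tau>p \<tau>tr \<tau>o in \<open>simp_all only: D_def not_False_eq_True simp_thms\<close>)

qed

end

subsection \<open>The interpolant on a mesh\<close>

lemma tangential_inner: "u \<bullet> tangential n w = tangential n u \<bullet> w"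
 by (simp add: tangential_def inner_diff_left inner_diff_right inner_commute)

lemma continuous_on_tangential [continuous_intros]:
 "continuous_on S w ==> continuous_on S (%x. tangential n (w x))"
 unfolding tangential_def by (intro continuous_intros)

text \<open>One functional has to be matched, so the mean plus one multiple of \<open>J\<close>
  suffices. Pythagoras for the mean bounds both parts by the deviation of \<open>f\<close> from any
  constant.\<close>

lemma functional_correction:
 fixes f J :: "real^'n::finite => real^'n"
 assumes int: "!!\<phi>::real^'n => real. cont \<phi> ==> set_integrable M F \<phi>"
  and pos: "0 < (LINT x:F|M. (1::real))" and f: "cont f" and J: "cont J"
 shows "EX m \<theta>. (LINT x:F|M. (m + \<theta> *\<^sub>R J x - f x) \<bullet> J x) = 0 &
   (ALL w. (LINT x:F|M. (norm (m + \<theta> *\<^sub>R J x - w))^2) <= 10 * (LINT x:F|M. (norm (f x - w))^2))"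
proof -
 define a where "a = (LINT x:F|M. (1::real))"
 define m :: "real^'n" where "m = (\<chi> i. (LINT x:F|M. f x $ i) / a)"
 have a: "0 < a" using pos by (simp add: a_def)
 have mean: "(LINT x:F|M. (f x - m) \<bullet> u) = 0" for u
 proof -
  have "(LINT x:F|M. (f x - m) \<bullet> u) = (LINT x:F|M. SUM i:UNIV. u $ i * (f x $ i - m $ i))"
   by (simp add: inner_vec_def mult.commute)
  also have "... = (SUM i:UNIV. LINT x:F|M. u $ i * (f x $ i - m $ i))"
   by (intro set_integral_sum int continuous_intros f)
  also have "... = (SUM i:UNIV. u $ i * ((LINT x:F|M. f x $ i) - (LINT x:F|M. m $ i)))"
   by (simp add: set_integral_diff int continuous_intros f)
  also have "... = 0"
  proof (intro sum.neutral ballI)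
   fix i
   have "(LINT x:F|M. m $ i) = m $ i * a" using set_integral_mult_right[where M=M and A=F and a="m $ i" and f="%_. 1"] by (simp add: a_def)
   then show "u $ i * ((LINT x:F|M. f x $ i) - (LINT x:F|M. m $ i)) = 0" using a by (simp add: m_def)
  qed
  finally show ?thesis .
 qed
 have split: "(LINT x:F|M. (norm (f x - w))^2) = (LINT x:F|M. (norm (f x - m))^2) + (LINT x:F|M. (norm (m - w))^2)" for w
 proof -
  have "(%x. (norm (f x - w))^2) = (%x. (norm (f x - m))^2 + ((f x - m) \<bullet> (2 *\<^sub>R (m - w)) + (norm (m - w))^2))"
  proof
   fix x
   have "f x - w = (f x - m) + (m - w)" by simp
   then show "(norm (f x - w))^2 = (norm (f x - m))^2 + ((f x - m) \<bullet> (2 *\<^sub>R (m - w)) + (norm (m - w))^2)"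
    by (simp only: power2_norm_eq_inner inner_add_left inner_add_right inner_scaleR_right) (simp add: inner_commute)
  qed
  then have "(LINT x:F|M. (norm (f x - w))^2) = (LINT x:F|M. (norm (f x - m))^2 + ((f x - m) \<bullet> (2 *\<^sub>R (m - w)) + (norm (m - w))^2))" by simp
  also have "... = (LINT x:F|M. (norm (f x - m))^2) + ((LINT x:F|M. (f x - m) \<bullet> (2 *\<^sub>R (m - w))) + (LINT x:F|M. (norm (m - w))^2))"
  proof -
   have i1: "set_integrable M F (%x. (norm (f x - m))^2)" and i2: "set_integrable M F (%x. (f x - m) \<bullet> (2 *\<^sub>R (m - w)))"
    and i3: "set_integrable M F (%x. (norm (m - w))^2)" by (intro int continuous_intros f)+
   show ?thesis by (simp only: set_integral_add(2)[OF i1 set_integral_add(1)[OF i2 i3]] set_integral_add(2)[OF i2 i3])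
  qed
  finally show ?thesis by (simp only: mean add_0_left)
 qed
 have nonneg: "0 <= (LINT x:F|M. (norm (h x))^2)" for h :: "real^'n => real^'n"
  unfolding set_lebesgue_integral_def by (intro integral_nonneg_AE) auto
 define S where "S = (LINT x:F|M. (norm (J x))^2)"
 define Y where "Y = (LINT x:F|M. (f x - m) \<bullet> J x)"
 define \<theta> where "\<theta> = Y / S"
 have CS: "Y^2 <= (LINT x:F|M. (norm (f x - m))^2) * S"
  unfolding Y_def S_def by (intro set_integral_Cauchy_Schwarz int continuous_intros f J)
 have S0: "0 <= S" unfolding S_def by (rule nonneg)
 have \<theta>S: "\<theta> * S = Y" using CS by (cases "S = 0") (auto simp: \<theta>_def)
 have \<theta>2: "\<theta>^2 * S <= (LINT x:F|M. (norm (f x - m))^2)"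
 proof (cases "S = 0")
  case True
  then show ?thesis using nonneg by simp
 next
  case False
  then have "\<theta>^2 * S = Y^2 / S" by (simp add: \<theta>_def power_divide power2_eq_square)
  also have "... <= (LINT x:F|M. (norm (f x - m))^2)" using CS False S0 by (simp add: divide_le_eq)
  finally show ?thesis .
 qed
 have "(LINT x:F|M. (m + \<theta> *\<^sub>R J x - f x) \<bullet> J x) = (LINT x:F|M. \<theta> * (norm (J x))^2 - (f x - m) \<bullet> J x)"
  by (simp add: power2_norm_eq_inner inner_diff_left inner_add_left algebra_simps)
 also have "... = (LINT x:F|M. \<theta> * (norm (J x))^2) - (LINT x:F|M. (f x - m) \<bullet> J x)"
  by (intro set_integral_diff(2) int continuous_intros f J)
 also have "... = 0" using \<theta>S by (simp add: S_def Y_def)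
 finally have 1: "(LINT x:F|M. (m + \<theta> *\<^sub>R J x - f x) \<bullet> J x) = 0" .
 have 2: "(LINT x:F|M. (norm (m + \<theta> *\<^sub>R J x - w))^2) <= 10 * (LINT x:F|M. (norm (f x - w))^2)" for w
 proof -
  have "(LINT x:F|M. (norm (m + \<theta> *\<^sub>R J x - w))^2) <= (LINT x:F|M. 2 * (norm (m - w))^2 + 2 * \<theta>^2 * (norm (J x))^2)"
  proof (intro set_integral_mono int continuous_intros J)
   fix x
   show "(norm (m + \<theta> *\<^sub>R J x - w))^2 <= 2 * (norm (m - w))^2 + 2 * \<theta>^2 * (norm (J x))^2"
    using norm_add_square_le[of "m - w" "\<theta> *\<^sub>R J x"] by (simp add: power_mult_distrib algebra_simps)
  qed
  also have "... = (LINT x:F|M. 2 * (norm (m - w))^2) + (LINT x:F|M. 2 * \<theta>^2 * (norm (J x))^2)"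
   by (intro set_integral_add(2) int continuous_intros J)
  also have "... = 2 * (LINT x:F|M. (norm (m - w))^2) + 2 * (\<theta>^2 * S)" unfolding set_integral_mult_right by (simp add: S_def)
  \<comment> \<open>The argument yields the factor 2; 10 leaves room.\<close>
  also have "... <= 10 * (LINT x:F|M. (norm (f x - w))^2)" using split[of w] \<theta>2 nonneg[of "%x. f x - m"] nonneg[of "%x. m - w"] by linarith
  finally show ?thesis .
 qed
 show ?thesis using 1 2 by blast
qed

context mesh begin

lemma face_correction:
 fixes f J :: "real^'n => real^'n"
 assumes F: "F : mesh_faces \<T>" and f: "cont f" and J: "cont J"
 shows "EX m \<theta>. fint F (%x. (m + \<theta> *\<^sub>R J x - f x) \<bullet> J x) = 0 &
   (ALL w. fint F (%x. (norm (m + \<theta> *\<^sub>R J x - w))^2) <= 10 * fint F (%x. (norm (f x - w))^2))"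
proof -
 obtain T where T: "T : \<T>" and FT: "F facet_of T" using F by (auto simp: mesh_faces_def)
 obtain M c where c: "0 < c"
  and M: "!!\<phi>::real^'n => real. cont \<phi> ==> set_integrable M F \<phi> & fint F \<phi> = c * (LINT x:F|M. \<phi> x)"
  and pos: "!!(\<phi>::real^'n => real) z. cont \<phi> ==> (!!x. x : F ==> 0 <= \<phi> x) ==> z : rel_interior F ==> 0 < \<phi> z ==> 0 < (LINT x:F|M. \<phi> x)"
  by (rule facet_measure[OF T FT]) blast
 have "convex F" "F ~= {}" using FT convex_T[OF T] by (auto simp: facet_of_def intro: face_of_imp_convex)
 then obtain z where z: "z : rel_interior F" using rel_interior_eq_empty by blast
 have p1: "0 < (LINT x:F|M. (1::real))" by (rule pos[OF _ _ z]) auto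
 have int: "set_integrable M F \<phi>" if "cont \<phi>" for \<phi> :: "real^'n => real" using M[OF that] by blast
 obtain m \<theta> where o: "(LINT x:F|M. (m + \<theta> *\<^sub>R J x - f x) \<bullet> J x) = 0"
  and b: "!!w. (LINT x:F|M. (norm (m + \<theta> *\<^sub>R J x - w))^2) <= 10 * (LINT x:F|M. (norm (f x - w))^2)"
  using functional_correction[OF int p1 f J] by blast
 have "fint F (%x. (m + \<theta> *\<^sub>R J x - f x) \<bullet> J x) = c * (LINT x:F|M. (m + \<theta> *\<^sub>R J x - f x) \<bullet> J x)"
  by (intro M[THEN conjunct2] continuous_intros f J)
 then have 1: "fint F (%x. (m + \<theta> *\<^sub>R J x - f x) \<bullet> J x) = 0" using o by simp
 have 2: "fint F (%x. (norm (m + \<theta> *\<^sub>R J x - w))^2) <= 10 * fint F (%x. (norm (f x - w))^2)" for w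
 proof -
  have e1: "fint F (%x. (norm (m + \<theta> *\<^sub>R J x - w))^2) = c * (LINT x:F|M. (norm (m + \<theta> *\<^sub>R J x - w))^2)"
   by (intro M[THEN conjunct2] continuous_intros J)
  have e2: "fint F (%x. (norm (f x - w))^2) = c * (LINT x:F|M. (norm (f x - w))^2)"
   by (intro M[THEN conjunct2] continuous_intros f)
  show ?thesis unfolding e1 e2 using mult_left_mono[OF b[of w], of c] c by simp
 qed
 show ?thesis using 1 2 by blast
qed

lemma face_pair:
 assumes F: "F : interior_faces \<Omega> \<T>"
 shows "Tout F : \<T>" "Tin F : \<T>" "Tout F ~= Tin F"
  "F facet_of Tout F" "F facet_of Tin F"
  "outward (\<nu> F) F (Tout F)" "~ outward (\<nu> F) F (Tin F)"
  "{T : \<T>. F facet_of T} = {Tout F, Tin F}"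
 by (rule interior_face_elements[OF F], simp)+

lemma facet_sum_swap:
 "(SUM T:\<T>. \<Sum>F | F facet_of T. f T F) = (SUM F:mesh_faces \<T>. \<Sum>T | T : \<T> & F facet_of T. f T F)"
proof -
 have "(SUM T:\<T>. \<Sum>F | F facet_of T. f T F) = (SUM T:\<T>. \<Sum>F | F : mesh_faces \<T> & F facet_of T. f T F)"
  by (intro sum.cong refl) (auto intro: mesh_facesI)
 also have "... = (SUM F:mesh_faces \<T>. \<Sum>T | T : \<T> & F facet_of T. f T F)"
  by (rule sum.swap_restrict[OF finite_mesh finite_mesh_faces])
 finally show ?thesis .
qed

lemma interior_faces_subset: "interior_faces \<Omega> \<T> \<subseteq> mesh_faces \<T>"
 by (auto simp: interior_faces_def)

lemma matrix_ibp:
 fixes A :: "real^'n => real^'n^'n" and V :: "real^'n => real^'n"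
 assumes T: "T : \<T>" and A: "!!i j. C1 (%x. A x $ i $ j)" and V: "!!i. C1 (%x. V x $ i)"
 shows "(LBINT x:T. mat_divergence A x \<bullet> V x) =
  (\<Sum>F | F facet_of T. fsgn F T * fint F (%x. V x \<bullet> (A x *v \<nu> F)))
  - (LBINT x:T. A x \<bullet> (\<chi> i. gradient (%y. V y $ i) x))"
proof -
 have row: "(LBINT x:T. A x $ i \<bullet> gradient (%y. V y $ i) x) =
   (\<Sum>F | F facet_of T. fsgn F T * fint F (%x. V x $ i * (\<nu> F \<bullet> A x $ i)))
   - (LBINT x:T. V x $ i * divergence (%y. A y $ i) x)" for i
  using element_ibp[OF T, of "%x. A x $ i" "%x. V x $ i"] A V by simp
 have Ac: "cont (%x. A x $ i)" for i
  by (rule continuous_on_vecI) (rule C1_cont[OF A])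
 have Vc: "cont (%x. V x $ i)" for i by (rule C1_cont[OF V])
 have dc: "cont (divergence (%y. A y $ i))" for i
  unfolding divergence_def using A by (intro continuous_intros) simp
 have i1: "set_integrable lborel T (%x. A x $ i \<bullet> gradient (%y. V y $ i) x)" for i
  by (intro element_integral_interior(1)[OF T] continuous_intros Ac gradient_continuous V)
 have i2: "set_integrable lborel T (%x. V x $ i * divergence (%y. A y $ i) x)" for i
  by (intro element_integral_interior(1)[OF T] continuous_intros Vc dc)
 have "(LBINT x:T. A x \<bullet> (\<chi> i. gradient (%y. V y $ i) x)) = (SUM i:UNIV. LBINT x:T. A x $ i \<bullet> gradient (%y. V y $ i) x)"
  unfolding inner_vec_def[of "A _"] by (simp add: set_integral_sum[OF i1])
 also have "... = (SUM i:UNIV. \<Sum>F | F facet_of T. fsgn F T * fint F (%x. V x $ i * (\<nu> F \<bullet> A x $ i)))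
   - (SUM i:UNIV. LBINT x:T. V x $ i * divergence (%y. A y $ i) x)"
  unfolding row sum_subtractf ..
 also have "(SUM i:UNIV. LBINT x:T. V x $ i * divergence (%y. A y $ i) x) = (LBINT x:T. mat_divergence A x \<bullet> V x)"
  by (simp add: inner_vec_def mat_divergence_def set_integral_sum[OF i2, symmetric] mult.commute)
 also have "(SUM i:UNIV. \<Sum>F | F facet_of T. fsgn F T * fint F (%x. V x $ i * (\<nu> F \<bullet> A x $ i)))
   = (\<Sum>F | F facet_of T. fsgn F T * fint F (%x. V x \<bullet> (A x *v \<nu> F)))"
 proof (subst sum.swap, rule sum.cong[OF refl])
  fix F assume "F : {F. F facet_of T}"
  then have F: "F : mesh_faces \<T>" using mesh_facesI[OF T] by simp
  have "fint F (%x. V x \<bullet> (A x *v \<nu> F)) = fint F (%x. SUM i:UNIV. V x $ i * (\<nu> F \<bullet> A x $ i))"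
   by (rule face_integral_cong) (simp add: inner_vec_def[of "V _"] matrix_vector_mul_component inner_commute)
  also have "... = (SUM i:UNIV. fint F (%x. V x $ i * (\<nu> F \<bullet> A x $ i)))"
   by (intro face_integral_sum F continuous_intros Vc Ac)
  finally show "(SUM i:UNIV. fsgn F T * fint F (%x. V x $ i * (\<nu> F \<bullet> A x $ i)))
    = fsgn F T * fint F (%x. V x \<bullet> (A x *v \<nu> F))" by (simp add: sum_distrib_left)
 qed
 finally show ?thesis by simp
qed

end

text \<open>\<open>V T\<close> is a polynomial on the whole space that extends \<open>v\<close> from
  the interior of \<open>T\<close>. This makes traces evaluations and keeps the arbitrary skeleton
  values of \<open>v\<close> out of the way.\<close>

locale mesh_velocity = mesh \<Omega> \<T> \<nu> for \<Omega> :: "(real^'n::finite) set" and \<T> \<nu> +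
 fixes V :: "(real^'n) set => real^'n => real^'n" and k :: nat
 assumes V_poly: "!!T i. T : \<T> ==> (%x. V T x $ i) : poly_space (int k)"
  and V_div: "!!T x. T : \<T> ==> x : T ==> divergence (V T) x = 0"
  and V_normal: "!!F x. F : interior_faces \<Omega> \<T> ==> x : F ==>
    \<nu> F \<bullet> V (Tout F) x = \<nu> F \<bullet> V (Tin F) x"
  and V_boundary: "!!T F x. T : \<T> ==> F facet_of T ==> F \<subseteq> frontier \<Omega> ==> x : F ==> \<nu> F \<bullet> V T x = 0"
begin

lemma V_C1: "T : \<T> ==> C1 (%x. V T x $ i)"
 by (rule ps_C_diff_1[OF V_poly])

lemma V_cont: "T : \<T> ==> cont (V T)"
 by (intro continuous_on_vecI ps_continuous[OF V_poly])

text \<open>After regrouping by faces, the boundary faces drop out since the normal velocity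
  vanishes there; on interior faces it is single-valued and factors out, leaving the jump of
  \<psi>.\<close>

lemma facet_jump_sum:
 fixes \<psi> :: "(real^'n) set => (real^'n) set => real^'n => real"
 assumes \<psi>: "!!T F. T : \<T> ==> cont (\<psi> T F)"
 shows "(SUM T:\<T>. \<Sum>F | F facet_of T. fsgn F T * fint F (%x. \<psi> T F x * (\<nu> F \<bullet> V T x)))
  = (SUM F:interior_faces \<Omega> \<T>. face_integral (\<nu> F) F
    (%x. (\<psi> (Tout F) F x - \<psi> (Tin F) F x) * (\<nu> F \<bullet> V (Tout F) x)))"
proof -
 define c where "c F = (\<Sum>T | T : \<T> & F facet_of T. fsgn F T * fint F (%x. \<psi> T F x * (\<nu> F \<bullet> V T x)))" for F
 have "(SUM T:\<T>. \<Sum>F | F facet_of T. fsgn F T * fint F (%x. \<psi> T F x * (\<nu> F \<bullet> V T x))) = (SUM F:mesh_faces \<T>. c F)"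
  unfolding facet_sum_swap c_def ..
 also have "... = (SUM F:interior_faces \<Omega> \<T>. c F)"
 proof (rule sum.mono_neutral_right[OF finite_mesh_faces interior_faces_subset], rule ballI)
  fix F assume "F : mesh_faces \<T> - interior_faces \<Omega> \<T>"
  then have "F \<subseteq> frontier \<Omega>" by (auto simp: interior_faces_def)
  then show "c F = 0" unfolding c_def
   by (intro sum.neutral ballI) (auto intro!: face_integral_zero simp: V_boundary)
 qed
 also have "... = (SUM F:interior_faces \<Omega> \<T>. face_integral (\<nu> F) F
    (%x. (\<psi> (Tout F) F x - \<psi> (Tin F) F x) * (\<nu> F \<bullet> V (Tout F) x)))"
 proof (rule sum.cong[OF refl])
  fix F assume F: "F : interior_faces \<Omega> \<T>"
  then have Fm: "F : mesh_faces \<T>" using interior_faces_subset by blast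
  obtain T1 T2 where T12: "T1 = Tout F" "T2 = Tin F" by blast
  note e = face_pair[OF F, folded T12] T12[symmetric]
  have "c F = fint F (%x. \<psi> T1 F x * (\<nu> F \<bullet> V T1 x)) - fint F (%x. \<psi> T2 F x * (\<nu> F \<bullet> V T2 x))"
   unfolding c_def e(8) using e(3,6,7) by (simp add: outer_sign_def)
  also have "fint F (%x. \<psi> T2 F x * (\<nu> F \<bullet> V T2 x)) = fint F (%x. \<psi> T2 F x * (\<nu> F \<bullet> V T1 x))"
   by (rule face_integral_cong) (use V_normal[OF F] in \<open>simp add: e(9,10)\<close>)
  also have "fint F (%x. \<psi> T1 F x * (\<nu> F \<bullet> V T1 x)) - fint F (%x. \<psi> T2 F x * (\<nu> F \<bullet> V T1 x))
    = fint F (%x. \<psi> T1 F x * (\<nu> F \<bullet> V T1 x) - \<psi> T2 F x * (\<nu> F \<bullet> V T1 x))"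
   by (rule face_integral_diff[symmetric, OF Fm]) (intro continuous_intros \<psi> V_cont e)+
  finally show "c F = face_integral (\<nu> F) F
    (%x. (\<psi> (Tout F) F x - \<psi> (Tin F) F x) * (\<nu> F \<bullet> V (Tout F) x))"
   by (simp add: e(9,10) left_diff_distrib)
 qed
 finally show ?thesis .
qed

lemma gradient_orthogonal:
 assumes \<phi>: "C1 \<phi>"
 shows "(SUM T:\<T>. LBINT x:T. V T x \<bullet> gradient \<phi> x) = 0"
proof -
 have "(SUM T:\<T>. LBINT x:T. V T x \<bullet> gradient \<phi> x)
   = (SUM T:\<T>. \<Sum>F | F facet_of T. fsgn F T * fint F (%x. \<phi> x * (\<nu> F \<bullet> V T x)))"
 proof (rule sum.cong[OF refl])
  fix T assume T: "T : \<T>"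
  have "(LBINT x:T. \<phi> x * divergence (V T) x) = 0"
   unfolding set_lebesgue_integral_def using V_div[OF T] by (intro integral_eq_zero_AE) (auto simp: indicator_def)
  then show "(LBINT x:T. V T x \<bullet> gradient \<phi> x) = (\<Sum>F | F facet_of T. fsgn F T * fint F (%x. \<phi> x * (\<nu> F \<bullet> V T x)))"
   using element_ibp[OF T V_C1[OF T] \<phi>] by simp
 qed
 also have "... = 0"
  using facet_jump_sum[of "%_ _. \<phi>"] C1_cont[OF \<phi>] by (simp add: face_integral_zero)
 finally show ?thesis .
qed

definition grad_V :: "(real^'n) set => real^'n => real^'n^'n" where
 "grad_V T x = (\<chi> i. gradient (%y. V T y $ i) x)"

text \<open>On interior faces the signs make this the tangential jump, on boundary faces the
  tangential trace up to sign. The latter is included since no boundary condition makes its pairing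
  with the stress vanish.\<close>

definition tangential_sum :: "(real^'n) set => real^'n => real^'n" where
 "tangential_sum F x = tangential (\<nu> F) (\<Sum>T | T : \<T> & F facet_of T. fsgn F T *\<^sub>R V T x)"

text \<open>Interpolation is exact for the bilinear form: tangentially, \<open>\<tau>\<close> and \<open>G\<close> differ by a single-valued
 field on each face, which is orthogonal to the tangential jump of \<open>V\<close>.\<close>

lemma form_identity:
 fixes G :: "real^'n => real^'n^'n" and \<tau> :: "(real^'n) set => real^'n => real^'n^'n"
 assumes G: "!!i j. C1 (%x. G x $ i $ j)" and \<tau>: "!!T i j. T : \<T> ==> C1 (%x. \<tau> T x $ i $ j)"
  and q: "!!F. F : mesh_faces \<T> ==> cont (q F)"
  and tang: "!!T F x. T : \<T> ==> F facet_of T ==> x : F ==> tangential (\<nu> F) (\<tau> T x *v \<nu> F) = tangential (\<nu> F) (q F x)"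
  and ortho: "!!F. F : mesh_faces \<T> ==> fint F (%x. (q F x - G x *v \<nu> F) \<bullet> tangential_sum F x) = 0"
  and bulk: "!!T. T : \<T> ==> (LBINT x:T. \<tau> T x \<bullet> grad_V T x) = (LBINT x:T. G x \<bullet> grad_V T x)"
 shows "(SUM T:\<T>. LBINT x:T. mat_divergence (\<tau> T) x \<bullet> V T x) - (SUM F:interior_faces \<Omega> \<T>. face_integral (\<nu> F) F
    (%x. (\<nu> F \<bullet> (\<tau> (Tout F) x *v \<nu> F) - \<nu> F \<bullet> (\<tau> (Tin F) x *v \<nu> F)) * (\<nu> F \<bullet> V (Tout F) x)))
  = (SUM T:\<T>. LBINT x:T. mat_divergence G x \<bullet> V T x)"
proof -
 define E where "E T F x = \<tau> T x *v \<nu> F - G x *v \<nu> F" for T F x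
 define t where "t F x = tangential (\<nu> F) (q F x - G x *v \<nu> F)" for F x
 have Gc: "cont G" by (intro matrix_continuousI C1_cont G)
 have \<tau>c: "cont (\<tau> T)" if "T : \<T>" for T by (intro matrix_continuousI C1_cont \<tau> that)
 have Ec: "cont (E T F)" if "T : \<T>" for T F unfolding E_def by (intro continuous_intros \<tau>c that Gc)
 have tc: "cont (t F)" if "F : mesh_faces \<T>" for F unfolding t_def by (intro continuous_intros q that Gc)
 \<comment> \<open>The tangential error \<open>t\<close> does not depend on the element, so the
   contributions at a face combine to its pairing with \<open>tangential_sum\<close>, which
   \<open>ortho\<close> makes zero.\<close>
 have s0: "(SUM T:\<T>. \<Sum>F | F facet_of T. fsgn F T * fint F (%x. V T x \<bullet> t F x)) = 0"
  unfolding facet_sum_swap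
 proof (rule sum.neutral, rule ballI)
  fix F assume F: "F : mesh_faces \<T>"
  have fin: "finite {T. T : \<T> & F facet_of T}" using finite_mesh by simp
  have "(\<Sum>T | T : \<T> & F facet_of T. fsgn F T * fint F (%x. V T x \<bullet> t F x))
    = (\<Sum>T | T : \<T> & F facet_of T. fint F (%x. fsgn F T * (V T x \<bullet> t F x)))"
   by (simp only: face_integral_cmult)
  also have "... = fint F (%x. \<Sum>T | T : \<T> & F facet_of T. fsgn F T * (V T x \<bullet> t F x))"
   by (rule face_integral_sum[symmetric, OF F]) (intro continuous_intros V_cont tc F; simp)
  also have "... = fint F (%x. (q F x - G x *v \<nu> F) \<bullet> tangential_sum F x)"
   unfolding tangential_sum_def tangential_inner t_def[symmetric] by (simp add: inner_sum_right inner_commute)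
  also have "... = 0" by (rule ortho[OF F])
  finally show "(\<Sum>T | T : \<T> & F facet_of T. fsgn F T * fint F (%x. V T x \<bullet> t F x)) = 0" .
 qed
 have el: "(LBINT x:T. mat_divergence (\<tau> T) x \<bullet> V T x) - (LBINT x:T. mat_divergence G x \<bullet> V T x)
   = (\<Sum>F | F facet_of T. fsgn F T * fint F (%x. (\<nu> F \<bullet> E T F x) * (\<nu> F \<bullet> V T x)))
    + (\<Sum>F | F facet_of T. fsgn F T * fint F (%x. V T x \<bullet> t F x))" if T: "T : \<T>" for T
 proof -
  have "(LBINT x:T. mat_divergence (\<tau> T) x \<bullet> V T x) - (LBINT x:T. mat_divergence G x \<bullet> V T x)
   = (\<Sum>F | F facet_of T. fsgn F T * fint F (%x. V T x \<bullet> (\<tau> T x *v \<nu> F)))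
    - (\<Sum>F | F facet_of T. fsgn F T * fint F (%x. V T x \<bullet> (G x *v \<nu> F)))"
   unfolding matrix_ibp[OF T \<tau>[OF T] V_C1[OF T]] matrix_ibp[OF T G V_C1[OF T]] using bulk[OF T] by (simp add: grad_V_def)
  also have "... = (\<Sum>F | F facet_of T. fsgn F T * fint F (%x. (\<nu> F \<bullet> E T F x) * (\<nu> F \<bullet> V T x))
    + fsgn F T * fint F (%x. V T x \<bullet> t F x))"
   unfolding sum_subtractf[symmetric]
  proof (rule sum.cong[OF refl])
   fix F assume "F : {F. F facet_of T}"
   then have FT: "F facet_of T" by simp
   have F: "F : mesh_faces \<T>" by (rule mesh_facesI[OF T FT])
   have "fint F (%x. V T x \<bullet> (\<tau> T x *v \<nu> F)) - fint F (%x. V T x \<bullet> (G x *v \<nu> F))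
    = fint F (%x. V T x \<bullet> (\<tau> T x *v \<nu> F) - V T x \<bullet> (G x *v \<nu> F))"
    by (intro face_integral_diff[symmetric] F continuous_intros V_cont \<tau>c T Gc)
   also have "... = fint F (%x. (\<nu> F \<bullet> E T F x) * (\<nu> F \<bullet> V T x) + V T x \<bullet> t F x)"
   proof (rule face_integral_cong)
    fix x assume x: "x : F"
    have "t F x = tangential (\<nu> F) (E T F x)" by (simp add: t_def E_def tangential_diff tang[OF T FT x])
    then show "V T x \<bullet> (\<tau> T x *v \<nu> F) - V T x \<bullet> (G x *v \<nu> F) = (\<nu> F \<bullet> E T F x) * (\<nu> F \<bullet> V T x) + V T x \<bullet> t F x"
     by (simp add: tangential_def E_def inner_diff_right inner_commute)
   qed
   also have "... = fint F (%x. (\<nu> F \<bullet> E T F x) * (\<nu> F \<bullet> V T x)) + fint F (%x. V T x \<bullet> t F x)"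
    by (intro face_integral_add F continuous_intros V_cont Ec T tc)
   finally show "fsgn F T * fint F (%x. V T x \<bullet> (\<tau> T x *v \<nu> F)) - fsgn F T * fint F (%x. V T x \<bullet> (G x *v \<nu> F))
    = fsgn F T * fint F (%x. (\<nu> F \<bullet> E T F x) * (\<nu> F \<bullet> V T x)) + fsgn F T * fint F (%x. V T x \<bullet> t F x)"
    by (simp only: right_diff_distrib[symmetric] distrib_left[symmetric])
  qed
  finally show ?thesis by (simp only: sum.distrib)
 qed
 have "(SUM T:\<T>. LBINT x:T. mat_divergence (\<tau> T) x \<bullet> V T x) - (SUM T:\<T>. LBINT x:T. mat_divergence G x \<bullet> V T x)
  = (SUM T:\<T>. \<Sum>F | F facet_of T. fsgn F T * fint F (%x. (\<nu> F \<bullet> E T F x) * (\<nu> F \<bullet> V T x)))"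
  unfolding sum_subtractf[symmetric] using s0 by (simp add: el sum.distrib)
 also have "... = (SUM F:interior_faces \<Omega> \<T>. face_integral (\<nu> F) F
    (%x. (\<nu> F \<bullet> E (Tout F) F x - \<nu> F \<bullet> E (Tin F) F x) * (\<nu> F \<bullet> V (Tout F) x)))"
  by (rule facet_jump_sum) (intro continuous_intros Ec)
 finally show ?thesis by (simp add: E_def inner_diff_right algebra_simps)
qed

end

subsection \<open>Normal-continuous divergence-free fields\<close>

lemma divergence_coordinates: "divergence (%x::real^'n::finite. x) x = real CARD('n)"
 by (simp add: divergence_def partial_coord)

context mesh begin

text \<open>For \<open>l = k\<close> zero divergence and Euler's identity give
  \<open>(d + k) * q = - div p\<close>, so \<open>q\<close> agrees on the element with a polynomial
  of degree \<open>k - 1\<close>. In either case \<open>q x *\<^sub>R x\<close> has degree at most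
  \<open>k\<close> there.\<close>

lemma velocity_representation:
 fixes k :: nat
 assumes v: "v : velocity_space \<Omega> \<T> \<nu> (int k) l" and w: "v : ker_div \<Omega>" and l: "l = int k \<or> l = int k - 1"
 shows "EX V. mesh_velocity \<Omega> \<T> \<nu> V k & (ALL T:\<T>. ALL x:interior T. v x = V T x)"
proof -
 have wd: "weak_divergence \<Omega> v (%x. 0)" using w by (simp add: ker_div_def)
 have "ALL T:\<T>. EX p q. p : vec_poly_space (int k) & q : hom_poly_space l & (ALL x:interior T. v x = p x + q x *\<^sub>R x)"
 proof
  fix T assume T: "T : \<T>"
  have "EX u:div_shape_space (int k) l. ALL x:interior T. v x = u x"
   using v T by (simp add: velocity_space_def piecewise_def)
  then show "EX p q. p : vec_poly_space (int k) & q : hom_poly_space l & (ALL x:interior T. v x = p x + q x *\<^sub>R x)"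
   unfolding div_shape_space_def by (elim bexE CollectE exE conjE) (intro exI conjI, auto)
 qed
 from bchoice[OF this] obtain p where "ALL T:\<T>. EX q. p T : vec_poly_space (int k) & q : hom_poly_space l & (ALL x:interior T. v x = p T x + q x *\<^sub>R x)"
  by (elim exE) (rule that, assumption)
 from bchoice[OF this] obtain q where pq: "ALL T:\<T>. p T : vec_poly_space (int k) & q T : hom_poly_space l & (ALL x:interior T. v x = p T x + q T x *\<^sub>R x)"
  by (elim exE) (rule that, assumption)
 define U where "U T x = p T x + q T x *\<^sub>R x" for T x
 have p: "(%x. p T x $ i) : poly_space (int k)" if "T : \<T>" for T i using pq that by (simp add: vec_poly_space_def)
 have q: "q T : hom_poly_space l" if "T : \<T>" for T using pq that by simp
 have qp: "q T : poly_space l" if "T : \<T>" for T using hom_poly_space_subset[OF q[OF that]] .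
 have U: "v x = U T x" if "T : \<T>" "x : interior T" for T x using pq that by (simp add: U_def)
 have UC: "C1 (%x. U T x $ i)" if T: "T : \<T>" for T i
  unfolding U_def using C1_add[OF ps_C_diff_1[OF p[OF T]] C1_mult[OF ps_C_diff_1[OF qp[OF T]] C1_coord]] by simp
 have Udiv: "divergence (p T) x + (real CARD('n) + real_of_int l) * q T x = 0" if T: "T : \<T>" and x: "x : T" for T x
 proof -
  have "divergence (U T) x = 0" by (rule divergence_zero[OF U UC wd T x])
  moreover have "divergence (U T) x = divergence (p T) x + divergence (%x. q T x *\<^sub>R x) x"
  proof -
   have d: "(%x. p T x $ i) differentiable at x" "(%x. q T x * x $ i) differentiable at x" for i
    using ps_differentiable[OF p[OF T]] C1_mult[OF ps_C_diff_1[OF qp[OF T]] C1_coord[of i]] by simp_all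
   show ?thesis unfolding divergence_def U_def by (simp add: partial_add[OF d] sum.distrib)
  qed
  moreover have "divergence (%x. q T x *\<^sub>R x) x = q T x * real CARD('n) + x \<bullet> gradient (q T) x"
   using divergence_scale[of "q T" x "%x. x"] ps_differentiable[OF qp[OF T]] by (simp add: divergence_coordinates)
  moreover have "x \<bullet> gradient (q T) x = real_of_int l * q T x"
   using hom_poly_space_euler[OF q[OF T], of x] by (simp add: inner_vec_def gradient_def)
  ultimately show ?thesis by (simp add: algebra_simps)
 qed
 have "ALL T:\<T>. EX W. (ALL i. (%x. W x $ i) : poly_space (int k)) & (ALL x:T. U T x = W x)"
 proof
  fix T assume T: "T : \<T>"
  show "EX W. (ALL i. (%x. W x $ i) : poly_space (int k)) & (ALL x:T. U T x = W x)"
  proof (cases "l = int k")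
   case True
   define c where "c = real CARD('n) + real k"
   have c: "c ~= 0" by (simp add: c_def add_nonneg_eq_0_iff)
   define W where "W x = p T x + (- (1 / c) * divergence (p T) x) *\<^sub>R x" for x
   have "(%x. W x $ i) : poly_space (int k)" for i
   proof -
    have "(%x. (- (1 / c) * divergence (p T) x) * x $ i) : poly_space (int k - 1 + 1)"
     unfolding divergence_def by (intro ps_mult ps_cmult ps_sum ps_partial p[OF T] ps_coord order_refl)
    from ps_add[OF p[OF T, of i] this[unfolded diff_add_cancel]]
    show ?thesis by (simp only: W_def vector_add_component vector_scaleR_component real_scaleR_def)
   qed
   moreover have "U T x = W x" if x: "x : T" for x
   proof -
    have "c * q T x = - divergence (p T) x" using Udiv[OF T x] True by (simp add: c_def)
    then have "q T x = - (1 / c) * divergence (p T) x" using c by (simp add: field_simps)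
    then show ?thesis by (simp add: U_def W_def)
   qed
   ultimately show ?thesis by blast
  next
   case False
   then have l': "l = int k - 1" using l by simp
   have "(%x. U T x $ i) : poly_space (int k)" for i
   proof -
    have "(%x. q T x * x $ i) : poly_space (l + 1)" by (intro ps_mult qp[OF T] ps_coord order_refl)
    then show ?thesis using ps_add[OF p[OF T]] l' by (simp add: U_def)
   qed
   then show ?thesis by blast
  qed
 qed
 from bchoice[OF this] obtain V where V: "ALL T:\<T>. (ALL i. (%x. V T x $ i) : poly_space (int k)) & (ALL x:T. U T x = V T x)"
  by (elim exE) (rule that, assumption)
 have Vp: "(%x. V T x $ i) : poly_space (int k)" if "T : \<T>" for T i using V that by simp
 have vV: "v x = V T x" if T: "T : \<T>" and x: "x : interior T" for T x
  using U[OF T x] V T x interior_subset[of T] by auto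
 have "mesh_velocity \<Omega> \<T> \<nu> V k"
 proof (unfold_locales)
  fix T i assume "T : \<T>" then show "(%x. V T x $ i) : poly_space (int k)" by (rule Vp)
 next
  fix T x assume T: "T : \<T>" and x: "x : T"
  show "divergence (V T) x = 0"
   by (rule divergence_zero[where V=V and v=v]) (rule vV wd T x ps_C_diff_1 Vp | assumption)+
 next
  fix F x assume F: "F : interior_faces \<Omega> \<T>" and x: "x : F"
  show "\<nu> F \<bullet> V (Tout F) x = \<nu> F \<bullet> V (Tin F) x"
   by (rule normal_continuous[where V=V and v=v and K=k]) (rule vV Vp wd F x | assumption)+
 next
  fix T F x assume T: "T : \<T>" and F: "F facet_of T" "F \<subseteq> frontier \<Omega>" and x: "x : F"
  have xT: "x : T" using F x by (meson facet_of_imp_subset subsetD)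
  have "elem_trace T v x = V T x"
   by (rule elem_trace_eq[OF convex_T[OF T] interior_nonempty[OF T] closed_T[OF T] xT vV[OF T]])
    (assumption, intro continuous_on_vecI ps_continuous[OF Vp[OF T]])
  moreover have "elem_trace T v x \<bullet> \<nu> F = 0" using v T F x by (simp add: velocity_space_def)
  ultimately show "\<nu> F \<bullet> V T x = 0" by (simp add: inner_commute)
 qed
 then show ?thesis using vV by blast
qed

lemma sum_indicator_interior:
 assumes T: "T : \<T>" and x: "x : interior T"
 shows "(SUM T':\<T>. indicator (interior T') x * (\<phi> T' :: real)) = \<phi> T"
proof -
 have "(SUM T':\<T>. indicator (interior T') x * \<phi> T') = (SUM T':\<T>. if T' = T then \<phi> T else 0)"
 proof (rule sum.cong[OF refl])
  fix T' assume T': "T' : \<T>"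
  show "indicator (interior T') x * \<phi> T' = (if T' = T then \<phi> T else 0)"
   using interior_disjoint[OF T T'] x interior_subset[of T'] by (auto simp: indicator_def)
 qed
 then show ?thesis using finite_mesh T by simp
qed

lemma sum_element_integrals:
 fixes \<phi> :: "(real^'n) set => real^'n => real"
 assumes \<phi>: "!!T. T : \<T> ==> cont (\<phi> T)"
 shows "integrable lborel (%x. SUM T:\<T>. indicator (interior T) x * \<phi> T x)"
  and "(LBINT x. (SUM T:\<T>. indicator (interior T) x * \<phi> T x)) = (SUM T:\<T>. LBINT x:T. \<phi> T x)"
proof -
 have i: "integrable lborel (%x. indicator (interior T) x * \<phi> T x)" if "T : \<T>" for T
  using element_integral_interior(2)[OF that \<phi>[OF that]] by (simp add: set_integrable_def)
 then show "integrable lborel (%x. SUM T:\<T>. indicator (interior T) x * \<phi> T x)" by (rule Bochner_Integration.integrable_sum)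
 have "(LBINT x. (SUM T:\<T>. indicator (interior T) x * \<phi> T x)) = (SUM T:\<T>. LBINT x. indicator (interior T) x * \<phi> T x)"
  using i by (rule Bochner_Integration.integral_sum)
 also have "... = (SUM T:\<T>. LBINT x:T. \<phi> T x)"
  using element_integral_interior(3)[OF _ \<phi>] by (intro sum.cong refl) (simp add: set_lebesgue_integral_def)
 finally show "(LBINT x. (SUM T:\<T>. indicator (interior T) x * \<phi> T x)) = (SUM T:\<T>. LBINT x:T. \<phi> T x)" .
qed

text \<open>Passes from the mesh to the surrounding cube, the only place where the potentials are
  controlled.\<close>

lemma element_integrals_le:
 fixes \<phi> :: "(real^'n) set => real^'n => real"
 assumes \<phi>: "!!T. T : \<T> ==> cont (\<phi> T)" and h: "set_integrable lborel Q h"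
  and h0: "!!x. x : Q ==> 0 <= h x" and Q: "closure \<Omega> \<subseteq> Q"
  and le: "!!T x. T : \<T> ==> x : interior T ==> \<phi> T x <= h x"
 shows "(SUM T:\<T>. LBINT x:T. \<phi> T x) <= (LBINT x:Q. h x)"
proof -
 have pt: "(SUM T:\<T>. indicator (interior T) x * \<phi> T x) <= indicat_real Q x *\<^sub>R h x" for x
 proof (cases "EX T:\<T>. x : interior T")
  case True
  then obtain T where T: "T : \<T>" "x : interior T" by blast
  have "x : Q" using T T_subset[OF T(1)] Q interior_subset[of T] by blast
  then show ?thesis using sum_indicator_interior[OF T, of "%T. \<phi> T x"] le[OF T] by simp
 next
  case False
  then have "(SUM T:\<T>. indicator (interior T) x * \<phi> T x) = 0" by (intro sum.neutral) auto
  then show ?thesis using h0[of x] by (auto simp: indicator_def)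
 qed
 have "(SUM T:\<T>. LBINT x:T. \<phi> T x) = (LBINT x. (SUM T:\<T>. indicator (interior T) x * \<phi> T x))"
  by (rule sum_element_integrals(2)[symmetric]) (rule \<phi>)
 also have "... <= (LBINT x. indicat_real Q x *\<^sub>R h x)"
  by (rule integral_mono[OF sum_element_integrals(1) h[unfolded set_integrable_def] pt]) (rule \<phi>)
 finally show ?thesis by (simp only: set_lebesgue_integral_def)
qed

end

context mesh_velocity begin

definition energy :: real where "energy = (SUM T:\<T>. LBINT x:T. (norm (V T x))^2)"

lemma face_data:
 fixes G :: "real^'n => real^'n^'n"
 assumes G: "cont G" and F: "F : mesh_faces \<T>"
 shows "EX q. face_datum k (\<nu> F) G F q & fint F (%x. (q x - G x *v \<nu> F) \<bullet> tangential_sum F x) = 0"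
proof -
 obtain T where T: "T : \<T>" and FT: "F facet_of T" using F by (auto simp: mesh_faces_def)
 have n: "norm (\<nu> F) = 1" "!!x y. x : F ==> y : F ==> \<nu> F \<bullet> (y - x) = 0"
  using facet_normal[OF T FT] by (auto simp: unit_normal_def)
 obtain x0 where x0: "x0 : F" using FT by (auto simp: facet_of_def)
 \<comment> \<open>The orthogonal projection onto the hyperplane of the face. Composing with it
   makes the jump constant along the normal without changing it on \<open>F\<close>.\<close>
 define \<pi> where "\<pi> x = x - (\<nu> F \<bullet> (x - x0)) *\<^sub>R \<nu> F" for x
 have \<pi>F: "\<pi> x = x" if "x : F" for x using n(2)[OF x0 that] by (simp add: \<pi>_def)
 have \<pi>inv: "\<pi> (x + t *\<^sub>R \<nu> F) = \<pi> x" for x t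
  using n(1) by (simp add: \<pi>_def inner_add_right inner_diff_right dot_square_norm algebra_simps)
 have \<pi>p: "(%x. \<pi> x $ i) : poly_space 1" for i
 proof -
  have "(%x. x $ i - (\<nu> F $ i) * (\<nu> F \<bullet> x + - (\<nu> F \<bullet> x0))) : poly_space 1"
   by (intro ps_diff ps_cmult ps_coord ps_affine order_refl)
  then show ?thesis by (simp add: \<pi>_def inner_diff_right mult.commute)
 qed
 define J where "J x = tangential_sum F (\<pi> x)" for x
 have Jp: "(%x. J x $ i) : poly_space (int k)" for i
 proof -
  have s: "(%x. (\<Sum>T | T : \<T> & F facet_of T. fsgn F T *\<^sub>R V T x) $ j) : poly_space (int k)" for j
   unfolding sum_component vector_scaleR_component real_scaleR_def
   by (intro ps_sum ps_cmult V_poly) simp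
  have "(%x. tangential_sum F x $ i) = (%x. (\<Sum>T | T : \<T> & F facet_of T. fsgn F T *\<^sub>R V T x) $ i
    - \<nu> F $ i * (SUM j:UNIV. \<nu> F $ j * (\<Sum>T | T : \<T> & F facet_of T. fsgn F T *\<^sub>R V T x) $ j))"
   by (rule ext) (simp add: tangential_sum_def tangential_def inner_vec_def mult.commute)
  also have "... : poly_space (int k)" by (intro ps_diff s ps_cmult ps_sum)
  finally show ?thesis unfolding J_def by (rule ps_compose_affine[where f=\<pi>, OF _ \<pi>p])
 qed
 have Jc: "cont J" by (intro continuous_on_vecI ps_continuous[OF Jp])
 have Gn: "cont (%x. G x *v \<nu> F)" by (intro continuous_intros G)
 obtain m \<theta> where o: "fint F (%x. (m + \<theta> *\<^sub>R J x - G x *v \<nu> F) \<bullet> J x) = 0"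
  and b: "ALL w. fint F (%x. (norm (m + \<theta> *\<^sub>R J x - w))^2) <= 10 * fint F (%x. (norm (G x *v \<nu> F - w))^2)"
  using face_correction[OF F Gn Jc] by (elim exE conjE)
 have "fint F (%x. (m + \<theta> *\<^sub>R J x - G x *v \<nu> F) \<bullet> tangential_sum F x)
   = fint F (%x. (m + \<theta> *\<^sub>R J x - G x *v \<nu> F) \<bullet> J x)"
  by (rule face_integral_cong) (simp add: J_def \<pi>F)
 moreover have "(%x. (m + \<theta> *\<^sub>R J x) $ i) : poly_space (int k)" for i
  using ps_add[OF ps_const ps_cmult[OF Jp]] by simp
 moreover have "m + \<theta> *\<^sub>R J (x + t *\<^sub>R \<nu> F) = m + \<theta> *\<^sub>R J x" for x t by (simp add: J_def \<pi>inv)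
 ultimately show ?thesis using o b unfolding face_datum_def by (intro exI[of _ "%x. m + \<theta> *\<^sub>R J x"] conjI allI) simp_all
qed

end

subsection \<open>A regular stress with prescribed divergence\<close>

text \<open>Removing the trace part is an orthogonal projection for the Frobenius product; here in
  coordinates, so that it applies also to matrices of derivatives.\<close>

lemma deviator_norm_le:
 fixes m :: "'n::finite => 'n => real"
 shows "(SUM i:UNIV. SUM j:UNIV. (m i j - (if i = j then 1 / real CARD('n) * (SUM l:UNIV. m l l) else 0))^2) <= (SUM i:UNIV. SUM j:UNIV. (m i j)^2)"
proof -
 define t where "t = (SUM l:UNIV. m l l)"
 define c where "c = 1 / real CARD('n) * t"
 have nc: "real CARD('n) * c = t" by (simp add: c_def)
 have "(SUM i:UNIV. SUM j:UNIV. (m i j - (if i = j then c else 0))^2)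
   = (SUM i:UNIV. SUM j:UNIV. (m i j)^2 + (if i = j then c^2 - 2 * c * m i i else 0))"
  by (intro sum.cong refl) (auto simp: power2_eq_square algebra_simps)
 also have "... = (SUM i:UNIV. SUM j:UNIV. (m i j)^2) + (SUM i:UNIV. c^2 - 2 * c * m i i)"
  by (simp add: sum.distrib)
 also have "(SUM i:UNIV. c^2 - 2 * c * m i i) = c * (real CARD('n) * c) - 2 * c * t"
  by (simp add: sum_subtractf t_def sum_distrib_left power2_eq_square)
 also have "... = - (real CARD('n) * c^2)" unfolding nc by (simp add: nc[symmetric] power2_eq_square)
 also have "(SUM i:UNIV. SUM j:UNIV. (m i j)^2) + - (real CARD('n) * c^2) <= (SUM i:UNIV. SUM j:UNIV. (m i j)^2)" by simp
 finally show ?thesis by (simp only: c_def t_def)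
qed

lemma vector_square_sum: "(norm (u :: real^'n::finite))^2 = (SUM i:UNIV. (u $ i)^2)"
 unfolding power2_norm_eq_inner inner_vec_def by (simp add: power2_eq_square)

context mesh_velocity begin

lemma energy_components: "energy = (SUM i:UNIV. SUM T:\<T>. LBINT x:T. (V T x $ i)^2)"
proof -
 have i: "set_integrable lborel T (%x. (V T x $ i)^2)" if "T : \<T>" for T i
  by (intro element_integral_interior(1) that continuous_intros V_cont)
 have "energy = (SUM T:\<T>. SUM i:UNIV. LBINT x:T. (V T x $ i)^2)"
  unfolding energy_def vector_square_sum by (intro sum.cong refl set_integral_sum i)
 then show ?thesis by (simp only: sum.swap[of _ UNIV])
qed

lemma component_potential:
 assumes ab: "a < b" and Q: "closure \<Omega> \<subseteq> cube.Q a b" and e: "0 < e"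
 shows "EX p c0. (ALL j. C1 (p j)) &
  (SUM T:\<T>. LBINT x:T. V T x $ i * (c0 + (SUM j:UNIV. partial j (p j) x))) >= (SUM T:\<T>. LBINT x:T. (V T x $ i)^2) / 2 - e / 2 &
  (ALL j. (LINT x:cube.Q a b|lborel. (p j x)^2) <= (1 / (cube.\<omega> a b)^2) * (2 * (SUM T:\<T>. LBINT x:T. (V T x $ i)^2) + 2 * e)) &
  (ALL d j. (LINT x:cube.Q a b|lborel. (partial d (p j) x)^2) <= 2 * (SUM T:\<T>. LBINT x:T. (V T x $ i)^2) + 2 * e)"
proof -
 interpret cube a b by unfold_locales (rule ab)
 have Vc: "cont (%x. V T x $ i)" if "T : \<T>" for T by (intro continuous_intros V_cont that)
 \<comment> \<open>The component of the velocity, extended by zero to the cube. It jumps on the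
   skeleton and across the boundary, which is harmless because only its norm matters.\<close>
 define f where "f x = (SUM T:\<T>. indicator (interior T) x * (V T x $ i))" for x
 have fT: "f x = V T x $ i" if "T : \<T>" "x : interior T" for T x
  unfolding f_def by (rule sum_indicator_interior[OF that, of "%T. V T x $ i"])
 have f0: "f x = 0" if "!!T. T : \<T> ==> x \<notin> interior T" for x
  unfolding f_def by (intro sum.neutral) (use that in auto)
 have fm: "f : borel_measurable borel" unfolding f_def
  by (intro borel_measurable_sum borel_measurable_times borel_measurable_indicator borel_measurable_continuous_onI Vc) auto
 have "EX B. ALL x:T. \<bar>V T x $ i\<bar> <= B" if T: "T : \<T>" for T
 proof -
  have "bounded ((%x. V T x $ i) ` T)"
   by (intro compact_imp_bounded compact_continuous_image compact_T T continuous_on_subset[OF Vc[OF T]]) auto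
  then show ?thesis unfolding bounded_iff by auto
 qed
 then obtain BT where BT: "!!T x. T : \<T> ==> x : T ==> \<bar>V T x $ i\<bar> <= BT T" by metis
 define Bf where "Bf = (SUM T:\<T>. \<bar>BT T\<bar>)"
 have Bf: "\<bar>f x\<bar> <= Bf" for x
  unfolding f_def Bf_def
 proof (rule order_trans[OF sum_abs sum_mono])
  fix T assume T: "T : \<T>"
  show "\<bar>indicator (interior T) x * (V T x $ i)\<bar> <= \<bar>BT T\<bar>"
   using BT[OF T, of x] interior_subset[of T] by (auto simp: indicator_def)
 qed
 have ff: "(LBINT x:Q. (f x)^2) = (SUM T:\<T>. LBINT x:T. (V T x $ i)^2)"
 proof -
  have "indicat_real Q x *\<^sub>R (f x)^2 = (SUM T:\<T>. indicator (interior T) x * (V T x $ i)^2)" for x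
  proof (cases "EX T:\<T>. x : interior T")
   case True
   then obtain T where T: "T : \<T>" "x : interior T" by blast
   have "x : Q" using T T_subset[OF T(1)] Q interior_subset[of T] by blast
   then show ?thesis using sum_indicator_interior[OF T, of "%T. (V T x $ i)^2"] fT[OF T] by simp
  next
   case False
   then have "(SUM T:\<T>. indicator (interior T) x * (V T x $ i)^2) = 0" by (intro sum.neutral) auto
   then show ?thesis using f0[of x] False by simp
  qed
  then have "(LBINT x:Q. (f x)^2) = (LBINT x. (SUM T:\<T>. indicator (interior T) x * (V T x $ i)^2))"
   by (simp only: set_lebesgue_integral_def)
  also have "... = (SUM T:\<T>. LBINT x:T. (V T x $ i)^2)"
   by (rule sum_element_integrals(2)) (intro continuous_intros Vc)
  finally show ?thesis .
 qed
 from cosine_potential[OF fm Bf e] obtain p c0 where pC: "ALL j. C1 (p j)"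
  and app: "(LBINT x:Q. (f x - (c0 + (SUM j:UNIV. partial j (p j) x)))^2) <= e"
  and b1: "ALL j. (LBINT x:Q. (p j x)^2) <= (1 / \<omega>^2) * (2 * (LBINT x:Q. (f x)^2) + 2 * e)"
  and b2: "ALL d j. (LBINT x:Q. (partial d (p j) x)^2) <= 2 * (LBINT x:Q. (f x)^2) + 2 * e"
  by (elim exE conjE) (rule that)
 define s where "s x = c0 + (SUM j:UNIV. partial j (p j) x)" for x
 have sc: "cont s" unfolding s_def using pC by (intro continuous_intros) simp
 have "bounded (s ` Q)" by (intro compact_imp_bounded compact_continuous_image compact_Q continuous_on_subset[OF sc]) auto
 then obtain Bs where Bs: "!!x. x : Q ==> \<bar>s x\<bar> <= Bs" unfolding bounded_iff by auto
 have hi: "set_integrable lborel Q (%x. (f x - s x)^2)"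
 proof (rule bounded_set_integrable[where B="(Bf + Bs)^2"])
  show "(%x. (f x - s x)^2) : borel_measurable borel"
   by (intro borel_measurable_power borel_measurable_diff fm borel_measurable_continuous_onI sc)
  fix x :: "real^'n" assume x: "x : Q"
  have "\<bar>f x - s x\<bar> <= Bf + Bs" using Bf[of x] Bs[OF x] by linarith
  then have "\<bar>f x - s x\<bar>^2 <= (Bf + Bs)^2" by (intro power_mono) auto
  then show "\<bar>(f x - s x)^2\<bar> <= (Bf + Bs)^2" by simp
 qed
 have err: "(SUM T:\<T>. LBINT x:T. (V T x $ i - s x)^2) <= e"
 proof -
  have "(SUM T:\<T>. LBINT x:T. (V T x $ i - s x)^2) <= (LBINT x:Q. (f x - s x)^2)"
   by (rule element_integrals_le[OF _ hi _ Q]) (auto intro!: continuous_intros Vc sc simp: fT)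
  then show ?thesis using app by (simp add: s_def)
 qed
 \<comment> \<open>With \<open>V\<close> for the component and \<open>s\<close> for its
   approximation, \<open>2 * V * s\<close> is at least
   \<open>V\<^sup>2 - (V - s)\<^sup>2\<close>.\<close>
 have "(SUM T:\<T>. LBINT x:T. (V T x $ i)^2) / 2 - e / 2 <= (SUM T:\<T>. (LBINT x:T. (V T x $ i)^2) / 2 - (LBINT x:T. (V T x $ i - s x)^2) / 2)"
  using err by (simp add: sum_subtractf sum_divide_distrib[symmetric])
 also have "... <= (SUM T:\<T>. LBINT x:T. V T x $ i * s x)"
 proof (rule sum_mono)
  fix T assume T: "T : \<T>"
  have i1: "set_integrable lborel T (%x. (V T x $ i)^2)" and i2: "set_integrable lborel T (%x. (V T x $ i - s x)^2)" and i3: "set_integrable lborel T (%x. V T x $ i * s x)"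
   by (intro element_integral_interior(1)[OF T] continuous_intros Vc[OF T] sc)+
  have "(LBINT x:T. (V T x $ i)^2) - (LBINT x:T. (V T x $ i - s x)^2) = (LBINT x:T. (V T x $ i)^2 - (V T x $ i - s x)^2)"
   by (rule set_integral_diff(2)[symmetric, OF i1 i2])
  also have "... <= (LBINT x:T. 2 * (V T x $ i * s x))"
   by (rule set_integral_mono[OF set_integral_diff(1)[OF i1 i2] set_integrable_mult_right[OF i3]])
    (simp add: power2_diff)
  also have "... = 2 * (LBINT x:T. V T x $ i * s x)" by (rule set_integral_mult_right)
  finally show "(LBINT x:T. (V T x $ i)^2) / 2 - (LBINT x:T. (V T x $ i - s x)^2) / 2 <= (LBINT x:T. V T x $ i * s x)" by simp
 qed
 finally have main: "(SUM T:\<T>. LBINT x:T. (V T x $ i)^2) / 2 - e / 2 <= (SUM T:\<T>. LBINT x:T. V T x $ i * (c0 + (SUM j:UNIV. partial j (p j) x)))"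
  by (simp only: s_def)
 show ?thesis
  by (rule exI[of _ p], rule exI[of _ c0], intro conjI pC main b1[unfolded ff] b2[unfolded ff])
qed

text \<open>The deviator does not change the pairing with \<open>V\<close>, because \<open>V\<close> is orthogonal to gradients.\<close>

lemma global_potential:
 assumes ab: "a < b" and Q: "closure \<Omega> \<subseteq> cube.Q a b" and en: "0 < energy"
 shows "EX G. (ALL i j. C1 (%x. G x $ i $ j)) & (ALL x. trace (G x) = 0) &
   energy / 4 <= (SUM T:\<T>. LBINT x:T. mat_divergence G x \<bullet> V T x) &
   (SUM T:\<T>. LBINT x:T. (norm (G x))^2) + (SUM T:\<T>. LBINT x:T. gradient_square G x)
    <= (3 * real CARD('n) / (cube.\<omega> a b)^2 + 3 * (real CARD('n))^2) * energy"
proof -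
 interpret cube a b by unfold_locales (rule ab)
 define N where "N = real CARD('n)"
 have N0: "0 < N" by (simp add: N_def)
 \<comment> \<open>The \<open>N\<close> components lose \<open>N * e / 2 = energy / 4\<close> from
   half the energy, which leaves a quarter; in the upper bounds they add
   \<open>2 * N * e = energy\<close>.\<close>
 define e where "e = energy / (2 * N)"
 have e0: "0 < e" using en N0 by (simp add: e_def)
 define E where "E i = (SUM T:\<T>. LBINT x:T. (V T x $ i)^2)" for i
 have sumE: "(SUM i:UNIV. E i) = energy" unfolding E_def energy_components ..
 have sumEe: "(SUM i:UNIV. 2 * E i + 2 * e) = 3 * energy"
  using N0 by (simp add: sum.distrib sum_distrib_left[symmetric] sumE N_def[symmetric]) (simp add: e_def)
 define R where "R i p c0 \<longleftrightarrow> (ALL j. C1 (p j)) &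
  E i / 2 - e / 2 <= (SUM T:\<T>. LBINT x:T. V T x $ i * (c0 + (SUM j:UNIV. partial j (p j) x))) &
  (ALL j. (LBINT x:Q. (p j x)^2) <= (1 / \<omega>^2) * (2 * E i + 2 * e)) &
  (ALL d j. (LBINT x:Q. (partial d (p j) x)^2) <= 2 * E i + 2 * e)" for i and p :: "'n => real^'n => real" and c0
 have "ALL i. EX p c0. R i p c0" unfolding R_def E_def by (intro allI component_potential[OF ab Q e0])
 from choice[OF this] obtain p where "ALL i. EX c0. R i (p i) c0" by (elim exE) (rule that, assumption)
 from choice[OF this] obtain c0 where R: "ALL i. R i (p i) (c0 i)" by (elim exE) (rule that, assumption)
 have pC: "C1 (p i j)" for i j using R by (simp add: R_def)
 have pd: "p i j differentiable at x" for i j x using pC[of i j] by simp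
 have pc: "cont (p i j)" for i j by (rule C1_cont[OF pC])
 have dc: "cont (partial d (p i j))" for d i j using pC[of i j] by simp
 have low: "E i / 2 - e / 2 <= (SUM T:\<T>. LBINT x:T. V T x $ i * (c0 i + (SUM j:UNIV. partial j (p i j) x)))" for i
  using R by (simp add: R_def)
 have b1: "(LBINT x:Q. (p i j x)^2) <= (1 / \<omega>^2) * (2 * E i + 2 * e)" for i j using R by (simp add: R_def)
 have b2: "(LBINT x:Q. (partial d (p i j) x)^2) <= 2 * E i + 2 * e" for d i j using R by (simp add: R_def)
 define \<phi> where "\<phi> x = 1 / N * (SUM l:UNIV. p l l x)" for x
 have \<phi>C: "C1 \<phi>" unfolding \<phi>_def by (intro C1_mult C1_const C1_sum pC)
 have \<phi>p: "partial d \<phi> x = 1 / N * (SUM l:UNIV. partial d (p l l) x)" for d x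
 proof -
  have "(%x. SUM l:UNIV. p l l x) differentiable at x" by (intro differentiable_sum) (simp_all add: pd)
  then have "partial d \<phi> x = 1 / N * partial d (%x. SUM l:UNIV. p l l x) x" unfolding \<phi>_def by (rule partial_cmult)
  then show ?thesis by (simp add: partial_sum[OF pd])
 qed
 define G :: "real^'n => real^'n^'n" where "G x = (\<chi> i j. p i j x - (if i = j then \<phi> x else 0))" for x
 have Gij: "(%x. G x $ i $ j) = (%x. p i j x - (if i = j then \<phi> x else 0))" for i j by (simp add: G_def)
 have \<phi>if: "C1 (%x. if i = j then \<phi> x else 0)" for i j :: 'n using \<phi>C by (cases "i = j") auto
 have GC: "C1 (%x. G x $ i $ j)" for i j
  unfolding Gij by (intro C1_diff pC \<phi>if)
 have Gp: "partial d (%x. G x $ i $ j) x = partial d (p i j) x - (if i = j then 1 / N * (SUM l:UNIV. partial d (p l l) x) else 0)" for d i j x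
 proof -
  have "partial d (%x. G x $ i $ j) x = partial d (p i j) x - partial d (%x. if i = j then \<phi> x else 0) x"
   unfolding Gij using \<phi>if[of i j] by (intro partial_diff pd) simp
  also have "partial d (%x. if i = j then \<phi> x else 0) x = (if i = j then partial d \<phi> x else 0)" by (cases "i = j") simp_all
  finally show ?thesis by (simp only: \<phi>p)
 qed
 have Gtr: "trace (G x) = 0" for x
 proof -
  have "trace (G x) = (SUM i:UNIV. p i i x) - N * \<phi> x" by (simp add: trace_def G_def sum_subtractf N_def)
  then show ?thesis using N0 by (simp add: \<phi>_def)
 qed
 \<comment> \<open>Its gradient collects the divergence of the trace part and the constants
   \<open>c0\<close>, so that \<open>mat_divergence G\<close> is the approximation of
   \<open>v\<close> minus a gradient.\<close>
 define \<psi> where "\<psi> x = \<phi> x + (SUM i:UNIV. c0 i * x $ i)" for x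
 have lC: "C1 (%x::real^'n. SUM i:UNIV. c0 i * x $ i)" by (intro C1_sum C1_mult C1_const C1_coord)
 have \<psi>C: "C1 \<psi>" unfolding \<psi>_def by (intro C1_add \<phi>C lC)
 have \<psi>p: "partial d \<psi> x = partial d \<phi> x + c0 d" for d x
 proof -
  have "partial d \<psi> x = partial d \<phi> x + partial d (%x::real^'n. SUM i:UNIV. c0 i * x $ i) x"
   unfolding \<psi>_def using \<phi>C lC by (intro partial_add) simp_all
  also have "partial d (%x::real^'n. SUM i:UNIV. c0 i * x $ i) x = (SUM i:UNIV. c0 i * partial d (%x. x $ i) x)"
   by (subst partial_sum) (auto intro!: sum.cong partial_cmult simp: C1_coord[unfolded C_diff.simps])
  also have "... = (SUM i:UNIV. if i = d then c0 d else 0)" by (intro sum.cong refl) (auto simp: partial_coord)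
  finally show ?thesis by simp
 qed
 define L where "L i x = c0 i + (SUM j:UNIV. partial j (p i j) x)" for i x
 have Lc: "cont (L i)" for i unfolding L_def by (intro continuous_intros dc)
 have divG: "mat_divergence G x $ i = L i x - gradient \<psi> x $ i" for x i
 proof -
  have "mat_divergence G x $ i = (SUM j:UNIV. partial j (p i j) x - (if i = j then 1 / N * (SUM l:UNIV. partial j (p l l) x) else 0))"
   by (simp add: mat_divergence_def divergence_def Gp)
  also have "... = (SUM j:UNIV. partial j (p i j) x) - partial i \<phi> x" by (simp add: sum_subtractf \<phi>p)
  finally show ?thesis by (simp add: L_def gradient_def \<psi>p)
 qed
 have low2: "energy / 4 <= (SUM T:\<T>. LBINT x:T. mat_divergence G x \<bullet> V T x)"
 proof -
  have "(SUM T:\<T>. LBINT x:T. mat_divergence G x \<bullet> V T x) = (SUM T:\<T>. (SUM i:UNIV. LBINT x:T. V T x $ i * L i x) - (LBINT x:T. V T x \<bullet> gradient \<psi> x))"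
  proof (rule sum.cong[OF refl])
   fix T assume T: "T : \<T>"
   have i1: "set_integrable lborel T (%x. V T x $ i * L i x)" for i
    by (intro element_integral_interior(1)[OF T] continuous_intros V_cont T Lc)
   have i2: "set_integrable lborel T (%x. V T x \<bullet> gradient \<psi> x)"
    by (intro element_integral_interior(1)[OF T] continuous_intros V_cont T gradient_continuous \<psi>C)
   have "(LBINT x:T. mat_divergence G x \<bullet> V T x) = (LBINT x:T. (SUM i:UNIV. V T x $ i * L i x) - V T x \<bullet> gradient \<psi> x)"
   proof -
    have "mat_divergence G x \<bullet> V T x = (SUM i:UNIV. V T x $ i * L i x) - V T x \<bullet> gradient \<psi> x" for x
     unfolding inner_vec_def divG inner_real_def sum_subtractf[symmetric]
     by (intro sum.cong refl) (simp add: algebra_simps)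
    then show ?thesis by (simp only:)
   qed
   also have "... = (LBINT x:T. SUM i:UNIV. V T x $ i * L i x) - (LBINT x:T. V T x \<bullet> gradient \<psi> x)"
    by (rule set_integral_diff(2)[OF set_integrable_sum[OF i1] i2])
   finally show "(LBINT x:T. mat_divergence G x \<bullet> V T x) = (SUM i:UNIV. LBINT x:T. V T x $ i * L i x) - (LBINT x:T. V T x \<bullet> gradient \<psi> x)"
    by (simp only: set_integral_sum[OF i1])
  qed
  also have "... = (SUM i:UNIV. SUM T:\<T>. LBINT x:T. V T x $ i * L i x)"
   unfolding sum_subtractf gradient_orthogonal[OF \<psi>C] by (simp only: sum.swap[of _ UNIV] diff_zero)
  also have "... >= (SUM i:UNIV. E i / 2 - e / 2)" by (intro sum_mono) (use low in \<open>simp only: L_def\<close>)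
  also have "(SUM i:UNIV. E i / 2 - e / 2) = energy / 2 - N * (e / 2)"
   by (simp add: sum_subtractf sum_divide_distrib[symmetric] sumE N_def)
  also have "... = energy / 4" using N0 by (simp add: e_def)
  finally show ?thesis .
 qed
 have Qi: "set_integrable lborel Q h" if "cont h" for h :: "real^'n => real"
  by (rule cont_set_integrable[OF that compact_imp_bounded[OF compact_Q] Q_borel])
 have Gc: "cont G" by (intro matrix_continuousI C1_cont GC)
 have n1: "(SUM T:\<T>. LBINT x:T. (norm (G x))^2) <= 3 * N / \<omega>^2 * energy"
 proof -
  have "(SUM T:\<T>. LBINT x:T. (norm (G x))^2) <= (LBINT x:Q. SUM i:UNIV. SUM j:UNIV. (p i j x)^2)"
  proof (rule element_integrals_le[OF _ _ _ Q])
   show "set_integrable lborel Q (%x. SUM i:UNIV. SUM j:UNIV. (p i j x)^2)" by (intro Qi continuous_intros pc)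
   fix x
   show "(norm (G x))^2 <= (SUM i:UNIV. SUM j:UNIV. (p i j x)^2)"
    unfolding norm_matrix_square using deviator_norm_le[of "%i j. p i j x"] by (simp add: G_def \<phi>_def N_def cong: if_cong)
  qed (auto intro!: sum_nonneg continuous_intros Gc)
  also have "... = (SUM i:UNIV. SUM j:UNIV. LBINT x:Q. (p i j x)^2)"
  proof -
   have i: "set_integrable lborel Q (%x. (p i j x)^2)" for i j by (intro Qi continuous_intros pc)
   show ?thesis by (simp only: set_integral_sum[OF set_integrable_sum[OF i]] set_integral_sum[OF i])
  qed
  also have "... <= (SUM i:UNIV. SUM j:(UNIV::'n set). (1 / \<omega>^2) * (2 * E i + 2 * e))" by (intro sum_mono b1)
  also have "... = N / \<omega>^2 * (SUM i:UNIV. 2 * E i + 2 * e)" by (simp add: sum_distrib_left N_def del: sum.distrib)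
  finally show ?thesis unfolding sumEe by (simp add: mult_ac)
 qed
 have n2: "(SUM T:\<T>. LBINT x:T. gradient_square G x) <= 3 * N^2 * energy"
 proof -
  have gs: "gradient_square G x = (SUM d:UNIV. SUM i:UNIV. SUM j:UNIV. (partial d (%y. G y $ i $ j) x)^2)" for x
  proof -
   have "gradient_square G x = (SUM i:UNIV. SUM j:UNIV. SUM d:UNIV. (partial d (%y. G y $ i $ j) x)^2)"
    unfolding gradient_square_def vector_square_sum by (simp add: gradient_def)
   also have "... = (SUM i:UNIV. SUM d:UNIV. SUM j:UNIV. (partial d (%y. G y $ i $ j) x)^2)"
    by (intro sum.cong refl sum.swap)
   also have "... = (SUM d:UNIV. SUM i:UNIV. SUM j:UNIV. (partial d (%y. G y $ i $ j) x)^2)" by (rule sum.swap)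
   finally show ?thesis .
  qed
  have gc: "cont (partial d (%y. G y $ i $ j))" for d i j using GC[of i j] by simp
  have "(SUM T:\<T>. LBINT x:T. gradient_square G x) <= (LBINT x:Q. SUM d:UNIV. SUM i:UNIV. SUM j:UNIV. (partial d (p i j) x)^2)"
  proof (rule element_integrals_le[OF _ _ _ Q])
   show "set_integrable lborel Q (%x. SUM d:UNIV. SUM i:UNIV. SUM j:UNIV. (partial d (p i j) x)^2)" by (intro Qi continuous_intros dc)
   show "cont (gradient_square G)" unfolding gs by (intro continuous_intros gc)
   fix x
   show "gradient_square G x <= (SUM d:UNIV. SUM i:UNIV. SUM j:UNIV. (partial d (p i j) x)^2)"
    unfolding gs Gp N_def by (intro sum_mono deviator_norm_le)
  qed (auto intro!: sum_nonneg)
  also have "... = (SUM d:UNIV. SUM i:UNIV. SUM j:UNIV. LBINT x:Q. (partial d (p i j) x)^2)"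
  proof -
   have i: "set_integrable lborel Q (%x. (partial d (p i j) x)^2)" for d i j by (intro Qi continuous_intros dc)
   show ?thesis by (simp only: set_integral_sum[OF set_integrable_sum[OF set_integrable_sum[OF i]]] set_integral_sum[OF set_integrable_sum[OF i]] set_integral_sum[OF i])
  qed
  also have "... <= (SUM d:(UNIV::'n set). SUM i:UNIV. SUM j:(UNIV::'n set). 2 * E i + 2 * e)" by (intro sum_mono b2)
  also have "... = N * (N * (SUM i:UNIV. 2 * E i + 2 * e))" unfolding N_def by (simp add: sum_distrib_left)
  finally show ?thesis unfolding sumEe by (simp add: power2_eq_square mult_ac)
 qed
 show ?thesis
  by (rule exI[of _ G], intro conjI allI GC Gtr low2) (use n1 n2 in \<open>simp add: N_def distrib_right\<close>)
qed

end

subsection \<open>The inf-sup condition\<close>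

lemma poly_matrix_zero:
 fixes A :: "real^'n::finite => real^'n^'n"
 assumes A: "!!i j. (%x. A x $ i $ j) : poly_space (int k)" and T: "interior T ~= {}" "bounded T" "T : sets borel"
  and zero: "(LBINT x:T. (norm (A x))^2) = 0"
 shows "A y = 0"
proof -
 obtain c where "c : interior T" using T(1) by blast
 then obtain r where r: "0 < r" "ball c r \<subseteq> T" using mem_interior by blast
 obtain C where C: "0 < C" "!!(p::real^'n => real) c' y' r'. p : poly_space (int k) ==> 0 < r' ==> norm (y' - c') <= (norm (y - c) / r) * r' ==>
   (p y')^2 <= C / r' ^ CARD('n) * (LBINT x:ball c' r'. (p x)^2)"
  using poly_sup_bound[of "norm (y - c) / r" k] r(1) by (metis divide_nonneg_pos norm_ge_zero)
 have Ac: "cont (%x. (norm (A x))^2)" by (intro continuous_intros poly_matrix_continuous[OF A])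
 have "(norm (A y))^2 <= C / r ^ CARD('n) * (LBINT x:ball c r. (norm (A x))^2)"
  by (rule poly_matrix_sup[where m="int k"]) (use C(2)[of _ r y c] r(1) A in auto)
 also have "... <= C / r ^ CARD('n) * (LBINT x:T. (norm (A x))^2)"
  using C(1) r by (intro mult_left_mono set_lebesgue_integral_mono_set cont_set_integrable Ac T) auto
 finally show ?thesis using zero by simp
qed

text \<open>A ball is chosen whose diameter exceeds half the supremum, so attainment is not an
  issue; the supremum is then below \<open>4 * r\<close>. The absolute value and \<open>+ 1\<close>
  make the constant positive for every \<sigma>.\<close>

lemma shape_regular_inball:
 fixes T :: "(real^'n::finite) set"
 assumes "interior T ~= {}" "bounded T" "diameter T <= \<sigma> * inball_diameter T"
 shows "EX z r. 0 < r & cball z r \<subseteq> T & diameter T <= (4 * \<bar>\<sigma>\<bar> + 1) * r"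
proof -
 define S where "S = {2 * r | c r. 0 <= r & cball c r \<subseteq> T}"
 obtain c where "c : interior T" using assms(1) by blast
 then obtain r0 where r0: "0 < r0" "cball c r0 \<subseteq> T" using mem_interior_cball by blast
 have r0S: "2 * r0 : S" unfolding S_def using r0 by (intro CollectI exI[of _ r0] exI[of _ c]) auto
 have "s <= diameter T" if s: "s : S" for s
 proof -
  obtain c r where cr: "s = 2 * r" "0 <= r" "cball c r \<subseteq> T" using s by (auto simp: S_def)
  have "diameter (cball c r) <= diameter T" by (rule diameter_subset[OF cr(3) assms(2)])
  then show ?thesis using cr by (simp add: diameter_cball)
 qed
 then have bdd: "bdd_above S" by (rule bdd_aboveI)
 have sup: "2 * r0 <= Sup S" by (rule cSup_upper[OF r0S bdd])
 then have "Sup S / 2 < Sup S" using r0 by simp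
 then obtain s where s: "s : S" "Sup S / 2 < s" using less_cSup_iff[OF _ bdd, of "Sup S / 2"] r0S by auto
 obtain z r where zr: "s = 2 * r" "cball z r \<subseteq> T" using s(1) by (auto simp: S_def)
 have r: "0 < r" using s(2) zr(1) sup r0(1) by linarith
 have "diameter T <= \<sigma> * Sup S" using assms(3) by (simp add: inball_diameter_def S_def)
 also have "... <= \<bar>\<sigma>\<bar> * (4 * r)" using s(2) zr(1) sup r0(1) by (intro mult_mono) auto
 also have "... <= (4 * \<bar>\<sigma>\<bar> + 1) * r" using r by (simp add: algebra_simps)
 finally show ?thesis using r zr(2) by blast
qed

lemma (in mesh) facet_count: "T : \<T> ==> card {F. F facet_of T} <= CARD('n) + 1"
proof -
 assume T: "T : \<T>"
 obtain C g \<beta> where b: "bary C g \<beta>" "T = convex hull C" by (rule simplex_bary[OF simplex_T[OF T]])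
 interpret b: bary C g \<beta> by (rule b(1))
 have "{F. F facet_of T} \<subseteq> (%a. convex hull (C - {a})) ` C" using b.facet_iff b(2) by auto
 then have "card {F. F facet_of T} <= card C" using b.fin by (meson card_image_le card_mono finite_imageI order_trans)
 then show ?thesis by (simp add: b.card_C)
qed

lemma (in mesh) broken_trace:
 fixes \<phi> :: "'c => 'b::euclidean_space"
 assumes \<sigma>: "!!T x. T : \<T> ==> x : interior T ==> \<sigma> x = \<tau> T x"
  and T: "T : \<T>" and x: "x : T" and c: "cont (%y. \<phi> (\<tau> T y))"
 shows "elem_trace T (%y. \<phi> (\<sigma> y)) x = \<phi> (\<tau> T x)"
 by (rule elem_trace_eq[where p="%y. \<phi> (\<tau> T y)", OF convex_T[OF T] interior_nonempty[OF T] closed_T[OF T] x _ c]) (simp add: \<sigma>[OF T])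

lemma (in mesh) broken_jump:
 fixes \<phi> :: "'c => 'b::euclidean_space"
 assumes \<sigma>: "!!T x. T : \<T> ==> x : interior T ==> \<sigma> x = \<tau> T x"
  and F: "F : interior_faces \<Omega> \<T>" and x: "x : F" and c: "!!T. T : \<T> ==> cont (%y. \<phi> (\<tau> T y))"
 shows "jump \<Omega> \<T> \<nu> F (%y. \<phi> (\<sigma> y)) x = \<phi> (\<tau> (Tout F) x) - \<phi> (\<tau> (Tin F) x)"
proof -
 obtain T1 T2 where T12: "T1 = Tout F" "T2 = Tin F" by blast
 note e = face_pair[OF F, folded T12] T12[symmetric]
 have x12: "x : T1" "x : T2" using x e(4,5) facet_of_imp_subset by blast+
 have "elem_trace T1 (%y. \<phi> (\<sigma> y)) x = \<phi> (\<tau> T1 x)" "elem_trace T2 (%y. \<phi> (\<sigma> y)) x = \<phi> (\<tau> T2 x)"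
  by (rule broken_trace[where \<phi>=\<phi> and \<sigma>=\<sigma> and \<tau>=\<tau>], rule \<sigma>, assumption+, rule e x12, rule x12, rule c, rule e)+
 then show ?thesis using F by (simp add: jump_def e(9,10))
qed

context mesh_velocity begin

text \<open>The form is at least a quarter of the energy, and the squared norm of the stress at most
  \<open>C0 * energy\<close>; since the norm of \<open>v\<close> is the square root of the energy,
  it cancels in the quotient.\<close>

lemma stress_of_elements:
 fixes G :: "real^'n => real^'n^'n" and \<tau> :: "(real^'n) set => real^'n => real^'n^'n"
 assumes v: "!!T x. T : \<T> ==> x : interior T ==> v x = V T x" and en: "0 < energy"
  and G: "!!i j. C1 (%x. G x $ i $ j)"
  and low: "energy / 4 <= (SUM T:\<T>. LBINT x:T. mat_divergence G x \<bullet> V T x)"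
  and up: "(SUM T:\<T>. LBINT x:T. (norm (G x))^2) + (SUM T:\<T>. LBINT x:T. gradient_square G x) <= CG * energy"
  and q: "!!F. F : mesh_faces \<T> ==> cont (q F)"
  and ortho: "!!F. F : mesh_faces \<T> ==> fint F (%x. (q F x - G x *v \<nu> F) \<bullet> tangential_sum F x) = 0"
  and B: "0 < B" and CG: "0 < CG"
  and \<tau>: "!!T. T : \<T> ==> element_interpolant k B \<nu> q G (grad_V T) T (\<tau> T)"
 shows "EX \<sigma>. \<sigma> : stress_space \<Omega> \<T> \<nu> (int k) & ~ zero_on \<Omega> \<sigma> &
  1 / (4 * sqrt ((2 * real CARD('n) + 4) * B * CG)) <= div_w_form \<Omega> \<T> \<nu> \<sigma> v / (div_w_norm \<Omega> \<T> \<nu> \<sigma> * L2_norm \<Omega> v)"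
proof -
 let ?w = "%F x. (\<nu> F \<bullet> (\<tau> (Tout F) x *v \<nu> F) - \<nu> F \<bullet> (\<tau> (Tin F) x *v \<nu> F)) * (\<nu> F \<bullet> V (Tout F) x)"
 note \<tau>' = \<tau>[unfolded element_interpolant_def]
 have \<tau>p: "(%x. \<tau> T x $ i $ j) : poly_space (int k)" and \<tau>tr: "trace (\<tau> T x) = 0"
  and bulk: "(LBINT x:T. \<tau> T x \<bullet> grad_V T x) = (LBINT x:T. G x \<bullet> grad_V T x)"
  and b1: "(LBINT x:T. (norm (\<tau> T x))^2) <= B * ((LBINT x:T. (norm (G x))^2) + (LBINT x:T. gradient_square G x))"
  and b2: "(LBINT x:T. (norm (mat_divergence (\<tau> T) x))^2) <= B * (LBINT x:T. gradient_square G x)"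
  if "T : \<T>" for T i j x using \<tau>'[OF that] by simp_all
 have tang: "x : F ==> tangential (\<nu> F) (\<tau> T x *v \<nu> F) = tangential (\<nu> F) (q F x)"
  and b3: "inverse (diameter F) * fint F (%x. (norm (\<tau> T x *v \<nu> F - G x *v \<nu> F))^2)
     <= B * (LBINT x:T. gradient_square G x)" if "T : \<T>" "F facet_of T" for T F x using \<tau>'[OF that(1)] that(2) by simp_all
 define \<sigma> :: "real^'n => real^'n^'n" where "\<sigma> x = (\<chi> i j. SUM T:\<T>. indicator (interior T) x * (\<tau> T x $ i $ j))" for x
 have \<sigma>T: "\<sigma> x = \<tau> T x" if "T : \<T>" "x : interior T" for T x
  using sum_indicator_interior[OF that, of "%T. \<tau> T x $ _ $ _"] by (simp add: \<sigma>_def vec_eq_iff)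
 have \<sigma>0: "\<sigma> x = 0" if "!!T. T : \<T> ==> x \<notin> interior T" for x
  unfolding \<sigma>_def vec_eq_iff using that by (auto intro!: sum.neutral)
 have \<sigma>tr: "trace (\<sigma> x) = 0" for x
 proof (cases "EX T:\<T>. x : interior T")
  case True
  then show ?thesis using \<sigma>T \<tau>tr by auto
 next
  case False
  then have "\<sigma> x = 0" by (intro \<sigma>0) auto
  then show ?thesis by (simp add: trace_def)
 qed
 have \<tau>c: "cont (\<tau> T)" if "T : \<T>" for T by (rule poly_matrix_continuous[OF \<tau>p[OF that]])
 have \<tau>C: "C1 (%x. \<tau> T x $ i $ j)" if "T : \<T>" for T i j by (rule ps_C_diff_1[OF \<tau>p[OF that]])
 have Gc: "cont G" by (intro matrix_continuousI C1_cont G)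
 define D where "D T = (LBINT x:T. gradient_square G x)" for T
 have D0: "0 <= D T" for T
  unfolding D_def set_lebesgue_integral_def by (intro integral_nonneg_AE) (auto simp: gradient_square_def intro!: AE_I2 mult_nonneg_nonneg sum_nonneg)
 have sq: "(%x. (norm (\<sigma> x))^2) x = (norm (\<tau> T x))^2" if "T : \<T>" "x : interior T" for T x using \<sigma>T[OF that] by simp
 have sqc: "cont (%x. (norm (\<tau> T x))^2)" if "T : \<T>" for T by (intro continuous_intros \<tau>c that)
 have int\<sigma>: "set_integrable lebesgue \<Omega> (%x. (norm (\<sigma> x))^2)"
  by (rule broken_integral(1)[where P="%T x. (norm (\<tau> T x))^2"]) (use sq sqc in auto)
 have val\<sigma>: "(LINT x:\<Omega>|lebesgue. (norm (\<sigma> x))^2) = (SUM T:\<T>. LBINT x:T. (norm (\<tau> T x))^2)"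
  by (rule broken_integral(2)[where P="%T x. (norm (\<tau> T x))^2"]) (use sq sqc in auto)
 have tnn: "0 <= (LBINT x:T. (norm (\<tau> T x))^2)" for T
  unfolding set_lebesgue_integral_def by (intro integral_nonneg_AE) auto
 have nn\<sigma>: "0 <= (LINT x:\<Omega>|lebesgue. (norm (\<sigma> x))^2)" unfolding val\<sigma> by (intro sum_nonneg tnn)
 have md: "mat_divergence \<sigma> x = mat_divergence (\<tau> T) x" if T: "T : \<T>" and x: "x : interior T" for T x
 proof -
  have "partial j (%y. \<sigma> y $ i $ j) x = partial j (%y. \<tau> T y $ i $ j) x" for i j
   by (rule partial_local[OF open_interior x]) (simp add: \<sigma>T[OF T])
  then show ?thesis by (simp add: mat_divergence_def divergence_def)
 qed
 have mdc: "cont (mat_divergence (\<tau> T))" if T: "T : \<T>" for T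
  unfolding mat_divergence_def divergence_def
  by (intro continuous_on_vec_lambda continuous_on_sum ps_continuous[OF ps_partial[OF \<tau>p[OF T]]])
 have \<tau>n: "cont (%y. \<tau> T y *v n)" if "T : \<T>" for T n by (intro continuous_intros \<tau>c that)
 define N where "N = real CARD('n)"
 define jn where "jn F = inverse (diameter F) * fint F (%x. (norm (jump \<Omega> \<T> \<nu> F (%y. \<sigma> y *v \<nu> F) x))^2)" for F
 have in_space: "\<sigma> : stress_space \<Omega> \<T> \<nu> (int k)"
 proof -
  have "\<sigma> : L2_space \<Omega> traceless"
   unfolding L2_space_def using broken_measurable(1)[where f=\<sigma> and P=\<tau>, OF \<sigma>T \<tau>c] int\<sigma> \<sigma>tr by (simp add: traceless_def)
  moreover have "piecewise \<T> (traceless_poly_space (int k)) \<sigma>"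
   unfolding piecewise_def
  proof
   fix T assume T: "T : \<T>"
   show "EX p:traceless_poly_space (int k). ALL x:interior T. \<sigma> x = p x"
    by (rule bexI[of _ "\<tau> T"]) (use \<sigma>T[OF T] \<tau>p[OF T] \<tau>tr[OF T] in \<open>auto simp: traceless_poly_space_def traceless_def\<close>)
  qed
  moreover have "jump \<Omega> \<T> \<nu> F (%y. tangential (\<nu> F) (\<sigma> y *v \<nu> F)) x = 0" if F: "F : interior_faces \<Omega> \<T>" and x: "x : F" for F x
  proof -
   obtain T1 T2 where T12: "T1 = Tout F" "T2 = Tin F" by blast
   note e = face_pair[OF F, folded T12] T12[symmetric]
   have "jump \<Omega> \<T> \<nu> F (%y. tangential (\<nu> F) (\<sigma> y *v \<nu> F)) x = tangential (\<nu> F) (\<tau> T1 x *v \<nu> F) - tangential (\<nu> F) (\<tau> T2 x *v \<nu> F)"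
    using broken_jump[where \<phi>="%M. tangential (\<nu> F) (M *v \<nu> F)" and \<sigma>=\<sigma> and \<tau>=\<tau>, OF \<sigma>T F x continuous_on_tangential[OF \<tau>n]]
    by (simp add: e(9,10))
   then show ?thesis using tang[OF e(1,4) x] tang[OF e(2,5) x] by simp
  qed
  ultimately show ?thesis by (simp add: stress_space_def)
 qed
 have form: "div_w_form \<Omega> \<T> \<nu> \<sigma> v = (SUM T:\<T>. LBINT x:T. mat_divergence (\<tau> T) x \<bullet> V T x) - (SUM F:interior_faces \<Omega> \<T>. face_integral (\<nu> F) F
    (?w F))"
  unfolding div_w_form_def
 proof (intro arg_cong2[where f="(-)"] sum.cong refl)
  fix T assume T: "T : \<T>"
  show "L2_inner (interior T) (mat_divergence \<sigma>) v = (LBINT x:T. mat_divergence (\<tau> T) x \<bullet> V T x)"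
   unfolding L2_inner_def
   by (rule interior_integral_lebesgue[OF T]) (simp add: md[OF T] v[OF T], intro continuous_intros mdc T V_cont)
 next
  fix F assume F: "F : interior_faces \<Omega> \<T>"
  obtain T1 T2 where T12: "T1 = Tout F" "T2 = Tin F" by blast
  note e = face_pair[OF F, folded T12] T12[symmetric]
  show "fint F (%x. jump \<Omega> \<T> \<nu> F (%y. \<nu> F \<bullet> (\<sigma> y *v \<nu> F)) x * elem_trace (Tout F) (%y. \<nu> F \<bullet> v y) x)
   = fint F (?w F)"
  proof (rule face_integral_cong)
   fix x assume x: "x : F"
   have x1: "x : T1" using x e(4) facet_of_imp_subset by blast
   have "jump \<Omega> \<T> \<nu> F (%y. \<nu> F \<bullet> (\<sigma> y *v \<nu> F)) x = \<nu> F \<bullet> (\<tau> T1 x *v \<nu> F) - \<nu> F \<bullet> (\<tau> T2 x *v \<nu> F)"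
    using broken_jump[where \<phi>="%M. \<nu> F \<bullet> (M *v \<nu> F)" and \<sigma>=\<sigma> and \<tau>=\<tau>, OF \<sigma>T F x continuous_on_inner[OF continuous_on_const \<tau>n]]
    by (simp add: e(9,10))
   moreover have "elem_trace T1 (%y. \<nu> F \<bullet> v y) x = \<nu> F \<bullet> V T1 x"
    by (rule elem_trace_eq[where p="%y. \<nu> F \<bullet> V T1 y", OF convex_T[OF e(1)] interior_nonempty[OF e(1)] closed_T[OF e(1)] x1])
     (simp add: v[OF e(1)], intro continuous_intros V_cont e(1))
   ultimately show "jump \<Omega> \<T> \<nu> F (%y. \<nu> F \<bullet> (\<sigma> y *v \<nu> F)) x * elem_trace (Tout F) (%y. \<nu> F \<bullet> v y) x
    = (\<nu> F \<bullet> (\<tau> (Tout F) x *v \<nu> F) - \<nu> F \<bullet> (\<tau> (Tin F) x *v \<nu> F)) * (\<nu> F \<bullet> V (Tout F) x)"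
    by (simp add: e(9,10))
  qed
 qed
 have form_low: "energy / 4 <= div_w_form \<Omega> \<T> \<nu> \<sigma> v"
 proof -
  have "div_w_form \<Omega> \<T> \<nu> \<sigma> v = (SUM T:\<T>. LBINT x:T. mat_divergence G x \<bullet> V T x)"
   unfolding form by (rule form_identity[where q=q and \<tau>=\<tau>]) (rule G \<tau>C q tang ortho bulk | assumption)+
  then show ?thesis using low by simp
 qed
 \<comment> \<open>If the stress vanished, all its polynomials would vanish and with them the form,
   which is positive by \<open>form_low\<close>.\<close>
 have pos: "0 < (LINT x:\<Omega>|lebesgue. (norm (\<sigma> x))^2)"
 proof (rule ccontr)
  assume "~ 0 < (LINT x:\<Omega>|lebesgue. (norm (\<sigma> x))^2)"
  then have "(SUM T:\<T>. LBINT x:T. (norm (\<tau> T x))^2) = 0" using nn\<sigma> val\<sigma> by simp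
  then have "ALL T:\<T>. (LBINT x:T. (norm (\<tau> T x))^2) = 0" by (rule sum_nonneg_eq_0_iff[OF finite_mesh tnn, THEN iffD1])
  then have z: "\<tau> T = (%x. 0)" if "T : \<T>" for T
   using poly_matrix_zero[OF \<tau>p[OF that] interior_nonempty[OF that] compact_imp_bounded[OF compact_T[OF that]] borel_compact[OF compact_T[OF that]]] that
   by (intro ext) simp
  have "mat_divergence (%x. 0) x = (0::real^'n)" for x by (simp add: mat_divergence_def divergence_def vec_eq_iff)
  then have s1: "(SUM T:\<T>. LBINT x:T. mat_divergence (\<tau> T) x \<bullet> V T x) = 0"
   by (intro sum.neutral ballI) (simp add: z set_lebesgue_integral_def)
  have s2: "(SUM F:interior_faces \<Omega> \<T>. face_integral (\<nu> F) F
    (?w F)) = 0"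
  proof (intro sum.neutral ballI)
   fix F assume F: "F : interior_faces \<Omega> \<T>"
   note face_pair(1,2)[OF F]
   then show "face_integral (\<nu> F) F
    (?w F) = 0"
    by (intro face_integral_zero) (simp add: z)
  qed
  show False using form_low en unfolding form s1 s2 by simp
 qed
 have nz: "~ zero_on \<Omega> \<sigma>"
 proof
  assume "zero_on \<Omega> \<sigma>"
  then have "AE x in lebesgue. indicator \<Omega> x *\<^sub>R (norm (\<sigma> x))^2 = 0" unfolding zero_on_def by (rule AE_mp) (auto intro!: AE_I2 simp: indicator_def)
  then have "(LINT x:\<Omega>|lebesgue. (norm (\<sigma> x))^2) = 0" unfolding set_lebesgue_integral_def by (rule integral_eq_zero_AE)
  then show False using pos by simp
 qed
 have N0: "0 <= N" by (simp add: N_def)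
 have L2\<sigma>: "(L2_norm \<Omega> \<sigma>)^2 = (SUM T:\<T>. LBINT x:T. (norm (\<tau> T x))^2)"
  using nn\<sigma> by (simp add: L2_norm_def val\<sigma>)
 have L2v: "L2_norm \<Omega> v = sqrt energy"
 proof -
  have "(LINT x:\<Omega>|lebesgue. (norm (v x))^2) = energy" unfolding energy_def
   by (rule broken_integral(2)) (simp add: v, intro continuous_intros V_cont)
  then show ?thesis by (simp add: L2_norm_def)
 qed
 have L2d: "(L2_norm (interior T) (mat_divergence \<sigma>))^2 <= B * D T" if T: "T : \<T>" for T
 proof -
  have e: "(LINT x:interior T|lebesgue. (norm (mat_divergence \<sigma> x))^2) = (LBINT x:T. (norm (mat_divergence (\<tau> T) x))^2)"
   by (rule interior_integral_lebesgue[OF T]) (simp add: md[OF T], intro continuous_intros mdc T)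
  have "0 <= (LINT x:interior T|lebesgue. (norm (mat_divergence \<sigma> x))^2)"
   unfolding set_lebesgue_integral_def by (intro integral_nonneg_AE) auto
  then show ?thesis using b2[OF T] by (simp add: L2_norm_def e D_def)
 qed
 \<comment> \<open>The trace of \<open>G\<close> is the same from both sides, so it is inserted
   between the two traces of the stress.\<close>
 have faceb: "jn F
   <= (\<Sum>T | T : \<T> & F facet_of T. 2 * B * D T)" if F: "F : interior_faces \<Omega> \<T>" for F
 proof -
  have Fm: "F : mesh_faces \<T>" using F interior_faces_subset by blast
  obtain T1 T2 where T12: "T1 = Tout F" "T2 = Tin F" by blast
  note e = face_pair[OF F, folded T12] T12[symmetric]
  define E where "E T x = (norm (\<tau> T x *v \<nu> F - G x *v \<nu> F))^2" for T x
  have Ec: "cont (E T)" if "T : \<T>" for T unfolding E_def by (intro continuous_intros \<tau>c that Gc)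
  have "fint F (%x. (norm (jump \<Omega> \<T> \<nu> F (%y. \<sigma> y *v \<nu> F) x))^2) = fint F (%x. (norm (\<tau> T1 x *v \<nu> F - \<tau> T2 x *v \<nu> F))^2)"
  proof (rule face_integral_cong)
   fix x assume x: "x : F"
   have "jump \<Omega> \<T> \<nu> F (%y. \<sigma> y *v \<nu> F) x = \<tau> T1 x *v \<nu> F - \<tau> T2 x *v \<nu> F"
    using broken_jump[where \<phi>="%M. M *v \<nu> F" and \<sigma>=\<sigma> and \<tau>=\<tau>, OF \<sigma>T F x \<tau>n] by (simp add: e(9,10))
   then show "(norm (jump \<Omega> \<T> \<nu> F (%y. \<sigma> y *v \<nu> F) x))^2 = (norm (\<tau> T1 x *v \<nu> F - \<tau> T2 x *v \<nu> F))^2" by simp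
  qed
  also have "... <= fint F (%x. 2 * E T1 x + 2 * E T2 x)"
  proof (rule face_integral_mono[OF Fm])
   fix x
   show "(norm (\<tau> T1 x *v \<nu> F - \<tau> T2 x *v \<nu> F))^2 <= 2 * E T1 x + 2 * E T2 x"
    using norm_diff_square_le[of "\<tau> T1 x *v \<nu> F - G x *v \<nu> F" "\<tau> T2 x *v \<nu> F - G x *v \<nu> F"] by (simp add: E_def)
  qed (intro continuous_intros \<tau>c e Ec)+
  also have "... = fint F (%x. 2 * E T1 x) + fint F (%x. 2 * E T2 x)"
   by (intro face_integral_add Fm continuous_intros Ec e)
  also have "... = 2 * fint F (E T1) + 2 * fint F (E T2)" by (simp only: face_integral_cmult)
  finally have 1: "fint F (%x. (norm (jump \<Omega> \<T> \<nu> F (%y. \<sigma> y *v \<nu> F) x))^2) <= 2 * fint F (E T1) + 2 * fint F (E T2)" .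
  have "bounded F" using compact_imp_bounded[OF compact_T[OF e(1)]] facet_of_imp_subset[OF e(4)] by (rule bounded_subset)
  then have "0 <= inverse (diameter F)" by (simp add: diameter_ge_0)
  from mult_left_mono[OF 1 this] have "jn F
    <= 2 * (inverse (diameter F) * fint F (E T1)) + 2 * (inverse (diameter F) * fint F (E T2))"
   by (simp add: jn_def algebra_simps)
  also have "... <= 2 * (B * D T1) + 2 * (B * D T2)"
   unfolding E_def D_def by (intro add_mono mult_left_mono b3 e) auto
  also have "... = (\<Sum>T | T : \<T> & F facet_of T. 2 * B * D T)" unfolding e(8) using e(3) by simp
  finally show ?thesis .
 qed
 \<comment> \<open>Regrouped by elements, each of which has at most \<open>N + 1\<close>
   facets.\<close>
 have "(SUM F:interior_faces \<Omega> \<T>. jn F)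
   <= (SUM F:interior_faces \<Omega> \<T>. \<Sum>T | T : \<T> & F facet_of T. 2 * B * D T)" by (intro sum_mono faceb)
 also have "... <= (SUM F:mesh_faces \<T>. \<Sum>T | T : \<T> & F facet_of T. 2 * B * D T)"
  using B D0 by (intro sum_mono2 finite_mesh_faces interior_faces_subset sum_nonneg) auto
 also have "... = (SUM T:\<T>. \<Sum>F | F facet_of T. 2 * B * D T)" by (rule facet_sum_swap[symmetric])
 also have "... <= (SUM T:\<T>. (N + 1) * (2 * B * D T))"
 proof (rule sum_mono)
  fix T assume T: "T : \<T>"
  have "real (card {F. F facet_of T}) <= N + 1" using facet_count[OF T] by (simp add: N_def)
  then show "(\<Sum>F | F facet_of T. 2 * B * D T) <= (N + 1) * (2 * B * D T)" using B D0 by (simp add: mult_right_mono)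
 qed
 also have "(SUM T:\<T>. (N + 1) * (2 * B * D T)) = 2 * (N + 1) * B * (SUM T:\<T>. D T)"
  unfolding sum_distrib_left by (intro sum.cong refl) (simp add: algebra_simps)
 finally have faces: "(SUM F:interior_faces \<Omega> \<T>. jn F)
   <= 2 * (N + 1) * B * (SUM T:\<T>. D T)" .
 define X where "X = (SUM T:\<T>. LBINT x:T. (norm (G x))^2)"
 define Y where "Y = (SUM T:\<T>. D T)"
 have X0: "0 <= X" unfolding X_def set_lebesgue_integral_def by (intro sum_nonneg integral_nonneg_AE) auto
 have Y0: "0 <= Y" unfolding Y_def by (intro sum_nonneg D0)
 have XY: "X + Y <= CG * energy" using up by (simp add: X_def Y_def D_def)
 define C0 where "C0 = (2 * N + 4) * B * CG"
 have C00: "0 < C0" unfolding C0_def using N0 B CG by simp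
 define nsq where "nsq = (L2_norm \<Omega> \<sigma>)^2 + (SUM T:\<T>. (L2_norm (interior T) (mat_divergence \<sigma>))^2)
   + (SUM F:interior_faces \<Omega> \<T>. jn F)"
 have "(L2_norm \<Omega> \<sigma>)^2 <= B * (X + Y)"
  unfolding L2\<sigma> X_def Y_def D_def sum.distrib[symmetric] sum_distrib_left by (intro sum_mono b1)
 moreover have "(SUM T:\<T>. (L2_norm (interior T) (mat_divergence \<sigma>))^2) <= B * Y"
  unfolding Y_def sum_distrib_left by (intro sum_mono L2d)
 ultimately have "nsq <= B * (X + Y) + B * Y + 2 * (N + 1) * B * Y" using faces by (simp add: nsq_def Y_def)
 \<comment> \<open>The coefficient of \<open>Y\<close> is 1 from the norm, 1 from the divergence and
   \<open>2 * (N + 1)\<close> from the jumps, each times \<open>B\<close>.\<close>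
 also have "... <= (2 * N + 4) * B * (X + Y)"
 proof -
  have "(2 * N + 4) * B * (X + Y) - (B * (X + Y) + B * Y + 2 * (N + 1) * B * Y) = (2 * N + 3) * B * X" by (simp add: algebra_simps)
  also have "... >= 0" using N0 B X0 by simp
  finally show ?thesis by simp
 qed
 also have "... <= (2 * N + 4) * B * (CG * energy)" using XY N0 B by (intro mult_left_mono) auto
 finally have nsq: "nsq <= C0 * energy" by (simp add: C0_def mult_ac)
 have "0 < (L2_norm \<Omega> \<sigma>)^2" using pos by (simp add: L2_norm_def)
 moreover have "0 <= (SUM F:interior_faces \<Omega> \<T>. jn F)"
  unfolding jn_def
 proof (intro sum_nonneg mult_nonneg_nonneg face_integral_nonneg)
  fix F assume "F : interior_faces \<Omega> \<T>"
  then obtain T where T: "T : \<T>" "F facet_of T" using interior_faces_subset by (auto simp: mesh_faces_def)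
  have "bounded F" using compact_imp_bounded[OF compact_T[OF T(1)]] facet_of_imp_subset[OF T(2)] by (rule bounded_subset)
  then show "0 <= inverse (diameter F)" by (simp add: diameter_ge_0)
 qed simp
 moreover have "0 <= (SUM T:\<T>. (L2_norm (interior T) (mat_divergence \<sigma>))^2)" by (simp add: sum_nonneg)
 ultimately have nsq0: "0 < nsq" unfolding nsq_def by linarith
 have norm: "div_w_norm \<Omega> \<T> \<nu> \<sigma> = sqrt nsq" by (simp add: div_w_norm_def nsq_def jn_def)
 have "sqrt nsq * sqrt energy <= sqrt (C0 * energy) * sqrt energy"
  using nsq en by (intro mult_right_mono) auto
 also have "... = sqrt C0 * energy" using en by (simp add: real_sqrt_mult)
 finally have den: "sqrt nsq * sqrt energy <= sqrt C0 * energy" .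
 have "1 / (4 * sqrt C0) = (energy / 4) / (sqrt C0 * energy)" using en C00 by (simp add: field_simps)
 also have "... <= div_w_form \<Omega> \<T> \<nu> \<sigma> v / (sqrt nsq * sqrt energy)"
  using form_low den nsq0 en C00 by (intro frac_le) auto
 finally have "1 / (4 * sqrt C0) <= div_w_form \<Omega> \<T> \<nu> \<sigma> v / (div_w_norm \<Omega> \<T> \<nu> \<sigma> * L2_norm \<Omega> v)"
  unfolding norm L2v .
 then show ?thesis using in_space nz unfolding C0_def N_def by blast
qed

end

theorem lemma2p10:
 fixes \<Omega> :: "(real^'n::finite) set"
  and H :: "real set"
  and \<T> :: "real \<Rightarrow> (real^'n) set set"
  and \<nu> :: "real \<Rightarrow> (real^'n) set \<Rightarrow> real^'n"
  and k :: nat and l :: int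
 assumes "2 \<le> CARD('n)"
  and "polytopal_domain \<Omega>"
  and "\<And>h. h \<in> H \<Longrightarrow> 0 < h \<and> simplicial_mesh \<Omega> (\<T> h) \<and> mesh_size (\<T> h) = h"
  and "shape_regular (\<T> ` H)"
  and "\<And>h. h \<in> H \<Longrightarrow> face_normals \<Omega> (\<T> h) (\<nu> h)"
  and "l = int k \<or> l = int k - 1"
 shows "\<exists>\<alpha>>0. \<forall>h\<in>H.
  (INF v \<in> {v \<in> velocity_space \<Omega> (\<T> h) (\<nu> h) (int k) l \<inter> ker_div \<Omega>. \<not> zero_on \<Omega> v}.
   SUP \<tau> \<in> {\<tau> \<in> stress_space \<Omega> (\<T> h) (\<nu> h) (int k). \<not> zero_on \<Omega> \<tau>}.
    ereal (div_w_form \<Omega> (\<T> h) (\<nu> h) \<tau> v / (div_w_norm \<Omega> (\<T> h) (\<nu> h) \<tau> * L2_norm \<Omega> v)))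
  \<ge> ereal \<alpha>"
proof -
 have "bounded \<Omega>"
 proof -
  obtain P where P: "finite P" "ALL p:P. polytope p" "\<Omega> = interior (\<Union>P)" using assms(2) by (auto simp: polytopal_domain_def)
  have "bounded (\<Union>P)" using P(1,2) by (intro bounded_Union) (auto intro: polytope_imp_bounded)
  then show ?thesis unfolding P(3) by (rule bounded_interior)
 qed
 then have bd: "bounded (closure \<Omega>)" by (rule bounded_closure)
 then obtain M where M: "!!x. x : closure \<Omega> ==> norm x <= M" unfolding bounded_iff by blast
 \<comment> \<open>The cube depends on the domain only, and so does \<open>CG\<close> through its
   lowest frequency.\<close>
 define b where "b = \<bar>M\<bar> + 1"
 have ab: "- b < b" by (simp add: b_def)
 have Q: "closure \<Omega> \<subseteq> cube.Q (- b) b"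
 proof
  fix x assume x: "x : closure \<Omega>"
  have "\<bar>x $ i\<bar> <= b" for i using component_le_norm_cart[of x i] M[OF x] by (simp add: b_def)
  then show "x : cube.Q (- b) b" using cube.Q_def[OF cube.intro[OF ab]] by (auto simp: abs_le_iff minus_le_iff)
 qed
 \<comment> \<open>Bounds all inradii, because the inballs lie in the closure of the domain.\<close>
 define R where "R = diameter (closure \<Omega>) + 1"
 have R0: "0 < R" using diameter_ge_0[OF bd] by (simp add: R_def)
 obtain \<sigma> where \<sigma>: "!!h T. h : H ==> T : \<T> h ==> diameter T <= \<sigma> * inball_diameter T"
  using assms(4) by (auto simp: shape_regular_def)
 define K where "K = 4 * \<bar>\<sigma>\<bar> + 1"
 have K0: "0 < K" by (simp add: K_def)
 obtain Cs where Cs: "0 < Cs" "!!(p::real^'n => real) c y s. p : poly_space (int k) ==> 0 < s ==> norm (y - c) <= (2 * K) * s ==>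
   (p y)^2 <= Cs / s ^ CARD('n) * (LBINT x:ball c s. (p x)^2)"
  using poly_sup_bound[of "2 * K" k] K0 by auto
 obtain Cp where Cp: "0 < Cp" "!!(p::real^'n => real) c y s i. p : poly_space (int k) ==> 0 < s ==> norm (y - c) <= (2 * K) * s ==>
   (partial i p y)^2 <= Cp / (s^2 * s ^ CARD('n)) * (LBINT x:ball c s. (p x)^2)"
  using poly_partial_bound[of "2 * K" k] K0 by auto
 define B where "B = element_const CARD('n) (measure lborel (ball (0::real^'n) 1)) K R Cs Cp"
 have B: "0 < B" unfolding B_def by (intro element_const_pos K0 Cs(1) Cp(1)) simp
 define CG where "CG = 3 * real CARD('n) / (cube.\<omega> (- b) b)^2 + 3 * (real CARD('n))^2"
 have CG0: "0 < CG" unfolding CG_def by (intro add_nonneg_pos) auto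
 define \<alpha> where "\<alpha> = 1 / (4 * sqrt ((2 * real CARD('n) + 4) * B * CG))"
 have \<alpha>0: "0 < \<alpha>" unfolding \<alpha>_def using B CG0 by (simp add: add_nonneg_pos)
 have key: "EX \<tau>. \<tau> : stress_space \<Omega> (\<T> h) (\<nu> h) (int k) & ~ zero_on \<Omega> \<tau> &
   \<alpha> <= div_w_form \<Omega> (\<T> h) (\<nu> h) \<tau> v / (div_w_norm \<Omega> (\<T> h) (\<nu> h) \<tau> * L2_norm \<Omega> v)"
  if h: "h : H" and v: "v : velocity_space \<Omega> (\<T> h) (\<nu> h) (int k) l" "v : ker_div \<Omega>" "~ zero_on \<Omega> v" for h v
 proof -
  interpret mesh \<Omega> "\<T> h" "\<nu> h" using assms(2,3,5) h by unfold_locales auto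
  obtain V where mv: "mesh_velocity \<Omega> (\<T> h) (\<nu> h) V k" and vV: "!!T x. T : \<T> h ==> x : interior T ==> v x = V T x"
   using velocity_representation[OF v(1,2) assms(6)] by blast
  interpret mesh_velocity \<Omega> "\<T> h" "\<nu> h" V k by (rule mv)
  have en: "0 < energy"
  proof -
   have vc: "cont (%x. (norm (V T x))^2)" if "T : \<T> h" for T by (intro continuous_intros V_cont that)
   have i: "set_integrable lebesgue \<Omega> (%x. (norm (v x))^2)"
    by (rule broken_integral(1)[where P="%T x. (norm (V T x))^2"]) (simp_all add: vV vc)
   have e: "(LINT x:\<Omega>|lebesgue. (norm (v x))^2) = energy" unfolding energy_def
    by (rule broken_integral(2)) (simp_all add: vV vc)
   have "energy ~= 0"
   proof
    assume "energy = 0"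
    then have "AE x in lebesgue. indicator \<Omega> x *\<^sub>R (norm (v x))^2 = 0"
     using e i by (subst integral_nonneg_eq_0_iff_AE[symmetric]) (auto simp: set_lebesgue_integral_def set_integrable_def)
    then have "zero_on \<Omega> v" unfolding zero_on_def by (rule AE_mp) (auto intro!: AE_I2 simp: indicator_def)
    then show False using v(3) by simp
   qed
   moreover have "0 <= energy" unfolding energy_def set_lebesgue_integral_def by (intro sum_nonneg integral_nonneg_AE) auto
   ultimately show ?thesis by simp
  qed
  from global_potential[OF ab Q en, folded CG_def]
  obtain G where G: "ALL i j. C1 (%x. G x $ i $ j)" "ALL x. trace (G x) = 0"
   and low: "energy / 4 <= (SUM T:\<T> h. LBINT x:T. mat_divergence G x \<bullet> V T x)"
   and up: "(SUM T:\<T> h. LBINT x:T. (norm (G x))^2) + (SUM T:\<T> h. LBINT x:T. gradient_square G x) <= CG * energy"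
   by (elim exE conjE) (rule that)
  have GC: "C1 (%x. G x $ i $ j)" for i j using G(1) by blast
  have Gtr: "trace (G x) = 0" for x using G(2) by blast
  have Gc: "cont G" by (intro matrix_continuousI C1_cont GC)
  have "ALL F:mesh_faces (\<T> h). EX q. face_datum k (\<nu> h F) G F q & face_integral (\<nu> h F) F (%x. (q x - G x *v \<nu> h F) \<bullet> tangential_sum F x) = 0"
   by (rule ballI, rule face_data[OF Gc])
  from bchoice[OF this] obtain q where q0: "ALL F:mesh_faces (\<T> h). face_datum k (\<nu> h F) G F (q F) &
    face_integral (\<nu> h F) F (%x. (q F x - G x *v \<nu> h F) \<bullet> tangential_sum F x) = 0" by (elim exE) (rule that, assumption)
  note q = q0[THEN bspec, THEN conjunct1] and ortho = q0[THEN bspec, THEN conjunct2]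
  have "ALL T:\<T> h. EX \<tau>. element_interpolant k B (\<nu> h) q G (grad_V T) T \<tau>"
  proof
   fix T assume T: "T : \<T> h"
   obtain C g \<beta> where b: "bary C g \<beta>" and TC: "T = convex hull C" by (rule simplex_bary[OF simplex_T[OF T]])
   obtain z r where zr: "0 < r" "cball z r \<subseteq> T" "diameter T <= K * r"
    using shape_regular_inball[OF interior_nonempty[OF T] compact_imp_bounded[OF compact_T[OF T]] \<sigma>[OF h T]] by (auto simp: K_def)
   have "shape_poly C g \<beta> z r K k Cs Cp"
    unfolding shape_poly_def shape_poly_axioms_def shape_bary_def shape_bary_axioms_def using b zr TC Cs Cp by simp
   then interpret shape_poly C g \<beta> z r K k Cs Cp .
   have "diameter (cball z r) <= diameter (closure \<Omega>)"
    by (rule diameter_subset[OF order_trans[OF zr(2) T_subset[OF T]] bd])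
   then have rR: "r <= R" using zr(1) by (simp add: R_def diameter_cball)
   \<comment> \<open>With the trace of \<open>grad_V T\<close> equal to the divergence, which
     vanishes on \<open>T\<close>, this makes \<open>grad_V T\<close> an admissible \<rho> for
     \<open>element_stress\<close>.\<close>
   have gp: "partial j (%y. V T y $ i) : poly_space (int k - 1)" for i j by (rule ps_partial[OF V_poly[OF T]])
   from rR show "EX \<tau>. element_interpolant k B (\<nu> h) q G (grad_V T) T \<tau>"
    unfolding TC B_def
    by (rule element_stress[OF assms(1)])
     (use facet_normal[OF T] GC Gtr q mesh_facesI[OF T] V_div[OF T] gp in \<open>auto simp: TC trace_def grad_V_def gradient_def divergence_def\<close>)
  qed
  from bchoice[OF this] obtain \<tau> where \<tau>0: "ALL T:\<T> h. element_interpolant k B (\<nu> h) q G (grad_V T) T (\<tau> T)"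
   by (elim exE) (rule that, assumption)
  note \<tau> = \<tau>0[THEN bspec]
  show ?thesis unfolding \<alpha>_def
  proof (rule stress_of_elements[where G=G and \<tau>=\<tau> and q=q, OF vV en GC low up _ ortho B CG0 \<tau>])
   fix F assume "F : mesh_faces (\<T> h)"
   then show "cont (q F)"
    using q by (intro continuous_on_vecI ps_continuous[where m="int k"]) (auto simp: face_datum_def)
  qed
 qed
 show ?thesis
 proof (intro exI[of _ \<alpha>] conjI \<alpha>0 ballI INF_greatest)
  fix h v assume h: "h : H" and "v : {v : velocity_space \<Omega> (\<T> h) (\<nu> h) (int k) l \<inter> ker_div \<Omega>. ~ zero_on \<Omega> v}"
  then have v: "v : velocity_space \<Omega> (\<T> h) (\<nu> h) (int k) l" "v : ker_div \<Omega>" "~ zero_on \<Omega> v" by auto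
  obtain \<tau> where \<tau>: "\<tau> : stress_space \<Omega> (\<T> h) (\<nu> h) (int k)" "~ zero_on \<Omega> \<tau>"
   "\<alpha> <= div_w_form \<Omega> (\<T> h) (\<nu> h) \<tau> v / (div_w_norm \<Omega> (\<T> h) (\<nu> h) \<tau> * L2_norm \<Omega> v)"
   using key[OF h v] by blast
  show "ereal \<alpha> <= (SUP \<tau> \<in> {\<tau> : stress_space \<Omega> (\<T> h) (\<nu> h) (int k). ~ zero_on \<Omega> \<tau>}.
    ereal (div_w_form \<Omega> (\<T> h) (\<nu> h) \<tau> v / (div_w_norm \<Omega> (\<T> h) (\<nu> h) \<tau> * L2_norm \<Omega> v)))"
   by (rule SUP_upper2[of \<tau>]) (use \<tau> in simp_all)
 qed
qed

end
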